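(* There exist effectively computable constants $c_1\in\mathbb{R}_{>0}$ and $c_2\in\mathbb{R}$ such that for every $\epsilon>0$, \[ N(X) = c_1 X^{1/6}\log X + c_2 X^{1/6} + O(X^{3/20+\epsilon}) \] as $X\to\infty$, where the implied constant depends on $\epsilon$.
   Context: Let $\mathscr{E}$ be the set of elliptic curves over $\mathbb{Q}$ of the form $E\colon y^2=x^3+Ax+B$ with $A,B\in\mathbb{Z}$, $4A^3+27B^2\neq 0$, and such that no prime $\ell$ satisfies both $\ell^4\mid A$ and $\ell^6\mid B$ (every elliptic curve over $\mathbb{Q}$ is isomorphic over $\mathbb{Q}$ to exactly one member of $\mathscr{E}$). The height of such $E$ is $\mathrm{ht}(E)=\max(|4A^3|,|27B^2|)$, and $\mathscr{E}_{\le X}=\{E\in\mathscr{E}:\mathrm{ht}(E)\le X\}$ for $X\geq 1$. Define $N(X)=\#\{E\in\mathscr{E}_{\le X}: E \text{ admits a } 7\text{-isogeny}\}$, where a $7$-isogeny means an isogeny of degree $7$ defined over $\mathbb{Q}$ (equivalently, $E$ has a subgroup of order $7$ stable under the absolute Galois group of $\mathbb{Q}$); it is automatically cyclic. A real number is effectively computable if there is an algorithm producing rational approximations to it of any prescribed accuracy. *)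

theory Defs
  imports
    "HOL-Analysis.Analysis"
    "HOL-Library.Landau_Symbols"
    "HOL-Computational_Algebra.Primes"
    "HOL-Algebra.Coset"
    "HOL-Algebra.Algebraic_Closure_Type"
begin

section \<open>Short Weierstrass curves and their group law\<close>

datatype 'a point = Infinity | Affine 'a 'a

text \<open>Points of \<open>y\<^sup>2 = x\<^sup>3 + a x + b\<close>, including the point at infinity.\<close>

definition ec_points :: "'a::field \<Rightarrow> 'a \<Rightarrow> 'a point set" where
  "ec_points a b = insert Infinity {Affine x y | x y. y ^ 2 = x ^ 3 + a * x + b}"

text \<open>Chord and tangent law. On the curve, equal abscissae force \<open>y\<^sub>2 = y\<^sub>1\<close> or \<open>y\<^sub>2 = - y\<^sub>1\<close>,
  so the tangent slope is only used for doubling a point with \<open>y\<^sub>1 \<noteq> 0\<close>.\<close>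

fun ec_add :: "'a::field \<Rightarrow> 'a point \<Rightarrow> 'a point \<Rightarrow> 'a point" where
  "ec_add a Infinity Q = Q"
| "ec_add a P Infinity = P"
| "ec_add a (Affine x1 y1) (Affine x2 y2) =
     (if x1 = x2 \<and> y1 = - y2 then Infinity
      else let m = (if x1 = x2 then (3 * x1 ^ 2 + a) / (2 * y1) else (y2 - y1) / (x2 - x1));
               x3 = m ^ 2 - x1 - x2
           in Affine x3 (m * (x1 - x3) - y1))"

definition ec_group :: "'a::field \<Rightarrow> 'a \<Rightarrow> 'a point monoid" where
  "ec_group a b = \<lparr>carrier = ec_points a b, monoid.mult = ec_add a, one = Infinity\<rparr>"


section \<open>Isogenies over the rationals\<close>

definition absolute_galois_group_Q :: "(rat alg_closure \<Rightarrow> rat alg_closure) set" where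
  "absolute_galois_group_Q =
     {\<sigma>. bij \<sigma> \<and> (\<forall>x y. \<sigma> (x + y) = \<sigma> x + \<sigma> y) \<and> (\<forall>x y. \<sigma> (x * y) = \<sigma> x * \<sigma> y) \<and>
         (\<forall>q. \<sigma> (to_ac q) = to_ac q)}"

text \<open>
  An isogeny defined over the rationals is given, up to isomorphism of its target, by its kernel:
  a finite subgroup of the group of points over the algebraic closure, stable under the absolute
  Galois group, whose order is the degree. We use this description for the curve
  \<open>y\<^sup>2 = x\<^sup>3 + A x + B\<close>. For prime \<open>n\<close> the subgroup is automatically cyclic.
\<close>

definition admits_isogeny :: "nat \<Rightarrow> int \<Rightarrow> int \<Rightarrow> bool" where
  "admits_isogeny n A B \<longleftrightarrow>
     (\<exists>H. subgroup H (ec_group (of_int A :: rat alg_closure) (of_int B)) \<and>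
          finite H \<and> card H = n \<and>
          (\<forall>\<sigma>\<in>absolute_galois_group_Q. map_point \<sigma> ` H = H))"


section \<open>Counting elliptic curves by height\<close>

text \<open>The curve \<open>y\<^sup>2 = x\<^sup>3 + A x + B\<close> is represented by the pair \<open>(A, B)\<close>.\<close>

definition minimal_curves :: "(int \<times> int) set" where
  "minimal_curves =
     {(A, B). 4 * A ^ 3 + 27 * B ^ 2 \<noteq> 0 \<and> \<not> (\<exists>l::int. Factorial_Ring.prime l \<and> l ^ 4 dvd A \<and> l ^ 6 dvd B)}"

fun height :: "int \<times> int \<Rightarrow> int" where
  "height (A, B) = max \<bar>4 * A ^ 3\<bar> \<bar>27 * B ^ 2\<bar>"

definition curves_upto :: "real \<Rightarrow> (int \<times> int) set" where
  "curves_upto x = {E \<in> minimal_curves. real_of_int (height E) \<le> x}"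

definition count_7_isogeny :: "real \<Rightarrow> nat" where
  "count_7_isogeny x = card {(A, B) \<in> curves_upto x. admits_isogeny 7 A B}"


section \<open>Effectively computable real numbers\<close>

text \<open>
  \<open>total_recursive k f\<close>: on argument lists of length \<open>k\<close>, \<open>f\<close> is a total recursive function
  (Kleene's schemes, with minimization restricted to functions that always have a zero). Values on
  lists of any other length are irrelevant.
\<close>

inductive total_recursive :: "nat \<Rightarrow> (nat list \<Rightarrow> nat) \<Rightarrow> bool" where
  zero: "total_recursive k (\<lambda>xs. 0)"
| succ: "total_recursive 1 (\<lambda>xs. Suc (hd xs))"
| proj: "i < k \<Longrightarrow> total_recursive k (\<lambda>xs. xs ! i)"
| comp: "total_recursive (length gs) f \<Longrightarrow> (\<forall>g\<in>set gs. total_recursive k g) \<Longrightarrow>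
           total_recursive k (\<lambda>xs. f (map (\<lambda>g. g xs) gs))"
| prim_rec: "total_recursive k f \<Longrightarrow> total_recursive (Suc (Suc k)) g \<Longrightarrow>
           total_recursive (Suc k)
             (\<lambda>xs. rec_nat (f (tl xs)) (\<lambda>n r. g (n # r # tl xs)) (hd xs))"
| minimization: "total_recursive (Suc k) f \<Longrightarrow>
           (\<forall>xs. length xs = k \<longrightarrow> (\<exists>n. f (n # xs) = 0)) \<Longrightarrow>
           total_recursive k (\<lambda>xs. LEAST n. f (n # xs) = 0)"

definition computable_fun :: "(nat \<Rightarrow> nat) \<Rightarrow> bool" where
  "computable_fun f \<longleftrightarrow> (\<exists>F. total_recursive 1 F \<and> (\<forall>n. f n = F [n]))"

text \<open>An algorithm computes, for every \<open>n\<close>, a rational approximation with error at most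
  \<open>2\<^sup>-\<^sup>n\<close>; the rational is encoded as \<open>(p n - q n) / (r n + 1)\<close> with natural numbers.\<close>

definition effectively_computable :: "real \<Rightarrow> bool" where
  "effectively_computable c \<longleftrightarrow>
     (\<exists>p q r. computable_fun p \<and> computable_fun q \<and> computable_fun r \<and>
        (\<forall>n. \<bar>c - (real (p n) - real (q n)) / (real (r n) + 1)\<bar> \<le> 1 / 2 ^ n))"

end

(*
  A curve y^2 = x^3 + Ax + B has a rational 7-isogeny iff its j-invariant lies in the image of the
  modular curve X_0(7), which has genus 0. In terms of the Tate normal form of a curve with a point
  of order 7, this means (A, B) = (s^2 A(a,b), s^3 B(a,b)) for binary forms A, B of degrees 4 and 6,
  coprime integers a, b and a rational s. Hence the curves correspond, up to sign, to pairs of a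
  minimal twist class and a squarefree twisting factor c. The twist classes of twist height at most
  z are lattice points in a dilated planar region, sorted by the defect e, the largest e with e^2 | A(a,b)
  and e^3 | B(a,b); both they and the squarefree c have counting functions linear up to a
  power saving, and Dirichlet's hyperbola method applied to their product yields the main term
  c_1 X^(1/6) log X + c_2 X^(1/6) with error O(X^(3/20)).
  The counting function is computable by bounded search, and with a(Y) = N(Y^6) both constants are
  limits of explicit expressions in the values of a, with a known power-saving rate.
*)
theory Submission
  imports Defs "HOL-Computational_Algebra.Squarefree" "HOL-Real_Asymp.Real_Asymp"
    "HOL-Number_Theory.Cong"
begin

section \<open>The fixed field of the absolute Galois group\<close>

text \<open>Two obstacles shape the counting. The number of parameters with defect divisible by g
  must be controlled uniformly in g. Residue classes mod g^3 work only while g^3 is below the radius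
  \<rho>; beyond that the points are bounded by packing with respect to the quadratic form
  \<open>q_form\<close>. Interpolation gives the error g^(-19/10) \<rho>^(17/10). With \<rho> =
  sqrt(e y)/d and g = e f the sum over e carries e^(-21/20) and converges, leaving y^(17/20).
  Moreover j has degree 8 on X_0(7), so distinct parameters may share a twist class; these are shown
  to be rare. Squarefree numbers contribute the exponent 3/5, and cutting the hyperbola at Y^(1/4)
  and Y^(3/4) then yields Y^(9/10) with Y = X^(1/6), that is X^(3/20). The constants arise as limits
  of Cauchy sequences, without usable formulas. Hence their computability is extracted afterwards
  from the asymptotic formula itself; the implied constant enters the algorithms only through a
  fixed power of 2 above it, whose existence suffices.\<close>

text \<open>A relation stands for a partial ring homomorphism over the rationals, so that unions of
  chains are again of this kind. The trivial kernel makes it single-valued: two images of x differ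
  by an image of 0.\<close>

definition partial_hom :: "(rat alg_closure \<times> rat alg_closure) set \<Rightarrow> bool" where
  "partial_hom r \<longleftrightarrow> (\<forall>q. (to_ac q, to_ac q) \<in> r) \<and>
     (\<forall>a b c d. (a, b) \<in> r \<longrightarrow> (c, d) \<in> r \<longrightarrow> (a + c, b + d) \<in> r \<and> (a * c, b * d) \<in> r) \<and>
     (\<forall>v. (0, v) \<in> r \<longrightarrow> v = 0)"

definition rel_poly :: "('a::zero \<times> 'a) set \<Rightarrow> 'a poly \<Rightarrow> 'a poly \<Rightarrow> bool" where
  "rel_poly r p p' \<longleftrightarrow> (\<forall>i. (poly.coeff p i, poly.coeff p' i) \<in> r)"

lemma partial_homD:
  assumes "partial_hom r"
  shows "(to_ac q, to_ac q) \<in> r" "(0, 0) \<in> r" "(1, 1) \<in> r"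
    and "(a, b) \<in> r \<Longrightarrow> (c, d) \<in> r \<Longrightarrow> (a + c, b + d) \<in> r"
    and "(a, b) \<in> r \<Longrightarrow> (c, d) \<in> r \<Longrightarrow> (a * c, b * d) \<in> r"
    and "(a, b) \<in> r \<Longrightarrow> (- a, - b) \<in> r"
    and "(a, b) \<in> r \<Longrightarrow> (c, d) \<in> r \<Longrightarrow> (a - c, b - d) \<in> r"
    and "(0, v) \<in> r \<Longrightarrow> v = 0"
proof -
  show 1: "(to_ac q, to_ac q) \<in> r" for q using assms by (auto simp: partial_hom_def)
  show "(0, 0) \<in> r" "(1, 1) \<in> r" using 1[of 0] 1[of 1] by auto
  show 2: "(a + c, b + d) \<in> r" if "(a, b) \<in> r" "(c, d) \<in> r" for a b c d
    using assms that by (auto simp: partial_hom_def)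
  show 3: "(a * c, b * d) \<in> r" if "(a, b) \<in> r" "(c, d) \<in> r" for a b c d
    using assms that by (auto simp: partial_hom_def)
  show 4: "(- a, - b) \<in> r" if "(a, b) \<in> r" for a b
    using 3[OF 1[of "-1"] that] by simp
  show "(a - c, b - d) \<in> r" if "(a, b) \<in> r" "(c, d) \<in> r" for a b c d
    using 2[OF that(1) 4[OF that(2)]] by simp
  show "(0, v) \<in> r \<Longrightarrow> v = 0" using assms by (auto simp: partial_hom_def)
qed

lemma partial_hom_power:
  assumes "partial_hom r" "(a, b) \<in> r"
  shows "(a ^ n, b ^ n) \<in> r"
  by (induction n) (use assms partial_homD[OF assms(1)] in auto)

lemma partial_hom_sum:
  assumes "partial_hom r" "\<And>i. i \<in> I \<Longrightarrow> (f i, g i) \<in> r"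
  shows "(sum f I, sum g I) \<in> r"
  using assms(2) by (induction I rule: infinite_finite_induct) (use partial_homD[OF assms(1)] in auto)

lemma poly_eq_sum_le:
  fixes p :: "'a::comm_semiring_1 poly"
  assumes "Polynomial.degree p \<le> n"
  shows "poly p x = (\<Sum>i\<le>n. poly.coeff p i * x ^ i)"
  unfolding poly_altdef
  by (rule sum.mono_neutral_left) (use assms in \<open>auto simp: coeff_eq_0\<close>)

lemma rel_poly_eval:
  assumes r: "partial_hom r" and "rel_poly r p p'" "(x, y) \<in> r"
  shows "(poly p x, poly p' y) \<in> r"
proof -
  define n where "n = max (Polynomial.degree p) (Polynomial.degree p')"
  have "poly p x = (\<Sum>i\<le>n. poly.coeff p i * x ^ i)" "poly p' y = (\<Sum>i\<le>n. poly.coeff p' i * y ^ i)"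
    by (rule poly_eq_sum_le; simp add: n_def)+
  then show ?thesis
    using assms partial_homD[OF r] partial_hom_power[OF r] by (auto intro!: partial_hom_sum simp: rel_poly_def)
qed

lemma rel_poly_rat: "partial_hom r \<Longrightarrow> rel_poly r (map_poly to_ac p) (map_poly to_ac p)"
  by (auto simp: rel_poly_def coeff_map_poly partial_homD)

lemma rel_poly_ops:
  assumes r: "partial_hom r" and pq: "rel_poly r p p'" "rel_poly r q q'"
  shows "rel_poly r (p + q) (p' + q')" "rel_poly r (p - q) (p' - q')" "rel_poly r (p * q) (p' * q')"
  using pq partial_homD[OF r] by (auto simp: rel_poly_def coeff_mult intro!: partial_hom_sum[OF r])

lemma rel_poly_monom: "partial_hom r \<Longrightarrow> (a, b) \<in> r \<Longrightarrow> rel_poly r (Polynomial.monom a n) (Polynomial.monom b n)"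
  by (auto simp: rel_poly_def partial_homD)

text \<open>An annihilating polynomial of least degree has nonzero constant term, so 1/u is a
  polynomial in u. This makes relations closed under ring operations closed under inversion as well,
  and thereby injective.\<close>

lemma alg_closure_inverse_poly:
  fixes u :: "rat alg_closure"
  assumes "u \<noteq> 0"
  obtains g where "u * poly (map_poly to_ac g) u = 1"
proof -
  define P where "P = (\<lambda>p::rat poly. p \<noteq> 0 \<and> poly (map_poly to_ac p) u = 0)"
  obtain p0 where "P p0" using alg_closure_algebraic[of u] unfolding P_def by blast
  then obtain p where p: "P p" "\<And>p'. P p' \<Longrightarrow> Polynomial.degree p \<le> Polynomial.degree p'"
    using ex_has_least_nat[of P p0 Polynomial.degree] by auto
  obtain c q where pq: "p = pCons c q" by (cases p)
  have e: "to_ac c + u * poly (map_poly to_ac q) u = 0"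
    using p(1) by (simp add: P_def pq map_poly_pCons)
  have "c \<noteq> 0"
  proof
    assume "c = 0"
    then have "P q" using p(1) e assms by (auto simp: P_def pq)
    from p(2)[OF this] \<open>P q\<close> show False by (simp add: pq P_def)
  qed
  have m: "map_poly to_ac (Polynomial.smult (- 1 / c) q) = Polynomial.smult (to_ac (-1 / c)) (map_poly to_ac q)"
    by (rule poly_eqI) (simp add: coeff_map_poly)
  have "u * poly (map_poly to_ac (Polynomial.smult (- 1 / c) q)) u = 1"
    unfolding m using \<open>c \<noteq> 0\<close> e by (auto simp: field_simps add_eq_0_iff)
  then show ?thesis using that by blast
qed

lemma partial_hom_inverse:
  assumes r: "partial_hom r" and uv: "(u, v) \<in> r" "u \<noteq> 0"
  shows "v \<noteq> 0" "(inverse u, inverse v) \<in> r"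
proof -
  obtain g where g: "u * poly (map_poly to_ac g) u = 1"
    using alg_closure_inverse_poly[OF uv(2)] .
  let ?a = "poly (map_poly to_ac g) u" and ?b = "poly (map_poly to_ac g) v"
  have ab: "(?a, ?b) \<in> r" by (intro rel_poly_eval[OF r] rel_poly_rat r uv)
  have "(u * ?a - 1, v * ?b - 1) \<in> r" using partial_homD[OF r] uv ab by simp
  then have vb: "v * ?b = 1" using partial_homD(8)[OF r] g by fastforce
  then show "v \<noteq> 0" by auto
  have "?a = inverse u" "?b = inverse v" using g vb by (auto simp: inverse_unique)
  then show "(inverse u, inverse v) \<in> r" using ab by simp
qed

lemma rel_poly_degree:
  assumes r: "partial_hom r" and "rel_poly r p p'"
  shows "Polynomial.degree p' = Polynomial.degree p"
proof (cases "p = 0")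
  case True
  then have "p' = 0" using assms partial_homD(8)[OF r] by (intro poly_eqI) (auto simp: rel_poly_def)
  then show ?thesis using True by simp
next
  case False
  have "poly.coeff p' i = 0" if "i > Polynomial.degree p" for i
    using assms(2) partial_homD(8)[OF r] coeff_eq_0[OF that] unfolding rel_poly_def by metis
  then have "Polynomial.degree p' \<le> Polynomial.degree p" by (intro degree_le) auto
  moreover have "poly.coeff p' (Polynomial.degree p) \<noteq> 0"
    using partial_hom_inverse(1)[OF r] assms(2) False unfolding rel_poly_def by (metis leading_coeff_0_iff)
  ultimately show ?thesis using le_degree by (metis antisym)
qed

text \<open>Long division runs on both polynomials at once, each step subtracting multiples with
  related leading quotients. In this way the remainder on the image side vanishes together with the
  remainder on the source side.\<close>

lemma rel_poly_division:
  assumes r: "partial_hom r" and p: "rel_poly r p p'" "Polynomial.degree p > 0"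
  shows "rel_poly r h h' \<Longrightarrow> \<exists>s s' t t'. rel_poly r s s' \<and> rel_poly r t t' \<and> h = p * s + t \<and> h' = p' * s' + t' \<and>
           Polynomial.degree t < Polynomial.degree p"
proof (induction "Polynomial.degree h" arbitrary: h h' rule: less_induct)
  case less
  show ?case
  proof (cases "Polynomial.degree h < Polynomial.degree p")
    case True
    then show ?thesis using less.prems
      by (intro exI[of _ 0] exI[of _ h] exI[of _ h'])
        (auto simp: rel_poly_def partial_homD[OF r])
  next
    case False
    define k where "k = Polynomial.degree h - Polynomial.degree p"
    define c where "c = poly.coeff h (Polynomial.degree h) * inverse (poly.coeff p (Polynomial.degree p))"
    define c' where "c' = poly.coeff h' (Polynomial.degree h) * inverse (poly.coeff p' (Polynomial.degree p))"
    have "poly.coeff p (Polynomial.degree p) \<noteq> 0" using p(2) by auto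
    then have cc: "(c, c') \<in> r" unfolding c_def c'_def
      using less.prems p(1) partial_homD(5)[OF r] partial_hom_inverse[OF r] by (auto simp: rel_poly_def)
    define h1 where "h1 = h - p * Polynomial.monom c k"
    define h1' where "h1' = h' - p' * Polynomial.monom c' k"
    have rel1: "rel_poly r h1 h1'" unfolding h1_def h1'_def
      by (intro rel_poly_ops rel_poly_monom r less.prems p cc)
    have "Polynomial.degree (p * Polynomial.monom c k) \<le> Polynomial.degree h"
      using degree_mult_le[of p "Polynomial.monom c k"] degree_monom_le[of c k] False k_def by linarith
    then have "Polynomial.degree h1 \<le> Polynomial.degree h" unfolding h1_def by (simp add: degree_diff_le)
    moreover have "poly.coeff h1 (Polynomial.degree h) = 0"
    proof -
      have e: "Polynomial.degree h = k + Polynomial.degree p" using False k_def by simp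
      have "poly.coeff (p * Polynomial.monom c k) (k + Polynomial.degree p) = poly.coeff p (Polynomial.degree p) * c"
        by (simp add: coeff_monom_mult mult.commute[of p])
      also have "\<dots> = poly.coeff h (Polynomial.degree h)"
        unfolding c_def using p(2) by (auto simp: field_simps)
      finally show ?thesis unfolding h1_def by (simp add: e)
    qed
    ultimately have "h1 = 0 \<or> Polynomial.degree h1 < Polynomial.degree h"
      by (rule eq_zero_or_degree_less)
    then have "\<exists>s s' t t'. rel_poly r s s' \<and> rel_poly r t t' \<and> h1 = p * s + t \<and> h1' = p' * s' + t' \<and>
           Polynomial.degree t < Polynomial.degree p"
    proof
      assume z: "h1 = 0"
      have "h1' = 0" using rel1 z partial_homD(8)[OF r] by (intro poly_eqI) (auto simp: rel_poly_def)
      then show ?thesis using z p(2)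
        by (intro exI[of _ 0]) (auto simp: rel_poly_def partial_homD[OF r])
    next
      assume "Polynomial.degree h1 < Polynomial.degree h"
      then show ?thesis using less.hyps rel1 by blast
    qed
    then obtain s s' t t' where st: "rel_poly r s s'" "rel_poly r t t'" "h1 = p * s + t" "h1' = p' * s' + t'"
      "Polynomial.degree t < Polynomial.degree p" by blast
    have "h = p * (s + Polynomial.monom c k) + t" using st(3) unfolding h1_def by (simp add: algebra_simps)
    moreover have "h' = p' * (s' + Polynomial.monom c' k) + t'" using st(4) unfolding h1'_def by (simp add: algebra_simps)
    moreover have "rel_poly r (s + Polynomial.monom c k) (s' + Polynomial.monom c' k)"
      by (intro rel_poly_ops rel_poly_monom r st cc)
    ultimately show ?thesis using st by blast
  qed
qed

text \<open>Adjunction of one element: x goes to a root y of the transported minimal polynomial. If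
  h(x) = 0, the remainder of h modulo p is 0 by minimality, so h' is a multiple of p' and kills y;
  this is the trivial kernel.\<close>

lemma partial_hom_extend:
  assumes r: "partial_hom r" and p: "rel_poly r p p'" "p \<noteq> 0" "poly p x = 0" "poly p' y = 0"
    and min: "\<forall>h h'. rel_poly r h h' \<longrightarrow> h \<noteq> 0 \<longrightarrow> poly h x = 0 \<longrightarrow> Polynomial.degree p \<le> Polynomial.degree h"
  obtains r' where "partial_hom r'" "r \<subseteq> r'" "(x, y) \<in> r'"
proof -
  define r' where "r' = {(poly h x, poly h' y) | h h'. rel_poly r h h'}"
  have dp: "Polynomial.degree p > 0"
    using p by (metis degree_eq_zeroE gr0I pCons_eq_0_iff poly_const_conv)
  have sub: "r \<subseteq> r'"
  proof
    fix z assume "z \<in> r"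
    then obtain a b where z: "z = (a, b)" "(a, b) \<in> r" by (cases z) auto
    have "rel_poly r (Polynomial.monom a 0) (Polynomial.monom b 0)" by (rule rel_poly_monom[OF r z(2)])
    then show "z \<in> r'" unfolding r'_def z by (force simp: poly_monom)
  qed
  have "rel_poly r (Polynomial.monom 1 1) (Polynomial.monom 1 1)" by (rule rel_poly_monom[OF r partial_homD(3)[OF r]])
  then have xy: "(x, y) \<in> r'" unfolding r'_def by (force simp: poly_monom)
  have "partial_hom r'" unfolding partial_hom_def
  proof (intro conjI allI impI)
    show "(to_ac q, to_ac q) \<in> r'" for q using sub partial_homD(1)[OF r] by auto
    show "(a + c, b + d) \<in> r'" "(a * c, b * d) \<in> r'" if ab: "(a, b) \<in> r'" "(c, d) \<in> r'" for a b c d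
    proof -
      from ab obtain h h' k k' where *: "a = poly h x" "b = poly h' y" "rel_poly r h h'"
        "c = poly k x" "d = poly k' y" "rel_poly r k k'" unfolding r'_def by blast
      have "rel_poly r (h + k) (h' + k')" "rel_poly r (h * k) (h' * k')" using rel_poly_ops[OF r] * by auto
      then show "(a + c, b + d) \<in> r'" "(a * c, b * d) \<in> r'"
        unfolding r'_def * by (force simp flip: poly_add poly_mult)+
    qed
    show "v = 0" if "(0, v) \<in> r'" for v
    proof -
      from that obtain h h' where h: "poly h x = 0" "v = poly h' y" "rel_poly r h h'" unfolding r'_def by auto
      obtain s s' t t' where st: "rel_poly r t t'" "h = p * s + t" "h' = p' * s' + t'"
        "Polynomial.degree t < Polynomial.degree p"
        using rel_poly_division[OF r p(1) dp h(3)] by blast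
      have "poly t x = 0" using h(1) p(3) st(2) by simp
      then have "t = 0" using min st(1) st(4) by (cases "t = 0") auto
      then have "t' = 0" using st(1) partial_homD(8)[OF r] by (intro poly_eqI) (auto simp: rel_poly_def)
      then show ?thesis using h(2) st(3) p(4) by simp
    qed
  qed
  then show ?thesis using that sub xy by blast
qed

lemma partial_hom_minimal_poly:
  assumes r: "partial_hom r"
  obtains p p' where "rel_poly r p p'" "p \<noteq> 0" "poly p x = 0"
    "\<forall>h h'. rel_poly r h h' \<longrightarrow> h \<noteq> 0 \<longrightarrow> poly h x = 0 \<longrightarrow> Polynomial.degree p \<le> Polynomial.degree h"
proof -
  define P where "P = (\<lambda>p. \<exists>p'. rel_poly r p p' \<and> p \<noteq> 0 \<and> poly p x = 0)"
  obtain g :: "rat poly" where g: "g \<noteq> 0" "poly (map_poly to_ac g) x = 0" by (rule alg_closure_algebraic)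
  have "P (map_poly to_ac g)" unfolding P_def
    using g rel_poly_rat[OF r] by (auto simp: map_poly_eq_0_iff)
  then obtain p where "P p" "\<And>h. P h \<Longrightarrow> Polynomial.degree p \<le> Polynomial.degree h"
    using ex_has_least_nat[of P "map_poly to_ac g" Polynomial.degree] by auto
  then show ?thesis using that unfolding P_def by blast
qed

lemma partial_hom_maximal_total:
  assumes r: "partial_hom r" and max: "\<And>r'. partial_hom r' \<Longrightarrow> r \<subseteq> r' \<Longrightarrow> r' = r"
  shows "\<exists>y. (x, y) \<in> r"
proof -
  obtain p p' where p: "rel_poly r p p'" "p \<noteq> 0" "poly p x = 0"
    "\<forall>h h'. rel_poly r h h' \<longrightarrow> h \<noteq> 0 \<longrightarrow> poly h x = 0 \<longrightarrow> Polynomial.degree p \<le> Polynomial.degree h"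
    using partial_hom_minimal_poly[OF r, of x] by metis
  have "Polynomial.degree p > 0"
    using p(2,3) by (metis degree_eq_zeroE gr0I pCons_eq_0_iff poly_const_conv)
  then obtain y where "poly p' y = 0"
    using alg_closed_imp_poly_has_root[of p'] rel_poly_degree[OF r p(1)] by auto
  then obtain r' where "partial_hom r'" "r \<subseteq> r'" "(x, y) \<in> r'"
    using partial_hom_extend[OF r p(1-3) _ p(4)] by metis
  then show ?thesis using max by metis
qed

text \<open>Zorn's lemma among the extensions of r. A maximal one is total, since a missing element
  could still be adjoined.\<close>

lemma partial_hom_extends_to_automorphism:
  assumes r: "partial_hom r" "(x, y) \<in> r"
  obtains \<sigma> where "\<sigma> \<in> absolute_galois_group_Q" "\<sigma> x = y"
proof -
  define \<A> where "\<A> = {r'. partial_hom r' \<and> r \<subseteq> r'}"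
  have "\<exists>M\<in>\<A>. \<forall>Z\<in>\<A>. M \<subseteq> Z \<longrightarrow> Z = M"
  proof (rule subset_Zorn_nonempty)
    show "\<A> \<noteq> {}" using r unfolding \<A>_def by auto
    fix C assume C: "C \<noteq> {}" "subset.chain \<A> C"
    then have C1: "\<And>c. c \<in> C \<Longrightarrow> partial_hom c \<and> r \<subseteq> c"
      and C2: "\<And>c d. c \<in> C \<Longrightarrow> d \<in> C \<Longrightarrow> c \<subseteq> d \<or> d \<subseteq> c"
      unfolding subset.chain_def pred_on.chain_def \<A>_def by blast+
    have "partial_hom (\<Union>C)" unfolding partial_hom_def
    proof (intro conjI allI impI)
      show "(to_ac q, to_ac q) \<in> \<Union>C" for q using C1 C(1) partial_homD(1) by blast
      show "(a + c, b + d) \<in> \<Union>C" "(a * c, b * d) \<in> \<Union>C" if ab: "(a, b) \<in> \<Union>C" "(c, d) \<in> \<Union>C" for a b c d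
      proof -
        obtain Z where "Z \<in> C" "(a, b) \<in> Z" "(c, d) \<in> Z" using ab C2 by blast
        then show "(a + c, b + d) \<in> \<Union>C" "(a * c, b * d) \<in> \<Union>C" using C1 partial_homD(4,5) by blast+
      qed
      show "v = 0" if "(0, v) \<in> \<Union>C" for v using that C1 partial_homD(8) by blast
    qed
    then show "\<Union>C \<in> \<A>" using C(1) C1 unfolding \<A>_def by auto
  qed
  then obtain M where M: "partial_hom M" "r \<subseteq> M" "\<And>Z. partial_hom Z \<Longrightarrow> M \<subseteq> Z \<Longrightarrow> Z = M"
    unfolding \<A>_def by auto
  define \<sigma> where "\<sigma> = (\<lambda>x. SOME y. (x, y) \<in> M)"
  have s: "(x, \<sigma> x) \<in> M" for x
    unfolding \<sigma>_def by (rule someI_ex, rule partial_hom_maximal_total[OF M(1) M(3)])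
  have uniq: "v = \<sigma> x" if "(x, v) \<in> M" for x v
    using partial_homD(8)[OF M(1), of "v - \<sigma> x"] partial_homD(7)[OF M(1) that s[of x]] by simp
  have add: "\<sigma> (x + y) = \<sigma> x + \<sigma> y" for x y using uniq partial_homD(4)[OF M(1) s s] by metis
  have mult: "\<sigma> (x * y) = \<sigma> x * \<sigma> y" for x y using uniq partial_homD(5)[OF M(1) s s] by metis
  have rat: "\<sigma> (to_ac q) = to_ac q" for q using uniq partial_homD(1)[OF M(1)] by metis
  have inj: "inj \<sigma>"
  proof (rule injI, rule ccontr)
    fix x y assume "\<sigma> x = \<sigma> y" "x \<noteq> y"
    then have "(x - y, 0) \<in> M" using partial_homD(7)[OF M(1) s[of x] s[of y]] by simp
    then show False using partial_hom_inverse(1)[OF M(1)] \<open>x \<noteq> y\<close> by fastforce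
  qed
  have "surj \<sigma>"
  proof -
    have "y \<in> range \<sigma>" for y
    proof -
      obtain g :: "rat poly" where g: "g \<noteq> 0" "poly (map_poly to_ac g) y = 0" by (rule alg_closure_algebraic)
      \<comment> \<open>Surjectivity: \<sigma> maps the finite root set of a rational polynomial
        injectively into itself and hence permutes it.\<close>
      define R where "R = {z. poly (map_poly to_ac g) z = 0}"
      have "map_poly to_ac g \<noteq> 0" using g(1) by (simp add: map_poly_eq_0_iff)
      then have fin: "finite R" unfolding R_def by (rule poly_roots_finite)
      have "\<sigma> ` R \<subseteq> R"
      proof
        fix z assume "z \<in> \<sigma> ` R"
        then obtain w where w: "z = \<sigma> w" "poly (map_poly to_ac g) w = 0" by (auto simp: R_def)
        have "(poly (map_poly to_ac g) w, poly (map_poly to_ac g) z) \<in> M"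
          unfolding w(1) by (intro rel_poly_eval rel_poly_rat M s)
        then show "z \<in> R" using w(2) partial_homD(8)[OF M(1)] by (simp add: R_def)
      qed
      then have "\<sigma> ` R = R" using fin inj by (intro endo_inj_surj) (auto intro: inj_on_subset)
      then show ?thesis using g(2) by (auto simp: R_def)
    qed
    then show ?thesis by auto
  qed
  then have "\<sigma> \<in> absolute_galois_group_Q"
    using inj add mult rat by (auto simp: absolute_galois_group_Q_def bij_def)
  moreover have "\<sigma> x = y" using uniq r M(2) by auto
  ultimately show ?thesis using that by blast
qed

text \<open>A minimal polynomial of degree above 1 has, by separability, a second root y, and x
  \<mapsto> y extends to an automorphism that moves x.\<close>

theorem fixed_imp_rational:
  fixes x :: "rat alg_closure"
  assumes fixed: "\<And>\<sigma>. \<sigma> \<in> absolute_galois_group_Q \<Longrightarrow> \<sigma> x = x"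
  shows "x \<in> range to_ac"
proof -
  define r :: "(rat alg_closure \<times> rat alg_closure) set" where "r = range (\<lambda>q. (to_ac q, to_ac q))"
  have r: "partial_hom r" unfolding partial_hom_def r_def
    by (auto simp flip: to_ac_add to_ac_mult)
  obtain p p' where p: "rel_poly r p p'" "p \<noteq> 0" "poly p x = 0"
    and min: "\<forall>h h'. rel_poly r h h' \<longrightarrow> h \<noteq> 0 \<longrightarrow> poly h x = 0 \<longrightarrow> Polynomial.degree p \<le> Polynomial.degree h"
    using partial_hom_minimal_poly[OF r, of x] by metis
  have [simp]: "p' = p"
  proof (rule poly_eqI)
    show "poly.coeff p' n = poly.coeff p n" for n
      using p(1)[unfolded rel_poly_def r_def, rule_format, of n] by auto
  qed
  have dp: "Polynomial.degree p > 0"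
    using p(2,3) by (metis degree_eq_zeroE gr0I pCons_eq_0_iff poly_const_conv)
  have rat: "poly.coeff p i \<in> range to_ac" for i using p(1) by (auto simp: rel_poly_def r_def)
  show ?thesis
  proof (cases "Polynomial.degree p = 1")
    case True
    obtain c0 c1 where c: "poly.coeff p 0 = to_ac c0" "poly.coeff p 1 = to_ac c1" using rat by blast
    have c1: "to_ac c1 \<noteq> 0" using True c(2) p(2) by (metis leading_coeff_0_iff)
    have "poly p x = to_ac c0 + to_ac c1 * x" using True c by (simp add: poly_altdef)
    then have "x = to_ac (- c0 / c1)" using p(3) c1
      by (auto simp: field_simps add_eq_0_iff)
    then show ?thesis by blast
  next
    case False
    \<comment> \<open>Separability: the derivative is rational, nonzero and of smaller degree, so
      minimality keeps it from vanishing at x.\<close>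
    have "rel_poly r (pderiv p) (pderiv p)"
      unfolding rel_poly_def coeff_pderiv
    proof
      fix i
      obtain c where "poly.coeff p (Suc i) = to_ac c" using rat by blast
      then have "of_nat (Suc i) * poly.coeff p (Suc i) = to_ac (of_nat (Suc i) * c)"
        unfolding to_ac_mult to_ac_of_nat by simp
      then show "(of_nat (Suc i) * poly.coeff p (Suc i), of_nat (Suc i) * poly.coeff p (Suc i)) \<in> r"
        unfolding r_def by (metis rangeI)
    qed
    moreover have "pderiv p \<noteq> 0" using dp by (simp add: pderiv_eq_0_iff)
    ultimately have d: "poly (pderiv p) x \<noteq> 0" using min dp by (fastforce simp: degree_pderiv)
    obtain s where s: "p = [:- x, 1:] * s" using p(3) by (auto simp: poly_eq_0_iff_dvd elim: dvdE)
    have "poly s x \<noteq> 0" using d unfolding s pderiv_mult by (simp add: pderiv_pCons)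
    moreover have "Polynomial.degree p = Suc (Polynomial.degree s)"
      using p(2) unfolding s by (subst degree_mult_eq) auto
    then have "Polynomial.degree s > 0" using False dp by simp
    then obtain y where y: "poly s y = 0" using alg_closed_imp_poly_has_root by blast
    ultimately have "y \<noteq> x" by auto
    have "poly p' y = 0" using y s by simp
    then obtain r' where r': "partial_hom r'" "(x, y) \<in> r'"
      using partial_hom_extend[OF r p(1-3) _ min] by metis
    then obtain \<sigma> where "\<sigma> \<in> absolute_galois_group_Q" "\<sigma> x = y"
      using partial_hom_extends_to_automorphism by metis
    then show ?thesis using fixed \<open>y \<noteq> x\<close> by auto
  qed
qed

section \<open>The chord and tangent law\<close>

fun ec_neg :: "'a::field point \<Rightarrow> 'a point" where
  "ec_neg Infinity = Infinity"
| "ec_neg (Affine x y) = Affine x (- y)"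

lemma ec_neg_neg [simp]: "ec_neg (ec_neg P) = P"
  by (cases P) auto

lemma ec_add_Infinity_right [simp]: "ec_add a P Infinity = P"
  by (cases P) auto

lemma Affine_in_ec_points: "Affine x y \<in> ec_points a b \<longleftrightarrow> y ^ 2 = x ^ 3 + a * x + b"
  by (auto simp: ec_points_def)

lemma Infinity_in_ec_points: "Infinity \<in> ec_points a b"
  by (auto simp: ec_points_def)

lemma ec_neg_in_ec_points: "P \<in> ec_points a b \<Longrightarrow> ec_neg P \<in> ec_points a b"
  by (cases P) (auto simp: ec_points_def)

text \<open>The slope enters through a multiplied-out equation, so that later verifications become
  polynomial identities free of division.\<close>

lemma ec_add_chord:
  assumes "x1 \<noteq> x2" "m * (x2 - x1) = y2 - y1" "x3 = m ^ 2 - x1 - x2" "y3 = m * (x1 - x3) - y1"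
  shows "ec_add a (Affine x1 y1) (Affine x2 y2) = Affine x3 y3"
proof -
  have "(y2 - y1) / (x2 - x1) = m" using assms(1,2) by (simp add: divide_eq_eq)
  then show ?thesis using assms(1,3,4) by (simp add: Let_def)
qed

lemma ec_add_tangent:
  fixes x1 :: "'a::field_char_0"
  assumes "y1 \<noteq> 0" "m * (2 * y1) = 3 * x1 ^ 2 + a" "x3 = m ^ 2 - 2 * x1" "y3 = m * (x1 - x3) - y1"
  shows "ec_add a (Affine x1 y1) (Affine x1 y1) = Affine x3 y3"
proof -
  have "(3 * x1 ^ 2 + a) / (2 * y1) = m" using assms(1,2) by (simp add: divide_eq_eq)
  then show ?thesis using assms(1,3,4) by (simp add: Let_def eq_neg_iff_add_eq_0)
qed

lemma ec_points_same_abscissa: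
  assumes "Affine x y1 \<in> ec_points a b" "Affine x y2 \<in> ec_points a b"
  shows "y1 = y2 \<or> y1 = - y2"
  using assms by (simp add: Affine_in_ec_points power2_eq_iff[symmetric])

lemma ec_add_commute:
  assumes "P \<in> ec_points a b" "Q \<in> ec_points a b"
  shows "ec_add a P Q = ec_add a Q P"
proof (cases "P = Infinity \<or> Q = Infinity")
  case False
  then obtain x1 y1 x2 y2 where PQ: "P = Affine x1 y1" "Q = Affine x2 y2"
    by (metis point.exhaust)
  show ?thesis
  proof (cases "x1 = x2")
    case True
    then show ?thesis using ec_points_same_abscissa[of x1 y1 a b y2] assms PQ by auto
  next
    case False
    define m where "m = (y2 - y1) / (x2 - x1)"
    have m: "m * (x2 - x1) = y2 - y1" using False by (simp add: m_def)
    define x3 where "x3 = m ^ 2 - x1 - x2"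
    have "ec_add a P Q = Affine x3 (m * (x1 - x3) - y1)"
      unfolding PQ by (rule ec_add_chord[OF False m x3_def refl])
    moreover have "ec_add a Q P = Affine x3 (m * (x1 - x3) - y1)"
      unfolding PQ by (rule ec_add_chord[where m = m]) (use False m in \<open>auto simp: x3_def algebra_simps\<close>)
    ultimately show ?thesis by simp
  qed
qed auto

lemma ec_add_eq_Infinity: "ec_add a P Q = Infinity \<longleftrightarrow> Q = ec_neg P"
  by (cases P; cases Q) (auto simp: Let_def)

lemma ec_add_neg:
  fixes P :: "'a::field point"
  shows "ec_add a (ec_neg P) (ec_neg Q) = ec_neg (ec_add a P Q)"
proof (cases "P = Infinity \<or> Q = Infinity")
  case False
  then obtain x1 y1 x2 y2 where PQ: "P = Affine x1 y1" "Q = Affine x2 y2"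
    by (metis point.exhaust)
  show ?thesis
  proof (cases "x1 = x2")
    case True
    have 2: "(3 * x1 ^ 2 + a) / (2 * - y1) = - ((3 * x1 ^ 2 + a) / (2 * y1))" by simp
    have 3: "- y1 = y2 \<longleftrightarrow> y1 = - y2" by auto
    show ?thesis unfolding PQ using True by (simp add: Let_def 2 3)
  next
    case False
    define m where "m = (y2 - y1) / (x2 - x1)"
    have m: "m * (x2 - x1) = y2 - y1" using False by (simp add: m_def)
    define x3 where "x3 = m ^ 2 - x1 - x2"
    have "ec_add a P Q = Affine x3 (m * (x1 - x3) - y1)"
      unfolding PQ by (rule ec_add_chord[OF False m x3_def refl])
    moreover have "ec_add a (ec_neg P) (ec_neg Q) = Affine x3 (- (m * (x1 - x3) - y1))"
      unfolding PQ ec_neg.simps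
      by (rule ec_add_chord[where m = "- m"]) (use False m in \<open>auto simp: x3_def algebra_simps\<close>)
    ultimately show ?thesis by simp
  qed
qed auto

text \<open>The equation \<open>m ^ 2 = x1 + 2 * x2\<close> says that the third intersection of the
  chord lies over \<open>x2\<close> again, which makes the chord the tangent there. If
  \<open>y2\<close> were 0, then \<open>x2\<close> would be a double root of the cubic, against the
  nonzero discriminant.\<close>

lemma tangency:
  fixes x1 :: "'a::field_char_0"
  assumes ns: "4 * a ^ 3 + 27 * b ^ 2 \<noteq> 0"
    and P: "y1 ^ 2 = x1 ^ 3 + a * x1 + b" "y2 ^ 2 = x2 ^ 3 + a * x2 + b" "x1 \<noteq> x2"
    and m: "m * (x2 - x1) = y2 - y1" "m ^ 2 = x1 + 2 * x2"
  shows "y2 \<noteq> 0" "m * (2 * y2) = 3 * x2 ^ 2 + a"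
proof -
  have "(x1 - x2) * (m * (y1 + y2)) = (x1 - x2) * (x1 ^ 2 + x1 * x2 + x2 ^ 2 + a)"
    using P(1,2) m(1) by Groebner_Basis.algebra
  then have e1: "m * (y1 + y2) = x1 ^ 2 + x1 * x2 + x2 ^ 2 + a" using P(3) by simp
  show e2: "m * (2 * y2) = 3 * x2 ^ 2 + a" using e1 m by Groebner_Basis.algebra
  show "y2 \<noteq> 0"
  proof
    assume "y2 = 0"
    then have "4 * a ^ 3 + 27 * b ^ 2 = 0" using e2 P(2) by Groebner_Basis.algebra
    then show False using ns by simp
  qed
qed

text \<open>This is the only shadow of associativity that is used. The line giving P + Q, reflected
  in the x-axis, passes through P + Q, -Q and -P, so the second sum is found with slope -m. When P +
  Q and -Q coincide the reflected line has to be recognised as the tangent.\<close>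

lemma ec_add_cancel:
  fixes P :: "'a::field_char_0 point"
  assumes ns: "4 * a ^ 3 + 27 * b ^ 2 \<noteq> 0" and PQ: "P \<in> ec_points a b" "Q \<in> ec_points a b"
  shows "ec_add a (ec_add a P Q) (ec_neg Q) = P"
proof (cases "P = Infinity \<or> Q = Infinity")
  case True
  then show ?thesis
    by (metis ec_add_Infinity_right ec_add_eq_Infinity ec_add.simps(1) ec_neg.simps(1))
next
  case False
  then obtain x1 y1 x2 y2 where PQ': "P = Affine x1 y1" "Q = Affine x2 y2"
    by (metis point.exhaust)
  have c: "y1 ^ 2 = x1 ^ 3 + a * x1 + b" "y2 ^ 2 = x2 ^ 3 + a * x2 + b"
    using PQ by (auto simp: PQ' Affine_in_ec_points)
  show ?thesis
  proof (cases "x1 = x2")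
    case True
    then consider "y1 = - y2" | "y1 = y2" "y1 \<noteq> 0"
      using ec_points_same_abscissa[of x1 y1 a b y2] PQ PQ' by force
    then show ?thesis
    proof cases
      case 1
      then show ?thesis using True by (simp add: PQ')
    next
      case 2
      define m where "m = (3 * x1 ^ 2 + a) / (2 * y1)"
      have m: "m * (2 * y1) = 3 * x1 ^ 2 + a" using 2 by (simp add: m_def)
      define x3 where "x3 = m ^ 2 - 2 * x1"
      define y3 where "y3 = m * (x1 - x3) - y1"
      have R: "ec_add a P Q = Affine x3 y3"
        unfolding PQ' True[symmetric] 2(1)[symmetric] by (rule ec_add_tangent[OF 2(2) m x3_def y3_def])
      show ?thesis
      proof (cases "x3 = x1")
        case x31: True
        then have y31: "y3 = - y1" by (simp add: y3_def)
        show ?thesis unfolding R unfolding PQ' ec_neg.simps True[symmetric] 2(1)[symmetric] x31 y31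
          by (rule ec_add_tangent[where m = "- m"]) (use 2 m x31 x3_def in \<open>auto simp: power2_eq_square\<close>)
      next
        case x31: False
        show ?thesis unfolding R unfolding PQ' ec_neg.simps True[symmetric] 2(1)[symmetric]
          by (rule ec_add_chord[where m = "- m"]) (use x31 in \<open>auto simp: x3_def y3_def algebra_simps\<close>)
      qed
    qed
  next
    case False
    define m where "m = (y2 - y1) / (x2 - x1)"
    have m: "m * (x2 - x1) = y2 - y1" using False by (simp add: m_def)
    define x3 where "x3 = m ^ 2 - x1 - x2"
    define y3 where "y3 = m * (x1 - x3) - y1"
    have R: "ec_add a P Q = Affine x3 y3"
      unfolding PQ' by (rule ec_add_chord[OF False m x3_def y3_def])
    show ?thesis
    proof (cases "x3 = x2")
      case x32: True
      have y32: "y3 = - y2" unfolding y3_def x32 using m by Groebner_Basis.algebra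
      have mm: "m ^ 2 = x1 + 2 * x2" using x32 unfolding x3_def by (simp add: algebra_simps)
      note t = tangency[OF ns c False m mm]
      show ?thesis unfolding R unfolding PQ' ec_neg.simps x32 y32
        by (rule ec_add_tangent[where m = "- m"]) (use t m mm in \<open>auto simp: algebra_simps\<close>)
    next
      case x32: False
      have "- m * (x2 - x3) = - y2 - y3" unfolding y3_def using m by Groebner_Basis.algebra
      then show ?thesis unfolding R unfolding PQ' ec_neg.simps
        by (intro ec_add_chord[where m = "- m"]) (use x32 in \<open>auto simp: x3_def y3_def algebra_simps\<close>)
    qed
  qed
qed

section \<open>Commutative loops with the inverse property and seven elements\<close>

lemma even_card_involution:
  assumes "finite A" "\<And>x. x \<in> A \<Longrightarrow> f x \<in> A" "\<And>x. x \<in> A \<Longrightarrow> f (f x) = x" "\<And>x. x \<in> A \<Longrightarrow> f x \<noteq> x"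
  shows "even (card A)"
  using assms
proof (induction "card A" arbitrary: A rule: less_induct)
  case less
  show ?case
  proof (cases "A = {}")
    case False
    then obtain x where x: "x \<in> A" by auto
    define B where "B = A - {x, f x}"
    have B: "finite B" "card B < card A" "\<And>y. y \<in> B \<Longrightarrow> f y \<in> B"
      using less.prems x unfolding B_def by (auto intro!: psubset_card_mono) (metis less.prems(3))+
    have "even (card B)"
      by (rule less.hyps[OF B(2) B(1) B(3)]) (use less.prems in \<open>auto simp: B_def\<close>)
    moreover have "card A = card B + 2"
    proof -
      have "f x \<noteq> x" using less.prems x by blast
      then have "card {x, f x} = 2" by (metis card_2_iff)
      moreover have "A = B \<union> {x, f x}" using less.prems(2)[OF x] x by (auto simp: B_def)
      ultimately show ?thesis using card_Un_disjoint[of B "{x, f x}"] B(1) by (auto simp: B_def)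
    qed
    ultimately show ?thesis by simp
  qed simp
qed

text \<open>Associativity of the chord and tangent law is never needed: a commutative loop with the
  inverse property and seven elements is already cyclic.\<close>

locale ip_loop7 =
  fixes H :: "'p set" and add :: "'p \<Rightarrow> 'p \<Rightarrow> 'p" and neg :: "'p \<Rightarrow> 'p" and z :: 'p
  assumes card_H: "card H = 7"
    and z: "z \<in> H" and closed: "\<And>p q. p \<in> H \<Longrightarrow> q \<in> H \<Longrightarrow> add p q \<in> H"
    and neg_closed: "\<And>p. p \<in> H \<Longrightarrow> neg p \<in> H"
    and comm: "\<And>p q. p \<in> H \<Longrightarrow> q \<in> H \<Longrightarrow> add p q = add q p"
    and zero: "\<And>p. add p z = p" and neg_neg: "\<And>p. neg (neg p) = p"
    and inv: "\<And>p q. add p q = z \<longleftrightarrow> q = neg p"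
    and neg_add: "\<And>p q. add (neg p) (neg q) = neg (add p q)"
    and cancel: "\<And>p q. p \<in> H \<Longrightarrow> q \<in> H \<Longrightarrow> add (add p q) (neg q) = p"
begin

lemma neg_z: "neg z = z"
  using inv zero by metis

lemma move: "p \<in> H \<Longrightarrow> q \<in> H \<Longrightarrow> add p q = s \<Longrightarrow> add s (neg q) = p"
  using cancel by blast

lemma move': "p \<in> H \<Longrightarrow> q \<in> H \<Longrightarrow> add p q = s \<Longrightarrow> add s (neg p) = q"
  using cancel comm by metis

lemma inj: "p \<in> H \<Longrightarrow> q \<in> H \<Longrightarrow> r \<in> H \<Longrightarrow> add p q = add p r \<longleftrightarrow> q = r"
  using move' by metis

text \<open>If p were its own negative, translation by p would be an involution without fixed
  points, and the number of elements would be even.\<close>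

lemma neg_ne:
  assumes "p \<in> H" "p \<noteq> z"
  shows "neg p \<noteq> p"
proof
  assume n: "neg p = p"
  have "even (card H)"
  proof (rule even_card_involution[of H "\<lambda>q. add q p"])
    show "finite H" using card_H by (simp add: card_ge_0_finite)
    show "add q p \<in> H" if "q \<in> H" for q using that assms closed by auto
    show "add (add q p) p = q" if "q \<in> H" for q using cancel[OF that assms(1)] n by simp
    show "add q p \<noteq> q" if "q \<in> H" for q using inj[OF that assms(1) z] assms zero by metis
  qed
  then show False using card_H by simp
qed

lemma distinct_pairs:
  assumes "p \<in> H" "p \<noteq> z" "q \<in> H" "q \<noteq> z" "q \<noteq> p" "q \<noteq> neg p"
  obtains r where "H = {z, p, neg p, q, neg q, r, neg r}" "r \<in> H" "card {z, p, neg p, q, neg q, r, neg r} = 7"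
proof -
  have fin: "finite H" using card_H by (simp add: card_ge_0_finite)
  have "card {z, p, neg p, q, neg q} \<le> 5" using card_length[of "[z, p, neg p, q, neg q]"] by simp
  then have "\<not> H \<subseteq> {z, p, neg p, q, neg q}" using card_H card_mono[of "{z, p, neg p, q, neg q}" H] by auto
  then obtain r where r: "r \<in> H" "r \<notin> {z, p, neg p, q, neg q}" by auto
  have ne: "neg x = neg y \<longleftrightarrow> x = y" "neg x = y \<longleftrightarrow> x = neg y" for x y using neg_neg by metis+
  have "distinct [z, p, neg p, q, neg q, r, neg r]"
    using r assms neg_ne[OF assms(1,2)] neg_ne[OF assms(3,4)] neg_ne[OF r(1)] neg_z by (auto simp: ne) (metis ne)+
  then have d: "card {z, p, neg p, q, neg q, r, neg r} = 7" using distinct_card by fastforce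
  have "{z, p, neg p, q, neg q, r, neg r} = H"
    by (rule card_subset_eq) (use fin d card_H assms r z neg_closed in auto)
  then show ?thesis using that r(1) d by auto
qed

text \<open>This excludes order 3. Outside {z, p, -p} lie two pairs \<plusminus>q, \<plusminus>s.
  Completing the addition table shows that p + q is neither s nor -s, and likewise for -q, so p + x
  = -x for both x = q and x = -q. Hence p = -(q + q) and p = q + q, contradicting
  \<open>neg_ne\<close>.\<close>

lemma double_ne_neg:
  assumes P: "p \<in> H" "p \<noteq> z"
  shows "add p p \<noteq> neg p"
proof
  assume pp: "add p p = neg p"
  have ne: "neg x = neg y \<longleftrightarrow> x = y" "neg x = y \<longleftrightarrow> x = neg y" for x y using neg_neg by metis+
  have third: "add p q \<noteq> s"
    if H: "H = {z, p, neg p, q, neg q, s, neg s}" "card {z, p, neg p, q, neg q, s, neg s} = 7" for q s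
  proof
    assume pq: "add p q = s"
    have mem: "q \<in> H" "s \<in> H" "neg q \<in> H" "neg s \<in> H" "neg p \<in> H" using H by auto
    have dist: "distinct [z, p, neg p, q, neg q, s, neg s]"
      by (rule card_distinct) (use H(2) in simp)
    \<comment> \<open>Translation by p is injective and already takes the values z, p, -p, s at -p,
      z, p, q. The other table entries are forced by the same elimination.\<close>
    have ps: "add p s \<in> {q, neg q, neg s}"
    proof -
      have "add p s \<in> H" using P mem closed by auto
      moreover have "add p s \<noteq> z" using inv dist by auto
      moreover have "add p s \<noteq> p" using inj[OF P(1) mem(2) z] zero dist by auto
      moreover have "add p s \<noteq> neg p" using inj[OF P(1) mem(2) P(1)] pp dist by auto
      moreover have "add p s \<noteq> s" using inj[OF P(1) mem(2) mem(1)] pq dist by auto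
      ultimately show ?thesis using H(1) by blast
    qed
    have p1: "add s (neg q) = p" using move[OF P(1) mem(1) pq] .
    have p2: "add p (neg s) = neg q"
      using move'[OF mem(2) mem(3) p1] neg_add[of s "neg q"] comm neg_neg mem P(1)
      by (metis move' neg_add p1)
    show False
    proof -
      from ps consider "add p s = q" | "add p s = neg q" | "add p s = neg s" by auto
      then show False
      proof cases
        case 1
        then have "add q (neg s) = p" using move P mem by blast
        moreover have "add q (neg s) = neg (add s (neg q))"
          using neg_add[of s "neg q"] comm mem neg_neg by metis
        ultimately have "p = neg p" using p1 by simp
        then show False using neg_ne[OF P] by metis
      next
        case 2
        then have "s = neg s" using p2 inj P mem by metis
        then show False using dist by auto
      next
        case 3
        have pnq: "add p (neg q) = q"
        proof -
          have "add p (neg q) \<in> H" using P mem closed by auto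
          moreover have "add p (neg q) \<noteq> z" using inv dist ne by auto
          moreover have "add p (neg q) \<noteq> p" using inj[OF P(1) mem(3) z] zero dist by auto
          moreover have "add p (neg q) \<noteq> neg p" using inj[OF P(1) mem(3) P(1)] pp dist by auto
          moreover have "add p (neg q) \<noteq> s" using inj[OF P(1) mem(3) mem(1)] pq dist by auto
          moreover have "add p (neg q) \<noteq> neg s" using inj[OF P(1) mem(3) mem(2)] 3 dist by auto
          moreover have "add p (neg q) \<noteq> neg q" using inj[OF P(1) mem(3) mem(4)] p2 dist by auto
          ultimately show ?thesis using H(1) by blast
        qed
        define t where "t = neg q"
        have tH: "t \<in> H" using mem by (simp add: t_def)
        have tp: "add t p = q" using pnq comm P tH by (simp add: t_def)
        have tt: "add t t = neg p"
        proof -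
          have "add q q = p" using move[OF P(1) mem(3) pnq] neg_neg by simp
          then show ?thesis unfolding t_def using neg_add by metis
        qed
        have tnp: "add t (neg p) = neg s"
          unfolding t_def using neg_add comm pq P mem by metis
        have tq: "add t q = z" unfolding t_def using inv neg_neg by metis
        have ts: "add t s = p"
          unfolding t_def using p1 comm mem by metis
        have "add t (neg s) = s"
        proof -
          have "add t (neg s) \<in> H" using tH mem closed by auto
          moreover have "add t (neg s) \<noteq> z" using inj[OF tH mem(4) mem(1)] tq dist by auto
          moreover have "add t (neg s) \<noteq> neg q" using inj[OF tH mem(4) z] zero dist by (auto simp: t_def)
          moreover have "add t (neg s) \<noteq> neg p" using inj[OF tH mem(4) tH] tt dist by (auto simp: t_def)
          moreover have "add t (neg s) \<noteq> neg s" using inj[OF tH mem(4) mem(5)] tnp dist by auto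
          moreover have "add t (neg s) \<noteq> q" using inj[OF tH mem(4) P(1)] tp dist by auto
          moreover have "add t (neg s) \<noteq> p" using inj[OF tH mem(4) mem(2)] ts dist by auto
          ultimately show ?thesis using H(1) by blast
        qed
        then have "add s s = t" using move[OF tH mem(4)] neg_neg by metis
        moreover have "add s s = neg p"
          using move[OF P(1) mem(2) 3] neg_add[of s s] neg_neg by metis
        ultimately show False using dist by (auto simp: t_def)
      qed
    qed
  qed
  have "\<not> H \<subseteq> {z, p, neg p}"
    using card_H card_mono[of "{z, p, neg p}" H] card_length[of "[z, p, neg p]"] by auto
  then obtain q where q: "q \<in> H" "q \<notin> {z, p, neg p}" by auto
  then obtain s where s: "H = {z, p, neg p, q, neg q, s, neg s}" "s \<in> H" "card {z, p, neg p, q, neg q, s, neg s} = 7"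
    using distinct_pairs[OF P, of q] by auto
  have both: "add p x = neg x" if "x = q \<or> x = neg q" for x
  proof -
    have x: "x \<in> H" using that s(1) by auto
    have dist: "distinct [z, p, neg p, q, neg q, s, neg s]"
      by (rule card_distinct) (use s(3) in simp)
    have e1: "{z, p, neg p, q, neg q, s, neg s} = {z, p, neg p, x, neg x, s, neg s}"
      using that neg_neg by auto
    have e2: "{z, p, neg p, x, neg x, neg s, neg (neg s)} = {z, p, neg p, x, neg x, s, neg s}"
      using neg_neg by auto
    have "add p x \<noteq> s" using third[of x s] s e1 by simp
    moreover have "add p x \<noteq> neg s" using third[of x "neg s"] s e1 e2 by simp
    moreover have "add p x \<in> H" using P x closed by auto
    moreover have "add p x \<noteq> z" using inv that dist ne by auto
    moreover have "add p x \<noteq> p" using inj[OF P(1) x z] zero that dist by auto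
    moreover have "add p x \<noteq> neg p" using inj[OF P(1) x P(1)] pp that dist by auto
    moreover have "add p x \<noteq> x" using inj[OF x P(1) z] comm[OF P(1) x] zero P by metis
    ultimately show ?thesis using s(1) e1 by blast
  qed
  have "p = neg (add q q)"
    using both[of q] move[OF P(1) q(1)] neg_add by metis
  moreover have "p = add q q"
    using both[of "neg q"] move[OF P(1), of "neg q" q] neg_closed[OF q(1)] neg_neg by metis
  ultimately show False using neg_ne P by metis
qed

text \<open>The elements p, q, r are p, 2p, 4p; doubling cycles through them because 8 = 1 modulo 7.
  Once the values 4p = p and 4p = -p are excluded, every remaining entry in the row of p is forced
  by injectivity of translation.\<close>

theorem cyclic:
  obtains p q r where "p \<in> H" "p \<noteq> z" "q \<in> H" "r \<in> H"
    "add p p = q" "add q q = r" "add r r = p" "add p q = neg r"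
    "H = {z, p, neg p, q, neg q, r, neg r}" "card {z, p, neg p, q, neg q, r, neg r} = 7"
proof -
  have ne: "neg x = neg y \<longleftrightarrow> x = y" "neg x = y \<longleftrightarrow> x = neg y" for x y using neg_neg by metis+
  have "\<not> H \<subseteq> {z}" using card_H card_mono[of "{z}" H] by auto
  then obtain p where p: "p \<in> H" "p \<noteq> z" by auto
  define q where "q = add p p"
  have q: "q \<in> H" "q \<noteq> z" "q \<noteq> p" "q \<noteq> neg p"
    using p closed inv neg_ne double_ne_neg inj[OF p(1) p(1) z] zero unfolding q_def by metis+
  define r where "r = add q q"
  have r: "r \<in> H" "r \<noteq> z" "r \<noteq> q" "r \<noteq> neg q"
    using q closed inv neg_ne double_ne_neg inj[OF q(1) q(1) z] zero unfolding r_def by metis+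
  have np: "neg p \<in> H" "neg q \<in> H" "neg r \<in> H" using p q r neg_closed by auto
  have pnq: "add p (neg q) = neg p"
  proof -
    have "add q (neg p) = p" using move p(1) q_def by metis
    then show ?thesis using neg_add[of q "neg p"] comm[OF p(1) np(2)] neg_neg by metis
  qed
  have "r \<noteq> p"
  proof
    assume "r = p"
    then have "add p (neg q) = q" using move[OF q(1) q(1)] r_def by metis
    then show False using pnq q by metis
  qed
  \<comment> \<open>This excludes order 5. For the one remaining pair \<plusminus>c the table forces
    p + c = -c and p - c = c, so p = -p as in the case of order 3.\<close>
  moreover have "r \<noteq> neg p"
  proof
    assume rp: "r = neg p"
    then have "add (neg p) (neg q) = q" using move[OF q(1) q(1)] r_def by metis
    then have pq: "add p q = neg q" using neg_add neg_neg by metis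
    obtain c where c: "H = {z, p, neg p, q, neg q, c, neg c}" "c \<in> H" "card {z, p, neg p, q, neg q, c, neg c} = 7"
      using distinct_pairs[OF p q(1,2,3,4)] by auto
    have dist: "distinct [z, p, neg p, q, neg q, c, neg c]"
      by (rule card_distinct) (use c(3) in simp)
    have val: "add p x = neg x" if x: "x = c \<or> x = neg c" for x
    proof -
      have xH: "x \<in> H" using x c neg_closed by auto
      have "add p x \<in> H" using p xH closed by auto
      moreover have "add p x \<noteq> z" using inv x dist ne by auto
      moreover have "add p x \<noteq> p" using inj[OF p(1) xH z] zero x dist by auto
      moreover have "add p x \<noteq> q" using inj[OF p(1) xH p(1)] q_def x dist by auto
      moreover have "add p x \<noteq> neg q" using inj[OF p(1) xH q(1)] pq x dist by auto
      moreover have "add p x \<noteq> neg p" using inj[OF p(1) xH np(2)] pnq x dist by auto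
      moreover have "add p x \<noteq> x" using inj[OF xH p(1) z] comm[OF p(1) xH] zero p by metis
      ultimately have "add p x \<in> {c, neg c}" "add p x \<noteq> x" using c(1) by blast+
      then show ?thesis using x neg_neg by (metis insertE singletonD)
    qed
    have "p = neg (add c c)"
      using val[of c] move[OF p(1) c(2)] neg_add by metis
    moreover have "p = add c c"
      using val[of "neg c"] move[OF p(1), of "neg c" c] neg_closed[OF c(2)] neg_neg by metis
    ultimately show False using neg_ne p by metis
  qed
  ultimately have rne: "r \<noteq> p" "r \<noteq> neg p" by auto
  obtain c where c: "H = {z, p, neg p, q, neg q, c, neg c}" "c \<in> H" "card {z, p, neg p, q, neg q, c, neg c} = 7"
    using distinct_pairs[OF p q(1,2,3,4)] by auto
  have "r = c \<or> r = neg c" using c(1) r rne by auto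
  then have eq: "{z, p, neg p, q, neg q, c, neg c} = {z, p, neg p, q, neg q, r, neg r}" using neg_neg by auto
  have H: "H = {z, p, neg p, q, neg q, r, neg r}" "card {z, p, neg p, q, neg q, r, neg r} = 7" using c eq by auto
  have dist: "distinct [z, p, neg p, q, neg q, r, neg r]"
    by (rule card_distinct) (use H(2) in simp)
  have pq: "add p q = neg r"
  proof -
    have "add p q \<in> H" using p q closed by auto
    moreover have "add p q \<noteq> z" using inv dist by auto
    moreover have "add p q \<noteq> p" using inj[OF p(1) q(1) z] zero dist by auto
    moreover have "add p q \<noteq> q" using inj[OF p(1) q(1) p(1)] q_def dist by auto
    moreover have "add p q \<noteq> neg p" using inj[OF p(1) q(1) np(2)] pnq dist by auto
    moreover have "add p q \<noteq> neg q"
    proof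
      assume "add p q = neg q"
      then have "p = neg r" using move[OF p(1) q(1)] neg_add r_def by metis
      then show False using dist ne by auto
    qed
    moreover have "add p q \<noteq> r"
    proof
      assume "add p q = r"
      then have "p = q" using inj[OF q(1) p(1) q(1)] comm[OF p(1) q(1)] r_def by metis
      then show False using dist by auto
    qed
    ultimately show ?thesis using H(1) by blast
  qed
  have pr: "add p r = neg q"
  proof -
    have "add (neg p) (neg q) = r" using pq neg_add neg_neg by metis
    then have "add r p = neg q" using move'[OF np(1,2)] neg_neg by metis
    then show ?thesis using comm p r by metis
  qed
  have "add p (neg r) = r"
  proof -
    have "add p (neg r) \<in> H" using p np closed by auto
    moreover have "add p (neg r) \<noteq> z" using inv dist ne by auto
    moreover have "add p (neg r) \<noteq> p" using inj[OF p(1) np(3) z] zero dist by auto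
    moreover have "add p (neg r) \<noteq> q" using inj[OF p(1) np(3) p(1)] q_def dist by auto
    moreover have "add p (neg r) \<noteq> neg p" using inj[OF p(1) np(3) np(2)] pnq dist by auto
    moreover have "add p (neg r) \<noteq> neg r" using inj[OF p(1) np(3) q(1)] pq dist by auto
    moreover have "add p (neg r) \<noteq> neg q" using inj[OF p(1) np(3) r(1)] pr dist by auto
    ultimately show ?thesis using H(1) by blast
  qed
  then have "add r r = p" using move[OF p(1) np(3)] neg_neg by metis
  then show ?thesis using that p q r pq H q_def r_def by metis
qed

end

section \<open>The modular parametrization\<close>

text \<open>With t = a/b as coordinate on X_0(7), the classical formulas read j = q u^3 / (a b^7)
  and j - 1728 = w^2 / (a b^7). The forms A = -3 q u and B = 2 q w are the coefficients of a curve
  with this j-invariant; its discriminant expression 4 A^3 + 27 B^2 equals -186624 q^2 a b^7, so a =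
  0 and b = 0 are the cusps.\<close>

definition q_form :: "'a::comm_ring_1 \<Rightarrow> 'a \<Rightarrow> 'a" where
  "q_form a b = a ^ 2 + 13 * a * b + 49 * b ^ 2"

definition u_form :: "'a::comm_ring_1 \<Rightarrow> 'a \<Rightarrow> 'a" where
  "u_form a b = a ^ 2 + 5 * a * b + b ^ 2"

definition w_form :: "'a::comm_ring_1 \<Rightarrow> 'a \<Rightarrow> 'a" where
  "w_form a b = a ^ 4 + 14 * a ^ 3 * b + 63 * a ^ 2 * b ^ 2 + 70 * a * b ^ 3 - 7 * b ^ 4"

definition A_form :: "'a::comm_ring_1 \<Rightarrow> 'a \<Rightarrow> 'a" where
  "A_form a b = - 3 * q_form a b * u_form a b"

definition B_form :: "'a::comm_ring_1 \<Rightarrow> 'a \<Rightarrow> 'a" where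
  "B_form a b = 2 * q_form a b * w_form a b"

lemmas form_defs = q_form_def u_form_def w_form_def A_form_def B_form_def

lemma w_form_square:
  fixes a b :: "'a::idom"
  shows "w_form a b ^ 2 = q_form a b * u_form a b ^ 3 - 1728 * a * b ^ 7"
  unfolding form_defs by Groebner_Basis.algebra

lemma q_form_pos:
  fixes a b :: "'a::linordered_idom"
  assumes "a \<noteq> 0 \<or> b \<noteq> 0"
  shows "q_form a b > 0"
proof -
  have "4 * q_form a b = (2 * a + 13 * b) ^ 2 + 27 * b ^ 2"
    unfolding form_defs by (simp add: power2_eq_square algebra_simps)
  moreover have "(2 * a + 13 * b) ^ 2 + 27 * b ^ 2 > 0"
    using assms by (cases "b = 0") (auto intro: add_nonneg_pos)
  ultimately show ?thesis by simp
qed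

text \<open>The form q is definite, and for u and w the rational root test leaves |b| = 1 with a
  dividing 1 or 7. Hence j = 0 and j = 1728 never occur, only quadratic twists matter, and the
  twisting factor is a ratio of nonzero rational numbers.\<close>

lemma coprime_forms_nonzero:
  fixes a b :: int
  assumes "coprime a b"
  shows "q_form a b \<noteq> 0" "u_form a b \<noteq> 0" "w_form a b \<noteq> 0" "A_form a b \<noteq> 0" "B_form a b \<noteq> 0"
proof -
  have unit: "\<bar>y\<bar> = 1" if "y dvd x ^ k" "coprime x y" for x y :: int and k
  proof -
    have "coprime (x ^ k) y" using that(2) by simp
    then have "is_unit y" using that(1) coprime_absorb_right by blast
    then show ?thesis by simp
  qed
  have "a \<noteq> 0 \<or> b \<noteq> 0" using assms by auto
  then show q: "q_form a b \<noteq> 0" using q_form_pos[of a b] by simp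
  show u: "u_form a b \<noteq> 0"
  proof
    assume u: "u_form a b = 0"
    have "a ^ 2 = b * (- 5 * a - b)" "b ^ 2 = a * (- 5 * b - a)"
      using u by (auto simp: form_defs power2_eq_square algebra_simps)
    then have "b dvd a ^ 2" "a dvd b ^ 2" by (metis dvd_triv_left)+
    then have "\<bar>b\<bar> = 1" "\<bar>a\<bar> = 1" using assms unit by (auto simp: coprime_commute)
    then have "a \<in> {1, -1}" "b \<in> {1, -1}" by auto
    then show False using u by (auto simp: form_defs)
  qed
  show w: "w_form a b \<noteq> 0"
  proof
    assume w: "w_form a b = 0"
    have "a ^ 4 = b * (- 14 * a ^ 3 - 63 * a ^ 2 * b - 70 * a * b ^ 2 + 7 * b ^ 3)"
      "7 * b ^ 4 = a * (a ^ 3 + 14 * a ^ 2 * b + 63 * a * b ^ 2 + 70 * b ^ 3)"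
      using w by (auto simp: form_defs eval_nat_numeral algebra_simps)
    then have "b dvd a ^ 4" "a dvd 7 * b ^ 4" by (metis dvd_triv_left)+
    then have b: "\<bar>b\<bar> = 1" using assms unit by blast
    have "coprime a (b ^ 4)" using assms by simp
    then have "a dvd 7" using \<open>a dvd 7 * b ^ 4\<close> by (simp add: coprime_dvd_mult_left_iff)
    have "\<bar>a\<bar> dvd 7" using \<open>a dvd 7\<close> by simp
    then have "\<bar>a\<bar> \<le> 7" "a \<noteq> 0" using zdvd_imp_le[of "\<bar>a\<bar>" 7] by auto
    have "\<bar>a\<bar> = 1 \<or> \<bar>a\<bar> = 7"
      using prime_int_iff[of 7] \<open>\<bar>a\<bar> dvd 7\<close> by auto
    then have "a \<in> {1, -1, 7, -7}" "b \<in> {1, -1}" using b by auto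
    then show False using w by (auto simp: form_defs)
  qed
  show "A_form a b \<noteq> 0" "B_form a b \<noteq> 0" using q u w by (auto simp: A_form_def B_form_def)
qed

lemma q_form_scale: "q_form (a * c) (b * c) = c ^ 2 * q_form a b" for a :: "'a::idom"
  unfolding form_defs by Groebner_Basis.algebra
lemma u_form_scale: "u_form (a * c) (b * c) = c ^ 2 * u_form a b" for a :: "'a::idom"
  unfolding form_defs by Groebner_Basis.algebra
lemma w_form_scale: "w_form (a * c) (b * c) = c ^ 4 * w_form a b" for a :: "'a::idom"
  unfolding form_defs by Groebner_Basis.algebra
lemma A_form_scale: "A_form (a * c) (b * c) = c ^ 4 * A_form a b" for a :: "'a::idom"
  unfolding form_defs by Groebner_Basis.algebra
lemma B_form_scale: "B_form (a * c) (b * c) = c ^ 6 * B_form a b" for a :: "'a::idom"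
  unfolding form_defs by Groebner_Basis.algebra

lemma form_of_int:
  "q_form (of_int a) (of_int b) = of_int (q_form a b)" "u_form (of_int a) (of_int b) = of_int (u_form a b)"
  "w_form (of_int a) (of_int b) = of_int (w_form a b)" "A_form (of_int a) (of_int b) = of_int (A_form a b)"
  "B_form (of_int a) (of_int b) = of_int (B_form a b)"
  by (auto simp: form_defs)

lemma form_to_ac:
  "q_form (to_ac a) (to_ac b) = to_ac (q_form a b)" "u_form (to_ac a) (to_ac b) = to_ac (u_form a b)"
  "w_form (to_ac a) (to_ac b) = to_ac (w_form a b)" "A_form (to_ac a) (to_ac b) = to_ac (A_form a b)"
  "B_form (to_ac a) (to_ac b) = to_ac (B_form a b)"
  by (auto simp: form_defs)

lemma rat_forms_nonzero:
  fixes t :: rat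
  shows "q_form t 1 \<noteq> 0" "A_form t 1 \<noteq> 0" "B_form t 1 \<noteq> 0"
proof -
  obtain a b where ab: "t = of_int a / of_int b" "b > 0" "coprime a b"
    by (cases t) (auto simp: Fract_of_int_quotient)
  have e: "t * of_int b = of_int a" "1 * of_int b = (of_int b :: rat)" using ab by auto
  have "of_int b ^ 2 * q_form t 1 = of_int (q_form a b)" "of_int b ^ 4 * A_form t 1 = of_int (A_form a b)"
    "of_int b ^ 6 * B_form t 1 = of_int (B_form a b)"
    using q_form_scale[of t "of_int b" 1] A_form_scale[of t "of_int b" 1] B_form_scale[of t "of_int b" 1] e
    by (simp_all only: form_of_int)
  then show "q_form t 1 \<noteq> 0" "A_form t 1 \<noteq> 0" "B_form t 1 \<noteq> 0"
    using coprime_forms_nonzero[OF ab(3)] by (metis mult_zero_right of_int_eq_0_iff)+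
qed

section \<open>From a Galois-stable subgroup to a rational parameter\<close>

lemma Galois_simps:
  assumes "\<sigma> \<in> absolute_galois_group_Q"
  shows "\<sigma> (x + y) = \<sigma> x + \<sigma> y" "\<sigma> (x * y) = \<sigma> x * \<sigma> y" "\<sigma> (to_ac q) = to_ac q"
    "\<sigma> 0 = 0" "\<sigma> 1 = 1" "\<sigma> (- x) = - \<sigma> x" "\<sigma> (x - y) = \<sigma> x - \<sigma> y" "\<sigma> (x / y) = \<sigma> x / \<sigma> y"
    "\<sigma> (x ^ n) = \<sigma> x ^ n" "\<sigma> (of_int k) = of_int k" "\<sigma> (numeral m) = numeral m"
    "\<sigma> x = \<sigma> y \<longleftrightarrow> x = y"
proof -
  show add: "\<sigma> (x + y) = \<sigma> x + \<sigma> y" and mult: "\<sigma> (x * y) = \<sigma> x * \<sigma> y" and rat: "\<sigma> (to_ac q) = to_ac q"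
    for x y q using assms by (auto simp: absolute_galois_group_Q_def)
  show inj: "\<sigma> x = \<sigma> y \<longleftrightarrow> x = y" for x y
    using assms by (auto simp: absolute_galois_group_Q_def bij_def dest: injD)
  show 0: "\<sigma> 0 = 0" and 1: "\<sigma> 1 = 1" using rat[of 0] rat[of 1] by auto
  show minus: "\<sigma> (- x) = - \<sigma> x" for x using add[of x "- x"] 0 by (simp add: eq_neg_iff_add_eq_0 add.commute)
  show "\<sigma> (x - y) = \<sigma> x - \<sigma> y" using add[of x "- y"] minus by simp
  show "\<sigma> (x / y) = \<sigma> x / \<sigma> y"
  proof (cases "y = 0")
    case False
    then have "\<sigma> y \<noteq> 0" using inj[of y 0] 0 by simp
    moreover have "\<sigma> (x / y) * \<sigma> y = \<sigma> x" using False by (simp flip: mult)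
    ultimately show ?thesis by (simp add: eq_divide_eq)
  qed (simp add: 0)
  show "\<sigma> (x ^ n) = \<sigma> x ^ n" by (induction n) (auto simp: 1 mult)
  show "\<sigma> (of_int k) = of_int k" using rat[of "of_int k"] by simp
  show "\<sigma> (numeral m) = numeral m" using rat[of "numeral m"] by simp
qed

lemma map_point_ec_add:
  assumes s: "\<sigma> \<in> absolute_galois_group_Q"
  shows "map_point \<sigma> (ec_add (of_int A) P Q) = ec_add (of_int A) (map_point \<sigma> P) (map_point \<sigma> Q)"
proof (cases "P = Infinity \<or> Q = Infinity")
  case False
  then obtain x1 y1 x2 y2 where PQ: "P = Affine x1 y1" "Q = Affine x2 y2"
    by (metis point.exhaust)
  have "\<sigma> y1 = - \<sigma> y2 \<longleftrightarrow> y1 = - y2" using Galois_simps(6,12)[OF s] by metis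
  then show ?thesis unfolding PQ by (simp add: Let_def Galois_simps[OF s])
qed auto

lemma ec_add_doubleD:
  fixes x y :: "'a::field_char_0"
  assumes "ec_add a (Affine x y) (Affine x y) = Affine x' y'"
  obtains m where "y \<noteq> 0" "m * (2 * y) = 3 * x ^ 2 + a" "x' = m ^ 2 - 2 * x" "y' = m * (x - x') - y"
proof -
  have y: "y \<noteq> 0" using assms by (auto split: if_splits)
  define m where "m = (3 * x ^ 2 + a) / (2 * y)"
  have m: "m * (2 * y) = 3 * x ^ 2 + a" using y by (simp add: m_def)
  show ?thesis using that[OF y m] ec_add_tangent[OF y m refl refl] assms by auto
qed

lemma ec_add_chordD:
  assumes "ec_add a (Affine x1 y1) (Affine x2 y2) = Affine x3 y3" "x1 \<noteq> x2"
  obtains m where "m * (x2 - x1) = y2 - y1" "x3 = m ^ 2 - x1 - x2" "y3 = m * (x1 - x3) - y1"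
proof -
  define m where "m = (y2 - y1) / (x2 - x1)"
  have m: "m * (x2 - x1) = y2 - y1" using assms(2) by (simp add: m_def)
  show ?thesis using that[OF m] ec_add_chord[OF assms(2) m refl refl] assms by auto
qed

text \<open>The points are P, 2P, 4P of a point of order 7. The description is invariant under
  cyclic rotation, that is under multiplication by 2; together with negation this gives all
  automorphisms of the cyclic group of order 7.\<close>

definition chain7 :: "'a::field \<Rightarrow> 'a \<Rightarrow> 'a point \<Rightarrow> 'a point \<Rightarrow> 'a point \<Rightarrow> bool" where
  "chain7 a b P Q R \<longleftrightarrow> {P, Q, R} \<subseteq> ec_points a b \<and> Infinity \<notin> {P, Q, R} \<and>
     Q \<notin> {P, ec_neg P} \<and> R \<notin> {Q, ec_neg Q} \<and> P \<notin> {R, ec_neg R} \<and>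
     ec_add a P P = Q \<and> ec_add a Q Q = R \<and> ec_add a R R = P \<and>
     ec_add a P Q = ec_neg R \<and> ec_add a Q R = ec_neg P \<and> ec_add a R P = ec_neg Q"

lemma chain7_rotate: "chain7 a b P Q R \<Longrightarrow> chain7 a b Q R P"
  unfolding chain7_def by auto

text \<open>This is the standard coordinate d on X_1(7), written in the coordinates of P and 2P. The
  quotient is unchanged by rescaling the model and by negating the points, and it is rational in the
  coordinates, so it commutes with Galois.\<close>

definition tate_d :: "'a::field point \<Rightarrow> 'a point \<Rightarrow> 'a" where
  "tate_d P Q = (case P of Infinity \<Rightarrow> 0 | Affine x1 y1 \<Rightarrow>
     (case Q of Infinity \<Rightarrow> 0 | Affine x2 y2 \<Rightarrow> (x1 - x2) ^ 3 / (4 * y1 * y2)))"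

lemma tate_d_neg: "tate_d (ec_neg P) (ec_neg Q) = tate_d P Q"
  by (auto simp: tate_d_def split: point.splits)

lemma tate_d_map:
  "\<sigma> \<in> absolute_galois_group_Q \<Longrightarrow> tate_d (map_point \<sigma> P) (map_point \<sigma> Q) = \<sigma> (tate_d P Q)"
  by (auto simp: tate_d_def Galois_simps split: point.splits)

text \<open>The translate of a point of order 7 to Tate normal form
  \<open>y\<^sup>2 + (1 - c) x y - b y = x\<^sup>3 - b x\<^sup>2\<close> has \<open>b = d\<^sup>3 - d\<^sup>2\<close> and \<open>c = d\<^sup>2 - d\<close>.\<close>

lemma chain7_tate:
  fixes a b :: "'a::field_char_0"
  assumes ch: "chain7 a b P Q R" and d: "d = tate_d P Q"
  obtains z where "z \<noteq> 0" "d \<noteq> 0" "d \<noteq> 1" "tate_d Q R = 1 - 1 / d"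
    "a = - 27 * z ^ 4 * (d ^ 2 - d + 1) * u_form (d ^ 3 - 8 * d ^ 2 + 5 * d + 1) (d ^ 2 - d)"
    "b = 54 * z ^ 6 * w_form (d ^ 3 - 8 * d ^ 2 + 5 * d + 1) (d ^ 2 - d)"
proof -
  obtain x1 y1 x2 y2 x3 y3 where PQR: "P = Affine x1 y1" "Q = Affine x2 y2" "R = Affine x3 y3"
    using ch unfolding chain7_def by (metis insertI1 insertI2 point.exhaust)
  have on: "y1 ^ 2 = x1 ^ 3 + a * x1 + b" using ch by (simp add: chain7_def PQR Affine_in_ec_points)
  have x12: "x1 \<noteq> x2"
    using ch ec_points_same_abscissa[of x1 y1 a b y2] by (auto simp: chain7_def PQR)
  have x23: "x2 \<noteq> x3"
    using ch ec_points_same_abscissa[of x2 y2 a b y3] by (auto simp: chain7_def PQR)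
  obtain m1 where m1: "y1 \<noteq> 0" "m1 * (2 * y1) = 3 * x1 ^ 2 + a" "x2 = m1 ^ 2 - 2 * x1" "y2 = m1 * (x1 - x2) - y1"
    by (rule ec_add_doubleD[of a x1 y1 x2 y2]) (use ch in \<open>auto simp: chain7_def PQR\<close>)
  obtain m2 where m2: "y2 \<noteq> 0" "m2 * (2 * y2) = 3 * x2 ^ 2 + a" "x3 = m2 ^ 2 - 2 * x2"
    by (rule ec_add_doubleD[of a x2 y2 x3 y3]) (use ch in \<open>auto simp: chain7_def PQR\<close>)
  obtain l where l: "l * (x2 - x1) = y2 - y1" "x3 = l ^ 2 - x1 - x2" "- y3 = l * (x1 - x3) - y1"
    by (rule ec_add_chordD[of a x1 y1 x2 y2 x3 "- y3"]) (use ch x12 in \<open>auto simp: chain7_def PQR\<close>)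
  define \<alpha> where "\<alpha> = x1 - x2"
  \<comment> \<open>The number z is the scale between the given model and the model with
    coefficients -27 c_4 and -54 c_6 of the Tate form, whose point (0, 0) corresponds to P. In that
    picture \<open>c\<close> and \<open>bb\<close> are Tate's parameters c and b.\<close>
  define z where "z = y1 / (3 * \<alpha>)"
  define c where "c = - y2 / y1"
  define bb where "bb = c * d"
  have al: "\<alpha> \<noteq> 0" using x12 by (simp add: \<alpha>_def)
  have z0: "z \<noteq> 0" using al m1(1) by (simp add: z_def)
  have c0: "c \<noteq> 0" using m1(1) m2(1) by (simp add: c_def)
  have y1: "y1 = 3 * z * \<alpha>" using al by (simp add: z_def)
  have y2: "y2 = - c * y1" using m1(1) by (simp add: c_def)
  have dd: "d = \<alpha> ^ 3 / (4 * y1 * y2)" by (simp add: d tate_d_def PQR \<alpha>_def)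
  have "d * (4 * y1 * y2) = \<alpha> ^ 3" using dd m1(1) m2(1) by simp
  then have "\<alpha> ^ 2 * (\<alpha> + 36 * bb * z ^ 2) = 0" unfolding y2 y1 bb_def by Groebner_Basis.algebra
  then have alb: "\<alpha> = - 36 * bb * z ^ 2" using al by (simp add: eq_neg_iff_add_eq_0)
  have "\<alpha> * (m1 - 3 * z * (1 - c)) = 0"
    using m1(4) y1 y2 unfolding \<alpha>_def by Groebner_Basis.algebra
  then have m1z: "m1 = 3 * z * (1 - c)" using al by simp
  have "\<alpha> * (l - 3 * z * (1 + c)) = 0"
    using l(1) y1 y2 unfolding \<alpha>_def by Groebner_Basis.algebra
  then have lz: "l = 3 * z * (1 + c)" using al by simp
  have "3 * x1 = \<alpha> + m1 ^ 2" using m1(3) by (simp add: \<alpha>_def)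
  then have "3 * x1 = 3 * (3 * z ^ 2 * ((1 - c) ^ 2 - 4 * bb))"
    unfolding alb m1z by Groebner_Basis.algebra
  then have x1: "x1 = 3 * z ^ 2 * ((1 - c) ^ 2 - 4 * bb)" by simp
  have x2: "x2 = x1 - \<alpha>" by (simp add: \<alpha>_def)
  have a: "a = m1 * (2 * y1) - 3 * x1 ^ 2" using m1(2) by simp
  have "2 * y2 * (m2 - 6 * z * d - 3 * z * (c - 1)) = 0"
    using m2(2) unfolding a x2 y2 y1 m1z x1 alb bb_def by Groebner_Basis.algebra
  then have "m2 - 6 * z * d - 3 * z * (c - 1) = 0" using m2(1) by (metis mult_eq_0_iff zero_neq_numeral)
  then have m2z: "m2 = 6 * z * d + 3 * z * (c - 1)" by (simp add: algebra_simps)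
  \<comment> \<open>Here the order 7 is used: 4P, by doubling 2P, and -3P, by the chord through P
    and 2P, have the same abscissa. This forces c = d^2 - d.\<close>
  have "m2 ^ 2 = l ^ 2 - \<alpha>" using m2(3) l(2) by (simp add: \<alpha>_def algebra_simps)
  then have "36 * z ^ 2 * (d ^ 2 - d - c) = 0" unfolding m2z lz alb bb_def by Groebner_Basis.algebra
  then have cd: "c = d ^ 2 - d" using z0 by simp
  have d01: "d \<noteq> 0" "d \<noteq> 1" using c0 cd by auto
  have bbd: "bb = d ^ 3 - d ^ 2" unfolding bb_def cd by (simp add: eval_nat_numeral algebra_simps)
  have "a = - 27 * z ^ 4 * (d ^ 2 - d + 1) * u_form (d ^ 3 - 8 * d ^ 2 + 5 * d + 1) (d ^ 2 - d)"
    unfolding a y1 m1z x1 alb cd bbd form_defs by Groebner_Basis.algebra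
  moreover have "b = 54 * z ^ 6 * w_form (d ^ 3 - 8 * d ^ 2 + 5 * d + 1) (d ^ 2 - d)"
  proof -
    have "b = y1 ^ 2 - x1 ^ 3 - a * x1" using on by simp
    then show ?thesis unfolding a y1 m1z x1 alb cd bbd form_defs by Groebner_Basis.algebra
  qed
  \<comment> \<open>Replacing P by 2P acts on X_1(7) as this automorphism of order 3.\<close>
  moreover have "tate_d Q R = 1 - 1 / d"
  proof -
    have x3: "x3 = x1 + 36 * c * z ^ 2" using l(2) unfolding lz x2 x1 alb by Groebner_Basis.algebra
    have y3: "y3 = - 108 * z ^ 3 * (bb - c - c ^ 2)"
      using l(3) unfolding lz x3 y1 alb by Groebner_Basis.algebra
    have num: "(x2 - x3) ^ 3 = 46656 * z ^ 6 * (d ^ 2 - d) ^ 3 * (d - 1) ^ 3"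
      unfolding x3 x2 alb bbd cd by Groebner_Basis.algebra
    have den: "4 * y2 * y3 = 46656 * z ^ 6 * (d ^ 2 - d) ^ 3 * (d - 1) ^ 2 * d"
      unfolding y3 y2 y1 alb bbd cd by Groebner_Basis.algebra
    have "d ^ 2 - d \<noteq> 0" "d - 1 \<noteq> 0" using c0 cd d01 by auto
    then have "(x2 - x3) ^ 3 / (4 * y2 * y3) = (d - 1) / d"
      unfolding num den using z0 d01 by (simp add: power3_eq_cube power2_eq_square)
    then show ?thesis using d01 by (simp add: tate_d_def PQR diff_divide_distrib)
  qed
  ultimately show ?thesis using that z0 d01 by blast
qed

text \<open>This is the sum of d, 1 - 1/d and 1/(1 - d), minus 8: an invariant of the order 3
  automorphism, hence the coordinate t of X_0(7) as a function on X_1(7).\<close>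

definition modular_t :: "'a::field \<Rightarrow> 'a" where
  "modular_t d = (d ^ 3 - 8 * d ^ 2 + 5 * d + 1) / (d ^ 2 - d)"

lemma modular_t_rotate:
  fixes d :: "'a::field"
  assumes "d \<noteq> 0" "d \<noteq> 1"
  shows "modular_t (1 - 1 / d) = modular_t d"
proof -
  have m: "d ^ 2 - d \<noteq> 0" using assms by (auto simp: power2_eq_square)
  define e where "e = 1 - 1 / d"
  have e: "e * d = d - 1" using assms by (simp add: e_def field_simps)
  have "d ^ 2 * (e ^ 2 - e) = (e * d) ^ 2 - d * (e * d)" by (simp add: algebra_simps power2_eq_square)
  also have "\<dots> = 1 - d" unfolding e by (simp add: algebra_simps power2_eq_square)
  finally have "e ^ 2 - e \<noteq> 0" using assms by auto
  moreover have "d ^ 3 * ((e ^ 3 - 8 * e ^ 2 + 5 * e + 1) * (d ^ 2 - d)) = d ^ 3 * ((d ^ 3 - 8 * d ^ 2 + 5 * d + 1) * (e ^ 2 - e))"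
    using e by Groebner_Basis.algebra
  then have "(e ^ 3 - 8 * e ^ 2 + 5 * e + 1) * (d ^ 2 - d) = (d ^ 3 - 8 * d ^ 2 + 5 * d + 1) * (e ^ 2 - e)"
    using assms by simp
  ultimately show ?thesis using m unfolding modular_t_def e_def[symmetric] by (simp add: frac_eq_eq)
qed

text \<open>The inverse is a definite description, and P + y = Infinity alone forces y = -P, so no
  group axioms of the curve enter.\<close>

lemma m_inv_ec_group:
  assumes "p \<in> ec_points a b"
  shows "m_inv (ec_group a b) p = ec_neg p"
  unfolding m_inv_def
proof (rule the_equality)
  show "ec_neg p \<in> carrier (ec_group a b) \<and> p \<otimes>\<^bsub>ec_group a b\<^esub> ec_neg p = \<one>\<^bsub>ec_group a b\<^esub> \<and>
     ec_neg p \<otimes>\<^bsub>ec_group a b\<^esub> p = \<one>\<^bsub>ec_group a b\<^esub>"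
    using assms ec_neg_in_ec_points by (auto simp: ec_group_def ec_add_eq_Infinity)
  fix y assume "y \<in> carrier (ec_group a b) \<and> p \<otimes>\<^bsub>ec_group a b\<^esub> y = \<one>\<^bsub>ec_group a b\<^esub> \<and>
     y \<otimes>\<^bsub>ec_group a b\<^esub> p = \<one>\<^bsub>ec_group a b\<^esub>"
  then have "ec_add a p y = Infinity" by (simp add: ec_group_def)
  then show "y = ec_neg p" by (simp only: ec_add_eq_Infinity)
qed

text \<open>Galois moves the chain p, 2p, 4p by rotation and sign only, so d moves within its orbit
  of three and t = \<open>modular_t d\<close> is fixed, hence rational. Substituting the Tate form
  then gives the coefficients as (s^2 A, s^3 B) at t, and s turns out rational as well.\<close>

lemma isogeny_imp_parametrized:
  fixes A B :: int
  assumes ns: "4 * A ^ 3 + 27 * B ^ 2 \<noteq> 0" and iso: "admits_isogeny 7 A B"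
  obtains t s :: rat where "t \<noteq> 0" "s \<noteq> 0" "of_int A = s ^ 2 * A_form t 1" "of_int B = s ^ 3 * B_form t 1"
proof -
  define a b where "a = (of_int A :: rat alg_closure)" and "b = (of_int B :: rat alg_closure)"
  have "4 * a ^ 3 + 27 * b ^ 2 = of_int (4 * A ^ 3 + 27 * B ^ 2)" by (simp add: a_def b_def)
  then have ns': "4 * a ^ 3 + 27 * b ^ 2 \<noteq> 0" using ns by (metis of_int_eq_0_iff)
  obtain H where H: "subgroup H (ec_group a b)" "finite H" "card H = 7"
    and gal: "\<And>\<sigma>. \<sigma> \<in> absolute_galois_group_Q \<Longrightarrow> map_point \<sigma> ` H = H"
    using iso unfolding admits_isogeny_def a_def b_def by blast
  have HE: "H \<subseteq> ec_points a b" using subgroup.subset[OF H(1)] by (simp add: ec_group_def)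
  have closed: "ec_add a p q \<in> H" if "p \<in> H" "q \<in> H" for p q
    using subgroup.m_closed[OF H(1) that] by (simp add: ec_group_def)
  have z: "Infinity \<in> H" using subgroup.one_closed[OF H(1)] by (simp add: ec_group_def)
  have negc: "ec_neg p \<in> H" if p: "p \<in> H" for p
  proof -
    have "m_inv (ec_group a b) p = ec_neg p" using p HE by (intro m_inv_ec_group) auto
    then show ?thesis using subgroup.m_inv_closed[OF H(1) p] by simp
  qed
  interpret ip_loop7 H "ec_add a" ec_neg Infinity
  proof
    show "ec_add a p q = ec_add a q p" if "p \<in> H" "q \<in> H" for p q
      using ec_add_commute[of p a b q] HE that by auto
    show "ec_add a (ec_add a p q) (ec_neg q) = p" if "p \<in> H" "q \<in> H" for p q
      using ec_add_cancel[OF ns', of p q] HE that by auto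
    show "ec_add a p q = Infinity \<longleftrightarrow> q = ec_neg p" for p q by (rule ec_add_eq_Infinity)
  qed (use H z closed negc ec_add_neg in auto)
  obtain p q r where pqr: "p \<in> H" "p \<noteq> Infinity" "q \<in> H" "r \<in> H"
    "ec_add a p p = q" "ec_add a q q = r" "ec_add a r r = p" "ec_add a p q = ec_neg r"
    "H = {Infinity, p, ec_neg p, q, ec_neg q, r, ec_neg r}"
    "card {Infinity, p, ec_neg p, q, ec_neg q, r, ec_neg r} = 7"
    by (rule cyclic) blast
  have dist: "distinct [Infinity, p, ec_neg p, q, ec_neg q, r, ec_neg r]"
    by (rule card_distinct) (use pqr(10) in simp)
  have np: "ec_neg p \<in> H" "ec_neg q \<in> H" "ec_neg r \<in> H" using pqr negc by auto
  have npq: "ec_add a (ec_neg p) (ec_neg q) = r" using pqr(8) ec_add_neg by (metis ec_neg_neg)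
  have "ec_add a q r = ec_neg p" using move[OF np(1,2) npq] comm pqr by (metis ec_neg_neg)
  moreover have "ec_add a r p = ec_neg q" using move'[OF np(1,2) npq] by (metis ec_neg_neg)
  ultimately have ch: "chain7 a b p q r"
    using pqr HE dist by (auto simp: chain7_def)
  define d where "d = tate_d p q"
  obtain \<zeta> where d: "\<zeta> \<noteq> 0" "d \<noteq> 0" "d \<noteq> 1" "tate_d q r = 1 - 1 / d"
    "a = - 27 * \<zeta> ^ 4 * (d ^ 2 - d + 1) * u_form (d ^ 3 - 8 * d ^ 2 + 5 * d + 1) (d ^ 2 - d)"
    "b = 54 * \<zeta> ^ 6 * w_form (d ^ 3 - 8 * d ^ 2 + 5 * d + 1) (d ^ 2 - d)"
    using chain7_tate[OF ch d_def] by metis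
  have t1: "modular_t (tate_d q r) = modular_t d" using modular_t_rotate[OF d(2,3)] d(4) by simp
  have t2: "modular_t (tate_d r p) = modular_t d"
  proof -
    obtain \<zeta>' where "tate_d q r \<noteq> 0" "tate_d q r \<noteq> 1" "tate_d r p = 1 - 1 / tate_d q r"
      using chain7_tate[OF chain7_rotate[OF ch] refl] by metis
    then show ?thesis using modular_t_rotate[of "tate_d q r"] t1 by simp
  qed
  define t where "t = modular_t d"
  have "t \<in> range to_ac"
  proof (rule fixed_imp_rational)
    fix \<sigma> assume s: "\<sigma> \<in> absolute_galois_group_Q"
    have "map_point \<sigma> p \<in> H" using gal[OF s] pqr(1) by auto
    moreover have "map_point \<sigma> p \<noteq> Infinity" using pqr(2) by (cases p) auto
    ultimately have "map_point \<sigma> p \<in> {p, ec_neg p, q, ec_neg q, r, ec_neg r}" using pqr(9) by auto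
    moreover have "map_point \<sigma> q = ec_add a (map_point \<sigma> p) (map_point \<sigma> p)"
      using map_point_ec_add[OF s] pqr(5) unfolding a_def by metis
    ultimately have "(map_point \<sigma> p, map_point \<sigma> q) \<in> {(p, q), (ec_neg p, ec_neg q), (q, r), (ec_neg q, ec_neg r),
        (r, p), (ec_neg r, ec_neg p)}"
      using pqr(5-7) ec_add_neg[of a] by auto
    then have "tate_d (map_point \<sigma> p) (map_point \<sigma> q) \<in> {tate_d p q, tate_d q r, tate_d r p}"
      by (auto simp: tate_d_neg)
    then have "modular_t (\<sigma> d) = t"
      using t1 t2 by (auto simp: tate_d_map[OF s] t_def d_def)
    moreover have "modular_t (\<sigma> d) = \<sigma> t" by (simp add: t_def modular_t_def Galois_simps[OF s])
    ultimately show "\<sigma> t = t" by simp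
  qed
  then obtain \<tau> where \<tau>: "t = to_ac \<tau>" by auto
  define m where "m = d ^ 2 - d"
  define e where "e = d ^ 2 - d + 1"
  define n where "n = d ^ 3 - 8 * d ^ 2 + 5 * d + 1"
  have m0: "m \<noteq> 0" using d(2,3) by (auto simp: m_def power2_eq_square)
  have n: "n = t * m" using m0 by (simp add: t_def modular_t_def n_def m_def)
  \<comment> \<open>The zeros of d^2 - d + 1 are the fixed points of d \<mapsto> 1 - 1/d, and those
    of q are their images, so q pulls back to a cube. This turns the coefficients of the Tate form
    into A and B up to the factor s.\<close>
  have "e ^ 3 = q_form n m" unfolding form_defs e_def n_def m_def by Groebner_Basis.algebra
  then have e3: "e ^ 3 = m ^ 2 * q_form t 1" using q_form_scale[of t m 1] by (simp add: n)
  have "q_form t 1 = to_ac (q_form \<tau> 1)" using form_to_ac(1)[of \<tau> 1] by (simp add: \<tau>)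
  then have "q_form t 1 \<noteq> 0" using rat_forms_nonzero(1)[of \<tau>] by (metis to_ac_eq_0_iff)
  then have e0: "e \<noteq> 0" using e3 m0 by auto
  define s where "s = 3 * \<zeta> ^ 2 * m ^ 2 / e"
  have se: "s * e = 3 * \<zeta> ^ 2 * m ^ 2" using e0 by (simp add: s_def)
  have s0: "s \<noteq> 0" using d(1) m0 e0 by (simp add: s_def)
  have U: "u_form n m = m ^ 2 * u_form t 1" and W: "w_form n m = m ^ 4 * w_form t 1"
    using u_form_scale[of t m 1] w_form_scale[of t m 1] by (auto simp: n)
  have a1: "a = s ^ 2 * A_form t 1"
  proof -
    have "e ^ 2 * (m ^ 2 * a) = - 3 * (s * e) ^ 2 * e ^ 3 * u_form t 1"
      unfolding se d(5)[folded n_def m_def e_def] U by Groebner_Basis.algebra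
    also have "\<dots> = e ^ 2 * (m ^ 2 * (s ^ 2 * A_form t 1))"
      unfolding e3 A_form_def by Groebner_Basis.algebra
    finally show ?thesis using e0 m0 by simp
  qed
  have b1: "b = s ^ 3 * B_form t 1"
  proof -
    have "e ^ 3 * (m ^ 2 * b) = 2 * (s * e) ^ 3 * e ^ 3 * w_form t 1"
      unfolding se d(6)[folded n_def m_def e_def] W by Groebner_Basis.algebra
    also have "\<dots> = e ^ 3 * (m ^ 2 * (s ^ 3 * B_form t 1))"
      using e3 unfolding B_form_def by Groebner_Basis.algebra
    finally show ?thesis using e0 m0 by simp
  qed
  define f g where "f = A_form \<tau> 1" and "g = B_form \<tau> 1"
  have fg0: "f \<noteq> 0" "g \<noteq> 0" using rat_forms_nonzero by (auto simp: f_def g_def)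
  have fg: "A_form t 1 = to_ac f" "B_form t 1 = to_ac g"
    using form_to_ac(4,5)[of \<tau> 1] by (auto simp: \<tau> f_def g_def)
  have a0: "a \<noteq> 0" using a1 fg fg0 s0 by auto
  \<comment> \<open>Since A = s^2 f and B = s^3 g, the factor s is a ratio of rational numbers. The
    denominator is nonzero because the forms have no rational zeros.\<close>
  define s' where "s' = (of_int B * f) / (of_int A * g)"
  have "b * to_ac f = s * (a * to_ac g)"
    unfolding a1 b1 fg by Groebner_Basis.algebra
  then have "s = (b * to_ac f) / (a * to_ac g)" using a0 fg0 by (simp add: eq_divide_eq)
  then have ss: "s = to_ac s'" by (simp add: s'_def a_def b_def)
  have A: "of_int A = s' ^ 2 * f"
    using a1 unfolding a_def fg ss by (metis to_ac_eq_iff to_ac_mult to_ac_of_int to_ac_power)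
  have B: "of_int B = s' ^ 3 * g"
    using b1 unfolding b_def fg ss by (metis to_ac_eq_iff to_ac_mult to_ac_of_int to_ac_power)
  \<comment> \<open>The value 0 is a cusp: the curve would be singular.\<close>
  have "\<tau> \<noteq> 0"
  proof
    assume "\<tau> = 0"
    then have "of_int A = - 147 * s' ^ 2" "of_int B = - 686 * s' ^ 3"
      using A B by (auto simp: f_def g_def form_defs)
    then have "4 * of_int A ^ 3 + 27 * of_int B ^ 2 = (0 :: rat)" by Groebner_Basis.algebra
    then have "of_int (4 * A ^ 3 + 27 * B ^ 2) = (0 :: rat)" by simp
    then show False using ns by (metis of_int_eq_0_iff)
  qed
  moreover have "s' \<noteq> 0" using s0 ss by auto
  ultimately show ?thesis using that A B by (simp add: f_def g_def)
qed

section \<open>From a rational parameter back to a Galois-stable subgroup\<close>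

text \<open>The abscissa of P divided by s, after z^2 has been eliminated by 3 z^2 m^2 = s e with m
  = d^2 - d and e = d^2 - d + 1. It is a rational function of d alone, so Galois acts on the
  abscissae through its action on d.\<close>

definition tate_x :: "'a::field \<Rightarrow> 'a" where
  "tate_x d = (d ^ 2 - d + 1) * ((1 - d ^ 2 + d) ^ 2 - 4 * (d ^ 3 - d ^ 2)) / (d ^ 2 - d) ^ 2"

lemma tate_x_rotate:
  fixes d :: "'a::field_char_0"
  assumes "d \<noteq> 0" "d \<noteq> 1"
  shows "tate_x (1 - 1 / d) = (d ^ 2 - d + 1) * ((1 - d ^ 2 + d) ^ 2 - 4 * (d ^ 3 - d ^ 2) + 12 * (d ^ 3 - d ^ 2)) / (d ^ 2 - d) ^ 2"
    and "tate_x (1 / (1 - d)) = (d ^ 2 - d + 1) * ((1 - d ^ 2 + d) ^ 2 - 4 * (d ^ 3 - d ^ 2) + 12 * (d ^ 2 - d)) / (d ^ 2 - d) ^ 2"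
proof -
  have m: "(d ^ 2 - d) ^ 2 \<noteq> 0" using assms by (auto simp: power2_eq_square)
  define e where "e = 1 - 1 / d"
  have e: "e * d = d - 1" using assms by (simp add: e_def field_simps)
  have "d ^ 2 * (e ^ 2 - e) = 1 - d" using e by Groebner_Basis.algebra
  then have me: "(e ^ 2 - e) ^ 2 \<noteq> 0" using assms by auto
  have "d ^ 6 * ((e ^ 2 - e + 1) * ((1 - e ^ 2 + e) ^ 2 - 4 * (e ^ 3 - e ^ 2)) * (d ^ 2 - d) ^ 2) =
     d ^ 6 * ((d ^ 2 - d + 1) * ((1 - d ^ 2 + d) ^ 2 - 4 * (d ^ 3 - d ^ 2) + 12 * (d ^ 3 - d ^ 2)) * (e ^ 2 - e) ^ 2)"
    using e by Groebner_Basis.algebra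
  then have "(e ^ 2 - e + 1) * ((1 - e ^ 2 + e) ^ 2 - 4 * (e ^ 3 - e ^ 2)) * (d ^ 2 - d) ^ 2 =
     (d ^ 2 - d + 1) * ((1 - d ^ 2 + d) ^ 2 - 4 * (d ^ 3 - d ^ 2) + 12 * (d ^ 3 - d ^ 2)) * (e ^ 2 - e) ^ 2"
    using assms(1) by simp
  then show "tate_x (1 - 1 / d) = (d ^ 2 - d + 1) * ((1 - d ^ 2 + d) ^ 2 - 4 * (d ^ 3 - d ^ 2) + 12 * (d ^ 3 - d ^ 2)) / (d ^ 2 - d) ^ 2"
    unfolding e_def[symmetric] tate_x_def frac_eq_eq[OF me m] .
  define f where "f = 1 / (1 - d)"
  have f: "f * (1 - d) = 1" using assms by (simp add: f_def)
  have "(1 - d) ^ 2 * (f ^ 2 - f) = d" using f by Groebner_Basis.algebra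
  then have mf: "(f ^ 2 - f) ^ 2 \<noteq> 0" using assms by auto
  have "(1 - d) ^ 6 * ((f ^ 2 - f + 1) * ((1 - f ^ 2 + f) ^ 2 - 4 * (f ^ 3 - f ^ 2)) * (d ^ 2 - d) ^ 2) =
     (1 - d) ^ 6 * ((d ^ 2 - d + 1) * ((1 - d ^ 2 + d) ^ 2 - 4 * (d ^ 3 - d ^ 2) + 12 * (d ^ 2 - d)) * (f ^ 2 - f) ^ 2)"
    using f by Groebner_Basis.algebra
  then have "(f ^ 2 - f + 1) * ((1 - f ^ 2 + f) ^ 2 - 4 * (f ^ 3 - f ^ 2)) * (d ^ 2 - d) ^ 2 =
     (d ^ 2 - d + 1) * ((1 - d ^ 2 + d) ^ 2 - 4 * (d ^ 3 - d ^ 2) + 12 * (d ^ 2 - d)) * (f ^ 2 - f) ^ 2"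
    using assms(2) by simp
  then show "tate_x (1 / (1 - d)) = (d ^ 2 - d + 1) * ((1 - d ^ 2 + d) ^ 2 - 4 * (d ^ 3 - d ^ 2) + 12 * (d ^ 2 - d)) / (d ^ 2 - d) ^ 2"
    unfolding f_def[symmetric] tate_x_def frac_eq_eq[OF mf m] .
qed

text \<open>The coordinates are the images of (0, 0), its double and its quadruple on the Tate
  curve. With the slopes supplied, the whole addition table becomes a list of polynomial identities
  in d and z.\<close>

lemma tate_points:
  fixes d z :: "'a::field_char_0"
  assumes d: "d \<noteq> 0" "d \<noteq> 1" and z: "z \<noteq> 0"
    and a: "a = - 27 * z ^ 4 * (d ^ 2 - d + 1) * u_form (d ^ 3 - 8 * d ^ 2 + 5 * d + 1) (d ^ 2 - d)"
    and b: "b = 54 * z ^ 6 * w_form (d ^ 3 - 8 * d ^ 2 + 5 * d + 1) (d ^ 2 - d)"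
    and x1: "x1 = 3 * z ^ 2 * ((1 - d ^ 2 + d) ^ 2 - 4 * (d ^ 3 - d ^ 2))"
    and x2: "x2 = x1 + 36 * (d ^ 3 - d ^ 2) * z ^ 2"
    and x3: "x3 = x1 + 36 * (d ^ 2 - d) * z ^ 2"
  obtains y1 y2 y3 where "chain7 a b (Affine x1 y1) (Affine x2 y2) (Affine x3 y3)"
    "card {Infinity, Affine x1 y1, ec_neg (Affine x1 y1), Affine x2 y2, ec_neg (Affine x2 y2), Affine x3 y3, ec_neg (Affine x3 y3)} = 7"
proof -
  define y1 where "y1 = - 108 * (d ^ 3 - d ^ 2) * z ^ 3"
  define y2 where "y2 = 108 * (d ^ 3 - d ^ 2) * (d ^ 2 - d) * z ^ 3"
  define y3 where "y3 = 108 * (d ^ 2 - d) * (d - 1) ^ 2 * z ^ 3"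
  have c0: "d ^ 2 - d \<noteq> 0" and bb0: "d ^ 3 - d ^ 2 \<noteq> 0" and d1: "d - 1 \<noteq> 0"
    using d by (auto simp: power2_eq_square power3_eq_cube)
  have y0: "y1 \<noteq> 0" "y2 \<noteq> 0" "y3 \<noteq> 0" using c0 bb0 d1 z by (auto simp: y1_def y2_def y3_def)
  have "x3 - x2 = - 36 * (d ^ 2 - d) * (d - 1) * z ^ 2" unfolding x2 x3 by Groebner_Basis.algebra
  then have x23: "x2 \<noteq> x3" using c0 d1 z by auto
  have x12: "x1 \<noteq> x2" "x1 \<noteq> x3" using c0 bb0 z by (auto simp: x2 x3)
  note ys = y1_def y2_def y3_def
  have on1: "y1 ^ 2 = x1 ^ 3 + a * x1 + b" unfolding ys x1 a b form_defs by Groebner_Basis.algebra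
  have on2: "y2 ^ 2 = x2 ^ 3 + a * x2 + b" unfolding ys x2 x1 a b form_defs by Groebner_Basis.algebra
  have on3: "y3 ^ 2 = x3 ^ 3 + a * x3 + b" unfolding ys x3 x1 a b form_defs by Groebner_Basis.algebra
  have double1: "ec_add a (Affine x1 y1) (Affine x1 y1) = Affine x2 y2"
    by (rule ec_add_tangent[OF y0(1), where m = "3 * z * (1 - d ^ 2 + d)"]; unfold ys x2 x1 a form_defs; Groebner_Basis.algebra)
  have double2: "ec_add a (Affine x2 y2) (Affine x2 y2) = Affine x3 y3"
    by (rule ec_add_tangent[OF y0(2), where m = "6 * z * d + 3 * z * (d ^ 2 - d - 1)"]; unfold ys x2 x3 x1 a form_defs; Groebner_Basis.algebra)
  have double3: "ec_add a (Affine x3 y3) (Affine x3 y3) = Affine x1 y1"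
    by (rule ec_add_tangent[OF y0(3), where m = "- 3 * z * (2 * d - 1 - d ^ 2 + d)"]; unfold ys x3 x1 a form_defs; Groebner_Basis.algebra)
  have add12: "ec_add a (Affine x1 y1) (Affine x2 y2) = Affine x3 (- y3)"
    by (rule ec_add_chord[OF x12(1), where m = "3 * z * (1 + d ^ 2 - d)"]; unfold ys x2 x3 x1; Groebner_Basis.algebra)
  have add23: "ec_add a (Affine x2 y2) (Affine x3 y3) = Affine x1 (- y1)"
    by (rule ec_add_chord[OF x23, where m = "3 * z * (1 + d ^ 2 - d)"]; unfold ys x2 x3 x1; Groebner_Basis.algebra)
  have add31: "ec_add a (Affine x3 y3) (Affine x1 y1) = Affine x2 (- y2)"
    by (rule ec_add_chord[OF x12(2)[symmetric], where m = "3 * z * (1 + d ^ 2 - d)"]; unfold ys x2 x3 x1; Groebner_Basis.algebra)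
  have "chain7 a b (Affine x1 y1) (Affine x2 y2) (Affine x3 y3)"
    unfolding chain7_def using on1 on2 on3 double1 double2 double3 add12 add23 add31 x12 x23
    by (simp add: Affine_in_ec_points)
  moreover have "card {Infinity, Affine x1 y1, ec_neg (Affine x1 y1), Affine x2 y2, ec_neg (Affine x2 y2), Affine x3 y3, ec_neg (Affine x3 y3)} = 7"
    using x12 x23 y0 by (simp add: card_insert_if eq_neg_iff_add_eq_0)
  ultimately show ?thesis using that by blast
qed

text \<open>All sums of two of the seven elements follow from the six sums in \<open>chain7\<close>
  by commutativity, negation and cancellation.\<close>

lemma chain7_subgroup:
  fixes a b :: "'a::field_char_0"
  assumes ns: "4 * a ^ 3 + 27 * b ^ 2 \<noteq> 0" and ch: "chain7 a b P Q R"
  shows "subgroup {Infinity, P, ec_neg P, Q, ec_neg Q, R, ec_neg R} (ec_group a b)"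
    (is "subgroup ?H _")
proof -
  have on: "P \<in> ec_points a b" "Q \<in> ec_points a b" "R \<in> ec_points a b"
    using ch by (auto simp: chain7_def)
  have sub: "?H \<subseteq> ec_points a b"
    using on ec_neg_in_ec_points Infinity_in_ec_points by auto
  have t: "ec_add a P P = Q" "ec_add a Q Q = R" "ec_add a R R = P"
     "ec_add a P Q = ec_neg R" "ec_add a Q R = ec_neg P" "ec_add a R P = ec_neg Q"
    using ch by (auto simp: chain7_def)
  have t': "ec_add a Q P = ec_neg R" "ec_add a R Q = ec_neg P" "ec_add a P R = ec_neg Q"
    using t ec_add_commute on by metis+
  have s: "ec_add a Q (ec_neg P) = P" "ec_add a R (ec_neg Q) = Q" "ec_add a P (ec_neg R) = R"
    using ec_add_cancel[OF ns, of P P] ec_add_cancel[OF ns, of Q Q] ec_add_cancel[OF ns, of R R] on t by auto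
  have s': "ec_add a (ec_neg P) Q = P" "ec_add a (ec_neg Q) R = Q" "ec_add a (ec_neg R) P = R"
    using s ec_add_commute on ec_neg_in_ec_points by metis+
  have n: "ec_add a (ec_neg p) (ec_neg q) = ec_neg (ec_add a p q)" for p q by (rule ec_add_neg)
  have v: "ec_add a P (ec_neg Q) = ec_neg P" "ec_add a Q (ec_neg R) = ec_neg Q" "ec_add a R (ec_neg P) = ec_neg R"
    "ec_add a (ec_neg Q) P = ec_neg P" "ec_add a (ec_neg R) Q = ec_neg Q" "ec_add a (ec_neg P) R = ec_neg R"
    using n[of "ec_neg P" Q] n[of "ec_neg Q" R] n[of "ec_neg R" P] n[of Q "ec_neg P"] n[of R "ec_neg Q"] n[of P "ec_neg R"] s s'
    by simp_all
  have i: "ec_add a p (ec_neg p) = Infinity" "ec_add a (ec_neg p) p = Infinity" for p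
    using ec_add_eq_Infinity by (metis ec_neg_neg)+
  have "ec_add a p q \<in> ?H" if "p \<in> ?H" "q \<in> ?H" for p q
    using that by (elim insertE emptyE; simp add: t t' s s' n v i)
  moreover have "m_inv (ec_group a b) p \<in> ?H" if "p \<in> ?H" for p
    using that m_inv_ec_group[of p a b] sub by auto
  ultimately show ?thesis using sub by (intro subgroup.intro) (auto simp: ec_group_def)
qed

text \<open>A root d of the cubic for t gives a Tate point of order 7 over the algebraic closure.
  Galois permutes the three roots of the cubic, hence the three abscissae, and the subgroup contains
  both points over each abscissa; so it is stable although its points need not be rational.\<close>

lemma parametrized_imp_isogeny:
  fixes A B :: int and t s :: rat
  assumes ns: "4 * A ^ 3 + 27 * B ^ 2 \<noteq> 0" and s: "s \<noteq> 0"
    and A: "of_int A = s ^ 2 * A_form t 1" and B: "of_int B = s ^ 3 * B_form t 1"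
  shows "admits_isogeny 7 A B"
proof -
  define a b where "a = (of_int A :: rat alg_closure)" and "b = (of_int B :: rat alg_closure)"
  define \<tau> \<rho> where "\<tau> = to_ac t" and "\<rho> = to_ac s"
  have "4 * a ^ 3 + 27 * b ^ 2 = of_int (4 * A ^ 3 + 27 * B ^ 2)" by (simp add: a_def b_def)
  then have ns': "4 * a ^ 3 + 27 * b ^ 2 \<noteq> 0" using ns by (metis of_int_eq_0_iff)
  have a: "a = \<rho> ^ 2 * A_form \<tau> 1" and b: "b = \<rho> ^ 3 * B_form \<tau> 1"
    using A B form_to_ac(4,5)[of t 1] unfolding a_def b_def \<tau>_def \<rho>_def
    by (metis to_ac_mult to_ac_of_int to_ac_power to_ac_1)+
  have \<rho>0: "\<rho> \<noteq> 0" using s by (simp add: \<rho>_def)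
  \<comment> \<open>The roots form the fibre of X_1(7) over t in X_0(7), a cubic in d.\<close>
  define root where "root = (\<lambda>x. x ^ 3 - 8 * x ^ 2 + 5 * x + 1 = \<tau> * (x ^ 2 - x))"
  have "\<exists>x. poly [:1, 5 + \<tau>, - 8 - \<tau>, 1:] x = 0"
    by (rule alg_closed_imp_poly_has_root) simp
  then obtain d where "poly [:1, 5 + \<tau>, - 8 - \<tau>, 1:] d = 0" ..
  then have rd: "root d" unfolding root_def by (simp add: algebra_simps power2_eq_square power3_eq_cube)
  have root01: "x \<noteq> 0" "x \<noteq> 1" if "root x" for x using that by (auto simp: root_def)
  note d01 = root01[OF rd]
  have mod_root: "root x \<longleftrightarrow> modular_t x = \<tau>" if "x \<noteq> 0" "x \<noteq> 1" for x
  proof -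
    have "x ^ 2 - x \<noteq> 0" using that by (auto simp: power2_eq_square)
    then show ?thesis unfolding root_def modular_t_def by (simp add: divide_eq_eq)
  qed
  define m where "m = d ^ 2 - d"
  define e where "e = d ^ 2 - d + 1"
  define n where "n = d ^ 3 - 8 * d ^ 2 + 5 * d + 1"
  have m0: "m \<noteq> 0" using d01 by (auto simp: m_def power2_eq_square)
  have n: "n = \<tau> * m" using rd by (simp add: root_def n_def m_def)
  have "e ^ 3 = q_form n m" unfolding form_defs e_def n_def m_def by Groebner_Basis.algebra
  then have e3: "e ^ 3 = m ^ 2 * q_form \<tau> 1" using q_form_scale[of \<tau> m 1] by (simp add: n)
  have "q_form \<tau> 1 = to_ac (q_form t 1)" using form_to_ac(1)[of t 1] by (simp add: \<tau>_def)
  then have "q_form \<tau> 1 \<noteq> 0" using rat_forms_nonzero(1)[of t] by (metis to_ac_eq_0_iff)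
  then have e0: "e \<noteq> 0" using e3 m0 by auto
  \<comment> \<open>The abscissae involve only z^2; the other square root negates the
    points.\<close>
  obtain z where z2: "z ^ 2 = \<rho> * e / (3 * m ^ 2)" using nth_root_exists[of 2 "\<rho> * e / (3 * m ^ 2)"] by auto
  have z0: "z \<noteq> 0" using z2 \<rho>0 e0 m0 by auto
  have se: "\<rho> * e = 3 * z ^ 2 * m ^ 2" unfolding z2 using m0 by simp
  have U: "u_form n m = m ^ 2 * u_form \<tau> 1" and W: "w_form n m = m ^ 4 * w_form \<tau> 1"
    using u_form_scale[of \<tau> m 1] w_form_scale[of \<tau> m 1] by (auto simp: n)
  have a1: "a = - 27 * z ^ 4 * e * u_form n m"
  proof -
    have "e ^ 2 * (m ^ 2 * (- 27 * z ^ 4 * e * u_form n m)) = - 3 * (\<rho> * e) ^ 2 * e ^ 3 * u_form \<tau> 1"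
      unfolding se U by Groebner_Basis.algebra
    also have "\<dots> = e ^ 2 * (m ^ 2 * a)"
      unfolding a e3 A_form_def by Groebner_Basis.algebra
    finally show ?thesis using e0 m0 by (metis mult_left_cancel power_not_zero)
  qed
  have b1: "b = 54 * z ^ 6 * w_form n m"
  proof -
    have "e ^ 3 * (m ^ 2 * (54 * z ^ 6 * w_form n m)) = 2 * (\<rho> * e) ^ 3 * e ^ 3 * w_form \<tau> 1"
      unfolding se W by Groebner_Basis.algebra
    also have "\<dots> = e ^ 3 * (m ^ 2 * b)"
      using e3 unfolding b B_form_def by Groebner_Basis.algebra
    finally show ?thesis using e0 m0 by simp
  qed
  define x1 where "x1 = 3 * z ^ 2 * ((1 - d ^ 2 + d) ^ 2 - 4 * (d ^ 3 - d ^ 2))"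
  define x2 where "x2 = x1 + 36 * (d ^ 3 - d ^ 2) * z ^ 2"
  define x3 where "x3 = x1 + 36 * (d ^ 2 - d) * z ^ 2"
  obtain y1 y2 y3 where ch: "chain7 a b (Affine x1 y1) (Affine x2 y2) (Affine x3 y3)"
    and crd: "card {Infinity, Affine x1 y1, ec_neg (Affine x1 y1), Affine x2 y2, ec_neg (Affine x2 y2), Affine x3 y3, ec_neg (Affine x3 y3)} = 7"
    by (rule tate_points[OF d01 z0 a1[unfolded e_def n_def m_def] b1[unfolded e_def n_def m_def] x1_def x2_def x3_def])
  define H where "H = {Infinity, Affine x1 y1, ec_neg (Affine x1 y1), Affine x2 y2, ec_neg (Affine x2 y2), Affine x3 y3, ec_neg (Affine x3 y3)}"
  have sub: "subgroup H (ec_group a b)" unfolding H_def by (rule chain7_subgroup[OF ns' ch])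
  have xF: "3 * z ^ 2 * k = \<rho> * (e * k / m ^ 2)" for k
    using m0 by (simp add: z2 field_simps)
  have F1: "x1 = \<rho> * tate_x d" unfolding x1_def xF tate_x_def e_def m_def ..
  have "x2 = 3 * z ^ 2 * ((1 - d ^ 2 + d) ^ 2 - 4 * (d ^ 3 - d ^ 2) + 12 * (d ^ 3 - d ^ 2))"
    unfolding x2_def x1_def by Groebner_Basis.algebra
  then have F2: "x2 = \<rho> * tate_x (1 - 1 / d)" unfolding tate_x_rotate[OF d01] xF e_def m_def .
  have "x3 = 3 * z ^ 2 * ((1 - d ^ 2 + d) ^ 2 - 4 * (d ^ 3 - d ^ 2) + 12 * (d ^ 2 - d))"
    unfolding x3_def x1_def by Groebner_Basis.algebra
  then have F3: "x3 = \<rho> * tate_x (1 / (1 - d))" unfolding tate_x_rotate[OF d01] xF e_def m_def .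
  \<comment> \<open>The equation of equal t-values for x and d splits into the three linear factors
    belonging to the orbit of d.\<close>
  have roots: "x \<in> {d, 1 - 1 / d, 1 / (1 - d)}" if x: "root x" for x
  proof -
    have "(x - d) * (d * x - (d - 1)) * ((d - 1) * x + 1) =
       (x ^ 3 - 8 * x ^ 2 + 5 * x + 1) * (d ^ 2 - d) - (d ^ 3 - 8 * d ^ 2 + 5 * d + 1) * (x ^ 2 - x)"
      by Groebner_Basis.algebra
    also have "\<dots> = 0" using x rd by (simp add: root_def)
    finally have "x - d = 0 \<or> d * x - (d - 1) = 0 \<or> (d - 1) * x + 1 = 0" by simp
    then consider "x = d" | "d * x = d - 1" | "(1 - d) * x = 1"
      by (elim disjE) (auto simp: algebra_simps)
    then show ?thesis
    proof cases
      case 2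
      then have "x = (d - 1) / d" using d01 by (simp add: eq_divide_eq mult.commute)
      then show ?thesis using d01 by (simp add: diff_divide_distrib)
    next
      case 3
      then have "x = 1 / (1 - d)" using d01 by (simp add: eq_divide_eq mult.commute)
      then show ?thesis by simp
    qed simp
  qed
  have rd2: "root (1 - 1 / d)"
  proof -
    have "1 - 1 / d \<noteq> 0" "1 - 1 / d \<noteq> 1" using d01 by auto
    then show ?thesis using mod_root[of "1 - 1 / d"] mod_root[OF d01] modular_t_rotate[OF d01] rd by simp
  qed
  have rd3: "root (1 / (1 - d))"
  proof -
    have e: "1 - 1 / (1 / (1 - d)) = d" using d01 by simp
    have ne: "1 / (1 - d) \<noteq> 0" "1 / (1 - d) \<noteq> 1" using d01 by auto
    have "modular_t (1 / (1 - d)) = modular_t d" using modular_t_rotate[OF ne] unfolding e by simp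
    then show ?thesis using mod_root[OF ne] mod_root[OF d01] rd by simp
  qed
  have on: "y1 ^ 2 = x1 ^ 3 + a * x1 + b" "y2 ^ 2 = x2 ^ 3 + a * x2 + b" "y3 ^ 2 = x3 ^ 3 + a * x3 + b"
    using ch by (auto simp: chain7_def Affine_in_ec_points)
  have member: "Affine x y \<in> H" if "x = \<rho> * tate_x \<delta>" "root \<delta>" "y ^ 2 = x ^ 3 + a * x + b" for x y \<delta>
  proof -
    have "x \<in> {x1, x2, x3}" using roots[OF that(2)] that(1) F1 F2 F3 by auto
    then have "(x = x1 \<and> y ^ 2 = y1 ^ 2) \<or> (x = x2 \<and> y ^ 2 = y2 ^ 2) \<or> (x = x3 \<and> y ^ 2 = y3 ^ 2)"
      using that(3) on by auto
    then show ?thesis by (auto simp: H_def power2_eq_iff)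
  qed
  have stable: "map_point \<sigma> ` H = H" if g: "\<sigma> \<in> absolute_galois_group_Q" for \<sigma>
  proof (rule endo_inj_surj)
    show "finite H" by (simp add: H_def)
    show "inj_on (map_point \<sigma>) H"
      by (rule inj_on_subset[OF point.inj_map]) (use g in \<open>auto simp: inj_on_def Galois_simps\<close>)
    show "map_point \<sigma> ` H \<subseteq> H"
    proof
      fix p assume "p \<in> map_point \<sigma> ` H"
      then obtain p' where p': "p = map_point \<sigma> p'" "p' \<in> H" by auto
      show "p \<in> H"
      proof (cases p')
        case Infinity
        then show ?thesis by (simp add: p' H_def)
      next
        case (Affine x y)
        have y: "y ^ 2 = x ^ 3 + a * x + b"
          using subgroup.subset[OF sub] p'(2) Affine by (auto simp: ec_group_def Affine_in_ec_points)
        have "x \<in> {x1, x2, x3}" using p'(2) Affine by (auto simp: H_def)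
        then obtain \<delta> where \<delta>: "x = \<rho> * tate_x \<delta>" "root \<delta>" using F1 F2 F3 rd rd2 rd3 by auto
        have "\<sigma> x = \<rho> * tate_x (\<sigma> \<delta>)"
          unfolding \<delta>(1) \<rho>_def tate_x_def by (simp add: Galois_simps[OF g])
        moreover have "\<sigma> (\<delta> ^ 3 - 8 * \<delta> ^ 2 + 5 * \<delta> + 1) = \<sigma> (\<tau> * (\<delta> ^ 2 - \<delta>))"
          using \<delta>(2) by (simp add: root_def)
        then have "root (\<sigma> \<delta>)" unfolding root_def \<tau>_def by (simp add: Galois_simps[OF g])
        moreover have "\<sigma> (y ^ 2) = \<sigma> (x ^ 3 + a * x + b)" using y by simp
        then have "\<sigma> y ^ 2 = \<sigma> x ^ 3 + a * \<sigma> x + b" by (simp add: Galois_simps[OF g] a_def b_def)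
        ultimately show ?thesis using member by (simp add: p' Affine)
      qed
    qed
  qed
  show ?thesis unfolding admits_isogeny_def
    using sub crd stable by (intro exI[of _ H]) (auto simp: a_def b_def H_def)
qed

text \<open>Homogenising t = a/b multiplies A by b^4 and B by b^6, which is the change of s by the
  factor b^2. The sign of the fraction is carried by a.\<close>

theorem seven_isogeny_iff:
  fixes A B :: int
  assumes ns: "4 * A ^ 3 + 27 * B ^ 2 \<noteq> 0"
  shows "admits_isogeny 7 A B \<longleftrightarrow> (\<exists>(a::int) (b::int) (s::rat). coprime a b \<and> a \<noteq> 0 \<and> b > 0 \<and> s \<noteq> 0 \<and>
    of_int A = s ^ 2 * of_int (A_form a b) \<and> of_int B = s ^ 3 * of_int (B_form a b))"
proof
  assume "admits_isogeny 7 A B"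
  then obtain t s :: rat where ts: "t \<noteq> 0" "s \<noteq> 0" "of_int A = s ^ 2 * A_form t 1" "of_int B = s ^ 3 * B_form t 1"
    using isogeny_imp_parametrized[OF ns] by metis
  obtain a b where ab: "t = of_int a / of_int b" "b > 0" "coprime a b"
    by (cases t) (auto simp: Fract_of_int_quotient)
  have e: "t * of_int b = of_int a" "1 * of_int b = (of_int b :: rat)" using ab by auto
  have "of_int (A_form a b) = of_int b ^ 4 * A_form t 1" "of_int (B_form a b) = of_int b ^ 6 * B_form t 1"
    using A_form_scale[of t "of_int b" 1] B_form_scale[of t "of_int b" 1] e by (simp_all only: form_of_int)
  then have "of_int A = (s / of_int b ^ 2) ^ 2 * of_int (A_form a b)" "of_int B = (s / of_int b ^ 2) ^ 3 * of_int (B_form a b)"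
    using ts ab(2) by (simp_all add: power_divide flip: power_mult)
  then show "\<exists>(a::int) (b::int) (s::rat). coprime a b \<and> a \<noteq> 0 \<and> b > 0 \<and> s \<noteq> 0 \<and>
    of_int A = s ^ 2 * of_int (A_form a b) \<and> of_int B = s ^ 3 * of_int (B_form a b)"
    using ts ab by (intro exI[of _ a] exI[of _ b] exI[of _ "s / of_int b ^ 2"]) auto
next
  assume "\<exists>(a::int) (b::int) (s::rat). coprime a b \<and> a \<noteq> 0 \<and> b > 0 \<and> s \<noteq> 0 \<and>
    of_int A = s ^ 2 * of_int (A_form a b) \<and> of_int B = s ^ 3 * of_int (B_form a b)"
  then obtain a b :: int and s :: rat where ab: "coprime a b" "a \<noteq> 0" "b > 0" "s \<noteq> 0"
    "of_int A = s ^ 2 * of_int (A_form a b)" "of_int B = s ^ 3 * of_int (B_form a b)" by blast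
  define t :: rat where "t = of_int a / of_int b"
  have e: "t * of_int b = of_int a" "1 * of_int b = (of_int b :: rat)" using ab by (auto simp: t_def)
  have "of_int (A_form a b) = of_int b ^ 4 * A_form t 1" "of_int (B_form a b) = of_int b ^ 6 * B_form t 1"
    using A_form_scale[of t "of_int b" 1] B_form_scale[of t "of_int b" 1] e by (simp_all only: form_of_int)
  then have "of_int A = (s * of_int b ^ 2) ^ 2 * A_form t 1" "of_int B = (s * of_int b ^ 2) ^ 3 * B_form t 1"
    using ab by (simp_all add: power_mult_distrib flip: power_mult)
  then show "admits_isogeny 7 A B"
    using ab by (intro parametrized_imp_isogeny[OF ns, of "s * of_int b ^ 2"]) auto
qed

section \<open>Arithmetic preliminaries\<close>

definition moebius_mu :: "nat \<Rightarrow> real" where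
  "moebius_mu n = (if squarefree n then (-1) ^ card (prime_factors n) else 0)"

lemma abs_moebius_le_1: "\<bar>moebius_mu n\<bar> \<le> 1"
  by (auto simp: moebius_mu_def)

lemma moebius_prime_mult:
  assumes p: "Factorial_Ring.prime p" "\<not> p dvd d" and d: "d > 0"
  shows "moebius_mu (p * d) = - moebius_mu d"
proof -
  have "coprime p d" using p by (simp add: prime_imp_coprime)
  then have sf: "squarefree (p * d) \<longleftrightarrow> squarefree d"
    using squarefree_mult_coprime[of p d] squarefree_multD(2)[of p d] squarefree_prime[OF p(1)] by blast
  have "prime_factors (p * d) = insert p (prime_factors d)"
    using p d by (subst prime_factors_product) (auto simp: prime_prime_factors)
  moreover have "p \<notin> prime_factors d" using p by auto
  ultimately show ?thesis using sf by (simp add: moebius_mu_def)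
qed

text \<open>Fix a prime p dividing n. The divisors d prime to p cancel against p d, and every other
  divisor is a multiple of p^2.\<close>

lemma sum_moebius:
  assumes n: "n > 0"
  shows "(\<Sum>d | d dvd n. moebius_mu d) = (if n = 1 then 1 else 0)"
proof (cases "n = 1")
  case False
  then obtain p where p: "Factorial_Ring.prime p" "p dvd n" using prime_factor_nat by blast
  have fin: "finite {d. d dvd n}" using n by simp
  define E where "E = {d. d dvd n \<and> \<not> p dvd d}"
  have pos: "d > 0" if "d \<in> E" for d using that n by (auto simp: E_def intro!: Nat.gr0I)
  have "(\<Sum>d | d dvd n. moebius_mu d) = (\<Sum>d\<in>E. moebius_mu d) + (\<Sum>d\<in>{d. d dvd n} - E. moebius_mu d)"
    using fin by (subst sum.subset_diff[of E]) (auto simp: E_def)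
  also have "(\<Sum>d\<in>{d. d dvd n} - E. moebius_mu d) = (\<Sum>d\<in>(\<lambda>d. p * d) ` E. moebius_mu d)"
  proof (rule sum.mono_neutral_right)
    show "finite ({d. d dvd n} - E)" using fin by auto
    show "(\<lambda>d. p * d) ` E \<subseteq> {d. d dvd n} - E"
    proof
      fix x assume "x \<in> (\<lambda>d. p * d) ` E"
      then obtain d where d: "x = p * d" "d dvd n" "\<not> p dvd d" by (auto simp: E_def)
      then have "p * d dvd n" using p by (intro divides_mult) (auto simp: prime_imp_coprime)
      then show "x \<in> {d. d dvd n} - E" using d by (auto simp: E_def)
    qed
    show "\<forall>x\<in>{d. d dvd n} - E - (\<lambda>d. p * d) ` E. moebius_mu x = 0"
    proof
      fix x assume x: "x \<in> {d. d dvd n} - E - (\<lambda>d. p * d) ` E"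
      then obtain d where d: "x = p * d" by (auto simp: E_def)
      then have "p dvd d" using x by (auto simp: E_def dest: dvd_mult_right)
      then have "p ^ 2 dvd x" using d by (auto simp: power2_eq_square)
      moreover have "\<not> p dvd 1" using p(1) by (metis not_prime_unit)
      ultimately have "\<not> squarefree x" by (rule not_squarefreeI)
      then show "moebius_mu x = 0" by (simp add: moebius_mu_def)
    qed
  qed
  also have "\<dots> = (\<Sum>d\<in>E. moebius_mu (p * d))"
    by (subst sum.reindex) (use p(1) in \<open>auto simp: inj_on_def\<close>)
  also have "\<dots> = (\<Sum>d\<in>E. - moebius_mu d)"
    using pos p by (intro sum.cong) (auto simp: moebius_prime_mult E_def)
  finally show ?thesis using False by (simp add: sum_negf)
qed (simp add: moebius_mu_def)

definition num_divisors :: "nat \<Rightarrow> nat" where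
  "num_divisors n = card {d. d dvd n}"

lemma num_divisors_prime_power_mult:
  assumes "Factorial_Ring.prime p" "m > 0"
  shows "num_divisors (p ^ k * m) \<le> Suc k * num_divisors m"
proof -
  have "{d. d dvd p ^ k * m} \<subseteq> (\<lambda>(i, d). p ^ i * d) ` ({..k} \<times> {d. d dvd m})"
  proof
    fix x assume "x \<in> {d. d dvd p ^ k * m}"
    then obtain b c where bc: "x = b * c" "b dvd p ^ k" "c dvd m"
      using division_decomp[of x "p ^ k" m] by auto
    then obtain i where "i \<le> k" "b = p ^ i" using divides_primepow_nat[OF assms(1)] by blast
    then show "x \<in> (\<lambda>(i, d). p ^ i * d) ` ({..k} \<times> {d. d dvd m})" using bc by force
  qed
  then have "num_divisors (p ^ k * m) \<le> card ((\<lambda>(i, d). p ^ i * d) ` ({..k} \<times> {d. d dvd m}))"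
    unfolding num_divisors_def using assms by (intro card_mono) auto
  also have "\<dots> \<le> card ({..k} \<times> {d. d dvd m})" using assms by (intro card_image_le) auto
  finally show ?thesis by (simp add: num_divisors_def card_cartesian_product)
qed

text \<open>Prime powers are split off one at a time. For p at least 2^(1/\<delta>) the factor k + 1
  is at most 2^k and hence at most p^(k \<delta>); each of the finitely many smaller primes costs
  one constant factor c.\<close>

lemma num_divisors_bound:
  fixes \<delta> :: real
  assumes \<delta>: "\<delta> > 0"
  obtains C where "C > 0" "\<And>n. n > 0 \<Longrightarrow> real (num_divisors n) \<le> C * real n powr \<delta>"
proof -
  have "(\<lambda>k::nat. real (Suc k) / 2 powr (real k * \<delta>)) \<longlonglongrightarrow> 0"
    using \<delta> by real_asymp
  then have "Bseq (\<lambda>k::nat. real (Suc k) / 2 powr (real k * \<delta>))"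
    by (intro convergent_imp_Bseq convergentI)
  then obtain c0 where "\<forall>k::nat. norm (real (Suc k) / 2 powr (real k * \<delta>)) \<le> c0"
    by (auto simp: Bseq_def)
  then have c0: "\<bar>real (Suc k) / 2 powr (real k * \<delta>)\<bar> \<le> c0" for k :: nat
    by (metis real_norm_def)
  define c where "c = max 1 c0"
  have c: "real (Suc k) \<le> c * 2 powr (real k * \<delta>)" for k
  proof -
    have "real (Suc k) / 2 powr (real k * \<delta>) \<le> c" using c0[of k] by (simp add: c_def)
    then show ?thesis by (simp add: divide_le_eq)
  qed
  define B where "B = nat \<lceil>2 powr (1 / \<delta>)\<rceil>"
  have B: "2 \<le> real p powr \<delta>" if "p \<ge> B" for p
  proof -
    have "2 powr (1 / \<delta>) \<le> real p" using that unfolding B_def by linarith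
    then have "(2 powr (1 / \<delta>)) powr \<delta> \<le> real p powr \<delta>" using \<delta> by (intro powr_mono2) auto
    then show ?thesis using \<delta> by (simp add: powr_powr)
  qed
  have main: "real (num_divisors n) \<le> c ^ card {p \<in> prime_factors n. p < B} * real n powr \<delta>" if "n > 0" for n
    using that
  proof (induction n rule: less_induct)
    case (less n)
    show ?case
    proof (cases "n = 1")
      case True
      then show ?thesis by (simp add: num_divisors_def)
    next
      case False
      then obtain p where p: "Factorial_Ring.prime p" "p dvd n" using prime_factor_nat by blast
      define k where "k = multiplicity p n"
      have "n \<noteq> 0" "\<not> is_unit p" using less.prems p(1) not_prime_unit by auto
      then obtain m where m: "n = p ^ k * m" "\<not> p dvd m"
        using multiplicity_decompose'[of n p] unfolding k_def by metis
      have k: "k > 0" using p less.prems unfolding k_def by (simp add: prime_multiplicity_gt_zero_iff)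
      have m0: "m > 0" using m less.prems by (auto intro!: Nat.gr0I)
      have p1: "p > 1" using p(1) prime_gt_1_nat by auto
      have "p ^ k > 1" using one_less_power[OF p1 k] .
      then have "m < n" using m(1) m0 by simp
      then have IH: "real (num_divisors m) \<le> c ^ card {p \<in> prime_factors m. p < B} * real m powr \<delta>"
        using less.IH m0 by blast
      have pf: "prime_factors n = insert p (prime_factors m)"
      proof -
        have "x \<in> prime_factors n \<longleftrightarrow> x \<in> insert p (prime_factors m)" for x
        proof -
          have "x \<in> prime_factors n \<longleftrightarrow> Factorial_Ring.prime x \<and> (x dvd p ^ k \<or> x dvd m)"
            using m0 p1 unfolding m(1) by (auto simp: in_prime_factors_iff prime_dvd_mult_iff)
          also have "\<dots> \<longleftrightarrow> x \<in> insert p (prime_factors m)"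
            using m0 p(1) k by (auto simp: in_prime_factors_iff prime_dvd_power_iff primes_dvd_imp_eq)
          finally show ?thesis .
        qed
        then show ?thesis by blast
      qed
      have pnm: "p \<notin> prime_factors m" using m(2) by auto
      have pk: "(real p ^ i) powr \<delta> = (real p powr \<delta>) ^ i" for i
        by (induction i) (auto simp: powr_mult)
      have np: "real n powr \<delta> = (real p powr \<delta>) ^ k * real m powr \<delta>"
        unfolding m(1) by (simp add: powr_mult pk)
      have "real (num_divisors n) \<le> real (Suc k) * real (num_divisors m)"
        using num_divisors_prime_power_mult[OF p(1) m0, of k] unfolding m(1)[symmetric] of_nat_mult[symmetric] of_nat_le_iff .
      also have "\<dots> \<le> real (Suc k) * (c ^ card {p \<in> prime_factors m. p < B} * real m powr \<delta>)"
        using IH by (intro mult_left_mono) auto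
      also have "\<dots> \<le> c ^ card {p \<in> prime_factors n. p < B} * real n powr \<delta>"
      proof (cases "p < B")
        case True
        then have "{q \<in> prime_factors n. q < B} = insert p {q \<in> prime_factors m. q < B}" using pf by auto
        then have cd: "card {q \<in> prime_factors n. q < B} = Suc (card {q \<in> prime_factors m. q < B})"
          using pnm by simp
        have "real (Suc k) \<le> c * 2 powr (real k * \<delta>)" by (rule c)
        also have "\<dots> \<le> c * real p powr (real k * \<delta>)"
          using p1 \<delta> by (intro mult_left_mono powr_mono2) (auto simp: c_def)
        also have "real p powr (real k * \<delta>) = (real p powr \<delta>) ^ k"
          using p1 by (simp add: powr_power mult.commute)
        finally have "real (Suc k) * (c ^ card {p \<in> prime_factors m. p < B} * real m powr \<delta>) \<le>
            (c * (real p powr \<delta>) ^ k) * (c ^ card {p \<in> prime_factors m. p < B} * real m powr \<delta>)"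
          by (intro mult_right_mono) (auto simp: c_def)
        then show ?thesis unfolding cd np by (simp add: mult_ac)
      next
        case False
        then have "{q \<in> prime_factors n. q < B} = {q \<in> prime_factors m. q < B}" using pf by auto
        moreover have "real (Suc k) \<le> (real p powr \<delta>) ^ k"
        proof -
          have "real (Suc k) \<le> real (2 ^ k)" unfolding of_nat_le_iff by (rule Suc_leI[OF less_exp])
          then have "real (Suc k) \<le> 2 ^ k" by simp
          also have "\<dots> \<le> (real p powr \<delta>) ^ k" using B False by (intro power_mono) auto
          finally show ?thesis .
        qed
        then have "real (Suc k) * (c ^ card {p \<in> prime_factors m. p < B} * real m powr \<delta>) \<le>
            (real p powr \<delta>) ^ k * (c ^ card {p \<in> prime_factors m. p < B} * real m powr \<delta>)"
          by (intro mult_right_mono) (auto simp: c_def)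
        ultimately show ?thesis unfolding np by (simp add: mult_ac)
      qed
      finally show ?thesis .
    qed
  qed
  have "real (num_divisors n) \<le> c ^ B * real n powr \<delta>" if "n > 0" for n
  proof -
    have "card {p \<in> prime_factors n. p < B} \<le> card {..<B}" by (intro card_mono) auto
    then have "c ^ card {p \<in> prime_factors n. p < B} \<le> c ^ B" by (intro power_increasing) (auto simp: c_def)
    then have "c ^ card {p \<in> prime_factors n. p < B} * real n powr \<delta> \<le> c ^ B * real n powr \<delta>"
      by (intro mult_right_mono) auto
    then show ?thesis using main[OF that] by linarith
  qed
  then show ?thesis using that[of "c ^ B"] by (auto simp: c_def)
qed

lemma coprime_int_primeI:
  fixes a b :: int
  assumes "\<And>p. Factorial_Ring.prime p \<Longrightarrow> p dvd a \<Longrightarrow> p dvd b \<Longrightarrow> False"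
  shows "coprime a b"
proof (rule ccontr)
  assume "\<not> coprime a b"
  then obtain c where c: "c dvd a" "c dvd b" "\<not> is_unit c" by (rule not_coprimeE)
  obtain p where "Factorial_Ring.prime p" "p dvd c"
  proof (cases "c = 0")
    case True
    then show ?thesis using that[of 2] by simp
  next
    case False
    then show ?thesis using that prime_divisor_exists[OF False c(3)] by blast
  qed
  then show False using assms c by (meson dvd_trans)
qed

lemma dvd_mult_gcd_right:
  fixes m :: int
  assumes "m dvd k * x" "m dvd k * y"
  shows "m dvd k * gcd x y"
  using gcd_greatest[OF assms] by (simp add: gcd_mult_left)

section \<open>Common divisors of the two forms\<close>

text \<open>The constant is 36 * 12096: the identities below produce 12096 = 7 * 1728, and 36 comes
  from the factors 3 and 2 in A and B.\<close>

abbreviation defect_const :: int where "defect_const \<equiv> 435456"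

text \<open>Homogeneous Bezout identities for the coprime forms w and q u^2, in degree 9 = 4 + 6 -
  1. They limit the common divisors of the values of w and q u^2, and over the reals they bound the
  region of small height.\<close>

lemma bezout_forms:
  fixes a b :: "'a::idom"
  shows "(- 993 * b ^ 5 - 1895 * a * b ^ 4 - 949 * a ^ 2 * b ^ 3 - 213 * a ^ 3 * b ^ 2 - 23 * a ^ 4 * b - a ^ 5) * w_form a b
      + (105 * b ^ 3 + 70 * a * b ^ 2 + 14 * a ^ 2 * b + a ^ 3) * (q_form a b * u_form a b ^ 2) = 12096 * b ^ 9" (is ?A)
    and "(- 36639 * a ^ 5 + 891863 * a ^ 4 * b + 13202917 * a ^ 3 * b ^ 2 + 40787229 * a ^ 2 * b ^ 3 + 15332975 * a * b ^ 4
        + 1541785 * b ^ 5) * w_form a b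
      + (38367 * a ^ 3 - 1261358 * a ^ 2 * b - 2273110 * a * b ^ 2 + 220255 * b ^ 3) * (q_form a b * u_form a b ^ 2) = 1728 * a ^ 9" (is ?B)
proof -
  show ?A unfolding form_defs by Groebner_Basis.algebra
  show ?B unfolding form_defs by Groebner_Basis.algebra
qed

text \<open>For coprime a, b membership means that g divides the defect. With the weaker demand that
  gcd(a, b) be prime to g, the set is periodic modulo g^3; Moebius inversion over the gcd restores
  coprimality later.\<close>

definition defect_pairs :: "nat \<Rightarrow> (int \<times> int) set" where
  "defect_pairs g = {(a, b). int g ^ 2 dvd A_form a b \<and> int g ^ 3 dvd B_form a b \<and> coprime (gcd a b) (int g)}"

lemma coprime_gcd_power:
  fixes a b g :: int
  assumes "coprime (gcd a b) g"
  shows "coprime (gcd (a ^ n) (b ^ n)) (g ^ k)"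
  using assms by (metis coprime_power_left_iff coprime_power_right_iff gcd_exp)

text \<open>Up to a constant, only q can carry a defect. Squaring g^2 | 3 q u gives g^3 | 36 q (q
  u^2), and g^3 | 36 q w is clear; the Bezout identities then leave q times a^9 or b^9, and gcd(a,
  b) is prime to g.\<close>

lemma defect_pairs_dvd_q:
  assumes "(a, b) \<in> defect_pairs g"
  shows "int g ^ 3 dvd defect_const * q_form a b"
proof -
  let ?g = "int g" and ?q = "q_form a b"
  have 1: "?g ^ 2 dvd 3 * ?q * u_form a b" and 2: "?g ^ 3 dvd 2 * ?q * w_form a b" and cop: "coprime (gcd a b) ?g"
    using assms by (auto simp: defect_pairs_def A_form_def B_form_def)
  have "?g ^ 3 dvd (?g ^ 2) ^ 2" by (simp add: power_mult[symmetric] le_imp_power_dvd)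
  also have "(?g ^ 2) ^ 2 dvd (3 * ?q * u_form a b) ^ 2" using 1 by (rule dvd_power_same)
  also have "(3 * ?q * u_form a b) ^ 2 dvd 36 * ?q * (?q * u_form a b ^ 2)"
    by (rule dvdI[of _ _ 4]) (simp add: power2_eq_square)
  finally have h1: "?g ^ 3 dvd 36 * ?q * (?q * u_form a b ^ 2)" .
  have "2 * ?q * w_form a b dvd 36 * ?q * w_form a b"
    by (rule dvdI[of _ _ 18]) simp
  with 2 have h2: "?g ^ 3 dvd 36 * ?q * w_form a b" by (rule dvd_trans)
  have comb: "?g ^ 3 dvd 36 * ?q * (s * w_form a b + t * (?q * u_form a b ^ 2))" for s t
    using dvd_add[OF dvd_mult[OF h2, of s] dvd_mult[OF h1, of t]] by (simp add: algebra_simps)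
  have "?g ^ 3 dvd 36 * ?q * (12096 * b ^ 9)" by (subst bezout_forms(1)[symmetric]) (rule comb)
  then have b9: "?g ^ 3 dvd (defect_const * ?q) * b ^ 9" by (simp add: mult_ac)
  have "?g ^ 3 dvd 36 * ?q * (1728 * a ^ 9)" by (subst bezout_forms(2)[symmetric]) (rule comb)
  from dvd_mult[OF this, of 7] have a9: "?g ^ 3 dvd (defect_const * ?q) * a ^ 9" by (simp add: mult_ac)
  have "?g ^ 3 dvd (defect_const * ?q) * gcd (a ^ 9) (b ^ 9)" by (rule dvd_mult_gcd_right[OF a9 b9])
  then show ?thesis using coprime_gcd_power[OF cop, of 9 3]
    by (metis coprime_commute coprime_dvd_mult_left_iff)
qed

text \<open>Half-open squares of side s contain at most one point each, and the hypothesis s \<le>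
  \<rho> absorbs the boundary squares.\<close>

lemma packing_bound:
  fixes V :: "(int \<times> int) set" and s \<rho> :: real
  assumes s: "s > 0" and box: "\<And>a b. (a, b) \<in> V \<Longrightarrow> \<bar>real_of_int a\<bar> \<le> \<rho> \<and> \<bar>real_of_int b\<bar> \<le> \<rho>"
    and sep: "\<And>a b c d. (a, b) \<in> V \<Longrightarrow> (c, d) \<in> V \<Longrightarrow> (a, b) \<noteq> (c, d) \<Longrightarrow>
      s \<le> real_of_int (max \<bar>a - c\<bar> \<bar>b - d\<bar>)" and \<rho>: "s \<le> \<rho>"
  shows "finite V" "real (card V) \<le> (4 * \<rho> / s) ^ 2"
proof -
  define \<phi> where "\<phi> = (\<lambda>(a, b). (\<lfloor>real_of_int a / s\<rfloor>, \<lfloor>real_of_int b / s\<rfloor>))"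
  have close: "\<bar>real_of_int a - real_of_int c\<bar> < s" if "\<lfloor>real_of_int a / s\<rfloor> = \<lfloor>real_of_int c / s\<rfloor>" for a c
  proof -
    have "\<bar>real_of_int a / s - real_of_int c / s\<bar> < 1" using that by linarith
    then have "\<bar>(real_of_int a - real_of_int c) / s\<bar> < 1" by (simp add: diff_divide_distrib)
    then show ?thesis using s by (simp add: abs_divide)
  qed
  have inj: "inj_on \<phi> V"
  proof (rule inj_onI)
    fix v w assume vw: "v \<in> V" "w \<in> V" "\<phi> v = \<phi> w"
    obtain a b c d where [simp]: "v = (a, b)" "w = (c, d)" by (cases v; cases w) auto
    show "v = w"
    proof (rule ccontr)
      assume "v \<noteq> w"
      then have "s \<le> real_of_int (max \<bar>a - c\<bar> \<bar>b - d\<bar>)" using sep vw by auto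
      moreover have "\<bar>real_of_int a - real_of_int c\<bar> < s" "\<bar>real_of_int b - real_of_int d\<bar> < s"
        using close vw(3) by (auto simp: \<phi>_def)
      ultimately show False by (simp add: max_def split: if_splits)
    qed
  qed
  define I where "I = {\<lfloor>- \<rho> / s\<rfloor>..\<lfloor>\<rho> / s\<rfloor>}"
  have "\<phi> ` V \<subseteq> I \<times> I"
  proof
    fix x assume "x \<in> \<phi> ` V"
    then obtain a b where ab: "(a, b) \<in> V" "x = \<phi> (a, b)" by auto
    have r: "\<lfloor>real_of_int c / s\<rfloor> \<in> I" if "\<bar>real_of_int c\<bar> \<le> \<rho>" for c
    proof -
      have "- \<rho> / s \<le> real_of_int c / s" "real_of_int c / s \<le> \<rho> / s"
        using that s by (intro divide_right_mono; simp)+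
      then show ?thesis unfolding I_def by (auto intro!: floor_mono simp del: minus_divide_left)
    qed
    show "x \<in> I \<times> I" using box[OF ab(1)] r ab(2) by (auto simp: \<phi>_def)
  qed
  moreover have "finite (I \<times> I)" by (simp add: I_def)
  ultimately have fin: "finite (\<phi> ` V)" and c: "card (\<phi> ` V) \<le> card (I \<times> I)"
    by (rule finite_subset, rule card_mono[rotated])
  show "finite V" using fin inj by (rule finite_imageD)
  have "1 \<le> \<rho> / s" using s \<rho> by simp
  have "real (card I) \<le> 4 * \<rho> / s"
  proof -
    have "real (card I) = real_of_int (\<lfloor>\<rho> / s\<rfloor> - \<lfloor>- \<rho> / s\<rfloor> + 1)"
      unfolding I_def using \<open>1 \<le> \<rho> / s\<close> by (simp add: of_nat_diff) linarith
    also have "\<dots> \<le> 2 * (\<rho> / s) + 2" by (simp; linarith)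
    also have "\<dots> \<le> 4 * \<rho> / s" using \<open>1 \<le> \<rho> / s\<close> by simp
    finally show ?thesis .
  qed
  then have "real (card I) ^ 2 \<le> (4 * \<rho> / s) ^ 2" by (intro power_mono) auto
  moreover have "real (card V) \<le> real (card I) ^ 2"
    using c card_image[OF inj] by (simp add: card_cartesian_product power2_eq_square flip: of_nat_mult)
  ultimately show "real (card V) \<le> (4 * \<rho> / s) ^ 2" by linarith
qed

lemma q_form_le_max:
  fixes a b :: int
  shows "q_form a b \<le> 63 * (max \<bar>a\<bar> \<bar>b\<bar>) ^ 2"
proof -
  let ?M = "max \<bar>a\<bar> \<bar>b\<bar>"
  have "a ^ 2 \<le> ?M ^ 2" "b ^ 2 \<le> ?M ^ 2"
    by (metis abs_ge_zero max.cobounded1 max.cobounded2 power2_abs power_mono)+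
  moreover have "a * b \<le> ?M ^ 2"
  proof -
    have "a * b \<le> \<bar>a\<bar> * \<bar>b\<bar>" by (metis abs_ge_self abs_mult)
    also have "\<dots> \<le> ?M * ?M" by (intro mult_mono) auto
    finally show ?thesis by (simp add: power2_eq_square)
  qed
  ultimately show ?thesis unfolding form_defs by simp
qed

text \<open>Think of q(a, b) = (a - \<theta> b)(a - \<theta>' b) with a0 = \<theta> b0 modulo g^3,
  up to a constant. The determinant a0 b - a b0 and its conjugate a b0 + a0 b + 13 b b0 play the
  role of the two factors, and their product is divisible by g^3 up to the constant. The gcd of the
  determinant with g^3 records how g^3 is distributed between them. For fixed distribution both
  conditions are linear and pass to differences.\<close>

lemma defect_pairs_difference:
  fixes a b a' b' a0 b0 :: int
  assumes g: "g > 0" and v0: "(a0, b0) \<in> defect_pairs g"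
    and v: "(a, b) \<in> defect_pairs g" "(a', b') \<in> defect_pairs g"
    and d: "gcd (int g ^ 3) (a0 * b - a * b0) = gcd (int g ^ 3) (a0 * b' - a' * b0)"
  shows "int g ^ 3 dvd defect_const ^ 2 * q_form (a - a') (b - b')"
proof -
  define m where "m = int g ^ 3"
  define D where "D = gcd m (a0 * b - a * b0)"
  define K :: int where "K = defect_const"
  have conj: "m dvd (K * D) * (x * b0 + a0 * y + 13 * y * b0)"
    if xy: "(x, y) \<in> defect_pairs g" "D = gcd m (a0 * y - x * b0)" for x y
  proof -
    let ?y' = "x * b0 + a0 * y + 13 * y * b0"
    have q: "m dvd K * q_form x y" "m dvd K * q_form a0 b0"
      using defect_pairs_dvd_q xy v0 by (auto simp: m_def K_def)
    have "K * ?y' * (a0 * y - x * b0) = y ^ 2 * (K * q_form a0 b0) - b0 ^ 2 * (K * q_form x y)"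
      unfolding form_defs by Groebner_Basis.algebra
    then have "m dvd K * ?y' * (a0 * y - x * b0)" using q by (metis dvd_diff dvd_mult)
    then have "m dvd K * ?y' * gcd m (a0 * y - x * b0)" by (intro dvd_mult_gcd_right) auto
    then show ?thesis unfolding xy(2) by (simp add: mult_ac)
  qed
  let ?x = "a - a'" and ?y = "b - b'"
  have "m dvd (K * D) * (a * b0 + a0 * b + 13 * b * b0) - (K * D) * (a' * b0 + a0 * b' + 13 * b' * b0)"
    using conj[OF v(1)] conj[OF v(2)] d by (intro dvd_diff) (auto simp: D_def m_def)
  then have c1: "m dvd (K * D) * (?x * b0 + a0 * ?y + 13 * ?y * b0)" by (simp add: algebra_simps)
  have "D dvd (a0 * b - a * b0) - (a0 * b' - a' * b0)"
  proof (rule dvd_diff)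
    show "D dvd a0 * b - a * b0" by (simp add: D_def)
    show "D dvd a0 * b' - a' * b0" using d by (simp add: D_def m_def)
  qed
  then have "D dvd a0 * ?y - ?x * b0" by (simp add: algebra_simps)
  then obtain k where k: "a0 * ?y - ?x * b0 = D * k" by (elim dvdE)
  have "m dvd K * (a0 * ?y - ?x * b0) * (?x * b0 + a0 * ?y + 13 * ?y * b0)"
    unfolding k using dvd_mult[OF c1, of k] by (simp add: mult_ac)
  also have "K * (a0 * ?y - ?x * b0) * (?x * b0 + a0 * ?y + 13 * ?y * b0) = ?y ^ 2 * (K * q_form a0 b0) - K * q_form ?x ?y * b0 ^ 2"
    unfolding form_defs by Groebner_Basis.algebra
  finally have c2: "m dvd ?y ^ 2 * (K * q_form a0 b0) - K * q_form ?x ?y * b0 ^ 2" .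
  have c3: "m dvd K * q_form a0 b0" using defect_pairs_dvd_q[OF v0] by (simp add: m_def K_def)
  have "m dvd K * q_form ?x ?y * b0 ^ 2"
    using dvd_diff[OF dvd_mult[OF c3, of "?y ^ 2"] c2] by simp
  then have c4: "m dvd K * q_form ?x ?y * gcd m (b0 ^ 2)" by (intro dvd_mult_gcd_right) auto
  \<comment> \<open>This removes the factor b0^2: a prime dividing g, b0 and q(a0, b0) would divide
    a0 too, against the coprimality of gcd(a0, b0) and g. So gcd(g^3, b0^2) divides the
    constant.\<close>
  have "coprime (gcd m (b0 ^ 2)) (q_form a0 b0)"
  proof (rule coprime_int_primeI)
    fix p assume p: "Factorial_Ring.prime p" "p dvd gcd m (b0 ^ 2)" "p dvd q_form a0 b0"
    have pb: "p dvd b0" using p by (meson dvd_trans gcd_dvd2 prime_dvd_power)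
    have pg: "p dvd int g" using p unfolding m_def by (meson dvd_trans gcd_dvd1 prime_dvd_power)
    have "a0 ^ 2 = q_form a0 b0 - b0 * (13 * a0 + 49 * b0)" unfolding form_defs by Groebner_Basis.algebra
    then have "p dvd a0 ^ 2" using pb p(3) by (metis dvd_diff dvd_mult2)
    then have "p dvd a0" using p(1) prime_dvd_power by blast
    then have "p dvd gcd a0 b0" using pb by simp
    moreover have "coprime (gcd a0 b0) (int g)" using v0 by (simp add: defect_pairs_def)
    ultimately have "is_unit p" using pg by (meson coprime_common_divisor)
    then show False using p(1) not_prime_unit by blast
  qed
  moreover have "gcd m (b0 ^ 2) dvd K * q_form a0 b0" using c3 by (meson dvd_trans gcd_dvd1)
  ultimately have "gcd m (b0 ^ 2) dvd K" by (simp add: coprime_dvd_mult_left_iff)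
  then have "K * q_form ?x ?y * gcd m (b0 ^ 2) dvd K * q_form ?x ?y * K" by (rule mult_dvd_mono[OF dvd_refl])
  with c4 have "m dvd K * q_form ?x ?y * K" by (rule dvd_trans)
  then show ?thesis by (simp add: m_def K_def power2_eq_square mult_ac)
qed

text \<open>The points split into at most \<open>\<tau>(g\<^sup>3)\<close> classes; inside a class the differences \<open>v\<close>
  satisfy \<open>g\<^sup>3 | K\<^sup>2 q(v)\<close>, hence are separated by a multiple of \<open>g\<^sup>3\<^sup>/\<^sup>2\<close>.\<close>

lemma card_defect_pairs_box:
  obtains C where "C > 0" "\<And>g \<rho>. g > 0 \<Longrightarrow> \<rho> > 0 \<Longrightarrow>
     finite {(a, b) \<in> defect_pairs g. (a, b) \<noteq> (0, 0) \<and> \<bar>real_of_int a\<bar> \<le> \<rho> \<and> \<bar>real_of_int b\<bar> \<le> \<rho>} \<and>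
     real (card {(a, b) \<in> defect_pairs g. (a, b) \<noteq> (0, 0) \<and> \<bar>real_of_int a\<bar> \<le> \<rho> \<and> \<bar>real_of_int b\<bar> \<le> \<rho>})
       \<le> C * real (num_divisors (g ^ 3)) * \<rho> ^ 2 / real g ^ 3"
proof -
  define K :: real where "K = 435456"
  define C where "C = 16 * (63 * K ^ 2)"
  have "finite {(a, b) \<in> defect_pairs g. (a, b) \<noteq> (0, 0) \<and> \<bar>real_of_int a\<bar> \<le> \<rho> \<and> \<bar>real_of_int b\<bar> \<le> \<rho>} \<and>
     real (card {(a, b) \<in> defect_pairs g. (a, b) \<noteq> (0, 0) \<and> \<bar>real_of_int a\<bar> \<le> \<rho> \<and> \<bar>real_of_int b\<bar> \<le> \<rho>})
       \<le> C * real (num_divisors (g ^ 3)) * \<rho> ^ 2 / real g ^ 3" if g: "g > 0" and \<rho>: "\<rho> > 0" for g :: nat and \<rho> :: real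
  proof -
    define V where "V = {(a, b) \<in> defect_pairs g. (a, b) \<noteq> (0, 0) \<and> \<bar>real_of_int a\<bar> \<le> \<rho> \<and> \<bar>real_of_int b\<bar> \<le> \<rho>}"
    \<comment> \<open>A nonzero difference v has g^3 \<le> K^2 q(v), and q(v) is at most 63 = 1 + 13
      + 49 times the squared maximum norm.\<close>
    define s where "s = sqrt (real g ^ 3 / (63 * K ^ 2))"
    have s0: "s > 0" using g by (simp add: s_def K_def)
    have s2: "s ^ 2 = real g ^ 3 / (63 * K ^ 2)" by (simp add: s_def)
    have sep: "s \<le> real_of_int (max \<bar>x\<bar> \<bar>y\<bar>)" if xy: "(x, y) \<noteq> (0, 0)" "int g ^ 3 dvd defect_const ^ 2 * q_form x y" for x y
    proof -
      have "q_form x y > 0" using xy(1) by (intro q_form_pos) auto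
      then have "int g ^ 3 \<le> defect_const ^ 2 * q_form x y" using xy(2) by (intro zdvd_imp_le) auto
      also have "\<dots> \<le> defect_const ^ 2 * (63 * (max \<bar>x\<bar> \<bar>y\<bar>) ^ 2)" by (intro mult_left_mono q_form_le_max) auto
      finally have "real_of_int (int g ^ 3) \<le> real_of_int (defect_const ^ 2 * (63 * (max \<bar>x\<bar> \<bar>y\<bar>) ^ 2))"
        by (simp only: of_int_le_iff)
      then have "real g ^ 3 \<le> (63 * K ^ 2) * real_of_int (max \<bar>x\<bar> \<bar>y\<bar>) ^ 2" by (simp add: K_def)
      then have "s ^ 2 \<le> real_of_int (max \<bar>x\<bar> \<bar>y\<bar>) ^ 2" unfolding s2 by (simp add: K_def divide_le_eq mult.commute)
      then show ?thesis by (rule power2_le_imp_le) simp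
    qed
    show ?thesis
    proof (cases "V = {}")
      case True
      then show ?thesis unfolding V_def[symmetric] using g by (simp add: C_def K_def)
    next
      case False
      then obtain a0 b0 where v0: "(a0, b0) \<in> V" by auto
      have v0': "(a0, b0) \<in> defect_pairs g" using v0 by (simp add: V_def)
      have "int g ^ 3 dvd defect_const ^ 2 * q_form a0 b0"
        using dvd_mult[OF defect_pairs_dvd_q[OF v0'], of defect_const] by (simp add: power2_eq_square)
      then have "s \<le> real_of_int (max \<bar>a0\<bar> \<bar>b0\<bar>)" using sep[of a0 b0] v0 by (auto simp: V_def)
      also have "\<dots> \<le> \<rho>" using v0 by (auto simp: V_def)
      finally have s\<rho>: "s \<le> \<rho>" .
      define cls where "cls = (\<lambda>(a, b). nat (gcd (int g ^ 3) (a0 * b - a * b0)))"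
      have clsd: "cls v dvd g ^ 3" for v
      proof -
        have "gcd (int g ^ 3) k dvd int (g ^ 3)" for k by simp
        then have "int (nat (gcd (int g ^ 3) k)) dvd int (g ^ 3)" for k by simp
        then have "nat (gcd (int g ^ 3) k) dvd g ^ 3" for k by (simp only: int_dvd_int_iff)
        then show ?thesis by (auto simp: cls_def split: prod.splits)
      qed
      have natgcd: "nat (gcd k x) = nat (gcd k y) \<longleftrightarrow> gcd k x = gcd k y" for k x y :: int
        by (simp add: eq_nat_nat_iff)
      have fiber: "finite {v \<in> V. cls v = e} \<and> real (card {v \<in> V. cls v = e}) \<le> (4 * \<rho> / s) ^ 2" for e
      proof -
        have "s \<le> real_of_int (max \<bar>a - c\<bar> \<bar>b - d\<bar>)"
          if "(a, b) \<in> {v \<in> V. cls v = e}" "(c, d) \<in> {v \<in> V. cls v = e}" "(a, b) \<noteq> (c, d)" for a b c d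
        proof (rule sep)
          show "(a - c, b - d) \<noteq> (0, 0)" using that by auto
          show "int g ^ 3 dvd defect_const ^ 2 * q_form (a - c) (b - d)"
            by (rule defect_pairs_difference[OF g v0']) (use that in \<open>auto simp: V_def cls_def natgcd\<close>)
        qed
        then show ?thesis using packing_bound[of s "{v \<in> V. cls v = e}" \<rho>] s0 s\<rho> by (auto simp: V_def)
      qed
      have VU: "V = (\<Union>e\<in>{e. e dvd g ^ 3}. {v \<in> V. cls v = e})" using clsd by auto
      have fin: "finite {e. e dvd g ^ 3}" using g by simp
      have finV: "finite V"
        by (subst VU, rule finite_UN_I[OF fin]) (use fiber in blast)
      have "real (card V) \<le> (\<Sum>e\<in>{e. e dvd g ^ 3}. real (card {v \<in> V. cls v = e}))"
      proof -
        have "card V \<le> (\<Sum>e\<in>{e. e dvd g ^ 3}. card {v \<in> V. cls v = e})"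
          by (subst VU) (rule card_UN_le[OF fin])
        then show ?thesis unfolding of_nat_sum[symmetric] of_nat_le_iff .
      qed
      also have "\<dots> \<le> (\<Sum>e\<in>{e. e dvd g ^ 3}. (4 * \<rho> / s) ^ 2)" using fiber by (intro sum_mono) auto
      also have "\<dots> = real (num_divisors (g ^ 3)) * (4 * \<rho> / s) ^ 2" by (simp add: num_divisors_def)
      also have "\<dots> = C * real (num_divisors (g ^ 3)) * \<rho> ^ 2 / real g ^ 3"
        unfolding power_divide s2 by (simp add: C_def power_mult_distrib K_def)
      finally show ?thesis using finV unfolding V_def by blast
    qed
  qed
  moreover have "C > 0" by (simp add: C_def K_def)
  ultimately show ?thesis using that by blast
qed

section \<open>The region of bounded height\<close>

text \<open>The height of (A(x, y), B(x, y)) is homogeneous of degree 12 in (x, y), so this is the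
  dilation by \<rho> of \<open>region 1\<close>.\<close>

definition region :: "real \<Rightarrow> (real \<times> real) set" where
  "region \<rho> = {(x, y). 4 * \<bar>A_form x y\<bar> ^ 3 \<le> \<rho> ^ 12 \<and> 27 * B_form x y ^ 2 \<le> \<rho> ^ 12}"

lemma abs_monomial_le:
  fixes x y M :: real
  assumes "\<bar>x\<bar> \<le> M" "\<bar>y\<bar> \<le> M" "i + j = k"
  shows "\<bar>x ^ i * y ^ j\<bar> \<le> M ^ k"
proof -
  have "0 \<le> M" using assms(1) by linarith
  have "\<bar>x ^ i * y ^ j\<bar> = \<bar>x\<bar> ^ i * \<bar>y\<bar> ^ j" by (simp add: abs_mult power_abs)
  also have "\<dots> \<le> M ^ i * M ^ j" using assms \<open>0 \<le> M\<close> by (intro mult_mono power_mono) auto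
  finally show ?thesis unfolding assms(3)[symmetric] by (simp add: power_add)
qed

lemma pow_diff_le:
  fixes x x' T m :: real
  assumes "\<bar>x\<bar> \<le> T" "\<bar>x'\<bar> \<le> T" "\<bar>x' - x\<bar> \<le> m"
  shows "\<bar>x' ^ i - x ^ i\<bar> \<le> real i * m * T ^ (i - 1)"
proof (induction i)
  case (Suc i)
  have T: "0 \<le> T" "0 \<le> m" using assms by linarith+
  have "x' ^ Suc i - x ^ Suc i = x' * (x' ^ i - x ^ i) + (x' - x) * x ^ i" by (simp add: algebra_simps)
  also have "\<bar>\<dots>\<bar> \<le> \<bar>x'\<bar> * \<bar>x' ^ i - x ^ i\<bar> + \<bar>x' - x\<bar> * \<bar>x\<bar> ^ i"
    by (metis abs_mult abs_triangle_ineq power_abs)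
  also have "\<dots> \<le> T * (real i * m * T ^ (i - 1)) + m * T ^ i"
    using assms Suc T by (intro add_mono mult_mono power_mono) auto
  also have "\<dots> = real (Suc i) * m * T ^ (Suc i - 1)"
    by (cases i) (auto simp: algebra_simps)
  finally show ?case .
qed simp

lemma monomial_diff_le:
  fixes x y x' y' T m :: real
  assumes "\<bar>x\<bar> \<le> T" "\<bar>x'\<bar> \<le> T" "\<bar>y\<bar> \<le> T" "\<bar>y'\<bar> \<le> T" "\<bar>x' - x\<bar> \<le> m" "\<bar>y' - y\<bar> \<le> m" "i + j = Suc k"
  shows "\<bar>x' ^ i * y' ^ j - x ^ i * y ^ j\<bar> \<le> (1 + real k) * m * T ^ k"
proof -
  have T: "0 \<le> T" "0 \<le> m" using assms by linarith+
  have "x' ^ i * y' ^ j - x ^ i * y ^ j = (x' ^ i - x ^ i) * y' ^ j + x ^ i * (y' ^ j - y ^ j)" by (simp add: algebra_simps)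
  also have "\<bar>\<dots>\<bar> \<le> \<bar>x' ^ i - x ^ i\<bar> * \<bar>y'\<bar> ^ j + \<bar>x\<bar> ^ i * \<bar>y' ^ j - y ^ j\<bar>"
    by (metis abs_mult abs_triangle_ineq power_abs)
  also have "\<dots> \<le> (real i * m * T ^ (i - 1)) * T ^ j + T ^ i * (real j * m * T ^ (j - 1))"
    using assms T pow_diff_le[of x T x' m i] pow_diff_le[of y T y' m j]
    by (intro add_mono mult_mono power_mono) auto
  also have "(real i * m * T ^ (i - 1)) * T ^ j = real i * m * T ^ k"
    using assms(7) by (cases i) (auto simp: power_add[symmetric] mult.assoc)
  also have "T ^ i * (real j * m * T ^ (j - 1)) = real j * m * T ^ k"
    using assms(7) by (cases j) (auto simp: power_add[symmetric] mult_ac add_ac)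
  also have "real i * m * T ^ k + real j * m * T ^ k = real (i + j) * m * T ^ k" by (simp add: algebra_simps)
  finally show ?thesis unfolding assms(7) by simp
qed

lemma power_le_imp_le_base':
  fixes x y :: real
  assumes "x ^ n \<le> y ^ n" "0 \<le> y" "0 < n"
  shows "x \<le> y"
proof (rule ccontr)
  assume "\<not> x \<le> y"
  then have "y ^ n < x ^ n" using assms by (intro power_strict_mono) auto
  then show False using assms(1) by simp
qed

lemma q_form_ge:
  fixes x y :: real
  assumes "M = max \<bar>x\<bar> \<bar>y\<bar>"
  shows "M ^ 2 / 8 \<le> q_form x y"
proof -
  have "27 * y ^ 2 + (2 * x + 13 * y) ^ 2 = 4 * q_form x y" "27 * x ^ 2 + (98 * y + 13 * x) ^ 2 = 196 * q_form x y"
    unfolding form_defs by (simp_all add: algebra_simps power2_eq_square)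
  moreover have "0 \<le> (2 * x + 13 * y) ^ 2" "0 \<le> (98 * y + 13 * x) ^ 2" "0 \<le> x ^ 2" "0 \<le> y ^ 2" by auto
  moreover have "M ^ 2 = x ^ 2 \<or> M ^ 2 = y ^ 2" using assms by (auto simp: max_def)
  ultimately show ?thesis by (elim disjE) linarith+
qed

text \<open>With M the maximum norm, q is at least M^2 / 8, while |q u| \<le> \<rho>^4 and |q w|
  \<le> \<rho>^6. Multiplying the Bezout identities by q bounds M^11 by multiples of M^5 \<rho>^6
  and M^3 \<rho>^8, so M is at most a multiple of \<rho>.\<close>

lemma region_bounded:
  assumes r: "(x, y) \<in> region \<rho>" and \<rho>: "\<rho> \<ge> 0"
  shows "\<bar>x\<bar> \<le> 9 * \<rho>" "\<bar>y\<bar> \<le> 9 * \<rho>"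
proof -
  define M where "M = max \<bar>x\<bar> \<bar>y\<bar>"
  have xy: "\<bar>x\<bar> \<le> M" "\<bar>y\<bar> \<le> M" by (auto simp: M_def)
  have M0: "M \<ge> 0" by (auto simp: M_def)
  define q u w where "q = q_form x y" and "u = u_form x y" and "w = w_form x y"
  have q: "M ^ 2 / 8 \<le> q" unfolding q_def by (rule q_form_ge[OF M_def])
  have q0: "q \<ge> 0" using q by (smt (verit) divide_nonneg_nonneg zero_le_power2)
  have qu: "\<bar>q * u\<bar> \<le> \<rho> ^ 4"
  proof (rule power_le_imp_le_base'[of _ 3])
    have "108 * \<bar>q * u\<bar> ^ 3 \<le> \<rho> ^ 12"
      using r by (simp add: region_def A_form_def q_def u_def abs_mult power_mult_distrib mult_ac)
    moreover have "0 \<le> \<bar>q * u\<bar> ^ 3" by simp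
    ultimately have "\<bar>q * u\<bar> ^ 3 \<le> \<rho> ^ 12" by linarith
    then show "\<bar>q * u\<bar> ^ 3 \<le> (\<rho> ^ 4) ^ 3" by (simp flip: power_mult)
  qed (use \<rho> in auto)
  have qw: "\<bar>q * w\<bar> \<le> \<rho> ^ 6"
  proof (rule power_le_imp_le_base'[of _ 2])
    have "108 * \<bar>q * w\<bar> ^ 2 \<le> \<rho> ^ 12"
      using r by (simp add: region_def B_form_def q_def w_def abs_mult power_mult_distrib mult_ac)
    moreover have "0 \<le> \<bar>q * w\<bar> ^ 2" by simp
    ultimately have "\<bar>q * w\<bar> ^ 2 \<le> \<rho> ^ 12" by linarith
    then show "\<bar>q * w\<bar> ^ 2 \<le> (\<rho> ^ 6) ^ 2" by (simp flip: power_mult)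
  qed (use \<rho> in auto)
  note mono = abs_monomial_le[OF xy]
  have m5: "\<bar>x ^ 5\<bar> \<le> M ^ 5" "\<bar>x ^ 4 * y\<bar> \<le> M ^ 5" "\<bar>x ^ 3 * y ^ 2\<bar> \<le> M ^ 5" "\<bar>x ^ 2 * y ^ 3\<bar> \<le> M ^ 5"
    "\<bar>x * y ^ 4\<bar> \<le> M ^ 5" "\<bar>y ^ 5\<bar> \<le> M ^ 5"
    using mono[of 5 0 5] mono[of 4 1 5] mono[of 3 2 5] mono[of 2 3 5] mono[of 1 4 5] mono[of 0 5 5] by simp_all
  have m3: "\<bar>x ^ 3\<bar> \<le> M ^ 3" "\<bar>x ^ 2 * y\<bar> \<le> M ^ 3" "\<bar>x * y ^ 2\<bar> \<le> M ^ 3" "\<bar>y ^ 3\<bar> \<le> M ^ 3"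
    using mono[of 3 0 3] mono[of 2 1 3] mono[of 1 2 3] mono[of 0 3 3] by simp_all
  define P1 where "P1 = - 993 * y ^ 5 - 1895 * (x * y ^ 4) - 949 * (x ^ 2 * y ^ 3) - 213 * (x ^ 3 * y ^ 2) - 23 * (x ^ 4 * y) - x ^ 5"
  define P2 where "P2 = - 36639 * x ^ 5 + 891863 * (x ^ 4 * y) + 13202917 * (x ^ 3 * y ^ 2) + 40787229 * (x ^ 2 * y ^ 3) + 15332975 * (x * y ^ 4)
        + 1541785 * y ^ 5"
  define Q1 where "Q1 = 105 * y ^ 3 + 70 * (x * y ^ 2) + 14 * (x ^ 2 * y) + x ^ 3"
  define Q2 where "Q2 = 38367 * x ^ 3 - 1261358 * (x ^ 2 * y) - 2273110 * (x * y ^ 2) + 220255 * y ^ 3"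
  \<comment> \<open>71793408 and, below, 3793090 are the sums of the absolute values of the
    coefficients of \<open>P2\<close> and \<open>Q2\<close>, the larger of each pair.\<close>
  have P: "\<bar>P1\<bar> \<le> 71793408 * M ^ 5" "\<bar>P2\<bar> \<le> 71793408 * M ^ 5"
    using m5[THEN abs_le_D1] m5[THEN abs_le_D2] unfolding P1_def P2_def by (intro abs_leI; linarith)+
  have Q: "\<bar>Q1\<bar> \<le> 3793090 * M ^ 3" "\<bar>Q2\<bar> \<le> 3793090 * M ^ 3"
    using m3[THEN abs_le_D1] m3[THEN abs_le_D2] unfolding Q1_def Q2_def by (intro abs_leI; linarith)+
  have id: "P1 * w + Q1 * (q * u ^ 2) = 12096 * y ^ 9" "P2 * w + Q2 * (q * u ^ 2) = 1728 * x ^ 9"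
    using bezout_forms(1)[of y x] bezout_forms(2)[of x y] unfolding P1_def P2_def Q1_def Q2_def q_def u_def w_def mult.assoc by simp_all
  have key: "q * \<bar>P * w + Q * (q * u ^ 2)\<bar> \<le> 71793408 * M ^ 5 * \<rho> ^ 6 + 3793090 * M ^ 3 * \<rho> ^ 8"
    if "\<bar>P\<bar> \<le> 71793408 * M ^ 5" "\<bar>Q\<bar> \<le> 3793090 * M ^ 3" for P Q
  proof -
    have "q * \<bar>P * w + Q * (q * u ^ 2)\<bar> = \<bar>P * (q * w) + Q * (q * u) ^ 2\<bar>"
      using q0 by (subst abs_of_nonneg[OF q0, symmetric], subst abs_mult[symmetric]) (simp add: algebra_simps power2_eq_square)
    also have "\<dots> \<le> \<bar>P\<bar> * \<bar>q * w\<bar> + \<bar>Q\<bar> * \<bar>q * u\<bar> ^ 2"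
      by (metis abs_mult abs_triangle_ineq power_abs)
    also have "\<dots> \<le> (71793408 * M ^ 5) * \<rho> ^ 6 + (3793090 * M ^ 3) * (\<rho> ^ 4) ^ 2"
      using that qw qu \<rho> M0 by (intro add_mono mult_mono power_mono) auto
    finally show ?thesis by (simp flip: power_mult)
  qed
  have "q * (1728 * M ^ 9) \<le> 71793408 * M ^ 5 * \<rho> ^ 6 + 3793090 * M ^ 3 * \<rho> ^ 8"
  proof -
    have "q * (12096 * \<bar>y\<bar> ^ 9) \<le> 71793408 * M ^ 5 * \<rho> ^ 6 + 3793090 * M ^ 3 * \<rho> ^ 8"
      using key[OF P(1) Q(1)] unfolding id(1) by (simp add: abs_mult power_abs)
    moreover have "q * (1728 * \<bar>x\<bar> ^ 9) \<le> 71793408 * M ^ 5 * \<rho> ^ 6 + 3793090 * M ^ 3 * \<rho> ^ 8"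
      using key[OF P(2) Q(2)] unfolding id(2) by (simp add: abs_mult power_abs)
    moreover have "M = \<bar>x\<bar> \<or> M = \<bar>y\<bar>" by (auto simp: M_def)
    then have "1728 * M ^ 9 \<le> 1728 * \<bar>x\<bar> ^ 9 \<or> 1728 * M ^ 9 \<le> 12096 * \<bar>y\<bar> ^ 9"
      by (elim disjE) simp_all
    ultimately show ?thesis using q0 by (meson mult_left_mono order_trans)
  qed
  moreover have "M ^ 2 / 8 * (1728 * M ^ 9) \<le> q * (1728 * M ^ 9)"
    using q M0 by (intro mult_right_mono) auto
  ultimately have main: "216 * M ^ 11 \<le> 71793408 * M ^ 5 * \<rho> ^ 6 + 3793090 * M ^ 3 * \<rho> ^ 8"
    by (simp add: power_add[symmetric] algebra_simps)
  \<comment> \<open>For \<rho> < M / 9 the right side of \<open>main\<close> is below 136 M^11,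
    while the left side is 216 M^11.\<close>
  have "M \<le> 9 * \<rho>"
  proof (rule ccontr)
    assume "\<not> M \<le> 9 * \<rho>"
    then have lt: "\<rho> < M / 9" by simp
    then have Mp: "M > 0" using \<rho> by simp
    have p: "\<rho> ^ n \<le> (M / 9) ^ n" for n using lt \<rho> by (intro power_mono) auto
    have "71793408 * M ^ 5 * \<rho> ^ 6 \<le> 71793408 * M ^ 5 * (M / 9) ^ 6"
      using p[of 6] M0 by (intro mult_left_mono) auto
    also have "\<dots> = 71793408 / 531441 * M ^ 11" by (simp add: power_divide power_add[symmetric])
    finally have 1: "71793408 * M ^ 5 * \<rho> ^ 6 \<le> 71793408 / 531441 * M ^ 11" .
    have "3793090 * M ^ 3 * \<rho> ^ 8 \<le> 3793090 * M ^ 3 * (M / 9) ^ 8"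
      using p[of 8] M0 by (intro mult_left_mono) auto
    also have "\<dots> = 3793090 / 43046721 * M ^ 11" by (simp add: power_divide power_add[symmetric])
    finally have "216 * M ^ 11 \<le> 71793408 / 531441 * M ^ 11 + 3793090 / 43046721 * M ^ 11"
      using main 1 by linarith
    moreover have "M ^ 11 > 0" using Mp by simp
    ultimately show False by simp
  qed
  then show "\<bar>x\<bar> \<le> 9 * \<rho>" "\<bar>y\<bar> \<le> 9 * \<rho>" using xy by auto
qed

lemma power_gap:
  fixes r s :: real
  assumes "0 \<le> r" "r \<le> s"
  shows "r ^ Suc n + (s - r) * s ^ n \<le> s ^ Suc n"
proof -
  have "r * r ^ n \<le> r * s ^ n" using assms by (intro mult_left_mono power_mono) auto
  then show ?thesis by (simp add: algebra_simps)
qed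

text \<open>The coefficients of A have absolute sum 1323 and every monomial varies by at most 4 m
  T^3; the bound is rounded up.\<close>

lemma A_form_diff:
  fixes x y x' y' T m :: real
  assumes "\<bar>x\<bar> \<le> T" "\<bar>x'\<bar> \<le> T" "\<bar>y\<bar> \<le> T" "\<bar>y'\<bar> \<le> T" "\<bar>x' - x\<bar> \<le> m" "\<bar>y' - y\<bar> \<le> m"
  shows "\<bar>A_form x' y' - A_form x y\<bar> \<le> 10000 * m * T ^ 3"
proof -
  note d = monomial_diff_le[OF assms, of _ _ 3]
  have d': "\<bar>x' ^ 4 - x ^ 4\<bar> \<le> 4 * (m * T ^ 3)" "\<bar>x' ^ 3 * y' - x ^ 3 * y\<bar> \<le> 4 * (m * T ^ 3)"
    "\<bar>x' ^ 2 * y' ^ 2 - x ^ 2 * y ^ 2\<bar> \<le> 4 * (m * T ^ 3)" "\<bar>x' * y' ^ 3 - x * y ^ 3\<bar> \<le> 4 * (m * T ^ 3)"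
    "\<bar>y' ^ 4 - y ^ 4\<bar> \<le> 4 * (m * T ^ 3)"
    using d[of 4 0] d[of 3 1] d[of 2 2] d[of 1 3] d[of 0 4] by simp_all
  have e: "A_form x y = - 3 * x ^ 4 - 54 * (x ^ 3 * y) - 345 * (x ^ 2 * y ^ 2) - 774 * (x * y ^ 3) - 147 * y ^ 4" for x y :: real
    unfolding form_defs by Groebner_Basis.algebra
  have "0 \<le> m * T ^ 3" using assms by (intro mult_nonneg_nonneg zero_le_power) linarith+
  then show ?thesis using d'[THEN abs_le_D1] d'[THEN abs_le_D2] unfolding e mult.assoc by (intro abs_leI; linarith)
qed

lemma B_form_diff:
  fixes x y x' y' T m :: real
  assumes "\<bar>x\<bar> \<le> T" "\<bar>x'\<bar> \<le> T" "\<bar>y\<bar> \<le> T" "\<bar>y'\<bar> \<le> T" "\<bar>x' - x\<bar> \<le> m" "\<bar>y' - y\<bar> \<le> m"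
  shows "\<bar>B_form x' y' - B_form x y\<bar> \<le> 200000 * m * T ^ 5"
proof -
  note d = monomial_diff_le[OF assms, of _ _ 5]
  have d': "\<bar>x' ^ 6 - x ^ 6\<bar> \<le> 6 * (m * T ^ 5)" "\<bar>x' ^ 5 * y' - x ^ 5 * y\<bar> \<le> 6 * (m * T ^ 5)"
    "\<bar>x' ^ 4 * y' ^ 2 - x ^ 4 * y ^ 2\<bar> \<le> 6 * (m * T ^ 5)" "\<bar>x' ^ 3 * y' ^ 3 - x ^ 3 * y ^ 3\<bar> \<le> 6 * (m * T ^ 5)"
    "\<bar>x' ^ 2 * y' ^ 4 - x ^ 2 * y ^ 4\<bar> \<le> 6 * (m * T ^ 5)" "\<bar>x' * y' ^ 5 - x * y ^ 5\<bar> \<le> 6 * (m * T ^ 5)"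
    "\<bar>y' ^ 6 - y ^ 6\<bar> \<le> 6 * (m * T ^ 5)"
    using d[of 6 0] d[of 5 1] d[of 4 2] d[of 3 3] d[of 2 4] d[of 1 5] d[of 0 6] by simp_all
  have e: "B_form x y = 2 * x ^ 6 + 54 * (x ^ 5 * y) + 588 * (x ^ 4 * y ^ 2) + 3150 * (x ^ 3 * y ^ 3)
      + 7980 * (x ^ 2 * y ^ 4) + 6678 * (x * y ^ 5) - 686 * y ^ 6" for x y :: real
    unfolding form_defs by Groebner_Basis.algebra
  have "0 \<le> m * T ^ 5" using assms by (intro mult_nonneg_nonneg zero_le_power) linarith+
  then show ?thesis using d'[THEN abs_le_D1] d'[THEN abs_le_D2] unfolding e mult.assoc by (intro abs_leI; linarith)
qed

text \<open>A substitute for the Lipschitz continuity of the gauge of the region.\<close>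

lemma region_perturb:
  obtains L where "L \<ge> 1" "\<And>x y x' y' m \<rho>. (x, y) \<in> region \<rho> \<Longrightarrow> \<rho> \<ge> 0 \<Longrightarrow> \<bar>x' - x\<bar> \<le> m \<Longrightarrow> \<bar>y' - y\<bar> \<le> m \<Longrightarrow>
      (x', y') \<in> region (\<rho> + L * m)"
proof -
  define ka where "ka = root 3 (1 / 4)"
  define kb where "kb = sqrt (1 / 27)"
  have ka: "ka > 0" "ka ^ 3 = 1 / 4" by (auto simp: ka_def)
  have kb: "kb > 0" "kb ^ 2 = 1 / 27" by (auto simp: kb_def)
  have iffA: "4 * \<bar>a\<bar> ^ 3 \<le> r ^ 12 \<longleftrightarrow> \<bar>a\<bar> \<le> ka * r ^ 4" if "r \<ge> 0" for a r :: real
  proof -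
    have "4 * \<bar>a\<bar> ^ 3 \<le> r ^ 12 \<longleftrightarrow> \<bar>a\<bar> ^ 3 \<le> (ka * r ^ 4) ^ 3" by (simp add: power_mult_distrib ka flip: power_mult) linarith
    also have "\<dots> \<longleftrightarrow> \<bar>a\<bar> \<le> ka * r ^ 4" using ka that by (intro power_mono_iff) auto
    finally show ?thesis .
  qed
  have iffB: "27 * b ^ 2 \<le> r ^ 12 \<longleftrightarrow> \<bar>b\<bar> \<le> kb * r ^ 6" if "r \<ge> 0" for b r :: real
  proof -
    have "27 * b ^ 2 \<le> r ^ 12 \<longleftrightarrow> \<bar>b\<bar> ^ 2 \<le> (kb * r ^ 6) ^ 2" by (simp add: power_mult_distrib kb flip: power_mult) linarith
    also have "\<dots> \<longleftrightarrow> \<bar>b\<bar> \<le> kb * r ^ 6" using kb that by (intro power_mono_iff) auto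
    finally show ?thesis .
  qed
  \<comment> \<open>By \<open>power_gap\<close>, enlarging \<rho> to s = \<rho> + L m raises the
    allowed size of A by at least \<open>ka * L * m * s ^ 3\<close>. This exceeds the variation of
    A, as T \<le> 9 s; the same works for B with fifth powers.\<close>
  define L where "L = max 1 (max (10000 * 9 ^ 3 / ka) (200000 * 9 ^ 5 / kb))"
  have L1: "L \<ge> 1" by (simp add: L_def)
  have LA: "10000 * 9 ^ 3 \<le> ka * L"
  proof -
    have "10000 * 9 ^ 3 / ka \<le> L" by (simp add: L_def)
    then show ?thesis using ka(1) by (simp add: divide_le_eq mult.commute)
  qed
  have LB: "200000 * 9 ^ 5 \<le> kb * L"
  proof -
    have "200000 * 9 ^ 5 / kb \<le> L" by (simp add: L_def)
    then show ?thesis using kb(1) by (simp add: divide_le_eq mult.commute)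
  qed
  have "(x', y') \<in> region (\<rho> + L * m)"
    if r: "(x, y) \<in> region \<rho>" and \<rho>: "\<rho> \<ge> 0" and m: "\<bar>x' - x\<bar> \<le> m" "\<bar>y' - y\<bar> \<le> m" for x y x' y' m \<rho>
  proof -
    have m0: "m \<ge> 0" using m by linarith
    define s where "s = \<rho> + L * m"
    have "1 * m \<le> L * m" using L1 m0 by (intro mult_right_mono) auto
    then have s: "\<rho> \<le> s" "\<rho> + m \<le> s" "s \<ge> 0" using m0 \<rho> by (auto simp: s_def)
    define T where "T = 9 * \<rho> + m"
    have T9: "T \<le> 9 * s" "T \<ge> 0" using s \<rho> m0 by (auto simp: T_def)
    have T: "\<bar>x\<bar> \<le> T" "\<bar>x'\<bar> \<le> T" "\<bar>y\<bar> \<le> T" "\<bar>y'\<bar> \<le> T"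
      using region_bounded[OF r \<rho>] m m0 unfolding T_def by linarith+
    have "\<bar>A_form x' y'\<bar> \<le> ka * s ^ 4"
    proof -
      have "\<bar>A_form x' y'\<bar> \<le> \<bar>A_form x y\<bar> + \<bar>A_form x' y' - A_form x y\<bar>" by linarith
      also have "\<dots> \<le> ka * \<rho> ^ 4 + 10000 * m * T ^ 3"
        using A_form_diff[OF T m] r iffA[OF \<rho>, of "A_form x y"] by (auto simp: region_def)
      also have "10000 * m * T ^ 3 \<le> 10000 * m * (9 * s) ^ 3"
        using T9 m0 by (intro mult_left_mono power_mono) auto
      also have "\<dots> = (10000 * 9 ^ 3) * (m * s ^ 3)" by (simp add: power_mult_distrib)
      also have "\<dots> \<le> (ka * L) * (m * s ^ 3)" using LA m0 s by (intro mult_right_mono) auto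
      also have "ka * \<rho> ^ 4 + (ka * L) * (m * s ^ 3) = ka * (\<rho> ^ Suc 3 + (s - \<rho>) * s ^ 3)"
        by (simp add: s_def algebra_simps eval_nat_numeral)
      also have "\<dots> \<le> ka * s ^ Suc 3" using power_gap[OF \<rho> s(1), of 3] ka by (intro mult_left_mono) auto
      finally show ?thesis by simp
    qed
    moreover have "\<bar>B_form x' y'\<bar> \<le> kb * s ^ 6"
    proof -
      have "\<bar>B_form x' y'\<bar> \<le> \<bar>B_form x y\<bar> + \<bar>B_form x' y' - B_form x y\<bar>" by linarith
      also have "\<dots> \<le> kb * \<rho> ^ 6 + 200000 * m * T ^ 5"
        using B_form_diff[OF T m] r iffB[OF \<rho>, of "B_form x y"] by (auto simp: region_def)
      also have "200000 * m * T ^ 5 \<le> 200000 * m * (9 * s) ^ 5"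
        using T9 m0 by (intro mult_left_mono power_mono) auto
      also have "\<dots> = (200000 * 9 ^ 5) * (m * s ^ 5)" by (simp add: power_mult_distrib)
      also have "\<dots> \<le> (kb * L) * (m * s ^ 5)" using LB m0 s by (intro mult_right_mono) auto
      also have "kb * \<rho> ^ 6 + (kb * L) * (m * s ^ 5) = kb * (\<rho> ^ Suc 5 + (s - \<rho>) * s ^ 5)"
        by (simp add: s_def algebra_simps eval_nat_numeral)
      also have "\<dots> \<le> kb * s ^ Suc 5" using power_gap[OF \<rho> s(1), of 5] kb by (intro mult_left_mono) auto
      finally show ?thesis by simp
    qed
    ultimately show ?thesis using iffA[OF s(3)] iffB[OF s(3)] unfolding s_def by (auto simp: region_def)
  qed
  then show ?thesis using that L1 by blast
qed

lemma region_scale: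
  assumes "c > 0"
  shows "(c * x, c * y) \<in> region (c * \<rho>) \<longleftrightarrow> (x, y) \<in> region \<rho>"
proof -
  have A: "A_form (c * x) (c * y) = c ^ 4 * A_form x y" and B: "B_form (c * x) (c * y) = c ^ 6 * B_form x y"
    using A_form_scale[of x c y] B_form_scale[of x c y] by (simp_all add: mult.commute)
  have c: "c ^ 12 > 0" using assms by simp
  have "4 * \<bar>c ^ 4 * A_form x y\<bar> ^ 3 = c ^ 12 * (4 * \<bar>A_form x y\<bar> ^ 3)"
    using assms by (simp add: abs_mult power_mult_distrib flip: power_mult)
  moreover have "27 * (c ^ 6 * B_form x y) ^ 2 = c ^ 12 * (27 * B_form x y ^ 2)"
    by (simp add: power_mult_distrib flip: power_mult)
  moreover have "(c * \<rho>) ^ 12 = c ^ 12 * \<rho> ^ 12" by (simp add: power_mult_distrib)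
  ultimately show ?thesis unfolding region_def A B mem_Collect_eq prod.case using mult_le_cancel_left_pos[OF c] by metis
qed

lemma region_measurable [measurable]: "region \<rho> \<in> sets borel"
proof -
  have "closed (region \<rho>)" unfolding region_def form_defs case_prod_beta
    by (intro closed_Collect_conj closed_Collect_le continuous_intros)
  then show ?thesis by simp
qed

lemma region_finite_measure: "\<rho> \<ge> 0 \<Longrightarrow> emeasure lborel (region \<rho>) < \<infinity>"
proof -
  assume \<rho>: "\<rho> \<ge> 0"
  have "region \<rho> \<subseteq> cbox (- 9 * \<rho>, - 9 * \<rho>) (9 * \<rho>, 9 * \<rho>)"
    using region_bounded[OF _ \<rho>] by (fastforce simp: abs_le_iff)
  then have "emeasure lborel (region \<rho>) \<le> emeasure lborel (cbox (- 9 * \<rho>, - 9 * \<rho>) (9 * \<rho>, 9 * \<rho>))"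
    by (intro emeasure_mono) auto
  also have "\<dots> < \<infinity>" by (rule emeasure_lborel_cbox_finite)
  finally show ?thesis .
qed

section \<open>Area of the region and lattice points in residue classes\<close>

definition region_area :: real where "region_area = measure lborel (region 1)"

lemma region_area_nonneg: "region_area \<ge> 0" by (simp add: region_area_def)

lemma measure_region:
  assumes "\<rho> > 0"
  shows "measure lborel (region \<rho>) = region_area * \<rho> ^ 2"
proof -
  have "emeasure lborel (region \<rho>) = emeasure (density (distr lborel borel (\<lambda>x. 0 + \<rho> *\<^sub>R x)) (\<lambda>_. ennreal (\<bar>\<rho>\<bar> ^ DIM(real \<times> real)))) (region \<rho>)"
    using lborel_affine[of \<rho> "0 :: real \<times> real"] assms by simp
  also have "\<dots> = ennreal (\<rho> ^ 2) * emeasure (distr lborel borel (\<lambda>x. 0 + \<rho> *\<^sub>R x)) (region \<rho>)"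
    using assms by (subst emeasure_density_const) (auto simp: power2_eq_square)
  also have "emeasure (distr lborel borel (\<lambda>x. 0 + \<rho> *\<^sub>R x)) (region \<rho>) = emeasure lborel ((\<lambda>x. 0 + \<rho> *\<^sub>R x) -` region \<rho> \<inter> space lborel)"
    by (rule emeasure_distr) auto
  also have "(\<lambda>x. 0 + \<rho> *\<^sub>R x) -` region \<rho> \<inter> space lborel = region 1"
    using region_scale[OF assms, of _ _ 1] by auto
  finally show ?thesis unfolding measure_def region_area_def using assms by (simp add: enn2real_mult mult.commute)
qed

lemma measure_cell:
  fixes a b m :: real
  assumes "m \<ge> 0"
  shows "measure lborel ({a..<a + m} \<times> {b..<b + m}) = m ^ 2"
    "{a..<a + m} \<times> {b..<b + m} \<in> fmeasurable lborel"
proof -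
  have "emeasure lborel ({a..<a + m} \<times> {b..<b + m}) = emeasure (lborel \<Otimes>\<^sub>M lborel) ({a..<a + m} \<times> {b..<b + m})"
    by (simp add: lborel_prod)
  also have "\<dots> = emeasure lborel {a..<a + m} * emeasure lborel {b..<b + m}"
    by (rule lborel.emeasure_pair_measure_Times) auto
  also have "\<dots> = ennreal (m ^ 2)" using assms by (simp add: ennreal_mult' power2_eq_square)
  finally have e: "emeasure lborel ({a..<a + m} \<times> {b..<b + m}) = ennreal (m ^ 2)" .
  then show "measure lborel ({a..<a + m} \<times> {b..<b + m}) = m ^ 2" by (simp add: measure_def)
  have "{a..<a + m} \<times> {b..<b + m} \<in> sets (lborel \<Otimes>\<^sub>M lborel)" by simp
  then have "{a..<a + m} \<times> {b..<b + m} \<in> sets lborel" unfolding lborel_prod .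
  then show "{a..<a + m} \<times> {b..<b + m} \<in> fmeasurable lborel"
    by (rule fmeasurableI) (simp add: e)
qed

definition residue_points :: "nat \<Rightarrow> int \<Rightarrow> int \<Rightarrow> real \<Rightarrow> (int \<times> int) set" where
  "residue_points m r s \<rho> = {(a, b). a mod int m = r \<and> b mod int m = s \<and> (real_of_int a, real_of_int b) \<in> region \<rho>}"

lemma finite_region_points:
  assumes "\<rho> \<ge> 0"
  shows "finite {(a, b). (real_of_int a, real_of_int b) \<in> region \<rho>}"
proof (rule finite_subset)
  show "{(a, b). (real_of_int a, real_of_int b) \<in> region \<rho>} \<subseteq> {- \<lfloor>9 * \<rho>\<rfloor>..\<lfloor>9 * \<rho>\<rfloor>} \<times> {- \<lfloor>9 * \<rho>\<rfloor>..\<lfloor>9 * \<rho>\<rfloor>}"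
  proof clarify
    fix a b assume "(real_of_int a, real_of_int b) \<in> region \<rho>"
    from region_bounded[OF this assms] show "a \<in> {- \<lfloor>9 * \<rho>\<rfloor>..\<lfloor>9 * \<rho>\<rfloor>} \<and> b \<in> {- \<lfloor>9 * \<rho>\<rfloor>..\<lfloor>9 * \<rho>\<rfloor>}"
      by (auto simp: abs_le_iff) linarith+
  qed
qed simp

text \<open>Attach to each point the half-open square of side m of which it is the lower left
  corner. These squares are disjoint, lie in the region of radius \<rho> + L m, and cover the region
  of radius \<rho> - L m.\<close>

lemma card_residue_points:
  obtains C where "C > 0" "\<And>m r s \<rho>. m > 0 \<Longrightarrow> \<rho> > 0 \<Longrightarrow> 0 \<le> r \<Longrightarrow> r < int m \<Longrightarrow> 0 \<le> s \<Longrightarrow> s < int m \<Longrightarrow>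
     \<bar>real (card (residue_points m r s \<rho>)) - region_area * \<rho> ^ 2 / real m ^ 2\<bar> \<le> C * (\<rho> / real m + 1)"
proof -
  obtain L where L: "L \<ge> 1" "\<And>x y x' y' m \<rho>. (x, y) \<in> region \<rho> \<Longrightarrow> \<rho> \<ge> 0 \<Longrightarrow> \<bar>x' - x\<bar> \<le> m \<Longrightarrow> \<bar>y' - y\<bar> \<le> m \<Longrightarrow>
      (x', y') \<in> region (\<rho> + L * m)" by (rule region_perturb) blast
  define C where "C = 1 + 2 * region_area * L + region_area * L ^ 2"
  have w0: "region_area \<ge> 0" by (rule region_area_nonneg)
  have "\<bar>real (card (residue_points m r s \<rho>)) - region_area * \<rho> ^ 2 / real m ^ 2\<bar> \<le> C * (\<rho> / real m + 1)"
    if m: "m > 0" and \<rho>: "\<rho> > 0" and rs: "0 \<le> r" "r < int m" "0 \<le> s" "s < int m" for m :: nat and r s \<rho>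
  proof -
    define V where "V = residue_points m r s \<rho>"
    have fin: "finite V" unfolding V_def residue_points_def
      by (rule finite_subset[OF _ finite_region_points[of \<rho>]]) (use \<rho> in auto)
    define cell where "cell = (\<lambda>(a::int, b::int). {real_of_int a..<real_of_int a + real m} \<times> {real_of_int b..<real_of_int b + real m})"
    have cell: "measure lborel (cell v) = real m ^ 2" "cell v \<in> fmeasurable lborel" for v
      using measure_cell[of "real m" "real_of_int (fst v)" "real_of_int (snd v)"] by (auto simp: cell_def case_prod_beta)
    have same: "a = a'" if "a mod int m = a' mod int m" "real_of_int a \<le> x" "x < real_of_int a + real m"
        "real_of_int a' \<le> x" "x < real_of_int a' + real m" for a a' :: int and x
    proof -
      have "real_of_int (a - a') < real_of_int (int m)" "real_of_int (a' - a) < real_of_int (int m)" using that by auto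
      then have "\<bar>a - a'\<bar> < int m" by (simp only: of_int_less_iff)
      moreover have "int m dvd a - a'" using that(1) by (simp add: mod_eq_dvd_iff)
      ultimately show ?thesis using zdvd_not_zless[of "\<bar>a - a'\<bar>" "int m"] by auto
    qed
    have disj: "pairwise (\<lambda>v w. disjnt (cell v) (cell w)) V"
    proof (rule pairwiseI)
      fix v w assume vw: "v \<in> V" "w \<in> V" "v \<noteq> w"
      obtain a b c d where [simp]: "v = (a, b)" "w = (c, d)" by (cases v; cases w) auto
      show "disjnt (cell v) (cell w)"
        using vw same[of a c] same[of b d] by (auto simp: disjnt_iff cell_def V_def residue_points_def)
    qed
    have mU: "measure lborel (\<Union>v\<in>V. cell v) = real (card V) * real m ^ 2"
      by (subst measure_UNION'[OF fin]) (use cell disj in auto)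
    have Ufm: "(\<Union>v\<in>V. cell v) \<in> fmeasurable lborel" using fin cell by (intro fmeasurable.finite_UN) auto
    have reg: "region t \<in> fmeasurable lborel" if "t > 0" for t
      using region_finite_measure[of t] that by (intro fmeasurableI) auto
    have m0: "real m > 0" using m by simp
    have upper: "real (card V) * real m ^ 2 \<le> region_area * (\<rho> + L * real m) ^ 2"
    proof -
      have "(\<Union>v\<in>V. cell v) \<subseteq> region (\<rho> + L * real m)"
      proof clarify
        fix x y a b assume "(a, b) \<in> V" "(x, y) \<in> cell (a, b)"
        then show "(x, y) \<in> region (\<rho> + L * real m)"
          using L(2)[of "real_of_int a" "real_of_int b" \<rho> x "real m" y] \<rho> by (auto simp: V_def residue_points_def cell_def)
      qed
      moreover have pos: "\<rho> + L * real m > 0" using \<rho> L m0 by (simp add: add_pos_nonneg)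
      ultimately have "measure lborel (\<Union>v\<in>V. cell v) \<le> measure lborel (region (\<rho> + L * real m))"
        using Ufm by (intro measure_mono_fmeasurable reg) (auto simp: fmeasurable_def)
      then show ?thesis using measure_region[OF pos] mU by simp
    qed
    have up: "real (card V) - region_area * \<rho> ^ 2 / real m ^ 2 \<le> C * (\<rho> / real m + 1)"
    proof -
      have "real (card V) \<le> region_area * (\<rho> + L * real m) ^ 2 / real m ^ 2"
        using upper m0 by (simp add: le_divide_eq)
      also have "\<dots> = region_area * \<rho> ^ 2 / real m ^ 2 + 2 * region_area * L * (\<rho> / real m) + region_area * L ^ 2"
        using m0 by (simp add: field_simps power2_eq_square)
      finally have "real (card V) - region_area * \<rho> ^ 2 / real m ^ 2 \<le> 2 * region_area * L * (\<rho> / real m) + region_area * L ^ 2" by simp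
      also have "\<dots> \<le> C * (\<rho> / real m) + C * 1"
        using w0 L(1) \<rho> m0 by (intro add_mono mult_right_mono) (auto simp: C_def)
      finally show ?thesis by (simp add: algebra_simps)
    qed
    have low: "region_area * \<rho> ^ 2 / real m ^ 2 - real (card V) \<le> C * (\<rho> / real m + 1)"
    \<comment> \<open>When the inner region degenerates, the main term itself is no larger than the
      permitted error.\<close>
    proof (cases "\<rho> \<le> L * real m")
      case True
      have "region_area * \<rho> ^ 2 / real m ^ 2 = region_area * (\<rho> / real m) * (\<rho> / real m)"
        by (simp add: power2_eq_square)
      also have "\<dots> \<le> region_area * L * (\<rho> / real m)"
        using True w0 \<rho> m0 by (intro mult_right_mono mult_left_mono) (auto simp: divide_le_eq)
      also have "\<dots> \<le> C * (\<rho> / real m)"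
        using w0 L(1) \<rho> m0 by (intro mult_right_mono) (auto simp: C_def)
      also have "\<dots> \<le> C * (\<rho> / real m + 1)" using w0 L(1) by (intro mult_left_mono) (auto simp: C_def)
      finally show ?thesis by linarith
    next
      case False
      then have pos: "\<rho> - L * real m > 0" by simp
      have "region (\<rho> - L * real m) \<subseteq> (\<Union>v\<in>V. cell v)"
      proof clarify
        fix x y assume xy: "(x, y) \<in> region (\<rho> - L * real m)"
        define corner where "corner = (\<lambda>z r. r + int m * \<lfloor>(z - real_of_int r) / real m\<rfloor>)"
        have c1: "corner z r mod int m = r" if "0 \<le> r" "r < int m" for z r
          using that by (simp add: corner_def)
        have c2: "real_of_int (corner z r) \<le> z \<and> z < real_of_int (corner z r) + real m" for z r
        proof -
          define k where "k = \<lfloor>(z - real_of_int r) / real m\<rfloor>"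
          have "real_of_int k \<le> (z - real_of_int r) / real m" "(z - real_of_int r) / real m < real_of_int k + 1"
            unfolding k_def by linarith+
          then have "real_of_int k * real m \<le> z - real_of_int r" "z - real_of_int r < (real_of_int k + 1) * real m"
            using m0 by (auto simp: le_divide_eq divide_less_eq)
          then show ?thesis unfolding corner_def k_def[symmetric] by (simp add: algebra_simps)
        qed
        let ?a = "corner x r" and ?b = "corner y s"
        have "(real_of_int ?a, real_of_int ?b) \<in> region ((\<rho> - L * real m) + L * real m)"
          by (rule L(2)[OF xy]) (use pos c2[of x r] c2[of y s] in \<open>auto simp: abs_le_iff\<close>)
        then have "(?a, ?b) \<in> V" using c1 rs by (auto simp: V_def residue_points_def)
        moreover have "(x, y) \<in> cell (?a, ?b)" using c2[of x r] c2[of y s] by (auto simp: cell_def)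
        ultimately show "(x, y) \<in> (\<Union>v\<in>V. cell v)" by blast
      qed
      then have "measure lborel (region (\<rho> - L * real m)) \<le> measure lborel (\<Union>v\<in>V. cell v)"
        using Ufm by (intro measure_mono_fmeasurable) auto
      then have "region_area * (\<rho> - L * real m) ^ 2 \<le> real (card V) * real m ^ 2"
        using measure_region[OF pos] mU by simp
      then have "region_area * (\<rho> - L * real m) ^ 2 / real m ^ 2 \<le> real (card V)"
        using m0 by (simp add: divide_le_eq)
      moreover have "region_area * (\<rho> - L * real m) ^ 2 / real m ^ 2 =
          region_area * \<rho> ^ 2 / real m ^ 2 - 2 * region_area * L * (\<rho> / real m) + region_area * L ^ 2"
        using m0 by (simp add: field_simps power2_eq_square)
      moreover have "0 \<le> region_area * L ^ 2" using w0 by simp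
      ultimately have "region_area * \<rho> ^ 2 / real m ^ 2 - real (card V) \<le> 2 * region_area * L * (\<rho> / real m)" by linarith
      also have "\<dots> \<le> C * (\<rho> / real m)"
        using w0 L(1) \<rho> m0 by (intro mult_right_mono) (auto simp: C_def)
      also have "\<dots> \<le> C * (\<rho> / real m + 1)" using w0 L(1) by (intro mult_left_mono) (auto simp: C_def)
      finally show ?thesis .
    qed
    show ?thesis using up low unfolding V_def by linarith
  qed
  moreover have "C > 0" using w0 L(1) unfolding C_def by (smt (verit) mult_nonneg_nonneg zero_le_power2)
  ultimately show ?thesis using that by blast
qed

section \<open>Counting points with divisibility conditions\<close>

text \<open>The origin has gcd 0, which every d divides, and so would spoil the Moebius inversion;
  it lies in \<open>defect_pairs g\<close> only for g = 1.\<close>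

definition defect_points :: "nat \<Rightarrow> real \<Rightarrow> (int \<times> int) set" where
  "defect_points g \<rho> = {(a, b) \<in> defect_pairs g. (a, b) \<noteq> (0, 0) \<and> (real_of_int a, real_of_int b) \<in> region \<rho>}"

lemma finite_defect_points: "\<rho> \<ge> 0 \<Longrightarrow> finite (defect_points g \<rho>)"
  unfolding defect_points_def by (rule finite_subset[OF _ finite_region_points]) auto

lemma form_cong:
  fixes a b a' b' m :: int
  assumes "[a = a'] (mod m)" "[b = b'] (mod m)"
  shows "[A_form a b = A_form a' b'] (mod m)" "[B_form a b = B_form a' b'] (mod m)"
  unfolding form_defs by (intro assms cong_mult cong_add cong_diff cong_pow cong_refl)+

lemma coprime_gcd_cong:
  fixes a b a' b' g m :: int
  assumes "[a = a'] (mod m)" "[b = b'] (mod m)" "g dvd m" "coprime (gcd a b) g"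
  shows "coprime (gcd a' b') g"
proof (rule coprime_int_primeI)
  fix p assume p: "Factorial_Ring.prime p" "p dvd gcd a' b'" "p dvd g"
  have "p dvd m" using p(3) assms(3) by (rule dvd_trans)
  have "[a = a'] (mod p)" "[b = b'] (mod p)" using assms(1,2) \<open>p dvd m\<close> by (auto intro: cong_dvd_modulus)
  then have "p dvd gcd a b" using p(2) by (simp add: cong_dvd_iff)
  then have "is_unit p" using p(3) assms(4) by (meson coprime_common_divisor)
  then show False using p(1) not_prime_unit by blast
qed

lemma defect_pairs_periodic:
  assumes "(a, b) \<in> defect_pairs g" "[a = a'] (mod int (g ^ 3))" "[b = b'] (mod int (g ^ 3))"
  shows "(a', b') \<in> defect_pairs g"
proof -
  note c = form_cong[OF assms(2,3)]
  have d: "int g dvd int (g ^ 3)" "int g ^ 2 dvd int (g ^ 3)" "int g ^ 3 dvd int (g ^ 3)" by (auto simp: le_imp_power_dvd)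
  have "int g ^ 2 dvd A_form a' b'" "int g ^ 3 dvd B_form a' b'"
    using assms(1) cong_dvd_iff[OF cong_dvd_modulus[OF c(1) d(2)]] cong_dvd_iff[OF cong_dvd_modulus[OF c(2) d(3)]]
    by (auto simp: defect_pairs_def)
  then show ?thesis using assms(1) coprime_gcd_cong[OF assms(2,3) d(1)] by (auto simp: defect_pairs_def)
qed

text \<open>A single bound for both regimes of the next count, with m = g^3: the error \<rho> from
  summing residue classes when m \<le> \<rho>, and the trivial size \<rho>^2 / m when m \<ge>
  \<rho>.\<close>

lemma powr_interpolate:
  fixes \<rho> m :: real
  assumes "\<rho> > 0" "m > 0"
  shows "m \<le> \<rho> \<Longrightarrow> \<rho> \<le> \<rho> powr (17/10) * m powr (-7/10)"
    and "\<rho> \<le> m \<Longrightarrow> \<rho> ^ 2 / m \<le> \<rho> powr (17/10) * m powr (-7/10)"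
proof -
  have mm: "m powr (-7/10) * m powr (7/10) = 1" using assms by (simp flip: powr_add)
  show "\<rho> \<le> \<rho> powr (17/10) * m powr (-7/10)" if "m \<le> \<rho>"
  proof -
    have "1 = m powr (-7/10) * m powr (7/10)" using mm by simp
    also have "\<dots> \<le> m powr (-7/10) * \<rho> powr (7/10)" using assms that by (intro mult_left_mono powr_mono2) auto
    finally have "\<rho> powr 1 * 1 \<le> \<rho> powr 1 * (m powr (-7/10) * \<rho> powr (7/10))" by (intro mult_left_mono) auto
    also have "\<dots> = (\<rho> powr 1 * \<rho> powr (7/10)) * m powr (-7/10)" by simp
    also have "\<rho> powr 1 * \<rho> powr (7/10) = \<rho> powr (17/10)" by (subst powr_add[symmetric]) simp
    finally show ?thesis using assms by simp
  qed
  show "\<rho> ^ 2 / m \<le> \<rho> powr (17/10) * m powr (-7/10)" if "\<rho> \<le> m"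
  proof -
    have "\<rho> ^ 2 / m = \<rho> powr (17/10) * \<rho> powr (3/10) * m powr (-1)"
      using assms by (simp add: powr_minus powr_numeral field_simps flip: powr_add)
    also have "\<dots> \<le> \<rho> powr (17/10) * m powr (3/10) * m powr (-1)"
      using assms that by (intro mult_left_mono mult_right_mono powr_mono2) auto
    also have "\<dots> = \<rho> powr (17/10) * (m powr (3/10) * m powr (-1))" by (simp only: mult.assoc)
    also have "m powr (3/10) * m powr (-1) = m powr (-7/10)" by (subst powr_add[symmetric]) simp
    finally show ?thesis .
  qed
qed

text \<open>If g^3 \<le> \<rho>, sum over the admissible residue classes modulo g^3, of which there
  are about g^3 up to a divisor factor. If g^3 > \<rho>, both the count and the main term are
  bounded by \<rho>^2 / g^3 up to the divisor factor.\<close>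

lemma card_defect_points_asymp:
  obtains C and dens :: "nat \<Rightarrow> real" where "C > 0" "\<And>g \<rho>. g > 0 \<Longrightarrow> \<rho> > 0 \<Longrightarrow>
    \<bar>real (card (defect_points g \<rho>)) - dens g * \<rho> ^ 2\<bar> \<le> C * (real g powr (-19/10) * \<rho> powr (17/10))"
proof -
  obtain C1 where C1: "C1 > 0" "\<And>m r s \<rho>. m > 0 \<Longrightarrow> \<rho> > 0 \<Longrightarrow> 0 \<le> r \<Longrightarrow> r < int m \<Longrightarrow> 0 \<le> s \<Longrightarrow> s < int m \<Longrightarrow>
     \<bar>real (card (residue_points m r s \<rho>)) - region_area * \<rho> ^ 2 / real m ^ 2\<bar> \<le> C1 * (\<rho> / real m + 1)"
    by (rule card_residue_points) blast
  obtain C2 where C2: "C2 > 0" "\<And>g \<rho>. g > 0 \<Longrightarrow> \<rho> > 0 \<Longrightarrow>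
     finite {(a, b) \<in> defect_pairs g. (a, b) \<noteq> (0, 0) \<and> \<bar>real_of_int a\<bar> \<le> \<rho> \<and> \<bar>real_of_int b\<bar> \<le> \<rho>} \<and>
     real (card {(a, b) \<in> defect_pairs g. (a, b) \<noteq> (0, 0) \<and> \<bar>real_of_int a\<bar> \<le> \<rho> \<and> \<bar>real_of_int b\<bar> \<le> \<rho>})
       \<le> C2 * real (num_divisors (g ^ 3)) * \<rho> ^ 2 / real g ^ 3"
    by (rule card_defect_pairs_box) blast
  obtain C3 where C3: "C3 > 0" "\<And>n. n > 0 \<Longrightarrow> real (num_divisors n) \<le> C3 * real n powr (1/15)"
    \<comment> \<open>Applied to g^3 this costs g^(1/5), turning g^(-21/10) into g^(-19/10).\<close>
    by (rule num_divisors_bound[of "1/15"]) auto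
  define R where "R = (\<lambda>g::nat. {(r, s). 0 \<le> r \<and> r < int (g ^ 3) \<and> 0 \<le> s \<and> s < int (g ^ 3) \<and> (r, s) \<in> defect_pairs g})"
  define dens where "dens = (\<lambda>g. region_area * real (card (R g)) / real (g ^ 3) ^ 2)"
  define K where "K = 1 + 2 * C1 * (1 + C2) + 81 * C2 + region_area * (1 + C2)"
  have w0: "region_area \<ge> 0" by (rule region_area_nonneg)
  have K0: "K > 0" using C1(1) C2(1) w0 by (auto simp: K_def intro!: add_pos_nonneg)
  have "\<bar>real (card (defect_points g \<rho>)) - dens g * \<rho> ^ 2\<bar> \<le> K * C3 * (real g powr (-19/10) * \<rho> powr (17/10))"
    if g: "g > 0" and \<rho>: "\<rho> > 0" for g \<rho>
  proof -
    define m where "m = g ^ 3"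
    have m: "m > 0" "real m > 0" "real m \<ge> 1" using g by (auto simp: m_def Suc_leI)
    define T where "T = C3 * real m powr (1/15)"
    have T: "real (num_divisors m) \<le> T" using C3(2)[OF m(1)] by (simp add: T_def)
    have "card {1::nat} \<le> num_divisors m" unfolding num_divisors_def using m(1) by (intro card_mono) auto
    then have T1: "T \<ge> 1" using T by simp
    have finR: "finite (R g)"
      by (rule finite_subset[of _ "{0..<int (g ^ 3)} \<times> {0..<int (g ^ 3)}"]) (auto simp: R_def)
    \<comment> \<open>A full system of residues lies in the box of radius m = g^3, so the packing
      bound applies; the extra 1 accounts for the origin.\<close>
    have cardR: "real (card (R g)) \<le> (1 + C2) * T * real m"
    proof -
      let ?B = "{(a, b) \<in> defect_pairs g. (a, b) \<noteq> (0, 0) \<and> \<bar>real_of_int a\<bar> \<le> real m \<and> \<bar>real_of_int b\<bar> \<le> real m}"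
      have "R g \<subseteq> insert (0, 0) ?B"
      proof
        fix v assume v: "v \<in> R g"
        obtain a b where [simp]: "v = (a, b)" by (cases v)
        have "\<bar>real_of_int a\<bar> \<le> real_of_int (int m)" "\<bar>real_of_int b\<bar> \<le> real_of_int (int m)"
          using v unfolding of_int_abs[symmetric] of_int_le_iff by (auto simp: R_def m_def)
        then show "v \<in> insert (0, 0) ?B" using v by (auto simp: R_def)
      qed
      then have "card (R g) \<le> card (insert (0, 0) ?B)" using C2(2)[OF g m(2)] by (intro card_mono) auto
      also have "\<dots> \<le> Suc (card ?B)" using C2(2)[OF g m(2)] by (intro card_insert_le_m1) auto
      finally have "real (card (R g)) \<le> 1 + real (card ?B)" by simp
      also have "\<dots> \<le> 1 + C2 * real (num_divisors m) * real m ^ 2 / real m"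
        using C2(2)[OF g m(2)] by (simp add: m_def)
      also have "\<dots> = 1 + C2 * real (num_divisors m) * real m" using m by (simp add: power2_eq_square)
      also have "\<dots> \<le> T * real m + C2 * T * real m"
      proof (rule add_mono)
        show "1 \<le> T * real m" using T1 m(3) by (metis mult_mono' mult_1 zero_le_one order_trans)
        show "C2 * real (num_divisors m) * real m \<le> C2 * T * real m"
          using T C2(1) m by (intro mult_right_mono mult_left_mono) auto
      qed
      finally show ?thesis by (simp add: algebra_simps)
    qed
    have main: "\<bar>real (card (defect_points g \<rho>)) - dens g * \<rho> ^ 2\<bar> \<le> K * T * (\<rho> powr (17/10) * real m powr (-7/10))"
    proof (cases "real m \<le> \<rho>")
      case True
      let ?U = "{(a, b) \<in> defect_pairs g. (real_of_int a, real_of_int b) \<in> region \<rho>}"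
      have finU: "finite ?U" by (rule finite_subset[OF _ finite_region_points[of \<rho>]]) (use \<rho> in auto)
      have U: "?U = (\<Union>(r, s)\<in>R g. residue_points m r s \<rho>)"
      proof (intro equalityI subsetI)
        fix v assume v: "v \<in> ?U"
        obtain a b where [simp]: "v = (a, b)" by (cases v)
        have "(a mod int m, b mod int m) \<in> defect_pairs g"
          by (rule defect_pairs_periodic[of a b]) (use v in \<open>auto simp: m_def cong_def\<close>)
        moreover have "a mod int m < int (g ^ 3)" "b mod int m < int (g ^ 3)" "0 \<le> a mod int m" "0 \<le> b mod int m"
          using g unfolding m_def by (simp_all del: of_nat_power)
        ultimately have "(a mod int m, b mod int m) \<in> R g" by (simp add: R_def)
        moreover have "v \<in> residue_points m (a mod int m) (b mod int m) \<rho>" using v by (simp add: residue_points_def)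
        ultimately show "v \<in> (\<Union>(r, s)\<in>R g. residue_points m r s \<rho>)" by blast
      next
        fix v assume "v \<in> (\<Union>(r, s)\<in>R g. residue_points m r s \<rho>)"
        then obtain r s where rs: "(r, s) \<in> R g" "v \<in> residue_points m r s \<rho>" by auto
        obtain a b where [simp]: "v = (a, b)" by (cases v)
        have "(a, b) \<in> defect_pairs g"
        proof (rule defect_pairs_periodic[of r s])
          show "(r, s) \<in> defect_pairs g" using rs by (simp add: R_def)
          show "[r = a] (mod int (g ^ 3))" "[s = b] (mod int (g ^ 3))"
            using rs by (auto simp: residue_points_def m_def[symmetric] cong_def R_def)
        qed
        then show "v \<in> ?U" using rs by (simp add: residue_points_def)
      qed
      have "card ?U = (\<Sum>v\<in>R g. card (case v of (r, s) \<Rightarrow> residue_points m r s \<rho>))"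
        unfolding U
      proof (rule card_UN_disjoint[OF finR])
        show "\<forall>i\<in>R g. finite (case i of (r, s) \<Rightarrow> residue_points m r s \<rho>)"
        proof
          fix i assume i: "i \<in> R g"
          have "(case i of (r, s) \<Rightarrow> residue_points m r s \<rho>) \<subseteq> ?U" unfolding U using i by blast
          then show "finite (case i of (r, s) \<Rightarrow> residue_points m r s \<rho>)" using finU by (rule finite_subset)
        qed
        show "\<forall>i\<in>R g. \<forall>j\<in>R g. i \<noteq> j \<longrightarrow> (case i of (r, s) \<Rightarrow> residue_points m r s \<rho>) \<inter> (case j of (r, s) \<Rightarrow> residue_points m r s \<rho>) = {}"
          by (auto simp: residue_points_def)
      qed
      then have cU: "real (card ?U) = (\<Sum>v\<in>R g. real (card (case v of (r, s) \<Rightarrow> residue_points m r s \<rho>)))" by simp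
      have "dens g * \<rho> ^ 2 = (\<Sum>v\<in>R g. region_area * \<rho> ^ 2 / real m ^ 2)"
        unfolding dens_def m_def[symmetric] by simp
      then have "\<bar>real (card ?U) - dens g * \<rho> ^ 2\<bar> = \<bar>\<Sum>v\<in>R g. (real (card (case v of (r, s) \<Rightarrow> residue_points m r s \<rho>)) - region_area * \<rho> ^ 2 / real m ^ 2)\<bar>"
        unfolding cU sum_subtractf by simp
      also have "\<dots> \<le> (\<Sum>v\<in>R g. C1 * (\<rho> / real m + 1))"
      proof (rule order_trans[OF sum_abs], rule sum_mono)
        fix v assume v: "v \<in> R g"
        obtain r s where [simp]: "v = (r, s)" by (cases v)
        show "\<bar>real (card (case v of (r, s) \<Rightarrow> residue_points m r s \<rho>)) - region_area * \<rho> ^ 2 / real m ^ 2\<bar> \<le> C1 * (\<rho> / real m + 1)"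
          using C1(2)[OF m(1) \<rho>, of r s] v by (auto simp: R_def m_def)
      qed
      also have "\<dots> = real (card (R g)) * (C1 * (\<rho> / real m + 1))" by simp
      also have "\<dots> \<le> ((1 + C2) * T * real m) * (C1 * (\<rho> / real m + \<rho> / real m))"
        using cardR True m \<rho> C1(1) C2(1) T1 by (intro mult_mono mult_left_mono add_mono) auto
      also have "\<dots> = 2 * C1 * (1 + C2) * T * \<rho>" using m by simp
      finally have e1: "\<bar>real (card ?U) - dens g * \<rho> ^ 2\<bar> \<le> 2 * C1 * (1 + C2) * T * \<rho>" .
      have "?U \<subseteq> insert (0, 0) (defect_points g \<rho>)" "defect_points g \<rho> \<subseteq> ?U" by (auto simp: defect_points_def)
      then have "card ?U \<le> card (insert (0, 0) (defect_points g \<rho>))" "card (defect_points g \<rho>) \<le> card ?U"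
        using finite_defect_points[of \<rho> g] \<rho> finU by (auto intro!: card_mono simp del: card_insert_disjoint)
      moreover have "card (insert (0, 0) (defect_points g \<rho>)) \<le> Suc (card (defect_points g \<rho>))"
        using finite_defect_points[of \<rho> g] \<rho> by (intro card_insert_le_m1) auto
      ultimately have e2: "\<bar>real (card (defect_points g \<rho>)) - real (card ?U)\<bar> \<le> 1" by linarith
      have "1 * 1 \<le> T * \<rho>" using T1 True m by (intro mult_mono) auto
      then have "\<bar>real (card (defect_points g \<rho>)) - dens g * \<rho> ^ 2\<bar> \<le> 1 * (T * \<rho>) + 2 * C1 * (1 + C2) * (T * \<rho>)"
        using e1 e2 by linarith
      also have "\<dots> = (1 + 2 * C1 * (1 + C2)) * (T * \<rho>)" by (simp add: algebra_simps)
      also have "\<dots> \<le> K * (T * (\<rho> powr (17/10) * real m powr (-7/10)))"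
        using powr_interpolate(1)[OF \<rho> m(2) True] T1 \<rho> C1(1) C2(1) w0 by (intro mult_mono mult_left_mono) (auto simp: K_def)
      finally show ?thesis by (simp add: mult.assoc)
    next
      case False
      let ?B = "{(a, b) \<in> defect_pairs g. (a, b) \<noteq> (0, 0) \<and> \<bar>real_of_int a\<bar> \<le> 9 * \<rho> \<and> \<bar>real_of_int b\<bar> \<le> 9 * \<rho>}"
      have "defect_points g \<rho> \<subseteq> ?B" using region_bounded[of _ _ \<rho>] \<rho> by (fastforce simp: defect_points_def)
      then have "card (defect_points g \<rho>) \<le> card ?B" using C2(2)[OF g, of "9 * \<rho>"] \<rho> by (intro card_mono) auto
      then have "real (card (defect_points g \<rho>)) \<le> C2 * real (num_divisors m) * (9 * \<rho>) ^ 2 / real m"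
        using C2(2)[OF g, of "9 * \<rho>"] \<rho> by (simp add: m_def)
      also have "\<dots> = 81 * C2 * real (num_divisors m) * (\<rho> ^ 2 / real m)" by (simp add: power_mult_distrib)
      also have "\<dots> \<le> 81 * C2 * T * (\<rho> ^ 2 / real m)"
        using T C2(1) by (intro mult_right_mono mult_left_mono) auto
      finally have e1: "real (card (defect_points g \<rho>)) \<le> 81 * C2 * T * (\<rho> ^ 2 / real m)" .
      have "dens g * \<rho> ^ 2 = region_area * real (card (R g)) / real m * (\<rho> ^ 2 / real m)"
        unfolding dens_def m_def[symmetric] by (simp add: power2_eq_square)
      also have "\<dots> \<le> region_area * ((1 + C2) * T * real m) / real m * (\<rho> ^ 2 / real m)"
        using cardR w0 m by (intro mult_right_mono divide_right_mono mult_left_mono) auto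
      also have "\<dots> = region_area * (1 + C2) * T * (\<rho> ^ 2 / real m)" using m by simp
      finally have e2: "dens g * \<rho> ^ 2 \<le> region_area * (1 + C2) * T * (\<rho> ^ 2 / real m)" .
      have "0 \<le> dens g * \<rho> ^ 2" using w0 by (simp add: dens_def)
      then have "\<bar>real (card (defect_points g \<rho>)) - dens g * \<rho> ^ 2\<bar> \<le> 81 * C2 * T * (\<rho> ^ 2 / real m) + region_area * (1 + C2) * T * (\<rho> ^ 2 / real m)"
        using e1 e2 by linarith
      also have "\<dots> = (81 * C2 + region_area * (1 + C2)) * (T * (\<rho> ^ 2 / real m))" by (simp add: algebra_simps)
      also have "\<dots> \<le> K * (T * (\<rho> powr (17/10) * real m powr (-7/10)))"
        using powr_interpolate(2)[OF \<rho> m(2)] False T1 \<rho> C1(1) C2(1) w0 by (intro mult_mono mult_left_mono) (auto simp: K_def)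
      finally show ?thesis by (simp add: mult.assoc)
    qed
    have "T * real m powr (-7/10) = C3 * real m powr (-19/30)"
      by (simp add: T_def flip: powr_add)
    also have "real m powr (-19/30) = real g powr (-19/10)"
      using g by (simp add: m_def powr_powr flip: powr_numeral)
    finally have tm: "T * real m powr (-7/10) = C3 * real g powr (-19/10)" .
    have "K * T * (\<rho> powr (17/10) * real m powr (-7/10)) = K * (T * real m powr (-7/10)) * \<rho> powr (17/10)"
      by (simp only: mult_ac)
    also have "\<dots> = K * C3 * (real g powr (-19/10) * \<rho> powr (17/10))" unfolding tm by (simp only: mult_ac)
    finally show ?thesis using main by linarith
  qed
  then show ?thesis using that[of "K * C3" dens] K0 C3(1) by auto
qed

lemma lcm_power_dvd:
  fixes x y :: nat and z :: int
  assumes "int x ^ n dvd z" "int y ^ n dvd z" "x > 0" "y > 0"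
  shows "int (lcm x y) ^ n dvd z"
proof -
  have "lcm x y ^ n * gcd x y ^ n = x ^ n * y ^ n" by (simp add: mult.commute flip: power_mult_distrib)
  also have "\<dots> = lcm (x ^ n) (y ^ n) * gcd x y ^ n" by (simp add: mult.commute flip: gcd_exp)
  finally have "lcm x y ^ n = lcm (x ^ n) (y ^ n)" using assms(3,4) by simp
  then have "int (lcm x y) ^ n = int (lcm (x ^ n) (y ^ n))" by (metis of_nat_power)
  also have "\<dots> = lcm (int x ^ n) (int y ^ n)" by (simp flip: of_nat_power)
  also have "\<dots> dvd z" using assms by simp
  finally show ?thesis .
qed

definition defect :: "int \<Rightarrow> int \<Rightarrow> nat" where
  "defect a b = Max {e. int e ^ 2 dvd A_form a b \<and> int e ^ 3 dvd B_form a b}"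

text \<open>The admissible e are closed under least common multiples, so the largest one is a
  multiple of all of them.\<close>

lemma dvd_defect_iff:
  assumes "coprime a b"
  shows "e dvd defect a b \<longleftrightarrow> int e ^ 2 dvd A_form a b \<and> int e ^ 3 dvd B_form a b"
    and "defect a b > 0"
proof -
  define E where "E = {e. int e ^ 2 dvd A_form a b \<and> int e ^ 3 dvd B_form a b}"
  have A0: "A_form a b \<noteq> 0" using coprime_forms_nonzero[OF assms] by simp
  have pos: "e > 0" if "e \<in> E" for e using that A0 by (auto simp: E_def intro!: Nat.gr0I)
  have fin: "finite E"
  proof (rule finite_subset)
    show "E \<subseteq> {..nat \<bar>A_form a b\<bar>}"
    proof
      fix e assume e: "e \<in> E"
      then have "int e dvd A_form a b" unfolding E_def by (auto intro: dvd_trans[of _ "int e ^ 2"])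
      then have "int e \<le> \<bar>A_form a b\<bar>" using A0 by (auto intro: zdvd_imp_le)
      then show "e \<in> {..nat \<bar>A_form a b\<bar>}" by simp
    qed
  qed simp
  have "1 \<in> E" by (simp add: E_def)
  have D: "defect a b \<in> E" "\<And>e. e \<in> E \<Longrightarrow> e \<le> defect a b"
    using Max_in[OF fin] Max_ge[OF fin] \<open>1 \<in> E\<close> unfolding defect_def E_def[symmetric] by auto
  show "defect a b > 0" using D(1) pos by blast
  show "e dvd defect a b \<longleftrightarrow> int e ^ 2 dvd A_form a b \<and> int e ^ 3 dvd B_form a b"
  proof
    assume "e dvd defect a b"
    then have "int e dvd int (defect a b)" by simp
    then have "int e ^ 2 dvd int (defect a b) ^ 2" "int e ^ 3 dvd int (defect a b) ^ 3" by (auto intro: dvd_power_same)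
    then show "int e ^ 2 dvd A_form a b \<and> int e ^ 3 dvd B_form a b"
      using D(1) unfolding E_def by (auto intro: dvd_trans)
  next
    assume "int e ^ 2 dvd A_form a b \<and> int e ^ 3 dvd B_form a b"
    then have e: "e \<in> E" by (simp add: E_def)
    then have "lcm e (defect a b) \<in> E" using D(1) pos[OF e] pos[OF D(1)] by (auto simp: E_def intro!: lcm_power_dvd)
    then have "lcm e (defect a b) \<le> defect a b" by (rule D(2))
    moreover have "defect a b dvd lcm e (defect a b)" by simp
    ultimately have "lcm e (defect a b) = defect a b"
      using pos[OF \<open>lcm e (defect a b) \<in> E\<close>] by (meson dvd_imp_le le_antisym)
    then show "e dvd defect a b" by (metis dvd_lcm1)
  qed
qed

lemma defect_pairs_coprime_iff:
  assumes "coprime a b" "g > 0"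
  shows "(a, b) \<in> defect_pairs g \<longleftrightarrow> g dvd defect a b"
  using assms by (auto simp: defect_pairs_def dvd_defect_iff)

text \<open>The constant is 435456 * 63 * 81: the defect cubed divides 435456 q, q is at most 63
  times the squared maximum norm, and that norm is at most 9 sqrt t.\<close>

abbreviation defect_bound :: nat where "defect_bound \<equiv> 2222131968"

lemma defect_cube_le:
  assumes "coprime a b" "(real_of_int a, real_of_int b) \<in> region (sqrt t)" "t \<ge> 0"
  shows "real (defect a b) ^ 3 \<le> real defect_bound * t"
proof -
  define D where "D = defect a b"
  have D0: "D > 0" using dvd_defect_iff(2)[OF assms(1)] by (simp add: D_def)
  have "(a, b) \<in> defect_pairs D" using defect_pairs_coprime_iff[OF assms(1) D0] by (simp add: D_def)
  then have "int D ^ 3 dvd defect_const * q_form a b" by (rule defect_pairs_dvd_q)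
  moreover have "a \<noteq> 0 \<or> b \<noteq> 0" using assms(1) by auto
  then have "q_form a b > 0" by (rule q_form_pos)
  ultimately have "int D ^ 3 \<le> defect_const * q_form a b" by (intro zdvd_imp_le) auto
  also have "\<dots> \<le> defect_const * (63 * (max \<bar>a\<bar> \<bar>b\<bar>) ^ 2)" by (intro mult_left_mono q_form_le_max) auto
  finally have "real_of_int (int D ^ 3) \<le> real_of_int (defect_const * (63 * (max \<bar>a\<bar> \<bar>b\<bar>) ^ 2))" by (simp only: of_int_le_iff)
  then have 1: "real D ^ 3 \<le> 27433728 * (real_of_int (max \<bar>a\<bar> \<bar>b\<bar>)) ^ 2" by simp
  have "real_of_int (max \<bar>a\<bar> \<bar>b\<bar>) \<le> 9 * sqrt t"
    using region_bounded[OF assms(2)] assms(3) by (simp add: max_def)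
  then have "(real_of_int (max \<bar>a\<bar> \<bar>b\<bar>)) ^ 2 \<le> (9 * sqrt t) ^ 2" by (intro power_mono) auto
  also have "\<dots> = 81 * t" using assms(3) by (simp add: power_mult_distrib)
  finally show ?thesis using 1 by (simp add: D_def)
qed

section \<open>Counting twist classes\<close>

text \<open>Dividing A by D^2 and B by D^3, for D the defect, divides the height by D^6. Hence
  height at most y^6 for the reduced pair amounts to \<rho>^12 = D^6 y^6, a radius that depends on
  the point.\<close>

definition twist_points :: "real \<Rightarrow> (int \<times> int) set" where
  "twist_points y = {(a, b). coprime a b \<and> (real_of_int a, real_of_int b) \<in> region (sqrt (real (defect a b) * y))}"

lemma twist_points_bounds:
  assumes "(a, b) \<in> twist_points y" "y \<ge> 0"
  shows "real (defect a b) ^ 2 \<le> real defect_bound * y"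
proof -
  define D where "D = defect a b"
  have c: "coprime a b" and r: "(real_of_int a, real_of_int b) \<in> region (sqrt (real D * y))"
    using assms by (auto simp: twist_points_def D_def)
  have D0: "D > 0" using dvd_defect_iff(2)[OF c] by (simp add: D_def)
  have "real D ^ 3 \<le> real defect_bound * (real D * y)"
    using defect_cube_le[OF c r] assms(2) by (simp add: D_def)
  then have "real D * real D ^ 2 \<le> real D * (real defect_bound * y)" by (simp add: power3_eq_cube power2_eq_square mult_ac)
  then show ?thesis using D0 unfolding D_def by simp
qed

lemma defect_points_scale:
  assumes d: "d > 0" and cop: "coprime d g"
  shows "card (defect_points g (\<rho> / real d)) = card {(a, b) \<in> defect_points g \<rho>. int d dvd a \<and> int d dvd b}"
proof (rule bij_betw_same_card[of "\<lambda>(a, b). (int d * a, int d * b)"], rule bij_betwI[where g = "\<lambda>(a, b). (a div int d, b div int d)"])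
  have dp: "(int d * a, int d * b) \<in> defect_pairs g \<longleftrightarrow> (a, b) \<in> defect_pairs g" for a b
  proof -
    have cd: "coprime (int g ^ k) (int d ^ l)" for k l using cop by (simp add: coprime_commute)
    have A: "A_form (int d * a) (int d * b) = int d ^ 4 * A_form a b" and B: "B_form (int d * a) (int d * b) = int d ^ 6 * B_form a b"
      using A_form_scale[of a "int d" b] B_form_scale[of a "int d" b] by (simp_all add: mult.commute)
    have "int g ^ 2 dvd int d ^ 4 * A_form a b \<longleftrightarrow> int g ^ 2 dvd A_form a b"
      "int g ^ 3 dvd int d ^ 6 * B_form a b \<longleftrightarrow> int g ^ 3 dvd B_form a b"
      using coprime_dvd_mult_right_iff[OF cd[of 2 4]] coprime_dvd_mult_right_iff[OF cd[of 3 6]] by blast+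
    moreover have "coprime (gcd (int d * a) (int d * b)) (int g) \<longleftrightarrow> coprime (gcd a b) (int g)"
      using cop by (simp add: gcd_mult_left)
    ultimately show ?thesis by (simp add: defect_pairs_def A B)
  qed
  have rg: "(real_of_int (int d * a), real_of_int (int d * b)) \<in> region \<rho> \<longleftrightarrow> (real_of_int a, real_of_int b) \<in> region (\<rho> / real d)" for a b
    using region_scale[of "real d" "real_of_int a" "real_of_int b" "\<rho> / real d"] d by simp
  have iff: "(int d * a, int d * b) \<in> defect_points g \<rho> \<longleftrightarrow> (a, b) \<in> defect_points g (\<rho> / real d)" for a b
    using dp[of a b] rg[of a b] d by (simp add: defect_points_def)
  show "(\<lambda>(a, b). (int d * a, int d * b)) \<in> defect_points g (\<rho> / real d) \<rightarrow> {(a, b) \<in> defect_points g \<rho>. int d dvd a \<and> int d dvd b}"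
    using iff by auto
  show "(\<lambda>(a, b). (a div int d, b div int d)) \<in> {(a, b) \<in> defect_points g \<rho>. int d dvd a \<and> int d dvd b} \<rightarrow> defect_points g (\<rho> / real d)"
  proof clarify
    fix a b assume ab: "(a, b) \<in> defect_points g \<rho>" "int d dvd a" "int d dvd b"
    then show "(a div int d, b div int d) \<in> defect_points g (\<rho> / real d)"
      using iff[of "a div int d" "b div int d"] by simp
  qed
qed (use d in auto)

lemma divisors_subset:
  fixes n B :: nat
  assumes "n > 0" "n \<le> B"
  shows "{d. d dvd n} \<subseteq> {1..B}"
proof
  fix d assume "d \<in> {d. d dvd n}"
  then have "d > 0" "d \<le> n" using assms(1) by (auto intro: dvd_pos_nat dvd_imp_le)
  then show "d \<in> {1..B}" using assms(2) by simp
qed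

text \<open>Moebius inversion over the divisors d of gcd(a, b). They are automatically prime to g,
  and B exceeds every coordinate, so no divisor is cut off.\<close>

lemma primitive_defect_count:
  assumes g: "g > 0" and \<rho>: "\<rho> > 0" and B: "9 * \<rho> \<le> real B"
  shows "real (card {(a, b) \<in> defect_points g \<rho>. coprime a b}) =
    (\<Sum>d\<in>{1..B}. (if coprime d g then moebius_mu d * real (card (defect_points g (\<rho> / real d))) else 0))"
proof -
  let ?V = "defect_points g \<rho>"
  have fin: "finite ?V" using finite_defect_points \<rho> by simp
  have inner: "(\<Sum>d\<in>{1..B}. (if coprime d g \<and> int d dvd a \<and> int d dvd b then moebius_mu d else 0)) = (if coprime a b then 1 else 0)"
    if v: "(a, b) \<in> ?V" for a b
  proof -
    define n where "n = nat (gcd a b)"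
    have n0: "n > 0" using v by (auto simp: n_def defect_points_def)
    have dn: "int d dvd a \<and> int d dvd b \<longleftrightarrow> d dvd n" for d
    proof -
      have "int d dvd a \<and> int d dvd b \<longleftrightarrow> int d dvd gcd a b" by simp
      also have "\<dots> \<longleftrightarrow> int d dvd int n" by (simp add: n_def)
      finally show ?thesis by simp
    qed
    have cop: "coprime n g"
    proof -
      have "coprime (int n) (int g)" using v by (simp add: defect_points_def defect_pairs_def n_def)
      then show ?thesis by simp
    qed
    have nB: "n \<le> B"
    proof -
      have "int n dvd a" "int n dvd b" using dn[of n] by auto
      moreover have "a \<noteq> 0 \<or> b \<noteq> 0" using v by (auto simp: defect_points_def)
      ultimately have "int n \<le> \<bar>a\<bar> \<or> int n \<le> \<bar>b\<bar>" by (metis abs_of_nat dvd_imp_le_int)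
      moreover have "\<bar>real_of_int a\<bar> \<le> 9 * \<rho>" "\<bar>real_of_int b\<bar> \<le> 9 * \<rho>"
        using region_bounded[of "real_of_int a" "real_of_int b" \<rho>] v \<rho> by (auto simp: defect_points_def)
      ultimately have "real n \<le> 9 * \<rho>" by linarith
      then show ?thesis using B by linarith
    qed
    have "(\<Sum>d\<in>{1..B}. (if coprime d g \<and> int d dvd a \<and> int d dvd b then moebius_mu d else 0)) = (\<Sum>d | d dvd n. moebius_mu d)"
    proof (rule sum.mono_neutral_cong_right)
      show "{d. d dvd n} \<subseteq> {1..B}" by (rule divisors_subset[OF n0 nB])
      show "(if coprime d g \<and> int d dvd a \<and> int d dvd b then moebius_mu d else 0) = moebius_mu d" if "d \<in> {d. d dvd n}" for d
        using that dn cop by (auto dest: coprime_divisors[of d n g g])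
      show "\<forall>i\<in>{1..B} - {d. d dvd n}. (if coprime i g \<and> int i dvd a \<and> int i dvd b then moebius_mu i else 0) = 0"
        using dn by auto
    qed auto
    also have "\<dots> = (if n = 1 then 1 else 0)" by (rule sum_moebius[OF n0])
    also have "n = 1 \<longleftrightarrow> coprime a b" by (auto simp: n_def coprime_iff_gcd_eq_1)
    finally show ?thesis .
  qed
  have "real (card {(a, b) \<in> ?V. coprime a b}) = (\<Sum>(a, b)\<in>?V. if coprime a b then 1 else 0)"
  proof -
    have "{(a, b) \<in> ?V. coprime a b} = ?V \<inter> {(a, b). coprime a b}" by auto
    then show ?thesis using fin by (simp add: sum.inter_restrict case_prod_beta' flip: sum.inter_filter)
  qed
  also have "\<dots> = (\<Sum>(a, b)\<in>?V. \<Sum>d\<in>{1..B}. (if coprime d g \<and> int d dvd a \<and> int d dvd b then moebius_mu d else 0))"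
    by (intro sum.cong refl) (use inner in auto)
  also have "\<dots> = (\<Sum>d\<in>{1..B}. \<Sum>(a, b)\<in>?V. (if coprime d g \<and> int d dvd a \<and> int d dvd b then moebius_mu d else 0))"
    unfolding case_prod_beta' by (rule sum.swap)
  also have "\<dots> = (\<Sum>d\<in>{1..B}. (if coprime d g then moebius_mu d * real (card (defect_points g (\<rho> / real d))) else 0))"
  proof (rule sum.cong[OF refl])
    fix d assume d: "d \<in> {1..B}"
    show "(\<Sum>(a, b)\<in>?V. (if coprime d g \<and> int d dvd a \<and> int d dvd b then moebius_mu d else 0)) =
       (if coprime d g then moebius_mu d * real (card (defect_points g (\<rho> / real d))) else 0)"
    proof (cases "coprime d g")
      case True
      have "(\<Sum>(a, b)\<in>?V. (if coprime d g \<and> int d dvd a \<and> int d dvd b then moebius_mu d else 0)) =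
         (\<Sum>v\<in>{v\<in>?V. int d dvd fst v \<and> int d dvd snd v}. moebius_mu d)"
        using True fin by (subst sum.inter_filter) (auto simp: case_prod_beta')
      also have "\<dots> = moebius_mu d * real (card {v\<in>?V. int d dvd fst v \<and> int d dvd snd v})" by simp
      also have "{v\<in>?V. int d dvd fst v \<and> int d dvd snd v} = {(a, b) \<in> ?V. int d dvd a \<and> int d dvd b}" by auto
      finally show ?thesis using True defect_points_scale[of d g \<rho>] d by simp
    qed simp
  qed
  finally show ?thesis .
qed

text \<open>Points are sorted by their defect e, so that the radius becomes constant. Defect exactly
  e is detected by Moebius inversion over f with e f dividing the defect, and coprimality by
  inversion over d. One large cutoff B serves all three sums.\<close>

lemma card_twist_points:
  assumes y: "y \<ge> 1" and B: "real B \<ge> real defect_bound * y"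
  shows "finite (twist_points y)"
    "real (card (twist_points y)) = (\<Sum>e\<in>{1..B}. \<Sum>f\<in>{1..B}. \<Sum>d\<in>{1..B}.
      (if coprime d (e * f) then moebius_mu f * moebius_mu d * real (card (defect_points (e * f) (sqrt (real e * y) / real d))) else 0))"
proof -
  have B1: "real B \<ge> 1" using B y by simp
  define P where "P = (\<lambda>e. {(a, b). coprime a b \<and> e dvd defect a b \<and> (real_of_int a, real_of_int b) \<in> region (sqrt (real e * y))})"
  have finP: "finite (P e)" for e
    unfolding P_def by (rule finite_subset[OF _ finite_region_points[of "sqrt (real e * y)"]]) (use y in auto)
  have DB: "e \<in> {1..B} \<and> (a, b) \<in> P e \<and> defect a b = e" if v: "(a, b) \<in> twist_points y" "e = defect a b" for a b e
  proof -
    have c: "coprime a b" using v by (simp add: twist_points_def)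
    have "real e ^ 2 \<le> real defect_bound * y" using twist_points_bounds[OF v(1)] y v(2) by simp
    also have "\<dots> \<le> real B * 1" using B by simp
    also have "\<dots> \<le> real B ^ 2" unfolding power2_eq_square using B1 by (intro mult_left_mono) auto
    finally have "real e \<le> real B" by (rule power2_le_imp_le) simp
    then show ?thesis using v dvd_defect_iff(2)[OF c] by (auto simp: P_def twist_points_def)
  qed
  have U: "twist_points y = (\<Union>e\<in>{1..B}. {(a, b) \<in> P e. defect a b = e})"
  proof (intro equalityI subsetI)
    fix v assume "v \<in> twist_points y"
    then show "v \<in> (\<Union>e\<in>{1..B}. {(a, b) \<in> P e. defect a b = e})" using DB by (cases v) auto
  qed (auto simp: P_def twist_points_def)
  have finQ: "finite {(a, b) \<in> P e. defect a b = e}" for e by (rule finite_subset[OF _ finP[of e]]) auto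
  show "finite (twist_points y)" unfolding U using finQ by auto
  have "card (twist_points y) = (\<Sum>e\<in>{1..B}. card {(a, b) \<in> P e. defect a b = e})"
    unfolding U by (rule card_UN_disjoint) (use finQ in auto)
  then have "real (card (twist_points y)) = (\<Sum>e\<in>{1..B}. real (card {(a, b) \<in> P e. defect a b = e}))" by simp
  also have "\<dots> = (\<Sum>e\<in>{1..B}. \<Sum>f\<in>{1..B}. moebius_mu f * real (card {(a, b) \<in> defect_points (e * f) (sqrt (real e * y)). coprime a b}))"
  proof (rule sum.cong[OF refl])
    fix e assume e: "e \<in> {1..B}"
    have inner: "(\<Sum>f\<in>{1..B}. (if e * f dvd defect a b then moebius_mu f else 0)) = (if defect a b = e then 1 else 0)"
      if v: "(a, b) \<in> P e" for a b
    proof -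
      have c: "coprime a b" and r: "(real_of_int a, real_of_int b) \<in> region (sqrt (real e * y))" using v by (auto simp: P_def)
      obtain n where n: "defect a b = e * n" using v by (auto simp: P_def elim: dvdE)
      have n0: "n > 0" using n dvd_defect_iff(2)[OF c] by (auto intro!: Nat.gr0I)
      have "real (defect a b) ^ 3 \<le> real defect_bound * (real e * y)" using defect_cube_le[OF c r] y by simp
      also have "\<dots> = (real defect_bound * y) * real e" by simp
      also have "\<dots> \<le> real B * real B" using B e by (intro mult_mono) auto
      also have "\<dots> \<le> real B ^ 3" using B1 by (simp add: power3_eq_cube)
      finally have "real (defect a b) \<le> real B" using power_le_imp_le_base'[of "real (defect a b)" 3 "real B"] by simp
      then have DB': "defect a b \<le> B" by simp
      have nB: "n \<le> B" using DB' n e by (metis One_nat_def atLeastAtMost_iff le_trans mult.commute mult_le_mono2 nat_mult_1_right)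
      have "(\<Sum>f\<in>{1..B}. (if e * f dvd defect a b then moebius_mu f else 0)) = (\<Sum>f | f dvd n. moebius_mu f)"
      proof (rule sum.mono_neutral_cong_right)
        show "{d. d dvd n} \<subseteq> {1..B}" by (rule divisors_subset[OF n0 nB])
      qed (use n e in auto)
      also have "\<dots> = (if n = 1 then 1 else 0)" by (rule sum_moebius[OF n0])
      finally show ?thesis using n e by auto
    qed
    have "real (card {(a, b) \<in> P e. defect a b = e}) = (\<Sum>v\<in>P e. if defect (fst v) (snd v) = e then 1 else 0)"
    proof -
      have "{(a, b) \<in> P e. defect a b = e} = {v \<in> P e. defect (fst v) (snd v) = e}" by auto
      then show ?thesis using finP[of e] by (simp flip: sum.inter_filter)
    qed
    also have "\<dots> = (\<Sum>v\<in>P e. \<Sum>f\<in>{1..B}. (if e * f dvd defect (fst v) (snd v) then moebius_mu f else 0))"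
      by (intro sum.cong refl) (use inner in auto)
    also have "\<dots> = (\<Sum>f\<in>{1..B}. \<Sum>v\<in>P e. (if e * f dvd defect (fst v) (snd v) then moebius_mu f else 0))" by (rule sum.swap)
    also have "\<dots> = (\<Sum>f\<in>{1..B}. moebius_mu f * real (card {(a, b) \<in> defect_points (e * f) (sqrt (real e * y)). coprime a b}))"
    proof (rule sum.cong[OF refl])
      fix f assume f: "f \<in> {1..B}"
      have ef: "e * f > 0" using e f by simp
      have "(\<Sum>v\<in>P e. (if e * f dvd defect (fst v) (snd v) then moebius_mu f else 0)) = (\<Sum>v\<in>{v \<in> P e. e * f dvd defect (fst v) (snd v)}. moebius_mu f)"
        by (rule sum.inter_filter[OF finP, symmetric])
      also have "{v \<in> P e. e * f dvd defect (fst v) (snd v)} = {(a, b) \<in> defect_points (e * f) (sqrt (real e * y)). coprime a b}"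
        using defect_pairs_coprime_iff[OF _ ef] by (auto simp: P_def defect_points_def dest: dvd_mult_left)
      finally show "(\<Sum>v\<in>P e. (if e * f dvd defect (fst v) (snd v) then moebius_mu f else 0)) =
         moebius_mu f * real (card {(a, b) \<in> defect_points (e * f) (sqrt (real e * y)). coprime a b})" by simp
    qed
    finally show "real (card {(a, b) \<in> P e. defect a b = e}) =
       (\<Sum>f\<in>{1..B}. moebius_mu f * real (card {(a, b) \<in> defect_points (e * f) (sqrt (real e * y)). coprime a b}))" .
  qed
  also have "\<dots> = (\<Sum>e\<in>{1..B}. \<Sum>f\<in>{1..B}. \<Sum>d\<in>{1..B}.
      (if coprime d (e * f) then moebius_mu f * moebius_mu d * real (card (defect_points (e * f) (sqrt (real e * y) / real d))) else 0))"
  proof (intro sum.cong refl)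
    fix e f assume ef: "e \<in> {1..B}" "f \<in> {1..B}"
    have "9 * sqrt (real e * y) \<le> real B"
    proof -
      have "(9 * sqrt (real e * y)) ^ 2 = 81 * y * real e" using y by (simp add: power_mult_distrib)
      also have "\<dots> \<le> real B * real B" using B y ef by (intro mult_mono) auto
      finally have "(9 * sqrt (real e * y)) ^ 2 \<le> real B ^ 2" by (simp add: power2_eq_square)
      then show ?thesis by (rule power2_le_imp_le) simp
    qed
    moreover have "sqrt (real e * y) > 0" "e * f > 0" using ef y by auto
    ultimately show "moebius_mu f * real (card {(a, b) \<in> defect_points (e * f) (sqrt (real e * y)). coprime a b}) =
      (\<Sum>d\<in>{1..B}. (if coprime d (e * f) then moebius_mu f * moebius_mu d * real (card (defect_points (e * f) (sqrt (real e * y) / real d))) else 0))"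
      by (subst primitive_defect_count[of "e * f" _ B]) (auto simp: sum_distrib_left if_distrib mult.assoc intro!: sum.cong)
  qed
  finally show "real (card (twist_points y)) = (\<Sum>e\<in>{1..B}. \<Sum>f\<in>{1..B}. \<Sum>d\<in>{1..B}.
      (if coprime d (e * f) then moebius_mu f * moebius_mu d * real (card (defect_points (e * f) (sqrt (real e * y) / real d))) else 0))" .
qed

text \<open>F does not depend on the cutoff B. Comparing two cutoffs at the same y gives |k m - k n|
  \<le> 2 C y^(\<beta> - 1), so the truncated coefficients are Cauchy and no separate tail estimate
  is required.\<close>

lemma linear_asymptotic_from_truncations:
  fixes F :: "real \<Rightarrow> real" and k :: "nat \<Rightarrow> real"
  assumes F: "\<And>y B. y \<ge> 1 \<Longrightarrow> real B \<ge> K * y \<Longrightarrow> \<bar>F y - k B * y\<bar> \<le> C * y powr \<beta>" and \<beta>: "\<beta> < 1"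
  obtains \<kappa> where "\<And>y. y \<ge> 1 \<Longrightarrow> \<bar>F y - \<kappa> * y\<bar> \<le> C * y powr \<beta>"
proof -
  have "Cauchy k"
  proof (rule metric_CauchyI)
    fix \<epsilon> :: real assume \<epsilon>: "\<epsilon> > 0"
    have "((\<lambda>y::real. 2 * C * y powr (\<beta> - 1)) \<longlongrightarrow> 2 * C * 0) at_top"
      using \<beta> by (intro tendsto_mult tendsto_const tendsto_neg_powr filterlim_ident) auto
    then have "eventually (\<lambda>y. 2 * C * y powr (\<beta> - 1) < \<epsilon>) at_top" using \<epsilon> by (intro order_tendstoD(2)) auto
    then have "eventually (\<lambda>y. 2 * C * y powr (\<beta> - 1) < \<epsilon> \<and> y \<ge> 1) at_top"
      using eventually_ge_at_top[of 1] by (rule eventually_conj)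
    then obtain y where y: "2 * C * y powr (\<beta> - 1) < \<epsilon>" "y \<ge> 1"
      by (metis (no_types, lifting) eventually_at_top_linorder order_refl)
    define N where "N = nat \<lceil>K * y\<rceil>"
    have "dist (k m) (k n) < \<epsilon>" if "m \<ge> N" "n \<ge> N" for m n
    proof -
      have "real m \<ge> K * y" "real n \<ge> K * y" using that unfolding N_def by linarith+
      then have "\<bar>F y - k m * y\<bar> \<le> C * y powr \<beta>" "\<bar>F y - k n * y\<bar> \<le> C * y powr \<beta>" using F[OF y(2)] by auto
      then have "\<bar>k m * y - k n * y\<bar> \<le> 2 * C * y powr \<beta>" by linarith
      also have "y powr \<beta> = y powr (\<beta> - 1) * y" using y(2) by (simp add: powr_diff)
      finally have "\<bar>k m - k n\<bar> * y \<le> (2 * C * y powr (\<beta> - 1)) * y"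
        using y(2) by (simp add: abs_mult mult.assoc flip: left_diff_distrib)
      then have "\<bar>k m - k n\<bar> \<le> 2 * C * y powr (\<beta> - 1)" using y(2) by simp
      then show ?thesis using y(1) by (simp add: dist_real_def)
    qed
    then show "\<exists>M. \<forall>m\<ge>M. \<forall>n\<ge>M. dist (k m) (k n) < \<epsilon>" by blast
  qed
  then obtain \<kappa> where \<kappa>: "k \<longlonglongrightarrow> \<kappa>" using Cauchy_convergent_iff convergent_def by blast
  have "\<bar>F y - \<kappa> * y\<bar> \<le> C * y powr \<beta>" if y: "y \<ge> 1" for y
  proof (rule LIMSEQ_le_const2)
    show "(\<lambda>B. \<bar>F y - k B * y\<bar>) \<longlonglongrightarrow> \<bar>F y - \<kappa> * y\<bar>" by (intro tendsto_intros \<kappa>)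
    have "\<bar>F y - k n * y\<bar> \<le> C * y powr \<beta>" if "n \<ge> nat \<lceil>K * y\<rceil>" for n
    proof -
      have "K * y \<le> real n" using that by linarith
      then show ?thesis using F y by blast
    qed
    then show "\<exists>N. \<forall>n\<ge>N. \<bar>F y - k n * y\<bar> \<le> C * y powr \<beta>" by blast
  qed
  then show ?thesis using that by blast
qed

lemma sum_powr_bounded:
  fixes s :: real
  assumes "s < -1"
  obtains S where "S \<ge> 0" "\<And>B. (\<Sum>k\<in>{1..B}. real k powr s) \<le> S"
proof -
  have sm: "summable (\<lambda>k. real k powr s)" using assms by (simp add: summable_real_powr_iff)
  have "(\<Sum>k\<in>{1..B}. real k powr s) \<le> (\<Sum>k. real k powr s)" for B
    by (rule sum_le_suminf[OF sm]) auto
  moreover have "0 \<le> (\<Sum>k. real k powr s)" by (rule suminf_nonneg[OF sm]) simp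
  ultimately show ?thesis using that by blast
qed

text \<open>With g = e f and \<rho> = sqrt(e y) / d the error becomes y^(17/20) e^(-21/20)
  f^(-19/10) d^(-17/10). All three exponents are below -1, so the triple sum of errors is bounded
  independently of the cutoff.\<close>

lemma twist_points_asymp:
  obtains \<kappa> C where "C \<ge> 0" "\<And>y. y \<ge> 1 \<Longrightarrow> \<bar>real (card (twist_points y)) - \<kappa> * y\<bar> \<le> C * y powr (17/20)"
proof -
  obtain C and dens :: "nat \<Rightarrow> real" where C: "C > 0" "\<And>g \<rho>. g > 0 \<Longrightarrow> \<rho> > 0 \<Longrightarrow>
    \<bar>real (card (defect_points g \<rho>)) - dens g * \<rho> ^ 2\<bar> \<le> C * (real g powr (-19/10) * \<rho> powr (17/10))"
    by (rule card_defect_points_asymp) blast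
  obtain S1 where S1: "S1 \<ge> 0" "\<And>B. (\<Sum>k\<in>{1..B}. real k powr (-21/20)) \<le> S1" by (rule sum_powr_bounded[of "-21/20"]) auto
  obtain S2 where S2: "S2 \<ge> 0" "\<And>B. (\<Sum>k\<in>{1..B}. real k powr (-19/10)) \<le> S2" by (rule sum_powr_bounded[of "-19/10"]) auto
  obtain S3 where S3: "S3 \<ge> 0" "\<And>B. (\<Sum>k\<in>{1..B}. real k powr (-17/10)) \<le> S3" by (rule sum_powr_bounded[of "-17/10"]) auto
  define k where "k = (\<lambda>B. \<Sum>e\<in>{1..B}. \<Sum>f\<in>{1..B}. \<Sum>d\<in>{1..B}.
      (if coprime d (e * f) then moebius_mu f * moebius_mu d * (dens (e * f) * real e / real d ^ 2) else (0::real)))"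
  have bound: "\<bar>real (card (twist_points y)) - k B * y\<bar> \<le> (C * (S1 * S2 * S3)) * y powr (17/20)"
    if y: "y \<ge> 1" and B: "real B \<ge> real defect_bound * y" for y B
  proof -
    define t1 where "t1 = (\<lambda>e f d. (if coprime d (e * f) then moebius_mu f * moebius_mu d * real (card (defect_points (e * f) (sqrt (real e * y) / real d))) else 0))"
    define t2 where "t2 = (\<lambda>e f d. (if coprime d (e * f) then moebius_mu f * moebius_mu d * (dens (e * f) * real e / real d ^ 2) else (0::real)) * y)"
    have trm: "\<bar>t1 e f d - t2 e f d\<bar> \<le> (C * y powr (17/20)) * (real e powr (-21/20) * (real f powr (-19/10) * real d powr (-17/10)))"
      if efd: "e \<in> {1..B}" "f \<in> {1..B}" "d \<in> {1..B}" for e f d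
    proof (cases "coprime d (e * f)")
      case True
      have p: "real e > 0" "real f > 0" "real d > 0" using efd by auto
      define \<rho> where "\<rho> = sqrt (real e * y) / real d"
      have \<rho>0: "\<rho> > 0" using p y by (simp add: \<rho>_def)
      have "\<rho> ^ 2 = real e * y / real d ^ 2" using p y by (simp add: \<rho>_def power_divide)
      then have "t2 e f d = moebius_mu f * moebius_mu d * (dens (e * f) * \<rho> ^ 2)" using True by (simp add: t2_def)
      moreover have "t1 e f d = moebius_mu f * moebius_mu d * real (card (defect_points (e * f) \<rho>))"
        using True by (simp only: t1_def \<rho>_def if_True)
      ultimately have "t1 e f d - t2 e f d = moebius_mu f * moebius_mu d * (real (card (defect_points (e * f) \<rho>)) - dens (e * f) * \<rho> ^ 2)"
        by (simp only: right_diff_distrib)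
      also have "\<bar>\<dots>\<bar> \<le> (1 * 1) * (C * (real (e * f) powr (-19/10) * \<rho> powr (17/10)))"
        unfolding abs_mult using C(2)[of "e * f" \<rho>] \<rho>0 p abs_moebius_le_1 by (intro mult_mono) auto
      also have "\<rho> powr (17/10) = real e powr (17/20) * y powr (17/20) * real d powr (-17/10)"
        using p y by (simp add: \<rho>_def powr_divide powr_mult powr_half_sqrt[symmetric] powr_powr powr_minus_divide)
      also have "real (e * f) powr (-19/10) = real e powr (-19/10) * real f powr (-19/10)" using p by (simp add: powr_mult)
      also have "(1 * 1) * (C * (real e powr (-19/10) * real f powr (-19/10) * (real e powr (17/20) * y powr (17/20) * real d powr (-17/10)))) =
         (C * y powr (17/20)) * ((real e powr (-19/10) * real e powr (17/20)) * (real f powr (-19/10) * real d powr (-17/10)))"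
        by (simp add: mult_ac)
      also have "real e powr (-19/10) * real e powr (17/20) = real e powr (-21/20)" by (simp flip: powr_add)
      finally show ?thesis .
    next
      case False
      then have "t1 e f d = 0" "t2 e f d = 0" unfolding t1_def t2_def by (simp_all only: if_False mult_zero_left)
      then show ?thesis using C(1) by simp
    qed
    have "real (card (twist_points y)) - k B * y = (\<Sum>e\<in>{1..B}. \<Sum>f\<in>{1..B}. \<Sum>d\<in>{1..B}. t1 e f d - t2 e f d)"
      unfolding card_twist_points(2)[OF y B] k_def t1_def t2_def by (simp add: sum_subtractf sum_distrib_right)
    also have "\<bar>\<dots>\<bar> \<le> (\<Sum>e\<in>{1..B}. \<Sum>f\<in>{1..B}. \<Sum>d\<in>{1..B}. \<bar>t1 e f d - t2 e f d\<bar>)"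
      by (intro order_trans[OF sum_abs] sum_mono order_refl)
    also have "\<dots> \<le> (\<Sum>e\<in>{1..B}. \<Sum>f\<in>{1..B}. \<Sum>d\<in>{1..B}. (C * y powr (17/20)) * (real e powr (-21/20) * (real f powr (-19/10) * real d powr (-17/10))))"
      by (intro sum_mono trm)
    also have "\<dots> = (C * y powr (17/20)) * ((\<Sum>e\<in>{1..B}. real e powr (-21/20)) * ((\<Sum>f\<in>{1..B}. real f powr (-19/10)) * (\<Sum>d\<in>{1..B}. real d powr (-17/10))))"
      by (simp only: sum_distrib_left[symmetric] sum_distrib_right[symmetric])
    also have "\<dots> \<le> (C * y powr (17/20)) * (S1 * (S2 * S3))"
      using S1 S2 S3 C(1) by (intro mult_left_mono mult_mono mult_nonneg_nonneg sum_nonneg) auto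
    finally show ?thesis by (simp add: mult_ac)
  qed
  obtain \<kappa> where "\<And>y. y \<ge> 1 \<Longrightarrow> \<bar>real (card (twist_points y)) - \<kappa> * y\<bar> \<le> (C * (S1 * S2 * S3)) * y powr (17/20)"
    by (rule linear_asymptotic_from_truncations[of "real defect_bound" "\<lambda>y. real (card (twist_points y))" k "C * (S1 * S2 * S3)" "17/20"])
      (use bound in auto)
  then show ?thesis using that[of "C * (S1 * S2 * S3)" \<kappa>] C(1) S1(1) S2(1) S3(1) by auto
qed

section \<open>Squarefree numbers and lower bounds\<close>

text \<open>The exponent 3/5 lies between the errors z for small z and 1 for large z. With z = y /
  k^2 it gives k^(-6/5), whose sum over all k converges.\<close>

lemma floor_error:
  fixes z :: real
  assumes "z \<ge> 0"
  shows "\<bar>real_of_int \<lfloor>z\<rfloor> - z\<bar> \<le> z powr (3/5)"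
proof (cases "z < 1")
  case True
  then have "\<lfloor>z\<rfloor> = 0" using assms by (simp add: floor_eq_iff)
  moreover have "z \<le> z powr (3/5)"
  proof (cases "z = 0")
    case False
    then have "z powr 1 \<le> z powr (3/5)" using True assms by (intro powr_mono') auto
    then show ?thesis using assms by simp
  qed simp
  ultimately show ?thesis using assms by simp
next
  case False
  have "\<bar>real_of_int \<lfloor>z\<rfloor> - z\<bar> \<le> 1" by linarith
  also have "\<dots> \<le> z powr (3/5)" using False by (intro ge_one_powr_ge_zero) auto
  finally show ?thesis .
qed

definition squarefree_upto :: "real \<Rightarrow> nat set" where
  "squarefree_upto y = {c. squarefree c \<and> real c \<le> y}"

lemma finite_squarefree_upto: "finite (squarefree_upto y)"
  by (rule finite_subset[of _ "{..nat \<lfloor>y\<rfloor>}"]) (auto simp: squarefree_upto_def le_nat_floor)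

lemma card_multiples:
  fixes k n :: nat
  assumes "k > 0"
  shows "card {c \<in> {1..n}. k dvd c} = n div k"
proof -
  have "{c \<in> {1..n}. k dvd c} = (\<lambda>j. k * j) ` {1..n div k}"
  proof (intro equalityI subsetI)
    fix c assume c: "c \<in> {c \<in> {1..n}. k dvd c}"
    then obtain j where j: "c = k * j" by auto
    have "j \<le> n div k" using c j assms by (simp add: less_eq_div_iff_mult_less_eq mult.commute)
    moreover have "j \<ge> 1" using c j by (cases j) auto
    ultimately show "c \<in> (\<lambda>j. k * j) ` {1..n div k}" using j by auto
  next
    fix c assume "c \<in> (\<lambda>j. k * j) ` {1..n div k}"
    then obtain j where j: "c = k * j" "j \<in> {1..n div k}" by (rule imageE)
    then have "k * j \<le> n" using assms by (simp add: less_eq_div_iff_mult_less_eq mult.commute)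
    then show "c \<in> {c \<in> {1..n}. k dvd c}" using j assms by simp
  qed
  then show ?thesis using assms by (simp add: card_image inj_on_def)
qed

text \<open>The k with k^2 | c are the divisors of the square part of c, which is 1 exactly for
  squarefree c.\<close>

lemma card_squarefree_upto:
  assumes y: "y \<ge> 1" and B: "real B \<ge> y"
  shows "real (card (squarefree_upto y)) = (\<Sum>k\<in>{1..B}. moebius_mu k * real_of_int \<lfloor>y / real k ^ 2\<rfloor>)"
proof -
  define N where "N = nat \<lfloor>y\<rfloor>"
  have N: "real c \<le> y \<longleftrightarrow> c \<le> N" for c using y unfolding N_def by (simp add: le_nat_iff le_floor_iff)
  have NB: "N \<le> B" using B y unfolding N_def by linarith
  have S: "squarefree_upto y = {c \<in> {1..N}. squarefree c}"
    using N by (auto simp: squarefree_upto_def Suc_le_eq intro!: Nat.gr0I)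
  have inner: "(\<Sum>k\<in>{1..B}. if k ^ 2 dvd c then moebius_mu k else 0) = (if squarefree c then 1 else 0)"
    if c: "c \<in> {1..N}" for c
  proof -
    define n where "n = square_part c"
    have n: "k dvd n \<longleftrightarrow> k ^ 2 dvd c" for k unfolding n_def by (rule dvd_square_part_iff)
    have n0: "n > 0" using c by (auto simp: n_def intro!: Nat.gr0I)
    have "n ^ 2 dvd c" using n[of n] by simp
    then have "n ^ 2 \<le> c" using c by (intro dvd_imp_le) auto
    moreover have "n \<le> n ^ 2" using n0 by (simp add: power2_eq_square)
    ultimately have nB: "n \<le> B" using c NB by simp
    have "(\<Sum>k\<in>{1..B}. if k ^ 2 dvd c then moebius_mu k else 0) = (\<Sum>k | k dvd n. moebius_mu k)"
    proof (rule sum.mono_neutral_cong_right)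
      show "{k. k dvd n} \<subseteq> {1..B}" by (rule divisors_subset[OF n0 nB])
      show "\<forall>k\<in>{1..B} - {k. k dvd n}. (if k ^ 2 dvd c then moebius_mu k else 0) = 0"
        unfolding n[symmetric] by simp
      show "(if k ^ 2 dvd c then moebius_mu k else 0) = moebius_mu k" if "k \<in> {k. k dvd n}" for k
        using that unfolding n[symmetric] by simp
    qed simp
    also have "\<dots> = (if n = 1 then 1 else 0)" by (rule sum_moebius[OF n0])
    also have "n = 1 \<longleftrightarrow> squarefree c"
    proof
      assume "n = 1"
      then have "x dvd 1" if "x ^ 2 dvd c" for x using n[of x] that by simp
      then show "squarefree c" by (rule squarefreeI)
    next
      assume "squarefree c"
      then show "n = 1" using \<open>n ^ 2 dvd c\<close> squarefreeD[of c n] by simp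
    qed
    finally show ?thesis .
  qed
  have mult: "real (card {c \<in> {1..N}. k ^ 2 dvd c}) = real_of_int \<lfloor>y / real k ^ 2\<rfloor>" if k: "k \<in> {1..B}" for k
  proof -
    have k2: "k ^ 2 > 0" using k by simp
    have "card {c \<in> {1..N}. k ^ 2 dvd c} = N div k ^ 2" by (rule card_multiples[OF k2])
    moreover have "int (N div k ^ 2) = \<lfloor>y / real k ^ 2\<rfloor>"
    proof -
      have "\<lfloor>y / real_of_int (int (k ^ 2))\<rfloor> = \<lfloor>y\<rfloor> div int (k ^ 2)" by (rule floor_divide_real_eq_div) simp
      then show ?thesis using y by (simp add: N_def zdiv_int)
    qed
    then have "real (N div k ^ 2) = real_of_int \<lfloor>y / real k ^ 2\<rfloor>" by (metis of_int_of_nat_eq)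
    ultimately show ?thesis by simp
  qed
  have "real (card (squarefree_upto y)) = (\<Sum>c\<in>{1..N}. if squarefree c then 1 else 0)"
    unfolding S by (simp flip: sum.inter_filter)
  also have "\<dots> = (\<Sum>c\<in>{1..N}. \<Sum>k\<in>{1..B}. if k ^ 2 dvd c then moebius_mu k else 0)"
    by (intro sum.cong refl inner[symmetric])
  also have "\<dots> = (\<Sum>k\<in>{1..B}. \<Sum>c\<in>{1..N}. if k ^ 2 dvd c then moebius_mu k else 0)" by (rule sum.swap)
  also have "\<dots> = (\<Sum>k\<in>{1..B}. moebius_mu k * real_of_int \<lfloor>y / real k ^ 2\<rfloor>)"
  proof (rule sum.cong[OF refl])
    fix k assume k: "k \<in> {1..B}"
    have "(\<Sum>c\<in>{1..N}. if k ^ 2 dvd c then moebius_mu k else 0) = (\<Sum>c\<in>{c \<in> {1..N}. k ^ 2 dvd c}. moebius_mu k)"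
      by (rule sum.inter_filter[symmetric]) simp
    also have "\<dots> = real (card {c \<in> {1..N}. k ^ 2 dvd c}) * moebius_mu k" by simp
    finally show "(\<Sum>c\<in>{1..N}. if k ^ 2 dvd c then moebius_mu k else 0) = moebius_mu k * real_of_int \<lfloor>y / real k ^ 2\<rfloor>"
      using mult[OF k] by simp
  qed
  finally show ?thesis .
qed

lemma squarefree_upto_asymp:
  obtains \<theta> C where "C \<ge> 0" "\<And>y. y \<ge> 1 \<Longrightarrow> \<bar>real (card (squarefree_upto y)) - \<theta> * y\<bar> \<le> C * y powr (3/5)"
proof -
  obtain S where S: "S \<ge> 0" "\<And>B. (\<Sum>k\<in>{1..B}. real k powr (-6/5)) \<le> S" by (rule sum_powr_bounded[of "-6/5"]) auto
  define \<kappa> where "\<kappa> = (\<lambda>B. \<Sum>k\<in>{1..B}. moebius_mu k / real k ^ 2)"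
  have bound: "\<bar>real (card (squarefree_upto y)) - \<kappa> B * y\<bar> \<le> S * y powr (3/5)" if y: "y \<ge> 1" and B: "real B \<ge> 1 * y" for y B
  proof -
    have "real (card (squarefree_upto y)) - \<kappa> B * y = (\<Sum>k\<in>{1..B}. moebius_mu k * (real_of_int \<lfloor>y / real k ^ 2\<rfloor> - y / real k ^ 2))"
    proof -
      have "real B \<ge> y" using B by simp
      then show ?thesis
        unfolding card_squarefree_upto[OF y \<open>real B \<ge> y\<close>] \<kappa>_def sum_distrib_right sum_subtractf[symmetric]
        by (intro sum.cong refl) (simp add: algebra_simps)
    qed
    also have "\<bar>\<dots>\<bar> \<le> (\<Sum>k\<in>{1..B}. y powr (3/5) * real k powr (-6/5))"
    proof (rule order_trans[OF sum_abs], rule sum_mono)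
      fix k assume k: "k \<in> {1..B}"
      have "\<bar>moebius_mu k * (real_of_int \<lfloor>y / real k ^ 2\<rfloor> - y / real k ^ 2)\<bar> \<le> 1 * (y / real k ^ 2) powr (3/5)"
        unfolding abs_mult using y by (intro mult_mono abs_moebius_le_1 floor_error) auto
      also have "(y / real k ^ 2) powr (3/5) = y powr (3/5) * real k powr (-6/5)"
      proof -
        have "(real k ^ 2) powr (3/5) = real k powr (6/5)" using k by (simp add: powr_powr flip: powr_numeral)
        then show ?thesis using y k by (simp add: powr_divide powr_minus_divide)
      qed
      finally show "\<bar>moebius_mu k * (real_of_int \<lfloor>y / real k ^ 2\<rfloor> - y / real k ^ 2)\<bar> \<le> y powr (3/5) * real k powr (-6/5)" by simp
    qed
    also have "\<dots> = y powr (3/5) * (\<Sum>k\<in>{1..B}. real k powr (-6/5))" by (simp add: sum_distrib_left)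
    also have "\<dots> \<le> y powr (3/5) * S" by (intro mult_left_mono S) auto
    finally show ?thesis by (simp add: mult.commute)
  qed
  obtain \<theta> where "\<And>y. y \<ge> 1 \<Longrightarrow> \<bar>real (card (squarefree_upto y)) - \<theta> * y\<bar> \<le> S * y powr (3/5)"
    by (rule linear_asymptotic_from_truncations[of 1 "\<lambda>y. real (card (squarefree_upto y))" \<kappa> S "3/5"]) (use bound in auto)
  then show ?thesis using that[of S \<theta>] S(1) by auto
qed

section \<open>Positivity of the densities\<close>

lemma sum_inverse_squares_le: "n \<ge> 1 \<Longrightarrow> (\<Sum>k\<in>{2..n}. 1 / real k ^ 2) \<le> 3/4"
proof -
  have "(\<Sum>k\<in>{2..n}. 1 / real k ^ 2) \<le> 3/4 - 1 / real n" if "n \<ge> 2" for n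
    using that
  proof (induction n rule: nat_induct_at_least)
    case base
    then show ?case by simp
  next
    case (Suc n)
    have "1 / real (Suc n) ^ 2 \<le> 1 / real n - 1 / real (Suc n)"
    proof -
      have "1 / real n - 1 / real (Suc n) = 1 / (real n * real (Suc n))" using Suc.hyps by (simp add: field_simps)
      also have "\<dots> \<ge> 1 / (real (Suc n) * real (Suc n))" using Suc.hyps by (intro divide_left_mono mult_right_mono) auto
      finally show ?thesis by (simp add: power2_eq_square)
    qed
    moreover have "(\<Sum>k\<in>{2..Suc n}. 1 / real k ^ 2) = (\<Sum>k\<in>{2..n}. 1 / real k ^ 2) + 1 / real (Suc n) ^ 2"
      using Suc.hyps by (simp add: sum.cl_ivl_Suc)
    ultimately show ?case using Suc.IH by linarith
  qed
  note this[of n]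
  moreover have "0 \<le> 1 / real n" by simp
  ultimately show ?thesis
  proof (cases "n \<ge> 2")
    case False
    then have "{2..n} = {}" by auto
    then show ?thesis by simp
  qed linarith
qed

text \<open>The density is known only as a limit, so its positivity comes from a union bound: at
  most n times the sum of 1/k^2 over k \<ge> 2, hence at most 3n/4, numbers are divisible by a
  square. The same sum handles coprime pairs below.\<close>

lemma card_squarefree_lower: "n \<ge> 1 \<Longrightarrow> real n / 4 \<le> real (card (squarefree_upto (real n)))"
proof -
  assume n: "n \<ge> 1"
  have "{1..n} - squarefree_upto (real n) \<subseteq> (\<Union>k\<in>{2..n}. {c \<in> {1..n}. k ^ 2 dvd c})"
  proof
    fix c assume c: "c \<in> {1..n} - squarefree_upto (real n)"
    then have "\<not> squarefree c" by (auto simp: squarefree_upto_def)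
    then obtain k where k: "k ^ 2 dvd c" "\<not> k dvd 1" by (rule not_squarefreeE)
    have "k \<noteq> 0" using k(1) c by (auto intro!: Nat.gr0I)
    have "k ^ 2 \<le> c" using k(1) c by (intro dvd_imp_le) auto
    moreover have "k \<le> k ^ 2" by (simp add: power2_eq_square)
    ultimately have "k \<le> n" using c by simp
    moreover have "k \<ge> 2" using k(2) \<open>k \<noteq> 0\<close> by (cases "k = 1") auto
    ultimately show "c \<in> (\<Union>k\<in>{2..n}. {c \<in> {1..n}. k ^ 2 dvd c})" using k(1) c by auto
  qed
  then have "card ({1..n} - squarefree_upto (real n)) \<le> card (\<Union>k\<in>{2..n}. {c \<in> {1..n}. k ^ 2 dvd c})" by (intro card_mono) auto
  also have "\<dots> \<le> (\<Sum>k\<in>{2..n}. card {c \<in> {1..n}. k ^ 2 dvd c})" by (rule card_UN_le) simp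
  also have "\<dots> = (\<Sum>k\<in>{2..n}. n div k ^ 2)" by (intro sum.cong refl card_multiples) auto
  finally have "real (card ({1..n} - squarefree_upto (real n))) \<le> real (\<Sum>k\<in>{2..n}. n div k ^ 2)" by (simp only: of_nat_le_iff)
  also have "\<dots> \<le> (\<Sum>k\<in>{2..n}. real n * (1 / real k ^ 2))"
    unfolding of_nat_sum
  proof (rule sum_mono)
    fix k assume "k \<in> {2..n}"
    have "real (n div k ^ 2) \<le> real n / real (k ^ 2)" by (rule of_nat_div_le_of_nat)
    then show "real (n div k ^ 2) \<le> real n * (1 / real k ^ 2)" by simp
  qed
  also have "\<dots> = real n * (\<Sum>k\<in>{2..n}. 1 / real k ^ 2)" by (simp add: sum_distrib_left)
  also have "\<dots> \<le> real n * (3/4)" by (intro mult_left_mono sum_inverse_squares_le n) auto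
  finally have 1: "real (card ({1..n} - squarefree_upto (real n))) \<le> 3/4 * real n" by simp
  have "n = card {1..n}" by simp
  also have "\<dots> \<le> card (({1..n} - squarefree_upto (real n)) \<union> squarefree_upto (real n))"
    by (intro card_mono) (auto simp: finite_squarefree_upto)
  also have "\<dots> \<le> card ({1..n} - squarefree_upto (real n)) + card (squarefree_upto (real n))" by (rule card_Un_le)
  finally show ?thesis using 1 by linarith
qed

lemma card_coprime_pairs_lower:
  assumes n: "n \<ge> 1"
  shows "real n ^ 2 / 4 \<le> real (card {(a, b). a \<in> {1..n} \<and> b \<in> {1..n} \<and> coprime a b})"
proof -
  let ?C = "{(a, b). a \<in> {1..n} \<and> b \<in> {1..n} \<and> coprime a b}"
  let ?M = "\<lambda>k. {c \<in> {1..n}. k dvd c}"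
  have finC: "finite ?C" by (rule finite_subset[of _ "{1..n} \<times> {1..n}"]) auto
  have "{1..n} \<times> {1..n} - ?C \<subseteq> (\<Union>k\<in>{2..n}. ?M k \<times> ?M k)"
  proof
    fix v assume v: "v \<in> {1..n} \<times> {1..n} - ?C"
    obtain a b where [simp]: "v = (a, b)" by (cases v)
    have "\<not> coprime a b" using v by auto
    then obtain k where k: "k dvd a" "k dvd b" "\<not> is_unit k" by (rule not_coprimeE)
    have "k \<noteq> 0" using k v by auto
    have "k \<le> a" using k(1) v by (intro dvd_imp_le) auto
    then have "k \<le> n" using v by simp
    moreover have "k \<ge> 2" using k(3) \<open>k \<noteq> 0\<close> by (cases "k = 1") auto
    ultimately show "v \<in> (\<Union>k\<in>{2..n}. ?M k \<times> ?M k)" using k v by auto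
  qed
  then have "card ({1..n} \<times> {1..n} - ?C) \<le> card (\<Union>k\<in>{2..n}. ?M k \<times> ?M k)" by (intro card_mono) auto
  also have "\<dots> \<le> (\<Sum>k\<in>{2..n}. card (?M k \<times> ?M k))" by (rule card_UN_le) simp
  also have "\<dots> = (\<Sum>k\<in>{2..n}. (n div k) ^ 2)" 
  proof (rule sum.cong[OF refl])
    fix k assume "k \<in> {2..n}"
    then have "card (?M k) = n div k" by (intro card_multiples) auto
    then show "card (?M k \<times> ?M k) = (n div k) ^ 2" by (simp only: card_cartesian_product power2_eq_square)
  qed
  finally have "real (card ({1..n} \<times> {1..n} - ?C)) \<le> real (\<Sum>k\<in>{2..n}. (n div k) ^ 2)" by (simp only: of_nat_le_iff)
  also have "\<dots> \<le> (\<Sum>k\<in>{2..n}. real n ^ 2 * (1 / real k ^ 2))"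
    unfolding of_nat_sum
  proof (rule sum_mono)
    fix k assume "k \<in> {2..n}"
    have "real ((n div k) ^ 2) \<le> (real n / real k) ^ 2" unfolding of_nat_power by (intro power_mono of_nat_div_le_of_nat) auto
    then show "real ((n div k) ^ 2) \<le> real n ^ 2 * (1 / real k ^ 2)" by (simp add: power_divide)
  qed
  also have "\<dots> = real n ^ 2 * (\<Sum>k\<in>{2..n}. 1 / real k ^ 2)" by (simp add: sum_distrib_left)
  also have "\<dots> \<le> real n ^ 2 * (3/4)" by (intro mult_left_mono sum_inverse_squares_le n) auto
  finally have 1: "real (card ({1..n} \<times> {1..n} - ?C)) \<le> 3/4 * real n ^ 2" by simp
  have "n ^ 2 = card ({1..n} \<times> {1..n})" by (simp add: card_cartesian_product power2_eq_square)
  also have "\<dots> \<le> card (({1..n} \<times> {1..n} - ?C) \<union> ?C)" using finC by (intro card_mono) auto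
  also have "\<dots> \<le> card ({1..n} \<times> {1..n} - ?C) + card ?C" by (rule card_Un_le)
  finally have "real (n ^ 2) \<le> real (card ({1..n} \<times> {1..n} - ?C)) + real (card ?C)" by linarith
  then show ?thesis using 1 by simp
qed

lemma small_box_in_region:
  assumes "\<bar>x\<bar> \<le> \<rho> / 10" "\<bar>y\<bar> \<le> \<rho> / 10"
  shows "(x, y) \<in> region \<rho>"
proof -
  define c where "c = \<rho> / 10"
  have c0: "c \<ge> 0" using assms by (simp add: c_def)
  have xy: "\<bar>x\<bar> \<le> c" "\<bar>y\<bar> \<le> c" using assms by (auto simp: c_def)
  note mono = abs_monomial_le[OF xy]
  have "\<bar>x * y\<bar> \<le> c ^ 2" "\<bar>x ^ 2\<bar> \<le> c ^ 2" "\<bar>y ^ 2\<bar> \<le> c ^ 2"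
    using mono[of 1 1 2] mono[of 2 0 2] mono[of 0 2 2] by simp_all
  note m2 = this[THEN abs_le_D1] this[THEN abs_le_D2]
  have q: "\<bar>q_form x y\<bar> \<le> 63 * c ^ 2" and u: "\<bar>u_form x y\<bar> \<le> 7 * c ^ 2"
    unfolding form_defs mult.assoc using m2 by (intro abs_leI; linarith)+
  have "\<bar>x ^ 4\<bar> \<le> c ^ 4" "\<bar>x ^ 3 * y\<bar> \<le> c ^ 4" "\<bar>x ^ 2 * y ^ 2\<bar> \<le> c ^ 4" "\<bar>x * y ^ 3\<bar> \<le> c ^ 4" "\<bar>y ^ 4\<bar> \<le> c ^ 4"
    using mono[of 4 0 4] mono[of 3 1 4] mono[of 2 2 4] mono[of 1 3 4] mono[of 0 4 4] by simp_all
  note m4 = this[THEN abs_le_D1] this[THEN abs_le_D2]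
  have w: "\<bar>w_form x y\<bar> \<le> 155 * c ^ 4" unfolding w_form_def mult.assoc using m4 by (intro abs_leI; linarith)
  have "\<bar>A_form x y\<bar> = 3 * (\<bar>q_form x y\<bar> * \<bar>u_form x y\<bar>)" by (simp add: A_form_def abs_mult)
  also have "\<dots> \<le> 3 * ((63 * c ^ 2) * (7 * c ^ 2))" using q u by (intro mult_left_mono mult_mono) auto
  finally have "\<bar>A_form x y\<bar> \<le> 1323 * c ^ 4" by (simp flip: power_add)
  then have "4 * \<bar>A_form x y\<bar> ^ 3 \<le> 4 * (1323 * c ^ 4) ^ 3" by (intro mult_left_mono power_mono) auto
  also have "\<dots> = 9262741068 * c ^ 12" by (simp add: power_mult_distrib flip: power_mult)
  also have "\<dots> \<le> 1000000000000 * c ^ 12" by (intro mult_right_mono) auto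
  also have "\<dots> = \<rho> ^ 12" by (simp add: c_def power_divide)
  finally have A: "4 * \<bar>A_form x y\<bar> ^ 3 \<le> \<rho> ^ 12" .
  have "\<bar>B_form x y\<bar> = 2 * (\<bar>q_form x y\<bar> * \<bar>w_form x y\<bar>)" by (simp add: B_form_def abs_mult)
  also have "\<dots> \<le> 2 * ((63 * c ^ 2) * (155 * c ^ 4))" using q w by (intro mult_left_mono mult_mono) auto
  finally have "\<bar>B_form x y\<bar> \<le> 19530 * c ^ 6" by (simp flip: power_add)
  then have "27 * \<bar>B_form x y\<bar> ^ 2 \<le> 27 * (19530 * c ^ 6) ^ 2" by (intro mult_left_mono power_mono) auto
  also have "\<dots> = 10298364300 * c ^ 12" by (simp add: power_mult_distrib flip: power_mult)
  also have "\<dots> \<le> 1000000000000 * c ^ 12" by (intro mult_right_mono) auto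
  also have "\<dots> = \<rho> ^ 12" by (simp add: c_def power_divide)
  finally show ?thesis using A by (simp add: region_def)
qed

text \<open>The defect is at least 1, so the radius is at least sqrt y = 10 n, and that region
  contains the box of size n.\<close>

lemma card_twist_points_lower:
  assumes n: "n \<ge> 1" and y: "y = 100 * real n ^ 2"
  shows "real n ^ 2 / 4 \<le> real (card (twist_points y))"
proof -
  have "y \<ge> 1 * 1" unfolding y using n by (intro mult_mono) (auto simp: one_le_power)
  then have y1: "y \<ge> 1" by simp
  have "(\<lambda>(a, b). (int a, int b)) ` {(a, b). a \<in> {1..n} \<and> b \<in> {1..n} \<and> coprime a b} \<subseteq> twist_points y"
  proof clarify
    fix a b assume ab: "a \<in> {1..n}" "b \<in> {1..n}" "coprime a b"
    have c: "coprime (int a) (int b)" using ab by simp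
    have "1 * y \<le> real (defect (int a) (int b)) * y" using dvd_defect_iff(2)[OF c] y1 by (intro mult_right_mono) auto
    then have "sqrt y \<le> sqrt (real (defect (int a) (int b)) * y)" by simp
    moreover have "sqrt y = 10 * real n" unfolding y by (simp add: real_sqrt_mult real_sqrt_unique[of 10])
    ultimately have "(real a, real b) \<in> region (sqrt (real (defect (int a) (int b)) * y))"
      using ab by (intro small_box_in_region) auto
    then show "(int a, int b) \<in> twist_points y" using c by (simp add: twist_points_def)
  qed
  moreover obtain B :: nat where "real B \<ge> real defect_bound * y" using real_arch_simple by blast
  then have "finite (twist_points y)" by (rule card_twist_points(1)[OF y1])
  ultimately have "card ((\<lambda>(a, b). (int a, int b)) ` {(a, b). a \<in> {1..n} \<and> b \<in> {1..n} \<and> coprime a b}) \<le> card (twist_points y)"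
    by (intro card_mono)
  also have "card ((\<lambda>(a, b). (int a, int b)) ` {(a, b). a \<in> {1..n} \<and> b \<in> {1..n} \<and> coprime a b}) =
     card {(a, b). a \<in> {1..n} \<and> b \<in> {1..n} \<and> coprime a b}"
    by (rule card_image) (auto simp: inj_on_def)
  finally show ?thesis using card_coprime_pairs_lower[OF n] by simp
qed

lemma linear_constant_pos:
  fixes F :: "real \<Rightarrow> real"
  assumes F: "\<And>y. y \<ge> 1 \<Longrightarrow> \<bar>F y - \<kappa> * y\<bar> \<le> C * y powr \<beta>" and \<beta>: "\<beta> < 1" and c: "c > 0"
    and lower: "\<And>N. \<exists>y\<ge>N. y \<ge> 1 \<and> c * y \<le> F y"
  shows "\<kappa> > 0"
proof -
  have "((\<lambda>y::real. C * y powr (\<beta> - 1)) \<longlongrightarrow> C * 0) at_top"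
    using \<beta> by (intro tendsto_mult tendsto_const tendsto_neg_powr filterlim_ident) auto
  then have "eventually (\<lambda>y. C * y powr (\<beta> - 1) < c) at_top" using c by (intro order_tendstoD(2)) auto
  then obtain N where N: "\<And>y. y \<ge> N \<Longrightarrow> C * y powr (\<beta> - 1) < c" by (auto simp: eventually_at_top_linorder)
  obtain y where y: "y \<ge> N" "y \<ge> 1" "c * y \<le> F y" using lower by blast
  have "c * y \<le> \<kappa> * y + C * y powr \<beta>" using F[OF y(2)] y(3) by linarith
  also have "y powr \<beta> = y powr (\<beta> - 1) * y" using y(2) by (simp add: powr_diff)
  finally have "c * y \<le> (\<kappa> + C * y powr (\<beta> - 1)) * y" by (simp add: algebra_simps)
  then have "c \<le> \<kappa> + C * y powr (\<beta> - 1)" using y(2) by simp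
  then show ?thesis using N[OF y(1)] by linarith
qed

section \<open>Partial summation and the hyperbola method\<close>

text \<open>Partial summation, obtained by writing each k^(-s) - b^(-s) as the integral of s
  z^(-s-1) from k to b and exchanging the finite sum with the integral.\<close>

lemma sum_decompose_integral:
  fixes k :: "'i \<Rightarrow> real" and s :: real
  assumes fin: "finite I" and k: "\<And>i. i \<in> I \<Longrightarrow> a \<le> k i \<and> k i \<le> b" and a: "a > 0" and s: "s > 0"
  shows "((\<lambda>z. real (card {i \<in> I. k i \<le> z}) * (s * z powr (- s - 1))) has_integral
     (\<Sum>i\<in>I. k i powr (- s) - b powr (- s))) {a..b}"
proof -
  have one: "((\<lambda>z. if k i \<le> z then s * z powr (- s - 1) else 0) has_integral (k i powr (- s) - b powr (- s))) {a..b}"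
    if i: "i \<in> I" for i
  proof -
    have ki: "a \<le> k i" "k i \<le> b" "k i > 0" using k[OF i] a by auto
    have "((\<lambda>z. s * z powr (- s - 1)) has_integral (- (b powr (- s)) - - (k i powr (- s)))) {k i..b}"
    proof (rule fundamental_theorem_of_calculus[OF ki(2)])
      fix z assume z: "z \<in> {k i..b}"
      then have "z > 0" using ki by simp
      then have "((\<lambda>z. - (z powr (- s))) has_real_derivative - (- s * z powr (- s - 1))) (at z within {k i..b})"
        by (auto intro!: derivative_eq_intros)
      then show "((\<lambda>z. - (z powr (- s))) has_vector_derivative s * z powr (- s - 1)) (at z within {k i..b})"
        by (simp add: has_real_derivative_iff_has_vector_derivative)
    qed
    then have "((\<lambda>z. s * z powr (- s - 1)) has_integral (k i powr (- s) - b powr (- s))) {k i..b}" by simp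
    then have "((\<lambda>z. if z \<in> {k i..b} then s * z powr (- s - 1) else 0) has_integral (k i powr (- s) - b powr (- s))) {k i..b}"
      by (rule has_integral_eq[rotated]) simp
    then have "((\<lambda>z. if z \<in> {k i..b} then s * z powr (- s - 1) else 0) has_integral (k i powr (- s) - b powr (- s))) {a..b}"
      by (rule has_integral_on_superset) (use ki in auto)
    then show ?thesis by (rule has_integral_eq[rotated]) auto
  qed
  have "((\<lambda>z. \<Sum>i\<in>I. if k i \<le> z then s * z powr (- s - 1) else 0) has_integral (\<Sum>i\<in>I. k i powr (- s) - b powr (- s))) {a..b}"
    by (rule has_integral_sum[OF fin one])
  then show ?thesis
  proof (rule has_integral_eq[rotated])
    fix z
    have "(\<Sum>i\<in>I. if k i \<le> z then s * z powr (- s - 1) else 0) = (\<Sum>i\<in>{i\<in>I. k i \<le> z}. s * z powr (- s - 1))"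
      by (rule sum.inter_filter[OF fin, symmetric])
    then show "(\<Sum>i\<in>I. if k i \<le> z then s * z powr (- s - 1) else 0) = real (card {i \<in> I. k i \<le> z}) * (s * z powr (- s - 1))" by simp
  qed
qed

text \<open>Weighted index sets rather than sequences: the weights of the twist classes are sixth
  roots of heights, so they need not be integers and may repeat.\<close>

locale linear_growth =
  fixes I :: "'i set" and k :: "'i \<Rightarrow> real" and \<kappa> C \<beta> :: real
  assumes k_ge: "\<And>i. i \<in> I \<Longrightarrow> k i \<ge> 1"
    and finite_le: "\<And>z. finite {i \<in> I. k i \<le> z}"
    and growth: "\<And>z. z \<ge> 1 \<Longrightarrow> \<bar>real (card {i \<in> I. k i \<le> z}) - \<kappa> * z\<bar> \<le> C * z powr \<beta>"
    and \<beta>: "0 < \<beta>" "\<beta> < 1" and C: "C \<ge> 0"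
begin

definition upto :: "real \<Rightarrow> 'i set" where "upto z = {i \<in> I. k i \<le> z}"

lemma finite_upto: "finite (upto z)" by (simp add: upto_def finite_le)

lemma upto_le: "real (card (upto z)) \<le> (\<bar>\<kappa>\<bar> + C) * z" if "z \<ge> 1"
proof -
  have "z powr \<beta> \<le> z powr 1" using that \<beta> by (intro powr_mono) auto
  then have "C * z powr \<beta> \<le> C * z" using C that by (intro mult_left_mono) auto
  moreover have "\<kappa> * z \<le> \<bar>\<kappa>\<bar> * z" using that by (intro mult_right_mono) auto
  moreover have "real (card (upto z)) \<le> \<kappa> * z + C * z powr \<beta>" using growth[OF that] unfolding upto_def by linarith
  ultimately show ?thesis by (simp add: algebra_simps)
qed

lemma sum_powr_le:
  assumes s: "0 < s" "s < 1"
  obtains K where "K \<ge> 0" "\<And>z. z \<ge> 1 \<Longrightarrow> (\<Sum>i\<in>upto z. k i powr (- s)) \<le> K * z powr (1 - s)"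
proof -
  define c where "c = \<bar>\<kappa>\<bar> + C"
  have c: "c \<ge> 0" using C by (simp add: c_def)
  have "(\<Sum>i\<in>upto z. k i powr (- s)) \<le> (c + c * s / (1 - s)) * z powr (1 - s)" if z: "z \<ge> 1" for z
  proof -
    have h1: "((\<lambda>t. real (card {i \<in> upto z. k i \<le> t}) * (s * t powr (- s - 1))) has_integral
     (\<Sum>i\<in>upto z. k i powr (- s) - z powr (- s))) {1..z}"
      by (rule sum_decompose_integral) (use s k_ge finite_upto in \<open>auto simp: upto_def\<close>)
    have h2: "((\<lambda>t. c * s * t powr (- s)) has_integral (c * s / (1 - s) * z powr (1 - s) - c * s / (1 - s) * 1 powr (1 - s))) {1..z}"
    proof (rule fundamental_theorem_of_calculus[OF z])
      fix t assume t: "t \<in> {1..z}"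
      then have "((\<lambda>t. c * s / (1 - s) * t powr (1 - s)) has_real_derivative c * s / (1 - s) * ((1 - s) * t powr (1 - s - 1))) (at t within {1..z})"
        by (auto intro!: derivative_eq_intros)
      then show "((\<lambda>t. c * s / (1 - s) * t powr (1 - s)) has_vector_derivative c * s * t powr (- s)) (at t within {1..z})"
        using s by (simp add: has_real_derivative_iff_has_vector_derivative mult.assoc)
    qed
    have "(\<Sum>i\<in>upto z. k i powr (- s) - z powr (- s)) \<le> c * s / (1 - s) * z powr (1 - s) - c * s / (1 - s) * 1 powr (1 - s)"
    proof (rule has_integral_le[OF h1 h2])
      fix t assume t: "t \<in> {1..z}"
      have "{i \<in> upto z. k i \<le> t} \<subseteq> upto t" by (auto simp: upto_def)
      then have "card {i \<in> upto z. k i \<le> t} \<le> card (upto t)" by (intro card_mono finite_upto)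
      then have "real (card {i \<in> upto z. k i \<le> t}) \<le> c * t" using upto_le[of t] t unfolding c_def by simp
      then have "real (card {i \<in> upto z. k i \<le> t}) * (s * t powr (- s - 1)) \<le> (c * t) * (s * t powr (- s - 1))"
        using s by (intro mult_right_mono) auto
      also have "\<dots> = c * s * (t powr 1 * t powr (- s - 1))" using t by simp
      also have "t powr 1 * t powr (- s - 1) = t powr (- s)" by (subst powr_add[symmetric]) simp
      finally show "real (card {i \<in> upto z. k i \<le> t}) * (s * t powr (- s - 1)) \<le> c * s * t powr (- s)" .
    qed
    also have "\<dots> \<le> c * s / (1 - s) * z powr (1 - s)" using c s by simp
    finally have "(\<Sum>i\<in>upto z. k i powr (- s)) \<le> c * s / (1 - s) * z powr (1 - s) + real (card (upto z)) * z powr (- s)"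
      by (simp add: sum_subtractf)
    also have "real (card (upto z)) * z powr (- s) \<le> (c * z powr 1) * z powr (- s)"
      using upto_le[OF z] z unfolding c_def by (intro mult_right_mono) auto
    also have "\<dots> = c * z powr (1 - s)" using z by (simp add: powr_diff powr_minus_divide)
    finally show ?thesis by (simp add: algebra_simps)
  qed
  then show ?thesis using that[of "c + c * s / (1 - s)"] c s by auto
qed

text \<open>The number \<gamma> is the analogue of Euler's constant. Partial summation on (z, w]
  bounds the oscillation of the sum minus \<kappa> ln by K z^(\<beta> - 1), which yields both the
  limit and the rate.\<close>

lemma sum_inverse_asymp:
  obtains \<gamma> K where "K \<ge> 0" "\<And>z. z \<ge> 1 \<Longrightarrow> \<bar>(\<Sum>i\<in>upto z. 1 / k i) - (\<kappa> * ln z + \<gamma>)\<bar> \<le> K * z powr (\<beta> - 1)"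
proof -
  define F where "F = (\<lambda>z. (\<Sum>i\<in>upto z. 1 / k i) - \<kappa> * ln z)"
  define K where "K = C / (1 - \<beta>) + 2 * C"
  have K0: "K \<ge> 0" using C \<beta> by (simp add: K_def)
  have osc: "\<bar>F w - F z\<bar> \<le> K * z powr (\<beta> - 1)" if z: "1 \<le> z" "z \<le> w" for z w
  proof -
    have w: "w \<ge> 1" using z by simp
    define J where "J = upto w - upto z"
    have finJ: "finite J" by (simp add: J_def finite_upto)
    have sub: "upto z \<subseteq> upto w" using z by (auto simp: upto_def)
    have "J = {i \<in> I. z < k i \<and> k i \<le> w}" by (auto simp: J_def upto_def)
    then have kJ: "z \<le> k i \<and> k i \<le> w" if "i \<in> J" for i using that by auto
    have h1: "((\<lambda>t. real (card {i \<in> J. k i \<le> t}) * (1 * t powr (- 1 - 1))) has_integral (\<Sum>i\<in>J. k i powr (- 1) - w powr (- 1))) {z..w}"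
      by (rule sum_decompose_integral) (use finJ kJ z in auto)
    define n where "n = real (card (upto z))"
    have cJ: "real (card {i \<in> J. k i \<le> t}) = real (card (upto t)) - n" if t: "t \<in> {z..w}" for t
    proof -
      have "{i \<in> J. k i \<le> t} = upto t - upto z" using t by (auto simp: J_def upto_def)
      moreover have "upto z \<subseteq> upto t" using t by (auto simp: upto_def)
      ultimately show ?thesis unfolding n_def using card_Diff_subset[of "upto z" "upto t"] card_mono[of "upto t" "upto z"]
        by (simp add: finite_upto of_nat_diff)
    qed
    \<comment> \<open>The comparison integral replaces the count on (z, t] by \<kappa> t - n, where
      n is the exact count up to z; only the deviation at t then remains in the integrand.\<close>
    have h2: "((\<lambda>t. \<kappa> * t powr (- 1) - n * t powr (- 2)) has_integral ((\<kappa> * ln w + n / w) - (\<kappa> * ln z + n / z))) {z..w}"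
    proof (rule fundamental_theorem_of_calculus[OF z(2)])
      fix t assume t: "t \<in> {z..w}"
      then have t0: "t > 0" using z by simp
      then have "((\<lambda>t. \<kappa> * ln t + n / t) has_real_derivative \<kappa> * (1 / t) - n / t ^ 2) (at t within {z..w})"
        by (auto intro!: derivative_eq_intros simp: power2_eq_square)
      moreover have "\<kappa> * (1 / t) - n / t ^ 2 = \<kappa> * t powr (- 1) - n * t powr (- 2)"
        using t0 by (simp add: powr_minus_divide powr_numeral)
      ultimately show "((\<lambda>t. \<kappa> * ln t + n / t) has_vector_derivative \<kappa> * t powr (- 1) - n * t powr (- 2)) (at t within {z..w})"
        by (simp add: has_real_derivative_iff_has_vector_derivative)
    qed
    have h3: "((\<lambda>t. C * t powr (\<beta> - 2)) has_integral (C / (\<beta> - 1) * w powr (\<beta> - 1) - C / (\<beta> - 1) * z powr (\<beta> - 1))) {z..w}"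
    proof (rule fundamental_theorem_of_calculus[OF z(2)])
      fix t assume t: "t \<in> {z..w}"
      then have "((\<lambda>t. C / (\<beta> - 1) * t powr (\<beta> - 1)) has_real_derivative C / (\<beta> - 1) * ((\<beta> - 1) * t powr (\<beta> - 1 - 1))) (at t within {z..w})"
        using z by (auto intro!: derivative_eq_intros)
      then show "((\<lambda>t. C / (\<beta> - 1) * t powr (\<beta> - 1)) has_vector_derivative C * t powr (\<beta> - 2)) (at t within {z..w})"
        using \<beta> by (simp add: has_real_derivative_iff_has_vector_derivative)
    qed
    define D where "D = (\<Sum>i\<in>J. k i powr (- 1) - w powr (- 1)) - ((\<kappa> * ln w + n / w) - (\<kappa> * ln z + n / z))"
    have h4: "((\<lambda>t. real (card {i \<in> J. k i \<le> t}) * (1 * t powr (- 1 - 1)) - (\<kappa> * t powr (- 1) - n * t powr (- 2))) has_integral D) {z..w}"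
      unfolding D_def by (rule has_integral_diff[OF h1 h2])
    have ptw: "\<bar>real (card {i \<in> J. k i \<le> t}) * (1 * t powr (- 1 - 1)) - (\<kappa> * t powr (- 1) - n * t powr (- 2))\<bar> \<le> C * t powr (\<beta> - 2)"
      if t: "t \<in> {z..w}" for t
    proof -
      have t1: "t \<ge> 1" using t z by simp
      have e1: "t powr (- 1) = t * t powr (- 2)" using t1 by (simp add: powr_minus_divide powr_numeral power2_eq_square)
      have "real (card {i \<in> J. k i \<le> t}) * (1 * t powr (- 1 - 1)) - (\<kappa> * t powr (- 1) - n * t powr (- 2)) =
         (real (card (upto t)) - \<kappa> * t) * t powr (- 2)" unfolding cJ[OF t] e1 by (simp add: algebra_simps)
      also have "\<bar>\<dots>\<bar> \<le> (C * t powr \<beta>) * t powr (- 2)"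
        unfolding abs_mult using growth[OF t1] by (intro mult_mono) (auto simp: upto_def)
      also have "\<dots> = C * (t powr \<beta> * t powr (- 2))" by (simp only: mult.assoc)
      also have "t powr \<beta> * t powr (- 2) = t powr (\<beta> - 2)" by (subst powr_add[symmetric]) simp
      finally show ?thesis .
    qed
    have "D \<le> C / (\<beta> - 1) * w powr (\<beta> - 1) - C / (\<beta> - 1) * z powr (\<beta> - 1)"
      by (rule has_integral_le[OF h4 h3]) (use ptw in \<open>auto simp: abs_le_iff\<close>)
    moreover have "- D \<le> C / (\<beta> - 1) * w powr (\<beta> - 1) - C / (\<beta> - 1) * z powr (\<beta> - 1)"
      by (rule has_integral_le[OF has_integral_neg[OF h4] h3]) (use ptw in \<open>auto simp: abs_le_iff\<close>)
    moreover have "C / (\<beta> - 1) * w powr (\<beta> - 1) \<le> 0" using C \<beta> by (intro mult_nonpos_nonneg) (auto simp: divide_le_0_iff)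
    moreover have "C / (\<beta> - 1) = - (C / (1 - \<beta>))" by (metis minus_diff_eq minus_divide_right)
    ultimately have D: "\<bar>D\<bar> \<le> C / (1 - \<beta>) * z powr (\<beta> - 1)" by (simp add: abs_le_iff)
    have "F w - F z = (\<Sum>i\<in>J. 1 / k i) - \<kappa> * ln w + \<kappa> * ln z"
      unfolding F_def J_def using sum.subset_diff[OF sub finite_upto, of "\<lambda>i. 1 / k i"] by simp
    moreover have "(\<Sum>i\<in>J. k i powr (- 1) - w powr (- 1)) = (\<Sum>i\<in>J. 1 / k i) - (real (card (upto w)) - n) / w"
    proof -
      have "{i \<in> J. k i \<le> w} = J" using kJ by auto
      then have "real (card J) = real (card (upto w)) - n" using cJ[of w] z by simp
      moreover have "(\<Sum>i\<in>J. k i powr (- 1)) = (\<Sum>i\<in>J. 1 / k i)"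
        by (rule sum.cong[OF refl]) (use kJ z in \<open>force simp: powr_minus_divide\<close>)
      ultimately show ?thesis using w by (simp add: sum_subtractf powr_minus_divide)
    qed
    ultimately have "F w - F z = D + (real (card (upto w)) / w - n / z)"
      unfolding D_def using w by (simp add: diff_divide_distrib)
    also have "\<bar>\<dots>\<bar> \<le> C / (1 - \<beta>) * z powr (\<beta> - 1) + 2 * C * z powr (\<beta> - 1)"
    proof -
      have dev: "\<bar>real (card (upto t)) / t - \<kappa>\<bar> \<le> C * z powr (\<beta> - 1)" if "z \<le> t" for t
      proof -
        have t1: "t \<ge> 1" using that z by simp
        have "real (card (upto t)) / t - \<kappa> = (real (card (upto t)) - \<kappa> * t) / t" using t1 by (simp add: diff_divide_distrib)
        also have "\<bar>\<dots>\<bar> \<le> (C * t powr \<beta>) / t"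
          unfolding abs_divide using growth[OF t1] t1 by (simp add: upto_def divide_right_mono)
        also have "\<dots> = C * t powr (\<beta> - 1)" using t1 by (simp add: powr_diff)
        also have "\<dots> \<le> C * z powr (\<beta> - 1)" using C z that \<beta> by (intro mult_left_mono powr_mono2') auto
        finally show ?thesis .
      qed
      show ?thesis using D dev[of w] dev[of z] z(2) unfolding n_def by linarith
    qed
    finally show ?thesis by (simp add: K_def algebra_simps)
  qed
  have lim0: "((\<lambda>y::real. K * y powr (\<beta> - 1)) \<longlongrightarrow> 0) at_top"
  proof -
    have "((\<lambda>y::real. K * y powr (\<beta> - 1)) \<longlongrightarrow> K * 0) at_top"
      using \<beta> by (intro tendsto_mult tendsto_const tendsto_neg_powr filterlim_ident) auto
    then show ?thesis by simp
  qed
  have "Cauchy (\<lambda>n::nat. F (real n))"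
  proof (rule metric_CauchyI)
    fix \<epsilon> :: real assume \<epsilon>: "\<epsilon> > 0"
    have "eventually (\<lambda>y. K * y powr (\<beta> - 1) < \<epsilon> / 2) at_top" using lim0 \<epsilon> by (intro order_tendstoD(2)) auto
    then obtain N where N: "\<And>y. y \<ge> N \<Longrightarrow> K * y powr (\<beta> - 1) < \<epsilon> / 2" by (auto simp: eventually_at_top_linorder)
    define M where "M = max 1 (nat \<lceil>N\<rceil>)"
    have M: "real M \<ge> 1" "real M \<ge> N" unfolding M_def by linarith+
    have "dist (F (real m)) (F (real n)) < \<epsilon>" if "m \<ge> M" "n \<ge> M" for m n
      using osc[of "real M" "real m"] osc[of "real M" "real n"] N[OF M(2)] M(1) that by (simp add: dist_real_def)
    then show "\<exists>M. \<forall>m\<ge>M. \<forall>n\<ge>M. dist (F (real m)) (F (real n)) < \<epsilon>" by blast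
  qed
  then obtain \<gamma> where \<gamma>: "(\<lambda>n::nat. F (real n)) \<longlonglongrightarrow> \<gamma>" using Cauchy_convergent_iff convergent_def by blast
  have "\<bar>(\<Sum>i\<in>upto z. 1 / k i) - (\<kappa> * ln z + \<gamma>)\<bar> \<le> K * z powr (\<beta> - 1)" if z: "z \<ge> 1" for z
  proof -
    have "\<bar>\<gamma> - F z\<bar> \<le> K * z powr (\<beta> - 1)"
    proof (rule LIMSEQ_le_const2)
      show "(\<lambda>n. \<bar>F (real n) - F z\<bar>) \<longlonglongrightarrow> \<bar>\<gamma> - F z\<bar>" by (intro tendsto_intros \<gamma>)
      have "\<bar>F (real n) - F z\<bar> \<le> K * z powr (\<beta> - 1)" if "n \<ge> nat \<lceil>z\<rceil>" for n
        using osc[OF z, of "real n"] that by linarith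
      then show "\<exists>N. \<forall>n\<ge>N. \<bar>F (real n) - F z\<bar> \<le> K * z powr (\<beta> - 1)" by blast
    qed
    then show ?thesis unfolding F_def by (simp add: abs_minus_commute algebra_simps)
  qed
  then show ?thesis using that K0 by blast
qed

end

text \<open>Pairs with l j \<le> y and pairs with k i \<le> Z, where y Z = Y, cover everything and
  overlap in a product set. With y = Y^(1/4) the terms governed by the exponent 3/5, namely Y
  y^(-2/5), Y^(3/5) Z^(2/5) and Z y^(3/5), all equal Y^(9/10). Those governed by 17/20 stay at or
  below Y^(71/80).\<close>

lemma hyperbola_method:
  fixes k :: "'i \<Rightarrow> real" and l :: "'j \<Rightarrow> real"
  assumes "linear_growth I k \<kappa> C (17/20)" and "linear_growth J l \<theta> D (3/5)"
  obtains c K where "K \<ge> 0" "\<And>Y. Y \<ge> 1 \<Longrightarrow> finite {(i, j) \<in> I \<times> J. k i * l j \<le> Y} \<and>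
    \<bar>real (card {(i, j) \<in> I \<times> J. k i * l j \<le> Y}) - (\<kappa> * \<theta> * Y * ln Y + c * Y)\<bar> \<le> K * Y powr (9/10)"
proof -
  interpret V: linear_growth I k \<kappa> C "17/20" by fact
  interpret Q: linear_growth J l \<theta> D "3/5" by fact
  obtain K1 where K1: "K1 \<ge> 0" "\<And>z. z \<ge> 1 \<Longrightarrow> (\<Sum>j\<in>Q.upto z. l j powr (- (17/20))) \<le> K1 * z powr (1 - 17/20)"
    by (rule Q.sum_powr_le[of "17/20"]) auto
  obtain K2 where K2: "K2 \<ge> 0" "\<And>z. z \<ge> 1 \<Longrightarrow> (\<Sum>i\<in>V.upto z. k i powr (- (3/5))) \<le> K2 * z powr (1 - 3/5)"
    by (rule V.sum_powr_le[of "3/5"]) auto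
  obtain gJ K3 where K3: "K3 \<ge> 0" "\<And>z. z \<ge> 1 \<Longrightarrow> \<bar>(\<Sum>j\<in>Q.upto z. 1 / l j) - (\<theta> * ln z + gJ)\<bar> \<le> K3 * z powr (3/5 - 1)"
    by (rule Q.sum_inverse_asymp) blast
  obtain gI K4 where K4: "K4 \<ge> 0" "\<And>z. z \<ge> 1 \<Longrightarrow> \<bar>(\<Sum>i\<in>V.upto z. 1 / k i) - (\<kappa> * ln z + gI)\<bar> \<le> K4 * z powr (17/20 - 1)"
    by (rule V.sum_inverse_asymp) blast
  \<comment> \<open>The last summand is the main term of the overlap, which inclusion-exclusion
    subtracts.\<close>
  define c where "c = \<kappa> * gJ + \<theta> * gI - \<kappa> * \<theta>"
  define K where "K = C * K1 + \<bar>\<kappa>\<bar> * K3 + D * K2 + \<bar>\<theta>\<bar> * K4 + (\<bar>\<kappa>\<bar> * D + \<bar>\<theta>\<bar> * C + C * D)"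
  have K0: "K \<ge> 0" unfolding K_def using K1(1) K2(1) K3(1) K4(1) V.C Q.C
    by (intro add_nonneg_nonneg mult_nonneg_nonneg) auto
  have "finite {(i, j) \<in> I \<times> J. k i * l j \<le> Y} \<and>
    \<bar>real (card {(i, j) \<in> I \<times> J. k i * l j \<le> Y}) - (\<kappa> * \<theta> * Y * ln Y + c * Y)\<bar> \<le> K * Y powr (9/10)" if Y: "Y \<ge> 1" for Y
  proof -
    define y where "y = Y powr (1/4)"
    define Z where "Z = Y powr (3/4)"
    have yZ: "y * Z = Y" unfolding y_def Z_def using Y by (subst powr_add[symmetric]) simp
    have y1: "y \<ge> 1" and Z1: "Z \<ge> 1" unfolding y_def Z_def using Y by (auto intro: ge_one_powr_ge_zero)
    have py: "y powr a = Y powr (a / 4)" and pZ: "Z powr a = Y powr (3 * a / 4)" for a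
      unfolding y_def Z_def by (simp_all add: powr_powr)
    have le9: "Y powr a \<le> Y powr (9/10)" if "a \<le> 9/10" for a using Y that by (rule powr_mono[rotated])
    define A where "A = (SIGMA j:Q.upto y. V.upto (Y / l j))"
    define B where "B = (SIGMA i:V.upto Z. Q.upto (Y / k i))"
    have finA: "finite A" unfolding A_def by (intro finite_SigmaI V.finite_upto Q.finite_upto)
    have finB: "finite B" unfolding B_def by (intro finite_SigmaI V.finite_upto Q.finite_upto)
    have div1: "k i * l j \<le> Y \<longleftrightarrow> k i \<le> Y / l j" "k i * l j \<le> Y \<longleftrightarrow> l j \<le> Y / k i" if "i \<in> I" "j \<in> J" for i j
      using V.k_ge[OF that(1)] Q.k_ge[OF that(2)] by (auto simp: le_divide_eq mult.commute)
    let ?P = "{(i, j) \<in> I \<times> J. k i * l j \<le> Y}"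
    have PU: "?P = prod.swap ` A \<union> B"
    proof (intro equalityI subsetI)
      fix v assume v: "v \<in> ?P"
      obtain i j where ij: "v = (i, j)" "i \<in> I" "j \<in> J" "k i * l j \<le> Y" using v by auto
      have "l j \<le> y \<or> k i \<le> Z"
      proof (rule ccontr)
        assume "\<not> (l j \<le> y \<or> k i \<le> Z)"
        then have "Z * y < k i * l j" using y1 Z1 by (intro mult_strict_mono) auto
        then show False using ij(4) yZ by (simp add: mult.commute)
      qed
      then show "v \<in> prod.swap ` A \<union> B"
      proof
        assume "l j \<le> y"
        then have "(j, i) \<in> A" using ij div1(1)[OF ij(2,3)] by (auto simp: A_def V.upto_def Q.upto_def)
        then show ?thesis using ij(1) by force
      next
        assume "k i \<le> Z"
        then show ?thesis using ij div1(2)[OF ij(2,3)] by (auto simp: B_def V.upto_def Q.upto_def)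
      qed
    next
      fix v assume "v \<in> prod.swap ` A \<union> B"
      then show "v \<in> ?P" using div1 by (auto simp: A_def B_def V.upto_def Q.upto_def)
    qed
    have PI: "prod.swap ` A \<inter> B = V.upto Z \<times> Q.upto y"
    proof (intro equalityI subsetI)
      fix v assume "v \<in> prod.swap ` A \<inter> B"
      then show "v \<in> V.upto Z \<times> Q.upto y" by (auto simp: A_def B_def)
    next
      fix v assume "v \<in> V.upto Z \<times> Q.upto y"
      then obtain i j where ij: "v = (i, j)" "i \<in> I" "k i \<le> Z" "j \<in> J" "l j \<le> y" by (auto simp: V.upto_def Q.upto_def)
      have "k i * l j \<le> Z * y" using ij V.k_ge[OF ij(2)] Q.k_ge[OF ij(4)] Z1 by (intro mult_mono) auto
      then have "k i * l j \<le> Y" using yZ by (simp add: mult.commute)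
      then have "(j, i) \<in> A" "(i, j) \<in> B" using ij div1[OF ij(2,4)] by (auto simp: A_def B_def V.upto_def Q.upto_def)
      then show "v \<in> prod.swap ` A \<inter> B" using ij(1) by force
    qed
    have finP: "finite ?P" unfolding PU using finA finB by simp
    have cA: "card (prod.swap ` A) = card A" by (rule card_image) (auto simp: inj_on_def)
    have "card (prod.swap ` A) + card B = card ?P + card (V.upto Z \<times> Q.upto y)"
      unfolding PU PI[symmetric] by (rule card_Un_Int) (use finA finB in auto)
    then have "real (card A) + real (card B) = real (card ?P) + real (card (V.upto Z)) * real (card (Q.upto y))"
      unfolding cA card_cartesian_product by (simp flip: of_nat_add of_nat_mult)
    then have cP: "real (card ?P) = real (card A) + real (card B) - real (card (V.upto Z)) * real (card (Q.upto y))" by simp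
    have sA: "\<bar>real (card A) - (\<kappa> * Y * (\<theta> * ln y + gJ))\<bar> \<le> (C * K1 + \<bar>\<kappa>\<bar> * K3) * Y powr (9/10)"
    proof -
      have "real (card A) = (\<Sum>j\<in>Q.upto y. real (card (V.upto (Y / l j))))"
        unfolding A_def using V.finite_upto by (subst card_SigmaI) (auto simp: Q.finite_upto)
      then have "real (card A) - \<kappa> * Y * (\<Sum>j\<in>Q.upto y. 1 / l j) = (\<Sum>j\<in>Q.upto y. real (card (V.upto (Y / l j))) - \<kappa> * (Y / l j))"
        by (simp add: sum_subtractf sum_distrib_left)
      also have "\<bar>\<dots>\<bar> \<le> (\<Sum>j\<in>Q.upto y. C * Y powr (17/20) * l j powr (- (17/20)))"
      proof (rule order_trans[OF sum_abs], rule sum_mono)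
        fix j assume j: "j \<in> Q.upto y"
        have l: "l j \<ge> 1" "l j \<le> y" using j Q.k_ge by (auto simp: Q.upto_def)
        have "Z * l j \<le> Z * y" using l Z1 by (intro mult_left_mono) auto
        then have "Z \<le> Y / l j" using l yZ by (simp add: le_divide_eq mult.commute)
        then have "\<bar>real (card (V.upto (Y / l j))) - \<kappa> * (Y / l j)\<bar> \<le> C * (Y / l j) powr (17/20)"
          using V.growth[of "Y / l j"] Z1 unfolding V.upto_def by simp
        also have "(Y / l j) powr (17/20) = Y powr (17/20) * l j powr (- (17/20))"
          using Y l by (simp add: powr_divide powr_minus_divide)
        finally show "\<bar>real (card (V.upto (Y / l j))) - \<kappa> * (Y / l j)\<bar> \<le> C * Y powr (17/20) * l j powr (- (17/20))"
          by (simp add: mult.assoc)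
      qed
      also have "\<dots> = C * Y powr (17/20) * (\<Sum>j\<in>Q.upto y. l j powr (- (17/20)))" by (simp add: sum_distrib_left)
      also have "\<dots> \<le> C * Y powr (17/20) * (K1 * y powr (1 - 17/20))"
        using K1(2)[OF y1] V.C by (intro mult_left_mono) auto
      also have "\<dots> = C * K1 * (Y powr (17/20) * Y powr (3/80))" by (simp add: py mult_ac)
      also have "Y powr (17/20) * Y powr (3/80) = Y powr (71/80)" by (subst powr_add[symmetric]) simp
      also have "C * K1 * Y powr (71/80) \<le> C * K1 * Y powr (9/10)"
        using V.C K1(1) by (intro mult_left_mono le9) auto
      finally have 1: "\<bar>real (card A) - \<kappa> * Y * (\<Sum>j\<in>Q.upto y. 1 / l j)\<bar> \<le> C * K1 * Y powr (9/10)" .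
      have "\<bar>\<kappa> * Y * (\<Sum>j\<in>Q.upto y. 1 / l j) - \<kappa> * Y * (\<theta> * ln y + gJ)\<bar> = \<bar>\<kappa>\<bar> * Y * \<bar>(\<Sum>j\<in>Q.upto y. 1 / l j) - (\<theta> * ln y + gJ)\<bar>"
        using Y by (simp add: abs_mult flip: right_diff_distrib)
      also have "\<dots> \<le> \<bar>\<kappa>\<bar> * Y * (K3 * y powr (3/5 - 1))"
        using K3(2)[OF y1] Y by (intro mult_left_mono) auto
      also have "\<dots> = \<bar>\<kappa>\<bar> * K3 * (Y powr 1 * Y powr (- 1/10))" using Y by (simp add: py mult_ac)
      also have "Y powr 1 * Y powr (- 1/10) = Y powr (9/10)" by (subst powr_add[symmetric]) simp
      finally show ?thesis using 1 unfolding distrib_right by linarith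
    qed
    have sB: "\<bar>real (card B) - (\<theta> * Y * (\<kappa> * ln Z + gI))\<bar> \<le> (D * K2 + \<bar>\<theta>\<bar> * K4) * Y powr (9/10)"
    proof -
      have "real (card B) = (\<Sum>i\<in>V.upto Z. real (card (Q.upto (Y / k i))))"
        unfolding B_def using Q.finite_upto by (subst card_SigmaI) (auto simp: V.finite_upto)
      then have "real (card B) - \<theta> * Y * (\<Sum>i\<in>V.upto Z. 1 / k i) = (\<Sum>i\<in>V.upto Z. real (card (Q.upto (Y / k i))) - \<theta> * (Y / k i))"
        by (simp add: sum_subtractf sum_distrib_left)
      also have "\<bar>\<dots>\<bar> \<le> (\<Sum>i\<in>V.upto Z. D * Y powr (3/5) * k i powr (- (3/5)))"
      proof (rule order_trans[OF sum_abs], rule sum_mono)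
        fix i assume i: "i \<in> V.upto Z"
        have k: "k i \<ge> 1" "k i \<le> Z" using i V.k_ge by (auto simp: V.upto_def)
        have "y * k i \<le> y * Z" using k y1 by (intro mult_left_mono) auto
        then have "y \<le> Y / k i" using k yZ by (simp add: le_divide_eq)
        then have "\<bar>real (card (Q.upto (Y / k i))) - \<theta> * (Y / k i)\<bar> \<le> D * (Y / k i) powr (3/5)"
          using Q.growth[of "Y / k i"] y1 unfolding Q.upto_def by simp
        also have "(Y / k i) powr (3/5) = Y powr (3/5) * k i powr (- (3/5))"
          using Y k by (simp add: powr_divide powr_minus_divide)
        finally show "\<bar>real (card (Q.upto (Y / k i))) - \<theta> * (Y / k i)\<bar> \<le> D * Y powr (3/5) * k i powr (- (3/5))"
          by (simp add: mult.assoc)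
      qed
      also have "\<dots> = D * Y powr (3/5) * (\<Sum>i\<in>V.upto Z. k i powr (- (3/5)))" by (simp add: sum_distrib_left)
      also have "\<dots> \<le> D * Y powr (3/5) * (K2 * Z powr (1 - 3/5))"
        using K2(2)[OF Z1] Q.C by (intro mult_left_mono) auto
      also have "\<dots> = D * K2 * (Y powr (3/5) * Y powr (3/10))" by (simp add: pZ mult_ac)
      also have "Y powr (3/5) * Y powr (3/10) = Y powr (9/10)" by (subst powr_add[symmetric]) simp
      finally have 1: "\<bar>real (card B) - \<theta> * Y * (\<Sum>i\<in>V.upto Z. 1 / k i)\<bar> \<le> D * K2 * Y powr (9/10)" .
      have "\<bar>\<theta> * Y * (\<Sum>i\<in>V.upto Z. 1 / k i) - \<theta> * Y * (\<kappa> * ln Z + gI)\<bar> = \<bar>\<theta>\<bar> * Y * \<bar>(\<Sum>i\<in>V.upto Z. 1 / k i) - (\<kappa> * ln Z + gI)\<bar>"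
        using Y by (simp add: abs_mult flip: right_diff_distrib)
      also have "\<dots> \<le> \<bar>\<theta>\<bar> * Y * (K4 * Z powr (17/20 - 1))"
        using K4(2)[OF Z1] Y by (intro mult_left_mono) auto
      also have "\<dots> = \<bar>\<theta>\<bar> * K4 * (Y powr 1 * Y powr (- 9/80))" using Y by (simp add: pZ mult_ac)
      also have "Y powr 1 * Y powr (- 9/80) = Y powr (71/80)" by (subst powr_add[symmetric]) simp
      also have "\<bar>\<theta>\<bar> * K4 * Y powr (71/80) \<le> \<bar>\<theta>\<bar> * K4 * Y powr (9/10)"
        using K4(1) by (intro mult_left_mono le9) auto
      finally show ?thesis using 1 unfolding distrib_right by linarith
    qed
    have sC: "\<bar>real (card (V.upto Z)) * real (card (Q.upto y)) - \<kappa> * \<theta> * Y\<bar> \<le> (\<bar>\<kappa>\<bar> * D + \<bar>\<theta>\<bar> * C + C * D) * Y powr (9/10)"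
    proof -
      define a where "a = real (card (V.upto Z)) - \<kappa> * Z"
      define b where "b = real (card (Q.upto y)) - \<theta> * y"
      have a: "\<bar>a\<bar> \<le> C * Z powr (17/20)" using V.growth[OF Z1] by (simp add: a_def V.upto_def)
      have b: "\<bar>b\<bar> \<le> D * y powr (3/5)" using Q.growth[OF y1] by (simp add: b_def Q.upto_def)
      have "real (card (V.upto Z)) * real (card (Q.upto y)) - \<kappa> * \<theta> * Y = \<kappa> * Z * b + \<theta> * y * a + a * b"
        unfolding a_def b_def yZ[symmetric] by (simp add: algebra_simps)
      also have "\<bar>\<dots>\<bar> \<le> \<bar>\<kappa> * Z * b\<bar> + \<bar>\<theta> * y * a\<bar> + \<bar>a * b\<bar>" by linarith
      also have "\<bar>\<kappa> * Z * b\<bar> \<le> \<bar>\<kappa>\<bar> * Z * (D * y powr (3/5))"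
        unfolding abs_mult using b Z1 by (intro mult_mono) auto
      also have "\<bar>\<kappa>\<bar> * Z * (D * y powr (3/5)) = \<bar>\<kappa>\<bar> * D * (Y powr (3/4) * Y powr (3/20))"
        by (simp add: py Z_def mult_ac)
      also have "Y powr (3/4) * Y powr (3/20) = Y powr (9/10)" by (subst powr_add[symmetric]) simp
      also have "\<bar>\<theta> * y * a\<bar> \<le> \<bar>\<theta>\<bar> * y * (C * Z powr (17/20))"
        unfolding abs_mult using a y1 by (intro mult_mono) auto
      also have "\<bar>\<theta>\<bar> * y * (C * Z powr (17/20)) = \<bar>\<theta>\<bar> * C * (Y powr (1/4) * Y powr (51/80))"
        by (simp add: pZ y_def mult_ac)
      also have "Y powr (1/4) * Y powr (51/80) = Y powr (71/80)" by (subst powr_add[symmetric]) simp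
      also have "\<bar>\<theta>\<bar> * C * Y powr (71/80) \<le> \<bar>\<theta>\<bar> * C * Y powr (9/10)" using V.C by (intro mult_left_mono le9) auto
      also have "\<bar>a * b\<bar> \<le> (C * Z powr (17/20)) * (D * y powr (3/5))"
        unfolding abs_mult using a b V.C by (intro mult_mono) auto
      also have "(C * Z powr (17/20)) * (D * y powr (3/5)) = C * D * (Y powr (51/80) * Y powr (3/20))"
        by (simp add: pZ py mult_ac)
      also have "Y powr (51/80) * Y powr (3/20) = Y powr (63/80)" by (subst powr_add[symmetric]) simp
      also have "C * D * Y powr (63/80) \<le> C * D * Y powr (9/10)" using V.C Q.C by (intro mult_left_mono le9) auto
      finally show ?thesis by (simp add: algebra_simps)
    qed
    have "ln (y * Z) = ln y + ln Z" using y1 Z1 by (intro ln_mult_pos) auto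
    then have "ln y + ln Z = ln Y" unfolding yZ by simp
    have "\<kappa> * Y * (\<theta> * ln y + gJ) + \<theta> * Y * (\<kappa> * ln Z + gI) - \<kappa> * \<theta> * Y = \<kappa> * \<theta> * Y * (ln y + ln Z) + c * Y"
      by (simp add: c_def algebra_simps)
    then have main: "\<kappa> * Y * (\<theta> * ln y + gJ) + \<theta> * Y * (\<kappa> * ln Z + gI) - \<kappa> * \<theta> * Y = \<kappa> * \<theta> * Y * ln Y + c * Y"
      unfolding \<open>ln y + ln Z = ln Y\<close> .
    have "K * Y powr (9/10) = (C * K1 + \<bar>\<kappa>\<bar> * K3) * Y powr (9/10) + (D * K2 + \<bar>\<theta>\<bar> * K4) * Y powr (9/10) +
        (\<bar>\<kappa>\<bar> * D + \<bar>\<theta>\<bar> * C + C * D) * Y powr (9/10)" unfolding K_def by (simp add: algebra_simps)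
    then have "\<bar>real (card ?P) - (\<kappa> * \<theta> * Y * ln Y + c * Y)\<bar> \<le> K * Y powr (9/10)"
      using sA sB sC main cP by linarith
    then show ?thesis using finP by blast
  qed
  then show ?thesis using that K0 by blast
qed

section \<open>Twist classes and coincidences\<close>

definition primitive_params :: "(int \<times> int) set" where
  "primitive_params = {(a, b). coprime a b \<and> a \<noteq> 0 \<and> b > 0}"

text \<open>The absolute value of B makes the representative unique up to quadratic twist: twisting
  by -1 only changes the sign of B, and that sign is reinstated when the twists are counted.\<close>

definition reduced_model :: "int \<times> int \<Rightarrow> int \<times> int" where
  "reduced_model = (\<lambda>(a, b). (A_form a b div int (defect a b) ^ 2, \<bar>B_form a b\<bar> div int (defect a b) ^ 3))"

lemma reduced_model:
  assumes "coprime a b"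
  obtains A0 B0 where "reduced_model (a, b) = (A0, B0)" "A_form a b = int (defect a b) ^ 2 * A0"
    "\<bar>B_form a b\<bar> = int (defect a b) ^ 3 * B0" "B0 > 0" "\<And>p. Factorial_Ring.prime p \<Longrightarrow> \<not> (p ^ 2 dvd A0 \<and> p ^ 3 dvd B0)"
proof -
  define D where "D = defect a b"
  have D0: "D > 0" using dvd_defect_iff(2)[OF assms] by (simp add: D_def)
  have d: "int D ^ 2 dvd A_form a b" "int D ^ 3 dvd B_form a b" using dvd_defect_iff(1)[OF assms, of D] by (auto simp: D_def)
  define A0 where "A0 = A_form a b div int D ^ 2"
  define B0 where "B0 = \<bar>B_form a b\<bar> div int D ^ 3"
  have A: "A_form a b = int D ^ 2 * A0" using d(1) by (simp add: A0_def)
  have B: "\<bar>B_form a b\<bar> = int D ^ 3 * B0" using d(2) by (simp add: B0_def)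
  have "\<bar>B_form a b\<bar> > 0" using coprime_forms_nonzero(5)[OF assms] by simp
  then have B0: "B0 > 0" unfolding B using D0 by (simp add: zero_less_mult_iff)
  have "\<not> (p ^ 2 dvd A0 \<and> p ^ 3 dvd B0)" if p: "Factorial_Ring.prime p" for p :: int
  proof
    assume dv: "p ^ 2 dvd A0 \<and> p ^ 3 dvd B0"
    have p1: "p > 1" using p prime_gt_1_int by blast
    \<comment> \<open>A further common factor p^2, p^3 would make D p admissible, although every
      admissible number divides the defect D.\<close>
    have "(int D * p) ^ 2 dvd A_form a b" "(int D * p) ^ 3 dvd \<bar>B_form a b\<bar>"
      unfolding A B power_mult_distrib using dv by (simp_all only: mult_dvd_mono dvd_refl)
    moreover have "int (D * nat p) = int D * p" using p1 by simp
    ultimately have "int (D * nat p) ^ 2 dvd A_form a b \<and> int (D * nat p) ^ 3 dvd B_form a b" by (simp only: dvd_abs_iff)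
    then have "D * nat p dvd D" using dvd_defect_iff(1)[OF assms, of "D * nat p"] by (simp add: D_def)
    then have "D * nat p \<le> D" using D0 by (intro dvd_imp_le)
    then show False using D0 p1 by simp
  qed
  note min = this
  have m: "reduced_model (a, b) = (A0, B0)" unfolding reduced_model_def A0_def B0_def D_def by simp
  show ?thesis by (rule that[OF m A[unfolded D_def] B[unfolded D_def] B0 min])
qed

text \<open>Twisting by c multiplies the height by c^6, so the sixth root makes the weight of a
  twist the product of the weight of the model with c. This is the multiplicative shape required by
  the hyperbola method.\<close>

definition model_weight :: "int \<times> int \<Rightarrow> real" where
  "model_weight E = root 6 (real_of_int (height E))"

lemma model_weight_le_iff:
  assumes "z \<ge> 0" "height E \<ge> 0"
  shows "model_weight E \<le> z \<longleftrightarrow> real_of_int (height E) \<le> z ^ 6"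
proof -
  have "model_weight E \<le> z \<longleftrightarrow> model_weight E ^ 6 \<le> z ^ 6"
    using assms by (subst power_mono_iff) (auto simp: model_weight_def)
  then show ?thesis using assms by (simp add: model_weight_def)
qed

lemma height_nonneg: "height E \<ge> 0"
  by (cases E) (auto simp: le_max_iff_disj)

lemma reduced_model_weight_le_iff:
  assumes "coprime a b" "z \<ge> 0"
  shows "model_weight (reduced_model (a, b)) \<le> z \<longleftrightarrow> (a, b) \<in> twist_points z"
proof -
  obtain A0 B0 where m: "reduced_model (a, b) = (A0, B0)" "A_form a b = int (defect a b) ^ 2 * A0"
    "\<bar>B_form a b\<bar> = int (defect a b) ^ 3 * B0" by (rule reduced_model[OF assms(1)]) blast
  define D where "D = real (defect a b)"
  have D0: "D > 0" using dvd_defect_iff(2)[OF assms(1)] by (simp add: D_def)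
  have A: "A_form (real_of_int a) (real_of_int b) = D ^ 2 * real_of_int A0"
    unfolding form_of_int m(2) by (simp add: D_def)
  have B: "\<bar>B_form (real_of_int a) (real_of_int b)\<bar> = D ^ 3 * real_of_int B0"
    unfolding form_of_int of_int_abs[symmetric] m(3) by (simp add: D_def)
  have s: "sqrt (D * z) ^ 12 = D ^ 6 * z ^ 6"
  proof -
    have "sqrt (D * z) ^ 12 = (sqrt (D * z) ^ 2) ^ 6" by (simp flip: power_mult)
    also have "\<dots> = D ^ 6 * z ^ 6" using D0 assms(2) by (simp add: power_mult_distrib)
    finally show ?thesis .
  qed
  have "4 * \<bar>A_form (real_of_int a) (real_of_int b)\<bar> ^ 3 \<le> sqrt (D * z) ^ 12 \<longleftrightarrow> 4 * \<bar>real_of_int A0\<bar> ^ 3 \<le> z ^ 6"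
  proof -
    have "4 * \<bar>A_form (real_of_int a) (real_of_int b)\<bar> ^ 3 = D ^ 6 * (4 * \<bar>real_of_int A0\<bar> ^ 3)"
      unfolding A using D0 by (simp add: abs_mult power_mult_distrib flip: power_mult)
    then show ?thesis unfolding s using D0 by simp
  qed
  moreover have "27 * B_form (real_of_int a) (real_of_int b) ^ 2 \<le> sqrt (D * z) ^ 12 \<longleftrightarrow> 27 * (real_of_int B0) ^ 2 \<le> z ^ 6"
  proof -
    have "27 * B_form (real_of_int a) (real_of_int b) ^ 2 = 27 * \<bar>B_form (real_of_int a) (real_of_int b)\<bar> ^ 2" by simp
    also have "\<dots> = D ^ 6 * (27 * (real_of_int B0) ^ 2)"
      unfolding B by (simp add: power_mult_distrib flip: power_mult)
    finally show ?thesis unfolding s using D0 by simp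
  qed
  moreover have "real_of_int (height (A0, B0)) = max (4 * \<bar>real_of_int A0\<bar> ^ 3) (27 * (real_of_int B0) ^ 2)"
    by (simp add: abs_mult power_abs of_int_max)
  ultimately show ?thesis
    using model_weight_le_iff[OF assms(2) height_nonneg, of "(A0, B0)"] assms(1)
    by (simp add: m(1) twist_points_def region_def D_def del: height.simps)
qed

definition models :: "(int \<times> int) set" where "models = reduced_model ` primitive_params"

lemma model_weight_ge_1:
  assumes "E \<in> models"
  shows "model_weight E \<ge> 1"
proof -
  obtain a b where ab: "coprime a b" "E = reduced_model (a, b)" using assms by (auto simp: models_def primitive_params_def)
  obtain A0 B0 where m: "reduced_model (a, b) = (A0, B0)" "B0 > 0" by (rule reduced_model[OF ab(1)]) blast
  have "1 \<le> B0 ^ 2" using m(2) by (simp add: one_le_power)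
  then have "1 \<le> height E" unfolding ab(2) m(1) by (simp add: le_max_iff_disj)
  then show ?thesis unfolding model_weight_def by (simp add: real_root_ge_1_iff)
qed

section \<open>Distinct parameters with the same j-invariant\<close>

definition coincidences :: "real \<Rightarrow> (int \<times> int) set" where
  "coincidences z = {v \<in> twist_points z \<inter> primitive_params.
     \<exists>v' \<in> twist_points z \<inter> primitive_params. v' \<noteq> v \<and> reduced_model v' = reduced_model v}"

text \<open>The conclusion is equality of j-invariants. The ratio A^3 / B^2 is free of the defects
  and signs and determines q u^3 / w^2; the formula for w^2 turns this into q u^3 / (a b^7).\<close>

lemma reduced_model_eq_imp:
  assumes ab: "coprime a b" and cd: "coprime c d" and eq: "reduced_model (a, b) = reduced_model (c, d)"
  shows "q_form a b * u_form a b ^ 3 * (c * d ^ 7) = q_form c d * u_form c d ^ 3 * (a * b ^ 7)"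
proof -
  define D E where "D = int (defect a b)" and "E = int (defect c d)"
  have DE: "D > 0" "E > 0" using dvd_defect_iff(2)[OF ab] dvd_defect_iff(2)[OF cd] by (auto simp: D_def E_def)
  obtain A0 B0 where m: "reduced_model (a, b) = (A0, B0)" "A_form a b = D ^ 2 * A0" "\<bar>B_form a b\<bar> = D ^ 3 * B0"
    unfolding D_def by (rule reduced_model[OF ab]) blast
  have m': "A_form c d = E ^ 2 * A0" "\<bar>B_form c d\<bar> = E ^ 3 * B0"
    using reduced_model[OF cd] eq m(1) unfolding E_def by (metis Pair_inject)+
  have "A_form a b ^ 3 * \<bar>B_form c d\<bar> ^ 2 = A_form c d ^ 3 * \<bar>B_form a b\<bar> ^ 2"
    unfolding m m' by (simp add: power_mult_distrib flip: power_mult)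
  then have e: "A_form a b ^ 3 * B_form c d ^ 2 = A_form c d ^ 3 * B_form a b ^ 2" by simp
  define q u w q' u' w' where "q = q_form a b" and "u = u_form a b" and "w = w_form a b"
    and "q' = q_form c d" and "u' = u_form c d" and "w' = w_form c d"
  have q0: "q \<noteq> 0" "q' \<noteq> 0" using coprime_forms_nonzero ab cd by (auto simp: q_def q'_def)
  have w: "w ^ 2 = q * u ^ 3 - 1728 * (a * b ^ 7)" "w' ^ 2 = q' * u' ^ 3 - 1728 * (c * d ^ 7)"
    using w_form_square[of a b] w_form_square[of c d] by (simp_all add: q_def u_def w_def q'_def u'_def w'_def mult.assoc)
  have "(q ^ 2 * q' ^ 2) * (q * u ^ 3 * w' ^ 2 - q' * u' ^ 3 * w ^ 2) = 0"
    using e unfolding A_form_def B_form_def q_def[symmetric] u_def[symmetric] w_def[symmetric] q'_def[symmetric] u'_def[symmetric] w'_def[symmetric]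
    by Groebner_Basis.algebra
  then have "q * u ^ 3 * w' ^ 2 = q' * u' ^ 3 * w ^ 2" using q0 by simp
  then have "q * u ^ 3 * (c * d ^ 7) = q' * u' ^ 3 * (a * b ^ 7)" unfolding w by Groebner_Basis.algebra
  then show ?thesis by (simp add: q_def u_def q'_def u'_def)
qed

text \<open>The fraction j = q u^3 / (a b^7) is in lowest terms up to a divisor of 49, since q u^3
  is a^8 modulo b and 49 b^8 modulo a.\<close>

lemma cusp_product_dvd:
  assumes ab: "coprime a b" and e: "q_form a b * u_form a b ^ 3 * r = n * (a * b ^ 7)"
  shows "a * b ^ 7 dvd 49 * (r :: int)"
proof (rule divides_mult)
  show "coprime a (b ^ 7)" using ab by simp
  have "coprime (a ^ 8) (b ^ 7)" using ab by simp
  define k where "k = 28 * a ^ 7 + 322 * a ^ 6 * b + 1904 * a ^ 5 * b ^ 2 + 5915 * a ^ 4 * b ^ 3 + 8624 * a ^ 3 * b ^ 4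
     + 4018 * a ^ 2 * b ^ 5 + 748 * a * b ^ 6 + 49 * b ^ 7"
  have "q_form a b * u_form a b ^ 3 = k * b + a ^ 8"
    unfolding form_defs k_def by Groebner_Basis.algebra
  moreover have "gcd b (k * b + a ^ 8) = gcd b (a ^ 8)" by (rule gcd_add_mult)
  moreover have "coprime b (a ^ 8)" using ab by (simp add: coprime_commute)
  ultimately have "gcd b (q_form a b * u_form a b ^ 3) = 1" by (simp add: coprime_iff_gcd_eq_1)
  then have "coprime b (q_form a b * u_form a b ^ 3)" by (simp only: coprime_iff_gcd_eq_1)
  then have "coprime (b ^ 7) (q_form a b * u_form a b ^ 3)" unfolding coprime_power_left_iff by (rule disjI1)
  moreover have "b ^ 7 dvd q_form a b * u_form a b ^ 3 * r" unfolding e by simp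
  ultimately have "b ^ 7 dvd r" by (simp only: coprime_dvd_mult_right_iff)
  then show "b ^ 7 dvd 49 * r" by simp
  define k' where "k' = a ^ 7 + 28 * a ^ 6 * b + 322 * a ^ 5 * b ^ 2 + 1904 * a ^ 4 * b ^ 3 + 5915 * a ^ 3 * b ^ 4 + 8624 * a ^ 2 * b ^ 5
     + 4018 * a * b ^ 6 + 748 * b ^ 7"
  have "q_form a b * u_form a b ^ 3 = a * k' + 49 * b ^ 8"
    unfolding form_defs k'_def by Groebner_Basis.algebra
  then have "b ^ 8 * (49 * r) = a * (n * b ^ 7 - k' * r)" using e by Groebner_Basis.algebra
  then have "a dvd b ^ 8 * (49 * r)" by (metis dvd_triv_left)
  moreover have "coprime a (b ^ 8)" using ab by simp
  ultimately show "a dvd 49 * r" by (simp only: coprime_dvd_mult_right_iff)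
qed

definition j_poly :: "real poly" where "j_poly = [:49, 13, 1:] * [:1, 5, 1:] ^ 3"

text \<open>Since j(t) = \<open>poly j_poly t\<close> / t, its nonzero roots t are the solutions of
  j(\<mu> t) = j(t), if \<mu> is nonzero. Its value 49 (1 - \<mu>) at 0 shows that it is not the
  zero polynomial when \<mu> \<noteq> 1.\<close>

definition ratio_poly :: "real \<Rightarrow> real poly" where
  "ratio_poly \<mu> = pcompose j_poly [:0, \<mu>:] - Polynomial.smult \<mu> j_poly"

lemma poly_j_poly: "poly j_poly t = q_form t 1 * u_form t 1 ^ 3"
  by (simp add: j_poly_def form_defs power2_eq_square algebra_simps)

lemma degree_j_poly: "Polynomial.degree j_poly \<le> 8"
proof -
  have "Polynomial.degree ([:1, 5, 1:] ^ 3 :: real poly) \<le> 2 * 3" by (rule order_trans[OF degree_power_le]) simp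
  then show ?thesis unfolding j_poly_def by (intro order_trans[OF degree_mult_le]) simp
qed

lemma ratio_poly:
  "poly (ratio_poly \<mu>) x = poly j_poly (\<mu> * x) - \<mu> * poly j_poly x"
  "\<mu> \<noteq> 1 \<Longrightarrow> finite {x. poly (ratio_poly \<mu>) x = 0} \<and> card {x. poly (ratio_poly \<mu>) x = 0} \<le> 8"
proof -
  show 1: "poly (ratio_poly \<mu>) x = poly j_poly (\<mu> * x) - \<mu> * poly j_poly x" for x
    by (simp add: ratio_poly_def poly_pcompose mult.commute)
  assume l: "\<mu> \<noteq> 1"
  have "poly (ratio_poly \<mu>) 0 = 49 * (1 - \<mu>)" unfolding 1 poly_j_poly form_defs by simp
  then have n0: "ratio_poly \<mu> \<noteq> 0" using l by auto
  have "Polynomial.degree (pcompose j_poly [:0, \<mu>:]) \<le> Polynomial.degree j_poly * Polynomial.degree [:0, \<mu>:]" by (rule degree_pcompose_le)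
  also have "\<dots> \<le> 8 * 1" using degree_j_poly by (intro mult_le_mono) auto
  finally have "Polynomial.degree (ratio_poly \<mu>) \<le> 8" unfolding ratio_poly_def
    using degree_j_poly by (intro degree_diff_le) (auto intro: order_trans[OF degree_smult_le])
  then show "finite {x. poly (ratio_poly \<mu>) x = 0} \<and> card {x. poly (ratio_poly \<mu>) x = 0} \<le> 8"
    using poly_roots_finite[OF n0] card_poly_roots_bound[OF n0] by linarith
qed

text \<open>The product \<open>a b\<^sup>7\<close> is, up to divisors of 49, determined by the \<open>j\<close>-invariant. Hence the
  quotient \<open>\<mu>\<close> of two parameters with the same \<open>j\<close>-invariant takes few values, and each value
  belongs to boundedly many parameters.\<close>

lemma reduced_fraction_unique:
  fixes a b c d :: int
  assumes ab: "coprime a b" "b > 0" and cd: "coprime c d" "d > 0"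
    and eq: "real_of_int a / real_of_int b = real_of_int c / real_of_int d"
  shows "(a, b) = (c, d)"
proof -
  have "real_of_int a * real_of_int d = real_of_int c * real_of_int b" using eq ab cd by (simp add: frac_eq_eq)
  then have ad: "a * d = c * b" unfolding of_int_mult[symmetric] of_int_eq_iff .
  have "coprime b a" "coprime d c" using ab cd by (simp_all add: coprime_commute)
  moreover have "b dvd a * d" unfolding ad by simp
  moreover have "d dvd c * b" unfolding ad[symmetric] by simp
  ultimately have "b dvd d" "d dvd b" by (simp_all only: coprime_dvd_mult_right_iff)
  then have "b = d" using ab cd by (intro zdvd_antisym_nonneg) auto
  then show ?thesis using ad ab by simp
qed

text \<open>From 49 c d^7 = m a b^7 and b = g \<beta>, d = g \<beta>' with coprime \<beta>,
  \<beta>', the quotient of c/d by a/b is m \<beta>^8 / (49 \<beta>'^8). Moreover \<beta>'^7 divides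
  m a and \<beta>^7 divides 49 c, which bounds \<beta> and \<beta>' in terms of the
  numerators.\<close>

lemma coincidence_ratio:
  assumes v: "(a, b) \<in> primitive_params" and v': "(c, d) \<in> primitive_params" and ne: "(c, d) \<noteq> (a, b)"
    and eq: "reduced_model (c, d) = reduced_model (a, b)"
    and M: "\<bar>real_of_int a\<bar> \<le> M" "\<bar>real_of_int c\<bar> \<le> M"
  obtains m :: int and \<beta> \<beta>' :: nat where "\<bar>m\<bar> \<le> 2401" "1 \<le> \<beta>" "1 \<le> \<beta>'" "real \<beta> ^ 2 \<le> 2401 * M" "real \<beta>' ^ 2 \<le> 2401 * M"
    "real_of_int m * real \<beta> ^ 8 / (49 * real \<beta>' ^ 8) \<noteq> 1"
    "poly (ratio_poly (real_of_int m * real \<beta> ^ 8 / (49 * real \<beta>' ^ 8))) (real_of_int a / real_of_int b) = 0"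
proof -
  have ab: "coprime a b" "a \<noteq> 0" "b > 0" and cd: "coprime c d" "c \<noteq> 0" "d > 0"
    using v v' by (auto simp: primitive_params_def)
  define r where "r = a * b ^ 7"
  define r' where "r' = c * d ^ 7"
  have r0: "r \<noteq> 0" "r' \<noteq> 0" using ab cd by (auto simp: r_def r'_def)
  have N: "q_form a b * u_form a b ^ 3 * r' = q_form c d * u_form c d ^ 3 * r"
    using reduced_model_eq_imp[OF ab(1) cd(1) eq[symmetric]] by (simp add: r_def r'_def)
  have "r dvd 49 * r'" unfolding r_def
    by (rule cusp_product_dvd[OF ab(1), of _ "q_form c d * u_form c d ^ 3"]) (use N in \<open>simp add: r_def\<close>)
  then obtain m where m: "49 * r' = r * m" by (elim dvdE)
  have "r' dvd 49 * r" unfolding r'_def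
    by (rule cusp_product_dvd[OF cd(1), of _ "q_form a b * u_form a b ^ 3"]) (use N in \<open>simp add: r'_def\<close>)
  then obtain n where n: "49 * r = r' * n" by (elim dvdE)
  have "r * (m * n) = r * 2401" using m n by Groebner_Basis.algebra
  \<comment> \<open>Divisibility holds in both directions up to 49, so m is a divisor of
    49^2.\<close>
  then have mn: "m * n = 2401" using r0 by simp
  then have "m dvd 2401" by (metis dvd_triv_left)
  then have "\<bar>m\<bar> dvd 2401" by simp
  then have m2401: "\<bar>m\<bar> \<le> 2401" by (rule zdvd_imp_le) simp
  define g where "g = gcd b d"
  have g0: "g > 0" using ab by (simp add: g_def)
  obtain \<beta> \<beta>' where bd: "b = g * \<beta>" "d = g * \<beta>'" "coprime \<beta> \<beta>'"
  proof -
    have "gcd b d \<noteq> 0" using g0 by (simp add: g_def)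
    then obtain x y where "b = x * gcd b d" "d = y * gcd b d" "coprime x y" using gcd_coprime_exists by blast
    then show ?thesis using that[of x y] unfolding g_def by (simp add: mult.commute)
  qed
  have b0: "\<beta> > 0" "\<beta>' > 0" using bd ab cd g0 by (simp_all add: zero_less_mult_iff)
  have "g ^ 7 * (49 * c * \<beta>' ^ 7) = g ^ 7 * (m * a * \<beta> ^ 7)"
    using m unfolding r_def r'_def bd by Groebner_Basis.algebra
  then have key: "49 * c * \<beta>' ^ 7 = m * a * \<beta> ^ 7" using g0 by simp
  have m0: "m \<noteq> 0" using mn by auto
  have small: "real_of_int x ^ 2 \<le> 2401 * M" if x: "x > 0" "x ^ 7 dvd k * e" "k * e \<noteq> 0" "\<bar>k\<bar> \<le> 2401" "\<bar>real_of_int e\<bar> \<le> M" for x k e :: int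
  proof -
    have "x ^ 7 \<le> \<bar>k * e\<bar>" using x by (intro zdvd_imp_le) auto
    have "x ^ 2 \<le> x ^ 7" using x(1) by (intro power_increasing) auto
    also have "\<dots> \<le> \<bar>k * e\<bar>" by fact
    also have "\<dots> \<le> 2401 * \<bar>e\<bar>" unfolding abs_mult using x(4) by (intro mult_right_mono) auto
    finally have "real_of_int (x ^ 2) \<le> real_of_int (2401 * \<bar>e\<bar>)" by (simp only: of_int_le_iff)
    then show ?thesis using x(5) by simp
  qed
  have "coprime (\<beta>' ^ 7) (\<beta> ^ 7)" using bd(3) by (simp add: coprime_commute)
  have "\<beta>' ^ 7 dvd (m * a) * \<beta> ^ 7" unfolding key[symmetric] by simp
  then have d1: "\<beta>' ^ 7 dvd m * a" using \<open>coprime (\<beta>' ^ 7) (\<beta> ^ 7)\<close> by (simp only: coprime_dvd_mult_left_iff)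
  have "\<beta> ^ 7 dvd (49 * c) * \<beta>' ^ 7" unfolding key by simp
  then have d2: "\<beta> ^ 7 dvd 49 * c" using \<open>coprime (\<beta>' ^ 7) (\<beta> ^ 7)\<close> by (simp only: coprime_dvd_mult_left_iff coprime_commute)
  define \<mu> where "\<mu> = real_of_int m * real (nat \<beta>) ^ 8 / (49 * real (nat \<beta>') ^ 8)"
  define t where "t = real_of_int a / real_of_int b"
  have rb: "real (nat \<beta>) = real_of_int \<beta>" "real (nat \<beta>') = real_of_int \<beta>'" using b0 by simp_all
  have key': "49 * real_of_int c * real_of_int \<beta>' ^ 7 = real_of_int m * real_of_int a * real_of_int \<beta> ^ 7"
    using arg_cong[OF key, of real_of_int] by simp
  have lt: "\<mu> * t = real_of_int c / real_of_int d"
  proof -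
    have "\<mu> * t = (real_of_int m * real_of_int a * real_of_int \<beta> ^ 7) * real_of_int \<beta> / (49 * real_of_int \<beta>' ^ 8 * (real_of_int g * real_of_int \<beta>))"
      unfolding \<mu>_def t_def rb bd by (simp add: eval_nat_numeral mult_ac)
    also have "\<dots> = real_of_int c / (real_of_int g * real_of_int \<beta>')"
      unfolding key'[symmetric] using b0 g0 by (simp add: eval_nat_numeral field_simps)
    finally show ?thesis by (simp add: bd)
  qed
  have t0: "t \<noteq> 0" using ab by (simp add: t_def)
  have l1: "\<mu> \<noteq> 1"
  proof
    assume "\<mu> = 1"
    then have "real_of_int a / real_of_int b = real_of_int c / real_of_int d" using lt by (simp add: t_def)
    then show False using reduced_fraction_unique[OF ab(1,3) cd(1,3)] ne by simp
  qed
  have "poly j_poly (\<mu> * t) * t = poly j_poly t * (\<mu> * t)"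
  proof -
    have fb: "poly j_poly (real_of_int x / real_of_int y) * real_of_int y ^ 8 = real_of_int (q_form x y * u_form x y ^ 3)" if "y > 0" for x y
    proof -
      define s where "s = real_of_int x / real_of_int y"
      have s: "real_of_int x = s * real_of_int y" using that by (simp add: s_def)
      have "real_of_int (q_form x y * u_form x y ^ 3) = q_form (s * real_of_int y) (1 * real_of_int y) * u_form (s * real_of_int y) (1 * real_of_int y) ^ 3"
        by (simp only: of_int_mult of_int_power form_of_int[symmetric] s mult_1)
      also have "\<dots> = poly j_poly s * real_of_int y ^ 8"
        unfolding q_form_scale u_form_scale poly_j_poly by (simp add: power_mult_distrib flip: power_mult power_add)
      finally show ?thesis by (simp add: s_def)
    qed
    have "real_of_int (q_form a b * u_form a b ^ 3 * r') = real_of_int (q_form c d * u_form c d ^ 3 * r)" by (simp only: N)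
    then have "(poly j_poly t * real_of_int b ^ 8) * (real_of_int c * real_of_int d ^ 7) =
        (poly j_poly (\<mu> * t) * real_of_int d ^ 8) * (real_of_int a * real_of_int b ^ 7)"
      unfolding lt unfolding t_def fb[OF ab(3)] fb[OF cd(3)] by (simp add: r_def r'_def)
    then have "(real_of_int b ^ 8 * real_of_int d ^ 8) * (poly j_poly t * (real_of_int c / real_of_int d)) =
       (real_of_int b ^ 8 * real_of_int d ^ 8) * (poly j_poly (\<mu> * t) * (real_of_int a / real_of_int b))"
      using ab cd by (simp add: field_simps eval_nat_numeral)
    moreover have "real_of_int b ^ 8 * real_of_int d ^ 8 \<noteq> 0" using ab cd by simp
    ultimately have "poly j_poly t * (real_of_int c / real_of_int d) = poly j_poly (\<mu> * t) * (real_of_int a / real_of_int b)"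
      using mult_left_cancel by blast
    then show ?thesis unfolding lt t_def[symmetric] by (rule sym)
  qed
  then have "poly (ratio_poly \<mu>) t * t = 0" unfolding ratio_poly by (simp add: algebra_simps)
  then have "poly (ratio_poly \<mu>) t = 0" using t0 by simp
  moreover have "real (nat \<beta>) ^ 2 \<le> 2401 * M" unfolding rb by (rule small[OF b0(1) d2]) (use cd M in auto)
  moreover have "real (nat \<beta>') ^ 2 \<le> 2401 * M" unfolding rb by (rule small[OF b0(2) d1]) (use ab M m0 m2401 in auto)
  moreover have "1 \<le> nat \<beta>" "1 \<le> nat \<beta>'" using b0 by auto
  ultimately show ?thesis using that[of m "nat \<beta>" "nat \<beta>'"] m2401 l1 by (simp add: \<mu>_def t_def)
qed

text \<open>Numerators are at most a multiple of z^(3/4), because the defect is at most a multiple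
  of z^(1/2). So \<beta> and \<beta>' take at most a multiple of z^(3/8) values each, and every
  \<mu> admits at most 8 parameters: z^(3/4) in total.\<close>

lemma card_coincidences:
  obtains C where "C \<ge> 0" "\<And>z. z \<ge> 1 \<Longrightarrow> real (card (coincidences z)) \<le> C * z powr (17/20)"
proof -
  define K where "K = real defect_bound"
  have "real (card (coincidences z)) \<le> (8 * 4803 * 2401 * 9 * K) * z powr (17/20)" if z: "z \<ge> 1" for z
  proof -
    define M where "M = 9 * K * z powr (3/4)"
    have K1: "K \<ge> 1" by (simp add: K_def)
    have M1: "M \<ge> 1"
    proof -
      have "1 * 1 \<le> (9 * K) * z powr (3/4)" using K1 z by (intro mult_mono ge_one_powr_ge_zero) auto
      then show ?thesis by (simp add: M_def)
    qed
    have bnd: "\<bar>real_of_int a\<bar> \<le> M" if v: "(a, b) \<in> twist_points z" for a b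
    proof -
      define D where "D = real (defect a b)"
      have "D ^ 2 \<le> K * z" using twist_points_bounds[OF v] z by (simp add: D_def K_def)
      also have "\<dots> \<le> K ^ 2 * z" using K1 z by (simp add: power2_eq_square)
      also have "\<dots> = (K * z powr (1/2)) ^ 2" using z by (simp add: power_mult_distrib powr_power)
      finally have D: "D \<le> K * z powr (1/2)" by (rule power2_le_imp_le) (use K1 in auto)
      have "\<bar>real_of_int a\<bar> \<le> 9 * sqrt (D * z)"
        using region_bounded[of "real_of_int a" "real_of_int b" "sqrt (D * z)"] v z by (auto simp: twist_points_def D_def)
      also have "sqrt (D * z) \<le> K * z powr (3/4)"
      proof (rule real_le_lsqrt)
        have "D * z \<le> (K * z powr (1/2)) * z powr 1" using D z by (intro mult_mono) (auto simp: D_def)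
        also have "\<dots> = K * (z powr (1/2) * z powr 1)" by (simp only: mult.assoc)
        also have "z powr (1/2) * z powr 1 = z powr (3/2)" by (subst powr_add[symmetric]) simp
        also have "K * z powr (3/2) \<le> K ^ 2 * z powr (3/2)" using K1 by (intro mult_right_mono) (auto simp: power2_eq_square)
        also have "\<dots> = (K * z powr (3/4)) ^ 2" using z by (simp add: power_mult_distrib powr_power)
        finally show "D * z \<le> (K * z powr (3/4)) ^ 2" .
      qed (use K1 in auto)
      finally show ?thesis by (simp add: M_def)
    qed
    define L where "L = nat \<lfloor>sqrt (2401 * M)\<rfloor>"
    define Ix where "Ix = {- 2401..2401 :: int} \<times> {1..L} \<times> {1..L}"
    define lam where "lam = (\<lambda>(m :: int, \<beta> :: nat, \<beta>' :: nat). real_of_int m * real \<beta> ^ 8 / (49 * real \<beta>' ^ 8))"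
    define Rt where "Rt = (\<lambda>i. if lam i = 1 then {} else {x. poly (ratio_poly (lam i)) x = 0})"
    have Rt: "finite (Rt i) \<and> card (Rt i) \<le> 8" for i using ratio_poly(2)[of "lam i"] by (auto simp: Rt_def)
    define \<phi> where "\<phi> = (\<lambda>(a, b). real_of_int a / real_of_int b)"
    have inj: "inj_on \<phi> (coincidences z)"
    proof (rule inj_onI)
      fix v w assume vw: "v \<in> coincidences z" "w \<in> coincidences z" "\<phi> v = \<phi> w"
      obtain a b c d where [simp]: "v = (a, b)" "w = (c, d)" by (cases v; cases w) auto
      have ab: "coprime a b" "b > 0" and cd: "coprime c d" "d > 0" using vw by (auto simp: coincidences_def primitive_params_def)
      show "v = w" using vw(3) reduced_fraction_unique[OF ab cd] by (simp add: \<phi>_def)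
    qed
    have "\<phi> ` coincidences z \<subseteq> (\<Union>i\<in>Ix. Rt i)"
    proof
      fix x assume "x \<in> \<phi> ` coincidences z"
      then obtain a b where ab: "(a, b) \<in> coincidences z" "x = real_of_int a / real_of_int b" by (auto simp: \<phi>_def)
      then obtain c d where cd: "(c, d) \<in> twist_points z" "(c, d) \<in> primitive_params" "(c, d) \<noteq> (a, b)" "reduced_model (c, d) = reduced_model (a, b)"
        and v: "(a, b) \<in> twist_points z" "(a, b) \<in> primitive_params" by (auto simp: coincidences_def)
      obtain m :: int and \<beta> \<beta>' :: nat where r: "\<bar>m\<bar> \<le> 2401" "1 \<le> \<beta>" "1 \<le> \<beta>'" "real \<beta> ^ 2 \<le> 2401 * M" "real \<beta>' ^ 2 \<le> 2401 * M"
        "real_of_int m * real \<beta> ^ 8 / (49 * real \<beta>' ^ 8) \<noteq> 1"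
        "poly (ratio_poly (real_of_int m * real \<beta> ^ 8 / (49 * real \<beta>' ^ 8))) (real_of_int a / real_of_int b) = 0"
        by (rule coincidence_ratio[OF v(2) cd(2,3,4) bnd[OF v(1)] bnd[OF cd(1)]]) blast
      have "\<beta> \<le> L" "\<beta>' \<le> L" using r(4,5) unfolding L_def by (auto intro!: le_nat_floor real_le_rsqrt)
      then have "(m, \<beta>, \<beta>') \<in> Ix" using r by (auto simp: Ix_def)
      moreover have "x \<in> Rt (m, \<beta>, \<beta>')" using r(6,7) ab(2) by (simp add: Rt_def lam_def)
      ultimately show "x \<in> (\<Union>i\<in>Ix. Rt i)" by blast
    qed
    moreover have finI: "finite Ix" by (simp add: Ix_def)
    then have "finite (\<Union>i\<in>Ix. Rt i)" using Rt by blast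
    ultimately have "card (\<phi> ` coincidences z) \<le> card (\<Union>i\<in>Ix. Rt i)" by (intro card_mono)
    also have "\<dots> \<le> (\<Sum>i\<in>Ix. card (Rt i))" by (rule card_UN_le[OF finI])
    also have "\<dots> \<le> (\<Sum>i\<in>Ix. 8)" using Rt by (intro sum_mono) auto
    also have "\<dots> = 8 * (4803 * (L * L))" by (simp add: Ix_def card_cartesian_product)
    finally have "real (card (coincidences z)) \<le> real (8 * (4803 * (L * L)))" unfolding card_image[OF inj] of_nat_le_iff .
    also have "\<dots> = 8 * 4803 * (real L) ^ 2" by (simp add: power2_eq_square)
    also have "\<dots> \<le> 8 * 4803 * (sqrt (2401 * M)) ^ 2"
      using M1 by (intro mult_left_mono power_mono) (auto simp: L_def)
    also have "\<dots> = 8 * 4803 * 2401 * 9 * K * z powr (3/4)" using M1 by (simp add: M_def)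
    also have "\<dots> \<le> 8 * 4803 * 2401 * 9 * K * z powr (17/20)"
      using z K1 by (intro mult_left_mono powr_mono) auto
    finally show ?thesis .
  qed
  moreover have "8 * 4803 * 2401 * 9 * K \<ge> 0" by (simp add: K_def)
  ultimately show ?thesis using that by blast
qed

section \<open>The counting function\<close>

lemma modelsE:
  assumes "(A0, B0) \<in> models"
  obtains a b where "coprime a b" "a \<noteq> 0" "b > 0" "reduced_model (a, b) = (A0, B0)"
    "A_form a b = int (defect a b) ^ 2 * A0" "\<bar>B_form a b\<bar> = int (defect a b) ^ 3 * B0" "B0 > 0"
    "\<And>p. Factorial_Ring.prime p \<Longrightarrow> \<not> (p ^ 2 dvd A0 \<and> p ^ 3 dvd B0)"
proof -
  obtain a b where ab: "(a, b) \<in> primitive_params" "(A0, B0) = reduced_model (a, b)"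
    using assms by (auto simp: models_def)
  then have c: "coprime a b" "a \<noteq> 0" "b > 0" by (auto simp: primitive_params_def)
  obtain A1 B1 where m: "reduced_model (a, b) = (A1, B1)" "A_form a b = int (defect a b) ^ 2 * A1"
    "\<bar>B_form a b\<bar> = int (defect a b) ^ 3 * B1" "B1 > 0" "\<And>p. Factorial_Ring.prime p \<Longrightarrow> \<not> (p ^ 2 dvd A1 \<and> p ^ 3 dvd B1)"
    by (rule reduced_model[OF c(1)]) blast
  have [simp]: "A1 = A0" "B1 = B0" using m(1) ab(2) by auto
  show ?thesis using that[OF c] m by simp
qed

lemma height_twist:
  fixes c \<epsilon> A B :: int
  assumes "\<epsilon> ^ 2 = 1"
  shows "height (c ^ 2 * A, \<epsilon> * c ^ 3 * B) = c ^ 6 * height (A, B)"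
proof -
  have c6: "c ^ 6 \<ge> 0" by simp
  have "\<bar>4 * (c ^ 2 * A) ^ 3\<bar> = c ^ 6 * \<bar>4 * A ^ 3\<bar>"
    using c6 by (simp add: power_mult_distrib abs_mult flip: power_mult)
  moreover have "(\<epsilon> * c ^ 3 * B) ^ 2 = c ^ 6 * B ^ 2"
    using assms by (simp add: power_mult_distrib flip: power_mult)
  then have "\<bar>27 * (\<epsilon> * c ^ 3 * B) ^ 2\<bar> = c ^ 6 * \<bar>27 * B ^ 2\<bar>"
    using c6 by (simp add: abs_mult)
  ultimately show ?thesis using c6 by (simp only: height.simps max_mult_distrib_left) simp
qed

section \<open>Curves with a 7-isogeny as signed squarefree twists of models\<close>

definition isogeny_curves :: "real \<Rightarrow> (int \<times> int) set" where
  "isogeny_curves x = {(A, B) \<in> curves_upto x. admits_isogeny 7 A B}"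

definition twist_pairs :: "real \<Rightarrow> ((int \<times> int) \<times> nat) set" where
  "twist_pairs y = {(E, c) \<in> models \<times> {c. squarefree c}. model_weight E * real c \<le> y}"

definition twist_by :: "int \<times> (int \<times> int) \<times> nat \<Rightarrow> int \<times> int" where
  "twist_by = (\<lambda>(\<epsilon>, (A, B), c). (int c ^ 2 * A, \<epsilon> * int c ^ 3 * B))"

lemma twist_weight_le_iff:
  assumes "x \<ge> 0" "\<epsilon> ^ 2 = 1"
  shows "model_weight (A, B) * real c \<le> root 6 x \<longleftrightarrow> real_of_int (height (int c ^ 2 * A, \<epsilon> * int c ^ 3 * B)) \<le> x"
proof -
  have h: "height (A, B) \<ge> 0" by (rule height_nonneg)
  have "model_weight (A, B) * real c \<le> root 6 x \<longleftrightarrow> (model_weight (A, B) * real c) ^ 6 \<le> root 6 x ^ 6"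
    using assms h by (subst power_mono_iff) (auto simp: model_weight_def)
  also have "\<dots> \<longleftrightarrow> real c ^ 6 * real_of_int (height (A, B)) \<le> x"
    using assms h by (simp add: power_mult_distrib model_weight_def mult.commute del: height.simps)
  also have "real c ^ 6 * real_of_int (height (A, B)) = real_of_int (height (int c ^ 2 * A, \<epsilon> * int c ^ 3 * B))"
    unfolding height_twist[OF assms(2)] by simp
  finally show ?thesis .
qed

text \<open>With r = s D the curve is (r^2 A0, \<plusminus> r^3 B0). The denominator n of r
  satisfies n^2 | A0 and n^3 | B0, so it is 1 by minimality of the model; minimality of the curve
  itself makes |r| squarefree.\<close>

lemma isogeny_curve_twist:
  assumes AB: "(A, B) \<in> minimal_curves" "admits_isogeny 7 A B"
  obtains a b \<epsilon> c A0 B0 where "coprime a b" "a \<noteq> 0" "b > 0" "reduced_model (a, b) = (A0, B0)" "\<epsilon> \<in> {1, -1}" "squarefree (c :: nat)"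
    "A = int c ^ 2 * A0" "B = \<epsilon> * int c ^ 3 * B0"
proof -
  have ns: "4 * A ^ 3 + 27 * B ^ 2 \<noteq> 0" and min: "\<And>l::int. Factorial_Ring.prime l \<Longrightarrow> \<not> (l ^ 4 dvd A \<and> l ^ 6 dvd B)"
    using AB by (auto simp: minimal_curves_def)
  obtain a b :: int and s :: rat where ab: "coprime a b" "a \<noteq> 0" "b > 0" "s \<noteq> 0"
    "of_int A = s ^ 2 * of_int (A_form a b)" "of_int B = s ^ 3 * of_int (B_form a b)"
    using AB(2) seven_isogeny_iff[OF ns] by blast
  obtain A0 B0 where m: "reduced_model (a, b) = (A0, B0)" "A_form a b = int (defect a b) ^ 2 * A0"
    "\<bar>B_form a b\<bar> = int (defect a b) ^ 3 * B0" "B0 > 0" "\<And>p. Factorial_Ring.prime p \<Longrightarrow> \<not> (p ^ 2 dvd A0 \<and> p ^ 3 dvd B0)"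
    by (rule reduced_model[OF ab(1)]) blast
  define D where "D = defect a b"
  define \<eta> where "\<eta> = sgn (B_form a b)"
  have Bf: "B_form a b = int D ^ 3 * (\<eta> * B0)" using m(3) by (simp add: \<eta>_def D_def mult.left_commute[of _ "sgn _"] flip: m(3)) (simp add: mult_sgn_abs)
  have \<eta>: "\<eta> \<in> {1, -1}" using coprime_forms_nonzero(5)[OF ab(1)] by (auto simp: \<eta>_def sgn_if)
  define r where "r = s * of_nat D"
  have rA: "of_int A = r ^ 2 * of_int A0"
    unfolding ab(5) m(2) r_def D_def by (simp add: power_mult_distrib)
  have rB: "of_int B = r ^ 3 * of_int (\<eta> * B0)"
    unfolding ab(6) Bf r_def by (simp add: power_mult_distrib)
  obtain m' n where mn: "r = of_int m' / of_int n" "n > 0" "coprime m' n"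
    by (cases r) (auto simp: Fract_of_int_quotient)
  have nr: "of_int n * r = (of_int m' :: rat)" using mn by simp
  have "(of_int (n ^ 2 * A) :: rat) = of_int (m' ^ 2 * A0)"
    unfolding of_int_mult of_int_power rA nr[symmetric] by (simp add: power_mult_distrib)
  then have nA: "n ^ 2 * A = m' ^ 2 * A0" by (simp only: of_int_eq_iff)
  have "(of_int (n ^ 3 * B) :: rat) = of_int (m' ^ 3 * (\<eta> * B0))"
    unfolding of_int_mult of_int_power rB nr[symmetric] by (simp add: power_mult_distrib)
  then have nB: "n ^ 3 * B = m' ^ 3 * (\<eta> * B0)" by (simp only: of_int_eq_iff)
  have c1: "coprime (n ^ 2) (m' ^ 2)" "coprime (n ^ 3) (m' ^ 3)" using mn(3) by (simp_all add: coprime_commute)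
  have "n ^ 2 dvd m' ^ 2 * A0" unfolding nA[symmetric] by simp
  then have d1: "n ^ 2 dvd A0" using c1(1) by (simp only: coprime_dvd_mult_right_iff)
  have "n ^ 3 dvd m' ^ 3 * (\<eta> * B0)" unfolding nB[symmetric] by simp
  then have "n ^ 3 dvd \<eta> * B0" using c1(2) by (simp only: coprime_dvd_mult_right_iff)
  then have d2: "n ^ 3 dvd B0" using \<eta> by auto
  have n1: "n = 1"
  proof (rule ccontr)
    assume "n \<noteq> 1"
    then have "\<not> is_unit n" using mn(2) by auto
    then obtain p where p: "Factorial_Ring.prime p" "p dvd n" using prime_divisor_exists[of n] mn(2) by auto
    have "p ^ 2 dvd A0" "p ^ 3 dvd B0" using d1 d2 dvd_power_same[OF p(2)] by (meson dvd_trans)+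
    then show False using m(5)[OF p(1)] by simp
  qed
  have A: "A = m' ^ 2 * A0" and B: "B = m' ^ 3 * (\<eta> * B0)" using nA nB n1 by auto
  define c where "c = nat \<bar>m'\<bar>"
  define \<epsilon> where "\<epsilon> = sgn m' * \<eta>"
  have "m' \<noteq> 0" using ab(4) mn nr n1 m(4) ns A B by auto
  then have \<epsilon>: "\<epsilon> \<in> {1, -1}" using \<eta> by (auto simp: \<epsilon>_def sgn_if)
  have mc: "m' = sgn m' * int c" by (simp add: c_def mult_sgn_abs)
  have cA: "A = int c ^ 2 * A0" unfolding A by (simp add: c_def)
  have s3: "sgn m' ^ 3 = sgn m'" using \<open>m' \<noteq> 0\<close> by (auto simp: sgn_if)
  have "m' ^ 3 = sgn m' * int c ^ 3" by (subst mc) (simp only: power_mult_distrib s3)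
  then have cB: "B = \<epsilon> * int c ^ 3 * B0" unfolding B \<epsilon>_def by (simp add: mult_ac)
  have "squarefree c"
  proof (rule ccontr)
    assume "\<not> squarefree c"
    then obtain k where k: "k ^ 2 dvd c" "\<not> k dvd 1" by (rule not_squarefreeE)
    obtain p :: nat where p: "Factorial_Ring.prime p" "p dvd k" using k(2) prime_factor_nat[of k] by auto
    have "p ^ 2 dvd c" using k(1) dvd_power_same[OF p(2)] by (meson dvd_trans)
    then have pc: "int p ^ 2 dvd int c" by (metis of_nat_dvd_iff of_nat_power)
    have "(int p ^ 2) ^ 2 dvd int c ^ 2" "(int p ^ 2) ^ 3 dvd int c ^ 3" by (rule dvd_power_same[OF pc])+
    then have "int p ^ 4 dvd A" "int p ^ 6 dvd B" unfolding cA cB by (auto simp flip: power_mult)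
    then show False using min[of "int p"] p(1) by simp
  qed
  then show ?thesis using that[OF ab(1-3) m(1) \<epsilon> _ cA cB] by blast
qed

text \<open>The sign is read off from B because models have positive second coordinate. Dividing c
  and c' by their gcd leaves coprime k, k' with k^2 A = k'^2 A' and k^3 B = k'^3 B', and minimality
  of both models gives k = k' = 1.\<close>

lemma bij_betw_twist_by:
  assumes x: "x \<ge> 0"
  shows "bij_betw twist_by ({1, -1} \<times> twist_pairs (root 6 x)) (isogeny_curves x)"
  unfolding bij_betw_def
proof (intro conjI)
  show "inj_on twist_by ({1, -1} \<times> twist_pairs (root 6 x))"
  proof (rule inj_onI)
    fix v w assume vw: "v \<in> {1, -1} \<times> twist_pairs (root 6 x)" "w \<in> {1, -1} \<times> twist_pairs (root 6 x)" "twist_by v = twist_by w"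
    obtain \<epsilon> A B c \<epsilon>' A' B' c' where [simp]: "v = (\<epsilon>, (A, B), c)" "w = (\<epsilon>', (A', B'), c')"
      by (metis surj_pair)
    have m: "(A, B) \<in> models" "(A', B') \<in> models" and sf: "squarefree c" "squarefree c'" and e: "\<epsilon> \<in> {1, -1}" "\<epsilon>' \<in> {1, -1}"
      using vw by (auto simp: twist_pairs_def)
    have B0: "B > 0" "B' > 0" and min: "\<And>p. Factorial_Ring.prime p \<Longrightarrow> \<not> (p ^ 2 dvd A \<and> p ^ 3 dvd B)"
      "\<And>p. Factorial_Ring.prime p \<Longrightarrow> \<not> (p ^ 2 dvd A' \<and> p ^ 3 dvd B')"
      by (rule modelsE[OF m(1)], simp) (rule modelsE[OF m(2)], simp, rule modelsE[OF m(1)], blast, rule modelsE[OF m(2)], blast)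
    have c0: "c > 0" "c' > 0" using sf by (auto intro!: Nat.gr0I)
    have eqA: "int c ^ 2 * A = int c' ^ 2 * A'" and eqB: "\<epsilon> * int c ^ 3 * B = \<epsilon>' * int c' ^ 3 * B'"
      using vw(3) by (auto simp: twist_by_def)
    have pos: "int c ^ 3 * B > 0" "int c' ^ 3 * B' > 0" using c0 B0 by auto
    have ee: "\<epsilon> = \<epsilon>'" using eqB e pos by auto
    have eqB': "int c ^ 3 * B = int c' ^ 3 * B'" using eqB e ee by auto
    have unit: "y = 1" if h: "x ^ 2 * E = y ^ 2 * E'" "x ^ 3 * F = y ^ 3 * F'" "coprime x y" "y > 0"
      "\<And>p. Factorial_Ring.prime p \<Longrightarrow> \<not> (p ^ 2 dvd E \<and> p ^ 3 dvd F)" for x y E E' F F' :: int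
    proof (rule ccontr)
      assume "y \<noteq> 1"
      then have "\<not> is_unit y" using h(4) by auto
      then obtain p where p: "Factorial_Ring.prime p" "p dvd y" using prime_divisor_exists[of y] h(4) by auto
      have c: "coprime (y ^ 2) (x ^ 2)" "coprime (y ^ 3) (x ^ 3)" using h(3) by (simp_all add: coprime_commute)
      have "y ^ 2 dvd x ^ 2 * E" "y ^ 3 dvd x ^ 3 * F" using h(1,2) by simp_all
      then have "y ^ 2 dvd E" "y ^ 3 dvd F" using c by (simp_all only: coprime_dvd_mult_right_iff)
      then have "p ^ 2 dvd E" "p ^ 3 dvd F" using dvd_power_same[OF p(2)] by (meson dvd_trans)+
      then show False using h(5)[OF p(1)] by simp
    qed
    have "gcd (int c) (int c') \<noteq> 0" using c0 by simp
    then obtain g k k' where g: "int c = k * g" "int c' = k' * g" "coprime k k'" "g = gcd (int c) (int c')"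
      using gcd_coprime_exists by metis
    have g0: "g > 0" using g(4) c0 by simp
    have k0: "k > 0" "k' > 0" using g g0 c0 by (metis of_nat_0_less_iff zero_less_mult_pos2)+
    have "g ^ 2 * (k ^ 2 * A) = g ^ 2 * (k' ^ 2 * A')" using eqA unfolding g(1,2) by (simp add: power_mult_distrib mult_ac)
    then have kA: "k ^ 2 * A = k' ^ 2 * A'" using g0 by simp
    have "g ^ 3 * (k ^ 3 * B) = g ^ 3 * (k' ^ 3 * B')" using eqB' unfolding g(1,2) by (simp add: power_mult_distrib mult_ac)
    then have kB: "k ^ 3 * B = k' ^ 3 * B'" using g0 by simp
    have "k' = 1" by (rule unit[OF kA kB g(3) k0(2) min(1)])
    moreover have "k = 1" by (rule unit[OF kA[symmetric] kB[symmetric] _ k0(1) min(2)]) (use g(3) in \<open>simp add: coprime_commute\<close>)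
    ultimately have "c = c'" "A = A'" "B = B'" using g(1,2) kA kB by simp_all
    then show "v = w" using ee by simp
  qed
  show "twist_by ` ({1, -1} \<times> twist_pairs (root 6 x)) = isogeny_curves x"
  proof (intro equalityI subsetI)
    fix v assume "v \<in> twist_by ` ({1, -1} \<times> twist_pairs (root 6 x))"
    then obtain \<epsilon> A0 B0 c where t: "\<epsilon> \<in> {1, -1}" "((A0, B0), c) \<in> twist_pairs (root 6 x)" "v = twist_by (\<epsilon>, (A0, B0), c)" by auto
    have e2: "\<epsilon> ^ 2 = 1" using t(1) by auto
    have mdl: "(A0, B0) \<in> models" and sf: "squarefree c" and w: "model_weight (A0, B0) * real c \<le> root 6 x"
      using t(2) by (auto simp: twist_pairs_def)
    obtain a b where ab: "coprime a b" "a \<noteq> 0" "b > 0" "A_form a b = int (defect a b) ^ 2 * A0"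
      "\<bar>B_form a b\<bar> = int (defect a b) ^ 3 * B0" "B0 > 0" "\<And>p. Factorial_Ring.prime p \<Longrightarrow> \<not> (p ^ 2 dvd A0 \<and> p ^ 3 dvd B0)"
      by (rule modelsE[OF mdl]) blast
    define D where "D = int (defect a b)"
    have D0: "D > 0" using dvd_defect_iff(2)[OF ab(1)] by (simp add: D_def)
    define \<eta> where "\<eta> = sgn (B_form a b)"
    have \<eta>: "\<eta> \<in> {1, -1}" using coprime_forms_nonzero(5)[OF ab(1)] by (auto simp: \<eta>_def sgn_if)
    have Bf: "\<eta> * B_form a b = D ^ 3 * B0" using ab(5) by (simp add: \<eta>_def D_def abs_sgn mult.commute)
    define A where "A = int c ^ 2 * A0"
    define B where "B = \<epsilon> * int c ^ 3 * B0"
    have v: "v = (A, B)" by (simp add: t(3) twist_by_def A_def B_def)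
    have c0: "c > 0" using sf by (auto intro!: Nat.gr0I)
    have disc: "D ^ 6 * (4 * A ^ 3 + 27 * B ^ 2) = int c ^ 6 * (4 * A_form a b ^ 3 + 27 * B_form a b ^ 2)"
    proof -
      have "D ^ 6 * (4 * A ^ 3) = int c ^ 6 * (4 * A_form a b ^ 3)"
        unfolding A_def ab(4) D_def by (simp add: power_mult_distrib flip: power_mult)
      moreover have "D ^ 6 * B ^ 2 = int c ^ 6 * B_form a b ^ 2"
      proof -
        have "D ^ 6 * B ^ 2 = \<epsilon> ^ 2 * int c ^ 6 * (D ^ 3 * B0) ^ 2"
          unfolding B_def by (simp add: power_mult_distrib flip: power_mult)
        also have "\<dots> = \<epsilon> ^ 2 * int c ^ 6 * (\<eta> ^ 2 * B_form a b ^ 2)" unfolding Bf[symmetric] by (simp add: power_mult_distrib)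
        also have "\<eta> ^ 2 = 1" using \<eta> by auto
        finally show ?thesis using e2 by simp
      qed
      ultimately show ?thesis by (simp add: algebra_simps)
    qed
    \<comment> \<open>Here 186624 = 108 * 1728. The excluded cusps a = 0 and b = 0 are exactly what
      keeps the curve nonsingular.\<close>
    have "4 * A_form a b ^ 3 + 27 * B_form a b ^ 2 = - 186624 * q_form a b ^ 2 * (a * b ^ 7)"
      unfolding form_defs by Groebner_Basis.algebra
    then have "4 * A_form a b ^ 3 + 27 * B_form a b ^ 2 \<noteq> 0" using coprime_forms_nonzero(1)[OF ab(1)] ab(2,3) by simp
    then have ns: "4 * A ^ 3 + 27 * B ^ 2 \<noteq> 0" using disc c0 by auto
    have min: "\<not> (l ^ 4 dvd A \<and> l ^ 6 dvd B)" if l: "Factorial_Ring.prime l" for l :: int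
    proof
      assume h: "l ^ 4 dvd A \<and> l ^ 6 dvd B"
      have l0: "l \<noteq> 0" using l by auto
      have Bd: "l ^ 6 dvd int c ^ 3 * B0" using h t(1) unfolding B_def by auto
      have Ad: "l ^ 4 dvd int c ^ 2 * A0" using h unfolding A_def by simp
      \<comment> \<open>A squarefree c contains l at most once, so c^2 and c^3 absorb at most l^2
        and l^3, leaving at least l^2 for A0 and l^3 for B0.\<close>
      have "l ^ 2 dvd A0 \<and> l ^ 3 dvd B0"
      proof (cases "l dvd int c")
        case False
        then have "coprime (l ^ 4) (int c ^ 2)" "coprime (l ^ 6) (int c ^ 3)" using l by (simp_all add: prime_imp_coprime)
        then have "l ^ 4 dvd A0" "l ^ 6 dvd B0" using Ad Bd by (simp_all only: coprime_dvd_mult_right_iff)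
        moreover have "l ^ 2 dvd l ^ 4" "l ^ 3 dvd l ^ 6" by (simp_all add: le_imp_power_dvd)
        ultimately show ?thesis by (meson dvd_trans)
      next
        case True
        then obtain k where k: "int c = l * k" by (elim dvdE)
        have "\<not> l dvd k"
        proof
          assume "l dvd k"
          then have "l ^ 2 dvd int c" unfolding k power2_eq_square by (rule mult_dvd_mono[OF dvd_refl])
          then have "int (nat \<bar>l\<bar> ^ 2) dvd int c" by simp
          then have "nat \<bar>l\<bar> ^ 2 dvd c" by (simp only: of_nat_dvd_iff)
          then have "nat \<bar>l\<bar> dvd 1" by (rule squarefreeD[OF sf])
          then show False using l prime_gt_1_int[OF l] by simp
        qed
        then have cp: "coprime (l ^ 2) (k ^ 2)" "coprime (l ^ 3) (k ^ 3)" using l by (simp_all add: prime_imp_coprime)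
        have "l ^ 2 * l ^ 2 dvd l ^ 2 * (k ^ 2 * A0)" using Ad unfolding k by (simp add: power_mult_distrib mult.assoc flip: power_add)
        then have "l ^ 2 dvd k ^ 2 * A0" using l0 by (simp only: dvd_mult_cancel_left) simp
        moreover have "l ^ 3 * l ^ 3 dvd l ^ 3 * (k ^ 3 * B0)" using Bd unfolding k by (simp add: power_mult_distrib mult.assoc flip: power_add)
        then have "l ^ 3 dvd k ^ 3 * B0" using l0 by (simp only: dvd_mult_cancel_left) simp
        ultimately show ?thesis using cp by (simp only: coprime_dvd_mult_right_iff)
      qed
      then show False using ab(7)[OF l] by simp
    qed
    have "admits_isogeny 7 A B"
    proof (subst seven_isogeny_iff[OF ns], intro exI conjI)
      define s :: rat where "s = of_int (\<epsilon> * \<eta>) * of_nat c / of_int D"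
      show "coprime a b" "a \<noteq> 0" "b > 0" by fact+
      show "s \<noteq> 0" using c0 D0 t(1) \<eta> by (auto simp: s_def)
      have sD: "s * of_int D = of_int (\<epsilon> * \<eta>) * of_nat c" using D0 by (simp add: s_def)
      have e3: "(\<epsilon> * \<eta>) ^ 2 = 1" "(\<epsilon> * \<eta>) ^ 3 = \<epsilon> * \<eta>" using t(1) \<eta> by auto
      have "s ^ 2 * of_int (A_form a b) = (s * of_int D) ^ 2 * of_int A0"
        unfolding ab(4) D_def by (simp add: power_mult_distrib)
      also have "\<dots> = of_int ((\<epsilon> * \<eta>) ^ 2) * of_int A" unfolding sD A_def by (simp add: power_mult_distrib)
      finally show "of_int A = s ^ 2 * of_int (A_form a b)" using e3 by simp
      have Bf': "B_form a b = D ^ 3 * (\<eta> * B0)"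
      proof -
        have "\<eta> * (\<eta> * B_form a b) = B_form a b" using \<eta> by auto
        then show ?thesis unfolding Bf by (simp add: mult.left_commute)
      qed
      have "s ^ 3 * of_int (B_form a b) = (s * of_int D) ^ 3 * of_int (\<eta> * B0)"
        unfolding Bf' by (simp add: power_mult_distrib)
      also have "\<dots> = of_int ((\<epsilon> * \<eta>) ^ 3 * int c ^ 3 * (\<eta> * B0))" unfolding sD by (simp add: power_mult_distrib)
      also have "(\<epsilon> * \<eta>) ^ 3 * int c ^ 3 * (\<eta> * B0) = B" unfolding e3 B_def using \<eta> by auto
      finally show "of_int B = s ^ 3 * of_int (B_form a b)" by simp
    qed
    moreover have "real_of_int (height (A, B)) \<le> x" using twist_weight_le_iff[OF x e2] w unfolding A_def B_def by blast
    ultimately show "v \<in> isogeny_curves x"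
      using ns min by (simp add: v isogeny_curves_def curves_upto_def minimal_curves_def del: height.simps)
  next
    fix v assume v: "v \<in> isogeny_curves x"
    obtain A B where [simp]: "v = (A, B)" by (cases v)
    have mc: "(A, B) \<in> minimal_curves" "admits_isogeny 7 A B" and h: "real_of_int (height (A, B)) \<le> x"
      using v by (auto simp: isogeny_curves_def curves_upto_def simp del: height.simps)
    obtain a b \<epsilon> c A0 B0 where t: "coprime a b" "a \<noteq> 0" "b > 0" "reduced_model (a, b) = (A0, B0)" "\<epsilon> \<in> {1, -1}" "squarefree (c :: nat)"
      "A = int c ^ 2 * A0" "B = \<epsilon> * int c ^ 3 * B0"
      by (rule isogeny_curve_twist[OF mc]) blast
    have "(a, b) \<in> primitive_params" using t by (simp add: primitive_params_def)
    then have "(A0, B0) \<in> models" using t(4) unfolding models_def by (metis imageI)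
    moreover have "\<epsilon> ^ 2 = 1" using t(5) by auto
    then have "model_weight (A0, B0) * real c \<le> root 6 x" using twist_weight_le_iff[OF x] h t(7,8) by blast
    ultimately have "(\<epsilon>, (A0, B0), c) \<in> {1, -1} \<times> twist_pairs (root 6 x)" using t(5,6) by (simp add: twist_pairs_def)
    then show "v \<in> twist_by ` ({1, -1} \<times> twist_pairs (root 6 x))"
      using t(7,8) by (intro image_eqI[of _ _ "(\<epsilon>, (A0, B0), c)"]) (simp_all add: twist_by_def)
  qed
qed

lemma count_eq_twist_pairs:
  assumes "x \<ge> 0"
  shows "count_7_isogeny x = 2 * card (twist_pairs (root 6 x))"
proof -
  have "count_7_isogeny x = card (isogeny_curves x)" by (simp add: count_7_isogeny_def isogeny_curves_def)
  also have "\<dots> = card ({1, -1 :: int} \<times> twist_pairs (root 6 x))"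
    by (rule bij_betw_same_card[OF bij_betw_twist_by[OF assms], symmetric])
  finally show ?thesis by (simp add: card_cartesian_product)
qed

section \<open>Growth of the two factors and the asymptotic formula\<close>

lemma neg_twist_points: "(- a, - b) \<in> twist_points z \<longleftrightarrow> (a, b) \<in> twist_points z"
proof -
  have f: "A_form (- x) (- y) = A_form x y" "B_form (- x) (- y) = B_form x y" for x y :: "'a::idom"
    using A_form_scale[of x "- 1" y] B_form_scale[of x "- 1" y] by simp_all
  have "defect (- a) (- b) = defect a b" by (simp add: defect_def f)
  then show ?thesis by (simp add: twist_points_def region_def f)
qed

text \<open>Both forms have even degree, so (a, b) and (-a, -b) are counted together; normalising b
  > 0 halves the count. Only the four coprime pairs at the cusps are left out.\<close>

lemma card_twist_points_half:
  assumes fin: "finite (twist_points z)"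
  shows "2 * card (twist_points z \<inter> primitive_params) \<le> card (twist_points z)"
    "card (twist_points z) \<le> 2 * card (twist_points z \<inter> primitive_params) + 4"
proof -
  let ?T = "twist_points z \<inter> primitive_params"
  let ?n = "\<lambda>(a, b). (- a, - b :: int)"
  have c: "card (?n ` ?T) = card ?T" by (rule card_image) (auto simp: inj_on_def)
  have disj: "?T \<inter> ?n ` ?T = {}" by (auto simp: primitive_params_def)
  have cU: "card (?T \<union> ?n ` ?T) = 2 * card ?T" using fin disj c by (simp add: card_Un_disjoint)
  have "?T \<union> ?n ` ?T \<subseteq> twist_points z" using neg_twist_points by auto
  then show "2 * card ?T \<le> card (twist_points z)" unfolding cU[symmetric] by (intro card_mono fin)
  have "twist_points z \<subseteq> (?T \<union> ?n ` ?T) \<union> {(1, 0), (-1, 0), (0, 1), (0, -1)}"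
  proof
    fix v assume v: "v \<in> twist_points z"
    obtain a b where [simp]: "v = (a, b)" by (cases v)
    have cop: "coprime a b" using v by (simp add: twist_points_def)
    consider "a = 0" | "b = 0" | "a \<noteq> 0" "b > 0" | "a \<noteq> 0" "b < 0" by linarith
    then show "v \<in> (?T \<union> ?n ` ?T) \<union> {(1, 0), (-1, 0), (0, 1), (0, -1)}"
    proof cases
      case 1
      then have "\<bar>b\<bar> = 1" using cop by simp
      then show ?thesis using 1 by auto
    next
      case 2
      then have "\<bar>a\<bar> = 1" using cop by simp
      then show ?thesis using 2 by auto
    next
      case 3
      then show ?thesis using v cop by (simp add: primitive_params_def)
    next
      case 4
      then have "(- a, - b) \<in> ?T" using v cop neg_twist_points by (simp add: primitive_params_def)
      then have "?n (- a, - b) \<in> ?n ` ?T" by (rule imageI)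
      then show ?thesis by simp
    qed
  qed
  then have "card (twist_points z) \<le> card ((?T \<union> ?n ` ?T) \<union> {(1, 0), (-1, 0), (0, 1), (0, -1)})"
    using fin by (intro card_mono) auto
  also have "\<dots> \<le> card (?T \<union> ?n ` ?T) + card {(1, 0), (-1, 0), (0, 1), (0, -1 :: int) :: int \<times> int}" by (rule card_Un_le)
  also have "card {(1, 0), (-1, 0), (0, 1), (0, -1 :: int) :: int \<times> int} \<le> 4" by (simp add: card_insert_if)
  finally show "card (twist_points z) \<le> 2 * card ?T + 4" using cU by simp
qed

lemma finite_twist_points: "z \<ge> 1 \<Longrightarrow> finite (twist_points z)"
  using card_twist_points(1) real_arch_simple by metis

lemma models_upto: "z \<ge> 0 \<Longrightarrow> {E \<in> models. model_weight E \<le> z} = reduced_model ` (twist_points z \<inter> primitive_params)"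
  using reduced_model_weight_le_iff by (fastforce simp: models_def primitive_params_def)

text \<open>The reduced model is injective away from the coincidences, so the number of models is
  half the number of twist points up to the permitted error.\<close>

lemma linear_growth_models:
  obtains \<kappa> C where "\<kappa> > 0" "linear_growth models model_weight \<kappa> C (17/20)"
proof -
  obtain \<kappa> C where C: "C \<ge> 0" "\<And>y. y \<ge> 1 \<Longrightarrow> \<bar>real (card (twist_points y)) - \<kappa> * y\<bar> \<le> C * y powr (17/20)"
    by (rule twist_points_asymp) blast
  obtain C' where C': "C' \<ge> 0" "\<And>z. z \<ge> 1 \<Longrightarrow> real (card (coincidences z)) \<le> C' * z powr (17/20)"
    by (rule card_coincidences) blast
  have "\<kappa> > 0"
  proof (rule linear_constant_pos[of "\<lambda>y. real (card (twist_points y))" \<kappa> C "17/20" "1/400"])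
    show "\<exists>y\<ge>N. y \<ge> 1 \<and> 1/400 * y \<le> real (card (twist_points y))" for N
    proof -
      define n where "n = max 1 (nat \<lceil>N\<rceil>)"
      have n: "n \<ge> 1" "real n \<ge> N" unfolding n_def by linarith+
      have "real n \<le> 100 * real n ^ 2" using n(1) by (simp add: power2_eq_square)
      moreover have "1 \<le> real n" using n(1) by simp
      ultimately have "100 * real n ^ 2 \<ge> N" "100 * real n ^ 2 \<ge> 1" using n by linarith+
      moreover have "1/400 * (100 * real n ^ 2) \<le> real (card (twist_points (100 * real n ^ 2)))"
        using card_twist_points_lower[OF n(1) refl] by simp
      ultimately show ?thesis by blast
    qed
  qed (use C in auto)
  moreover have "linear_growth models model_weight (\<kappa> / 2) (C + 2 + C') (17/20)"
  proof
    show "1 \<le> model_weight i" if "i \<in> models" for i using model_weight_ge_1[OF that] .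
    show "finite {i \<in> models. model_weight i \<le> z}" for z
    proof -
      have "{i \<in> models. model_weight i \<le> z} \<subseteq> {i \<in> models. model_weight i \<le> max 1 z}" by auto
      moreover have "finite {i \<in> models. model_weight i \<le> max 1 z}"
        by (subst models_upto) (auto intro!: finite_imageI finite_subset[OF _ finite_twist_points[of "max 1 z"]])
      ultimately show ?thesis by (rule finite_subset)
    qed
    show "\<bar>real (card {i \<in> models. model_weight i \<le> z}) - \<kappa> / 2 * z\<bar> \<le> (C + 2 + C') * z powr (17/20)" if z: "z \<ge> 1" for z
    proof -
      let ?T = "twist_points z \<inter> primitive_params"
      have fin: "finite ?T" using finite_twist_points[OF z] by auto
      have V: "{i \<in> models. model_weight i \<le> z} = reduced_model ` ?T" using models_upto[of z] z by simp
      have up: "card (reduced_model ` ?T) \<le> card ?T" using fin by (rule card_image_le)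
      have sub: "coincidences z \<subseteq> ?T" by (auto simp: coincidences_def)
      have "inj_on reduced_model (?T - coincidences z)" by (auto simp: inj_on_def coincidences_def)
      then have "card (?T - coincidences z) = card (reduced_model ` (?T - coincidences z))" by (simp add: card_image)
      also have "\<dots> \<le> card (reduced_model ` ?T)" using fin by (intro card_mono) auto
      finally have low: "card ?T \<le> card (reduced_model ` ?T) + card (coincidences z)"
        using card_Diff_subset[OF finite_subset[OF sub fin] sub] by linarith
      have h: "2 * real (card ?T) \<le> real (card (twist_points z))" "real (card (twist_points z)) \<le> 2 * real (card ?T) + 4"
        using card_twist_points_half[OF finite_twist_points[OF z]] by linarith+
      have p1: "1 \<le> z powr (17/20)" using z by (simp add: ge_one_powr_ge_zero)
      have Cp: "0 \<le> C * z powr (17/20)" "0 \<le> C' * z powr (17/20)" using C(1) C'(1) by auto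
      have "\<bar>real (card (reduced_model ` ?T)) - \<kappa> / 2 * z\<bar> \<le> C * z powr (17/20) + 2 * z powr (17/20) + C' * z powr (17/20)"
        using C(2)[OF z] C'(2)[OF z] h up low p1 Cp by linarith
      then show ?thesis unfolding V by (simp add: algebra_simps)
    qed
  qed (use C(1) C'(1) in auto)
  ultimately show ?thesis using that[of "\<kappa> / 2"] by auto
qed

lemma linear_growth_squarefree:
  obtains \<theta> D where "\<theta> > 0" "linear_growth {c. squarefree c} real \<theta> D (3/5)"
proof -
  obtain \<theta> D where D: "D \<ge> 0" "\<And>y. y \<ge> 1 \<Longrightarrow> \<bar>real (card (squarefree_upto y)) - \<theta> * y\<bar> \<le> D * y powr (3/5)"
    by (rule squarefree_upto_asymp) blast
  have "\<theta> > 0"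
  proof (rule linear_constant_pos[of "\<lambda>y. real (card (squarefree_upto y))" \<theta> D "3/5" "1/4"])
    show "\<exists>y\<ge>N. y \<ge> 1 \<and> 1/4 * y \<le> real (card (squarefree_upto y))" for N
    proof -
      define n where "n = max 1 (nat \<lceil>N\<rceil>)"
      have n: "n \<ge> 1" "real n \<ge> N" "real n \<ge> 1" unfolding n_def by linarith+
      then show ?thesis using card_squarefree_lower[OF n(1)] by (intro exI[of _ "real n"]) auto
    qed
  qed (use D in auto)
  moreover have eq: "{i \<in> {c. squarefree c}. real i \<le> z} = squarefree_upto z" for z by (auto simp: squarefree_upto_def)
  have "linear_growth {c. squarefree c} real \<theta> D (3/5)"
  proof
    show "1 \<le> real i" if "i \<in> {c. squarefree c}" for i :: nat using that by (cases "i = 0") auto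
    show "finite {i \<in> {c. squarefree c}. real i \<le> z}" for z unfolding eq by (rule finite_squarefree_upto)
    show "\<bar>real (card {i \<in> {c. squarefree c}. real i \<le> z}) - \<theta> * z\<bar> \<le> D * z powr (3/5)" if "z \<ge> 1" for z
      unfolding eq using D(2)[OF that] .
  qed (use D(1) in auto)
  ultimately show ?thesis using that by blast
qed

theorem count_7_isogeny_asymp:
  obtains c1 c2 K where "c1 > 0" "K \<ge> 0" "\<And>x. x \<ge> 1 \<Longrightarrow>
    \<bar>real (count_7_isogeny x) - (c1 * x powr (1/6) * ln x + c2 * x powr (1/6))\<bar> \<le> K * x powr (3/20)"
proof -
  obtain \<kappa> C where M: "\<kappa> > 0" "linear_growth models model_weight \<kappa> C (17/20)" by (rule linear_growth_models)
  obtain \<theta> D where S: "\<theta> > 0" "linear_growth {c. squarefree c} real \<theta> D (3/5)" by (rule linear_growth_squarefree)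
  obtain c K where K: "K \<ge> 0" "\<And>Y. Y \<ge> 1 \<Longrightarrow> finite {(i, j) \<in> models \<times> {c. squarefree c}. model_weight i * real j \<le> Y} \<and>
    \<bar>real (card {(i, j) \<in> models \<times> {c. squarefree c}. model_weight i * real j \<le> Y}) - (\<kappa> * \<theta> * Y * ln Y + c * Y)\<bar> \<le> K * Y powr (9/10)"
    by (rule hyperbola_method[OF M(2) S(2)]) blast
  \<comment> \<open>The two signs of a twist contribute the factor 2 and ln Y = ln x / 6, whence the
    leading constant \<kappa> \<theta> / 3.\<close>
  have "\<bar>real (count_7_isogeny x) - (\<kappa> * \<theta> / 3 * x powr (1/6) * ln x + 2 * c * x powr (1/6))\<bar> \<le> 2 * K * x powr (3/20)" if x: "x \<ge> 1" for x
  proof -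
    define Y where "Y = root 6 x"
    have Y1: "Y \<ge> 1" using x by (simp add: Y_def real_root_ge_1_iff)
    have Yp: "Y = x powr (1/6)" using x by (simp add: Y_def root_powr_inverse)
    have lnY: "ln Y = ln x / 6" unfolding Yp by simp
    have Y9: "Y powr (9/10) = x powr (3/20)" unfolding Yp by (simp add: powr_powr)
    have "real (count_7_isogeny x) = 2 * real (card (twist_pairs Y))"
      using count_eq_twist_pairs[of x] x by (simp add: Y_def)
    moreover have "\<bar>real (card (twist_pairs Y)) - (\<kappa> * \<theta> * Y * ln Y + c * Y)\<bar> \<le> K * Y powr (9/10)"
      using K(2)[OF Y1] by (simp add: twist_pairs_def)
    ultimately have "\<bar>real (count_7_isogeny x) - 2 * (\<kappa> * \<theta> * Y * ln Y + c * Y)\<bar> \<le> 2 * (K * Y powr (9/10))"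
      by (simp add: abs_mult flip: right_diff_distrib)
    also have "2 * (\<kappa> * \<theta> * Y * ln Y + c * Y) = \<kappa> * \<theta> / 3 * x powr (1/6) * ln x + 2 * c * x powr (1/6)"
      unfolding lnY Yp by (simp add: field_simps)
    finally show ?thesis unfolding Y9 by simp
  qed
  then show ?thesis using that[of "\<kappa> * \<theta> / 3" "2 * K" "2 * c"] M(1) S(1) K(1) by simp
qed

section \<open>A language of recursive functions\<close>

text \<open>Agreement is asked only on argument lists of the right length, so that functions may be
  rewritten freely without controlling their values elsewhere.\<close>

definition trec :: "nat \<Rightarrow> (nat list \<Rightarrow> nat) \<Rightarrow> bool" where
  "trec k f \<longleftrightarrow> (\<exists>F. total_recursive k F \<and> (\<forall>xs. length xs = k \<longrightarrow> F xs = f xs))"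

lemma trecI: "total_recursive k f \<Longrightarrow> trec k f"
  by (auto simp: trec_def)

lemma trec_cong: "trec k f \<Longrightarrow> (\<And>xs. length xs = k \<Longrightarrow> f xs = g xs) \<Longrightarrow> trec k g"
  unfolding trec_def by metis

lemma trec_comp:
  assumes "trec (length gs) f" "\<And>g. g \<in> set gs \<Longrightarrow> trec k g"
  shows "trec k (\<lambda>xs. f (map (\<lambda>g. g xs) gs))"
proof -
  obtain F where F: "total_recursive (length gs) F" "\<And>xs. length xs = length gs \<Longrightarrow> F xs = f xs"
    using assms(1) by (auto simp: trec_def)
  define G where "G g = (SOME G. total_recursive k G \<and> (\<forall>xs. length xs = k \<longrightarrow> G xs = g xs))" for g
  have G: "total_recursive k (G g) \<and> (\<forall>xs. length xs = k \<longrightarrow> G g xs = g xs)" if "g \<in> set gs" for g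
    unfolding G_def using assms(2)[OF that] unfolding trec_def by (rule someI_ex)
  have "total_recursive k (\<lambda>xs. F (map (\<lambda>g. g xs) (map G gs)))"
    by (rule total_recursive.comp) (use F(1) G in auto)
  then have "trec k (\<lambda>xs. F (map (\<lambda>g. g xs) (map G gs)))" by (rule trecI)
  then show ?thesis
  proof (rule trec_cong)
    fix xs :: "nat list" assume "length xs = k"
    then have "map (\<lambda>g. g xs) (map G gs) = map (\<lambda>g. g xs) gs" using G by simp
    then show "F (map (\<lambda>g. g xs) (map G gs)) = f (map (\<lambda>g. g xs) gs)"
      by (simp only:) (simp add: F(2))
  qed
qed

lemma trec_zero: "trec k (\<lambda>xs. 0)"
  by (rule trecI) (rule total_recursive.zero)

lemma trec_proj: "i < k \<Longrightarrow> trec k (\<lambda>xs. xs ! i)"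
  by (rule trecI) (rule total_recursive.proj)

lemma trec_Suc: "trec k g \<Longrightarrow> trec k (\<lambda>xs. Suc (g xs))"
  using trec_comp[of "[g]" "\<lambda>xs. Suc (hd xs)" k] trecI[OF total_recursive.succ] by simp

lemma trec_const: "trec k (\<lambda>xs. c)"
  by (induction c) (use trec_zero trec_Suc in auto)

lemma trec_drop:
  assumes "trec k f"
  shows "trec (j + k) (\<lambda>xs. f (drop j xs))"
proof -
  have "trec (j + k) (\<lambda>xs. f (map (\<lambda>g. g xs) (map (\<lambda>i xs. xs ! (j + i)) [0..<k])))"
    by (rule trec_comp) (use assms in \<open>auto intro: trec_proj\<close>)
  then show ?thesis
  proof (rule trec_cong)
    fix xs :: "nat list" assume "length xs = j + k"
    then have "map (\<lambda>g. g xs) (map (\<lambda>i xs. xs ! (j + i)) [0..<k]) = drop j xs"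
      by (intro nth_equalityI) auto
    then show "f (map (\<lambda>g. g xs) (map (\<lambda>i xs. xs ! (j + i)) [0..<k])) = f (drop j xs)" by simp
  qed
qed

lemma trec_subst:
  assumes "trec (length gs + k) f" "\<And>g. g \<in> set gs \<Longrightarrow> trec (j + k) g"
  shows "trec (j + k) (\<lambda>xs. f (map (\<lambda>g. g xs) gs @ drop j xs))"
proof -
  let ?hs = "gs @ map (\<lambda>i xs. xs ! (j + i)) [0..<k]"
  have "trec (j + k) (\<lambda>xs. f (map (\<lambda>g. g xs) ?hs))"
    by (rule trec_comp) (use assms in \<open>auto intro: trec_proj\<close>)
  then show ?thesis
  proof (rule trec_cong)
    fix xs :: "nat list" assume "length xs = j + k"
    then have "map (\<lambda>g. g xs) (map (\<lambda>i xs. xs ! (j + i)) [0..<k]) = drop j xs"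
      by (intro nth_equalityI) auto
    then show "f (map (\<lambda>g. g xs) ?hs) = f (map (\<lambda>g. g xs) gs @ drop j xs)" by simp
  qed
qed

lemma trec_rec:
  assumes "trec k t" "trec k f" "trec (2 + k) g"
  shows "trec k (\<lambda>xs. rec_nat (f xs) (\<lambda>n r. g (n # r # xs)) (t xs))"
proof -
  obtain F where F: "total_recursive k F" "\<And>xs. length xs = k \<Longrightarrow> F xs = f xs"
    using assms(2) by (auto simp: trec_def)
  obtain G where G: "total_recursive (Suc (Suc k)) G" "\<And>xs. length xs = Suc (Suc k) \<Longrightarrow> G xs = g xs"
    using assms(3) by (auto simp: trec_def)
  have "trec (1 + k) (\<lambda>xs. rec_nat (F (tl xs)) (\<lambda>n r. G (n # r # tl xs)) (hd xs))"
    using total_recursive.prim_rec[OF F(1) G(1)] by (simp add: trecI)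
  then have "trec (1 + k) (\<lambda>xs. rec_nat (f (tl xs)) (\<lambda>n r. g (n # r # tl xs)) (hd xs))"
    by (rule trec_cong) (simp add: F(2) G(2))
  then have "trec (0 + k) (\<lambda>xs. rec_nat (f (tl (map (\<lambda>g. g xs) [t] @ drop 0 xs)))
      (\<lambda>n r. g (n # r # tl (map (\<lambda>g. g xs) [t] @ drop 0 xs))) (hd (map (\<lambda>g. g xs) [t] @ drop 0 xs)))"
    by (intro trec_subst[of "[t]" k _ 0]) (use assms(1) in auto)
  then show ?thesis by simp
qed

lemma trec_add:
  assumes "trec k a" "trec k b"
  shows "trec k (\<lambda>xs. a xs + b xs)"
proof -
  have "trec k (\<lambda>xs. rec_nat (b xs) (\<lambda>n r. Suc ((n # r # xs) ! 1)) (a xs))"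
    by (rule trec_rec[OF assms, of "\<lambda>ys. Suc (ys ! 1)"]) (simp add: trec_Suc trec_proj)
  moreover have "rec_nat m (\<lambda>n r. Suc r) n = n + m" for m n :: nat by (induction n) auto
  ultimately show ?thesis by simp
qed

lemma trec_mult:
  assumes "trec k a" "trec k b"
  shows "trec k (\<lambda>xs. a xs * b xs)"
proof -
  have "trec k (\<lambda>xs. rec_nat 0 (\<lambda>n r. (n # r # xs) ! 1 + b (drop 2 (n # r # xs))) (a xs))"
    by (rule trec_rec[OF assms(1) trec_zero, of "\<lambda>ys. ys ! 1 + b (drop 2 ys)"])
      (intro trec_add trec_proj trec_drop assms, simp)
  moreover have "rec_nat 0 (\<lambda>n r. r + m) n = n * m" for m n :: nat by (induction n) auto
  ultimately show ?thesis by simp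
qed

lemma trec_monus:
  assumes "trec k a" "trec k b"
  shows "trec k (\<lambda>xs. a xs - b xs)"
proof -
  have pred: "trec j (\<lambda>xs. c xs - 1)" if c: "trec j c" for j c
  proof -
    have "trec j (\<lambda>xs. rec_nat 0 (\<lambda>n r. (n # r # xs) ! 0) (c xs))"
      by (rule trec_rec[OF c trec_zero, of "\<lambda>ys. ys ! 0"]) (simp add: trec_proj)
    moreover have "rec_nat 0 (\<lambda>n r. n) n = n - 1" for n :: nat by (cases n) auto
    ultimately show ?thesis by simp
  qed
  have "trec k (\<lambda>xs. rec_nat (a xs) (\<lambda>n r. (n # r # xs) ! 1 - 1) (b xs))"
    by (rule trec_rec[OF assms(2,1), of "\<lambda>ys. ys ! 1 - 1"]) (rule pred, simp add: trec_proj)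
  moreover have "rec_nat m (\<lambda>n r. r - 1) n = m - n" for m n :: nat by (induction n) auto
  ultimately show ?thesis by simp
qed

lemma trec_pow2:
  assumes "trec k a"
  shows "trec k (\<lambda>xs. 2 ^ a xs)"
proof -
  have "trec k (\<lambda>xs. rec_nat 1 (\<lambda>n r. (n # r # xs) ! 1 + (n # r # xs) ! 1) (a xs))"
    by (rule trec_rec[OF assms trec_const, of "\<lambda>ys. ys ! 1 + ys ! 1"]) (simp add: trec_proj trec_add)
  moreover have "rec_nat 1 (\<lambda>n r. r + r) n = (2::nat) ^ n" for n by (induction n) auto
  ultimately show ?thesis by simp
qed

lemma trec_sum:
  assumes "trec k t" "trec (1 + k) g"
  shows "trec k (\<lambda>xs. \<Sum>i<t xs. g (i # xs))"
proof -
  have "trec (2 + k) (\<lambda>ys. g (map (\<lambda>h. h ys) [\<lambda>ys. ys ! 0] @ drop 2 ys))"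
    by (rule trec_subst) (use assms(2) in \<open>auto intro: trec_proj\<close>)
  then have "trec k (\<lambda>xs. rec_nat 0 (\<lambda>n r. (n # r # xs) ! 1 + g (map (\<lambda>h. h (n # r # xs)) [\<lambda>ys. ys ! 0] @ drop 2 (n # r # xs))) (t xs))"
    by (intro trec_rec[OF assms(1) trec_zero, of "\<lambda>ys. ys ! 1 + g (map (\<lambda>h. h ys) [\<lambda>ys. ys ! 0] @ drop 2 ys)"] trec_add)
      (simp_all add: trec_proj)
  moreover have "rec_nat 0 (\<lambda>n r. r + g (n # xs)) m = (\<Sum>i<m. g (i # xs))" for m xs by (induction m) auto
  ultimately show ?thesis by simp
qed

text \<open>Variables are de Bruijn indices into the argument list; \<open>ESum\<close> and \<open>ELet\<close> bind index \<open>0\<close>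
  in their second argument.\<close>

datatype expr = EVar nat | EConst nat | EAdd expr expr | EMul expr expr | EMonus expr expr
  | EPow2 expr | ESum expr expr | ELet expr expr

fun ev :: "expr \<Rightarrow> nat list \<Rightarrow> nat" where
  "ev (EVar i) xs = (if i < length xs then xs ! i else 0)"
| "ev (EConst c) xs = c"
| "ev (EAdd d e) xs = ev d xs + ev e xs"
| "ev (EMul d e) xs = ev d xs * ev e xs"
| "ev (EMonus d e) xs = ev d xs - ev e xs"
| "ev (EPow2 e) xs = 2 ^ ev e xs"
| "ev (ESum d e) xs = (\<Sum>i<ev d xs. ev e (i # xs))"
| "ev (ELet d e) xs = ev e (ev d xs # xs)"

lemma ev_eqs:
  "ev (EConst c) = (\<lambda>xs. c)" "ev (EAdd d e) = (\<lambda>xs. ev d xs + ev e xs)"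
  "ev (EMul d e) = (\<lambda>xs. ev d xs * ev e xs)" "ev (EMonus d e) = (\<lambda>xs. ev d xs - ev e xs)"
  "ev (EPow2 e) = (\<lambda>xs. 2 ^ ev e xs)" "ev (ESum d e) = (\<lambda>xs. \<Sum>i<ev d xs. ev e (i # xs))"
  "ev (ELet d e) = (\<lambda>xs. ev e (ev d xs # xs))"
  by (simp_all add: fun_eq_iff)

lemma trec_ev: "trec k (ev e)"
proof (induction e arbitrary: k)
  case (EVar i)
  have "trec k (\<lambda>xs. if i < k then xs ! i else 0)" by (cases "i < k") (auto intro: trec_proj trec_zero)
  then show ?case by (rule trec_cong) simp
next
  case (ELet d e)
  have "trec (0 + k) (\<lambda>xs. ev e (map (\<lambda>g. g xs) [ev d] @ drop 0 xs))"
    by (rule trec_subst) (use ELet in auto)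
  then show ?case by (simp add: ev_eqs)
next
  case (ESum d e)
  then show ?case using trec_sum[of k "ev d" "ev e"] by (simp add: ev_eqs)
qed (simp_all add: ev_eqs trec_const trec_add trec_mult trec_monus trec_pow2)

lemma computable_fun_ev: "computable_fun (\<lambda>n. ev e [n])"
  using trec_ev[of 1 e] unfolding trec_def computable_fun_def by auto

lemma effectively_computableI:
  assumes "\<And>n. \<bar>c - (real (ev e\<^sub>1 [n]) - real (ev e\<^sub>2 [n])) / (real (ev e\<^sub>3 [n]) + 1)\<bar> \<le> 1 / 2 ^ n"
  shows "effectively_computable c"
  unfolding effectively_computable_def using computable_fun_ev assms by blast

section \<open>Predicates and integer arithmetic in the language\<close>

text \<open>Truth is any nonzero value, so products serve as conjunctions and bounded sums as
  bounded existential quantifiers.\<close>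

definition holds :: "expr \<Rightarrow> nat list \<Rightarrow> bool" where "holds e xs \<longleftrightarrow> ev e xs \<noteq> 0"

definition ENot :: "expr \<Rightarrow> expr" where "ENot e = EMonus (EConst 1) e"
definition EEx :: "expr \<Rightarrow> expr \<Rightarrow> expr" where "EEx d e = ESum d e"
definition ELe :: "expr \<Rightarrow> expr \<Rightarrow> expr" where "ELe d e = ENot (EMonus d e)"

lemma ev_ENot: "ev (ENot e) xs = of_bool (\<not> holds e xs)"
  by (simp add: ENot_def holds_def)

lemma holds_simps [simp]:
  "holds (ENot e) xs \<longleftrightarrow> \<not> holds e xs"
  "holds (EMul d e) xs \<longleftrightarrow> holds d xs \<and> holds e xs"
  "holds (EEx d e) xs \<longleftrightarrow> (\<exists>i<ev d xs. holds e (i # xs))"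
  "holds (ELe d e) xs \<longleftrightarrow> ev d xs \<le> ev e xs"
  by (auto simp: holds_def ENot_def EEx_def ELe_def)

text \<open>Integer expressions, as formal differences.\<close>

fun ival :: "expr \<times> expr \<Rightarrow> nat list \<Rightarrow> int" where
  "ival (p, q) xs = int (ev p xs) - int (ev q xs)"

fun iadd :: "expr \<times> expr \<Rightarrow> expr \<times> expr \<Rightarrow> expr \<times> expr" where
  "iadd (p, q) (p', q') = (EAdd p p', EAdd q q')"

fun imul :: "expr \<times> expr \<Rightarrow> expr \<times> expr \<Rightarrow> expr \<times> expr" where
  "imul (p, q) (p', q') = (EAdd (EMul p p') (EMul q q'), EAdd (EMul p q') (EMul q p'))"

fun ipow :: "expr \<times> expr \<Rightarrow> nat \<Rightarrow> expr \<times> expr" where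
  "ipow p 0 = (EConst 1, EConst 0)"
| "ipow p (Suc n) = imul p (ipow p n)"

definition iconst :: "int \<Rightarrow> expr \<times> expr" where
  "iconst c = (EConst (nat c), EConst (nat (- c)))"

fun ile :: "expr \<times> expr \<Rightarrow> expr \<times> expr \<Rightarrow> expr" where
  "ile (p, q) (p', q') = ELe (EAdd p q') (EAdd p' q)"

definition ieq :: "expr \<times> expr \<Rightarrow> expr \<times> expr \<Rightarrow> expr" where
  "ieq p q = EMul (ile p q) (ile q p)"

lemma ival_simps [simp]:
  "ival (iadd p q) xs = ival p xs + ival q xs"
  "ival (imul p q) xs = ival p xs * ival q xs"
  "ival (ipow p n) xs = ival p xs ^ n"
  "ival (iconst c) xs = c"
  "holds (ile p q) xs \<longleftrightarrow> ival p xs \<le> ival q xs"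
  "holds (ieq p q) xs \<longleftrightarrow> ival p xs = ival q xs"
proof -
  show "ival (iadd p q) xs = ival p xs + ival q xs" by (cases p; cases q) simp
  show m: "ival (imul p q) xs = ival p xs * ival q xs" for p q by (cases p; cases q) (simp add: algebra_simps)
  show "ival (ipow p n) xs = ival p xs ^ n" by (induction n) (simp_all add: m)
  show "ival (iconst c) xs = c" by (simp add: iconst_def)
  show l: "holds (ile p q) xs \<longleftrightarrow> ival p xs \<le> ival q xs" for p q by (cases p; cases q) auto
  show "holds (ieq p q) xs \<longleftrightarrow> ival p xs = ival q xs" by (auto simp: ieq_def l)
qed

section \<open>Computing the counting function\<close>

lemma dvd_iff_bounded:
  fixes d A :: int
  assumes "d > 0" "\<bar>A\<bar> \<le> int M"
  shows "d dvd A \<longleftrightarrow> (\<exists>u<2 * M + 1. A = d * (int u - int M))"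
proof
  assume "d dvd A"
  then obtain k where k: "A = d * k" by (elim dvdE)
  have "\<bar>k\<bar> \<le> d * \<bar>k\<bar>" using assms(1) by (simp add: mult_le_cancel_right1)
  then have "\<bar>k\<bar> \<le> int M" using assms k by (simp add: abs_mult)
  then show "\<exists>u<2 * M + 1. A = d * (int u - int M)"
    by (intro exI[of _ "nat (k + int M)"]) (use k in auto)
qed auto

text \<open>Primality is traded for l \<ge> 2, written as l + 2 with natural l, since a prime factor
  of l inherits both divisibilities. The bounds come from whichever of A, B is nonzero; quotients
  are shifted to be natural numbers.\<close>

lemma minimal_iff_bounded:
  assumes "\<bar>A\<bar> \<le> int M" "\<bar>B\<bar> \<le> int N" "A \<noteq> 0 \<or> B \<noteq> 0"
  shows "(\<exists>l::int. Factorial_Ring.prime l \<and> l ^ 4 dvd A \<and> l ^ 6 dvd B) \<longleftrightarrow>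
    (\<exists>l<M + N + 1. (\<exists>u<2 * M + 1. A = (int l + 2) ^ 4 * (int u - int M)) \<and>
      (\<exists>v<2 * N + 1. B = (int l + 2) ^ 6 * (int v - int N)))"
proof -
  have "(\<exists>l::int. Factorial_Ring.prime l \<and> l ^ 4 dvd A \<and> l ^ 6 dvd B) \<longleftrightarrow>
    (\<exists>l<M + N + 1. (int l + 2) ^ 4 dvd A \<and> (int l + 2) ^ 6 dvd B)"
  proof
    assume "\<exists>l::int. Factorial_Ring.prime l \<and> l ^ 4 dvd A \<and> l ^ 6 dvd B"
    then obtain l :: int where l: "Factorial_Ring.prime l" "l ^ 4 dvd A" "l ^ 6 dvd B" by blast
    have l2: "l \<ge> 2" using prime_ge_2_int[OF l(1)] .
    have le: "l \<le> \<bar>x\<bar>" if "l ^ k dvd x" "x \<noteq> 0" "k > 0" for x k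
    proof -
      have "l dvd x" using that by (meson dvd_power dvd_trans)
      then have "\<bar>l\<bar> \<le> \<bar>x\<bar>" using that(2) by (rule dvd_imp_le_int[rotated])
      then show ?thesis using l2 by simp
    qed
    have "l \<le> int M \<or> l \<le> int N"
      using assms le[OF l(2)] le[OF l(3)] by fastforce
    then have "nat (l - 2) < M + N + 1" using l2 by auto
    then show "\<exists>l<M + N + 1. (int l + 2) ^ 4 dvd A \<and> (int l + 2) ^ 6 dvd B"
      by (intro exI[of _ "nat (l - 2)"]) (use l l2 in simp)
  next
    assume "\<exists>l<M + N + 1. (int l + 2) ^ 4 dvd A \<and> (int l + 2) ^ 6 dvd B"
    then obtain l where l: "(int l + 2) ^ 4 dvd A" "(int l + 2) ^ 6 dvd B" by blast
    obtain p where p: "Factorial_Ring.prime p" "p dvd int l + 2"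
      using prime_divisor_exists[of "int l + 2"] by (auto simp: zdvd_not_zless)
    have "p ^ 4 dvd A" "p ^ 6 dvd B"
      by (rule dvd_trans[OF dvd_power_same[OF p(2)] l(1)], rule dvd_trans[OF dvd_power_same[OF p(2)] l(2)])
    then show "\<exists>l::int. Factorial_Ring.prime l \<and> l ^ 4 dvd A \<and> l ^ 6 dvd B" using p(1) by blast
  qed
  then show ?thesis using assms by (simp add: dvd_iff_bounded)
qed

text \<open>This replaces the Galois condition by a finite search. The witnesses are the parameter
  (a, b), the defect D as denominator n and the signed twist as numerator m; height at most Y^6
  gives D \<le> K Y, twist at most Y, and |a|, |b| \<le> 9 sqrt(D Y) \<le> 9 K Y. Conversely any
  solution, coprime or not, supplies t = a/b and s = m b^2 / n.\<close>

lemma isogeny_iff_bounded: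
  assumes AB: "(A, B) \<in> minimal_curves" and h: "height (A, B) \<le> int Y ^ 6" and Y: "Y \<ge> 1"
  defines "L \<equiv> 9 * defect_bound * Y"
  shows "admits_isogeny 7 A B \<longleftrightarrow> (\<exists>a<2 * L + 1. \<exists>b<L. \<exists>m<2 * L + 1. \<exists>n<L.
    (int n + 1) ^ 2 * A = (int m - int L) ^ 2 * A_form (int a - int L) (int b + 1) \<and>
    (int n + 1) ^ 3 * B = (int m - int L) ^ 3 * B_form (int a - int L) (int b + 1))"
proof
  have ns: "4 * A ^ 3 + 27 * B ^ 2 \<noteq> 0" using AB by (auto simp: minimal_curves_def)
  assume "\<exists>a<2 * L + 1. \<exists>b<L. \<exists>m<2 * L + 1. \<exists>n<L.
    (int n + 1) ^ 2 * A = (int m - int L) ^ 2 * A_form (int a - int L) (int b + 1) \<and>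
    (int n + 1) ^ 3 * B = (int m - int L) ^ 3 * B_form (int a - int L) (int b + 1)"
  then obtain a b m n :: int where e: "b > 0" "n > 0" "n ^ 2 * A = m ^ 2 * A_form a b" "n ^ 3 * B = m ^ 3 * B_form a b"
    by (metis add_pos_nonneg add.commute of_nat_0_le_iff zero_less_one)
  have m0: "m \<noteq> 0"
  proof
    assume "m = 0"
    then have "A = 0" "B = 0" using e by auto
    then show False using ns by simp
  qed
  define t s :: rat where "t = of_int a / of_int b" and "s = of_int m / of_int n * of_int b ^ 2"
  have ab: "of_int a = t * of_int b" "(of_int b :: rat) = 1 * of_int b" using e(1) by (simp_all add: t_def)
  have sn: "s * of_int n = of_int m * of_int b ^ 2" using e(2) by (simp add: s_def)
  have n0: "(of_int n :: rat) \<noteq> 0" using e(2) by simp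
  have fA: "of_int (A_form a b) = of_int b ^ 4 * A_form t 1" unfolding form_of_int[symmetric]
    by (subst ab(1), subst ab(2)) (rule A_form_scale)
  have fB: "of_int (B_form a b) = of_int b ^ 6 * B_form t 1" unfolding form_of_int[symmetric]
    by (subst ab(1), subst ab(2)) (rule B_form_scale)
  show "admits_isogeny 7 A B"
  proof (rule parametrized_imp_isogeny[OF ns])
    show "s \<noteq> 0" using m0 e by (simp add: s_def)
    have "of_int n ^ 2 * (of_int A :: rat) = of_int (m ^ 2 * A_form a b)" unfolding e(3)[symmetric] by simp
    also have "\<dots> = (of_int m * of_int b ^ 2) ^ 2 * A_form t 1" by (simp add: fA power_mult_distrib flip: power_mult)
    also have "\<dots> = of_int n ^ 2 * (s ^ 2 * A_form t 1)" unfolding sn[symmetric] by (simp add: power_mult_distrib)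
    finally show "of_int A = s ^ 2 * A_form t 1" using n0 by simp
    have "of_int n ^ 3 * (of_int B :: rat) = of_int (m ^ 3 * B_form a b)" unfolding e(4)[symmetric] by simp
    also have "\<dots> = (of_int m * of_int b ^ 2) ^ 3 * B_form t 1" by (simp add: fB power_mult_distrib flip: power_mult)
    also have "\<dots> = of_int n ^ 3 * (s ^ 3 * B_form t 1)" unfolding sn[symmetric] by (simp add: power_mult_distrib)
    finally show "of_int B = s ^ 3 * B_form t 1" using n0 by simp
  qed
next
  assume iso: "admits_isogeny 7 A B"
  obtain a b \<epsilon> c A0 B0 where t: "coprime a b" "a \<noteq> 0" "b > 0" "reduced_model (a, b) = (A0, B0)" "\<epsilon> \<in> {1, -1}" "squarefree (c :: nat)"
    "A = int c ^ 2 * A0" "B = \<epsilon> * int c ^ 3 * B0"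
    by (rule isogeny_curve_twist[OF AB iso]) blast
  have m: "A_form a b = int (defect a b) ^ 2 * A0" "\<bar>B_form a b\<bar> = int (defect a b) ^ 3 * B0"
    by (rule reduced_model[OF t(1)], use t(4) in simp)+
  define D where "D = defect a b"
  have D0: "D > 0" using dvd_defect_iff(2)[OF t(1)] by (simp add: D_def)
  have c0: "c \<ge> 1" using t(6) by (cases "c = 0") auto
  have Y1: "real Y \<ge> 1" using Y by simp
  have e2: "\<epsilon> ^ 2 = 1" using t(5) by auto
  have "real_of_int (height (A, B)) \<le> real_of_int (int Y ^ 6)" using h by (simp only: of_int_le_iff)
  then have w: "model_weight (A0, B0) * real c \<le> root 6 (real Y ^ 6)"
    unfolding t(7,8) by (subst twist_weight_le_iff[OF _ e2]) (simp_all del: height.simps)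
  have mw: "model_weight (A0, B0) \<ge> 1"
    by (rule model_weight_ge_1) (use t in \<open>force simp: models_def primitive_params_def\<close>)
  have w': "model_weight (A0, B0) * real c \<le> real Y" using w Y1 by (simp add: real_root_power_cancel)
  have cY: "real c \<le> real Y" using mw w' mult_right_mono[OF mw, of "real c"] by simp
  have "model_weight (A0, B0) * 1 \<le> model_weight (A0, B0) * real c"
    by (rule mult_left_mono) (use mw c0 in simp_all)
  then have "model_weight (A0, B0) \<le> real Y" using w' by simp
  then have tp: "(a, b) \<in> twist_points (real Y)" using reduced_model_weight_le_iff[OF t(1), of "real Y"] t(4) by simp
  define K where "K = real defect_bound"
  have K1: "K \<ge> 1" by (simp add: K_def)
  have D2: "real D ^ 2 \<le> K * real Y" using twist_points_bounds[OF tp] by (simp add: D_def K_def)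
  have KY: "K * real Y \<ge> 1" using mult_mono[OF K1 Y1] K1 by simp
  have "real D \<le> real D ^ 2" using D0 by (simp add: power2_eq_square)
  then have DK: "real D \<le> K * real Y" using D2 by (rule order_trans)
  have "real D * real Y \<le> K * real Y * (K * real Y)"
    using mult_mono[OF DK, of "real Y" "K * real Y"] K1 Y1 KY mult_right_mono[OF K1, of "real Y"] by simp
  then have "sqrt (real D * real Y) \<le> K * real Y" using KY by (intro real_le_lsqrt) (simp_all add: power2_eq_square)
  moreover have "(real_of_int a, real_of_int b) \<in> region (sqrt (real D * real Y))"
    using tp by (simp add: twist_points_def D_def)
  then have "\<bar>real_of_int a\<bar> \<le> 9 * sqrt (real D * real Y)" "\<bar>real_of_int b\<bar> \<le> 9 * sqrt (real D * real Y)"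
    by (rule region_bounded, simp)+
  moreover have L: "real L = 9 * (K * real Y)" by (simp add: L_def K_def)
  ultimately have "\<bar>real_of_int a\<bar> \<le> real L" "\<bar>real_of_int b\<bar> \<le> real L" by linarith+
  then have abL: "\<bar>a\<bar> \<le> int L" "\<bar>b\<bar> \<le> int L" by linarith+
  have "real D \<le> real L" using DK KY L by linarith
  then have DL: "D \<le> L" by simp
  have "real c \<le> real L" using cY mult_right_mono[OF K1, of "real Y"] L by simp
  then have cL: "c \<le> L" by simp
  define \<eta> where "\<eta> = sgn (B_form a b)"
  have \<eta>: "\<eta> \<in> {1, -1}" using coprime_forms_nonzero(5)[OF t(1)] by (auto simp: \<eta>_def sgn_if)
  define k where "k = \<epsilon> * \<eta> * int c"
  have kL: "\<bar>k\<bar> \<le> int L" using t(5) \<eta> cL by (auto simp: k_def)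
  have Bf: "B_form a b = \<eta> * (int D ^ 3 * B0)"
    unfolding D_def m(2)[symmetric] \<eta>_def by (simp add: sgn_mult_abs)
  have k2: "k ^ 2 = int c ^ 2" and k3: "k ^ 3 * \<eta> = \<epsilon> * int c ^ 3"
    using t(5) \<eta> by (auto simp: k_def power_mult_distrib)
  have eqA: "int D ^ 2 * A = k ^ 2 * A_form a b" unfolding k2 m(1) t(7) D_def by simp
  have "k ^ 3 * B_form a b = (k ^ 3 * \<eta>) * (int D ^ 3 * B0)" unfolding Bf by simp
  then have eqB: "int D ^ 3 * B = k ^ 3 * B_form a b" unfolding k3 t(8) by simp
  show "\<exists>a<2 * L + 1. \<exists>b<L. \<exists>m<2 * L + 1. \<exists>n<L.
    (int n + 1) ^ 2 * A = (int m - int L) ^ 2 * A_form (int a - int L) (int b + 1) \<and>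
    (int n + 1) ^ 3 * B = (int m - int L) ^ 3 * B_form (int a - int L) (int b + 1)"
  proof (rule exI[of _ "nat (a + int L)"], intro conjI, goal_cases)
    case 1 show ?case using abL by auto
    case 2 show ?case
    proof (rule exI[of _ "nat (b - 1)"], intro conjI, goal_cases)
      case 1 show ?case using abL t(3) by auto
      case 2 show ?case
      proof (rule exI[of _ "nat (k + int L)"], intro conjI, goal_cases)
        case 1 show ?case using kL by auto
        case 2
        have eqs: "int (nat (a + int L)) - int L = a" "int (nat (b - 1)) + 1 = b" "int (nat (k + int L)) - int L = k"
          "int (D - 1) + 1 = int D"
          using abL kL t(3) D0 by auto
        have "D - 1 < L" using DL D0 by simp
        then show ?case by (intro exI[of _ "D - 1"]) (simp only: eqs eqA eqB simp_thms)
      qed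
    qed
  qed
qed

declare iadd.simps [simp del] imul.simps [simp del] ipow.simps [simp del] ile.simps [simp del]

definition ESq :: "expr \<Rightarrow> expr" where "ESq e = EMul e e"
definition ECube :: "expr \<Rightarrow> expr" where "ECube e = EMul e (EMul e e)"
definition ESpan :: "expr \<Rightarrow> expr" where "ESpan e = EAdd (EMul (EConst 2) e) (EConst 1)"

lemma ev_poly [simp]:
  "ev (ESq e) xs = ev e xs ^ 2" "ev (ECube e) xs = ev e xs ^ 3" "ev (ESpan e) xs = 2 * ev e xs + 1"
  by (simp_all add: ESq_def ECube_def ESpan_def power2_eq_square power3_eq_cube)

definition q_expr :: "expr \<times> expr \<Rightarrow> expr \<times> expr \<Rightarrow> expr \<times> expr" where
  "q_expr a b = iadd (iadd (ipow a 2) (imul (imul (iconst 13) a) b)) (imul (iconst 49) (ipow b 2))"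

definition u_expr :: "expr \<times> expr \<Rightarrow> expr \<times> expr \<Rightarrow> expr \<times> expr" where
  "u_expr a b = iadd (iadd (ipow a 2) (imul (imul (iconst 5) a) b)) (ipow b 2)"

definition w_expr :: "expr \<times> expr \<Rightarrow> expr \<times> expr \<Rightarrow> expr \<times> expr" where
  "w_expr a b = iadd (iadd (iadd (iadd (ipow a 4) (imul (imul (iconst 14) (ipow a 3)) b))
     (imul (imul (iconst 63) (ipow a 2)) (ipow b 2))) (imul (imul (iconst 70) a) (ipow b 3)))
     (imul (iconst (- 7)) (ipow b 4))"

definition A_expr :: "expr \<times> expr \<Rightarrow> expr \<times> expr \<Rightarrow> expr \<times> expr" where
  "A_expr a b = imul (imul (iconst (- 3)) (q_expr a b)) (u_expr a b)"

definition B_expr :: "expr \<times> expr \<Rightarrow> expr \<times> expr \<Rightarrow> expr \<times> expr" where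
  "B_expr a b = imul (imul (iconst 2) (q_expr a b)) (w_expr a b)"

lemma ival_forms [simp]:
  "ival (A_expr a b) xs = A_form (ival a xs) (ival b xs)"
  "ival (B_expr a b) xs = B_form (ival a xs) (ival b xs)"
  by (simp_all add: A_expr_def B_expr_def q_expr_def u_expr_def w_expr_def form_defs)

text \<open>In the environment \<open>[j, i, Y]\<close> the curve is \<open>A = i - Y\<^sup>2\<close>, \<open>B = j - Y\<^sup>3\<close>.\<close>

definition nonminimal_expr :: expr where
  "nonminimal_expr = EEx (EAdd (EAdd (ESq (EVar 2)) (ECube (EVar 2))) (EConst 1)) (EMul
     (EEx (ESpan (ESq (EVar 3))) (ieq (EVar 3, ESq (EVar 4))
        (imul (ipow (EAdd (EVar 1) (EConst 2), EConst 0) 4) (EVar 0, ESq (EVar 4)))))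
     (EEx (ESpan (ECube (EVar 3))) (ieq (EVar 2, ECube (EVar 4))
        (imul (ipow (EAdd (EVar 1) (EConst 2), EConst 0) 6) (EVar 0, ECube (EVar 4))))))"

definition search_bound :: "expr \<Rightarrow> expr" where
  "search_bound e = EMul (EConst (9 * defect_bound)) e"

lemma ev_search_bound [simp]: "ev (search_bound e) xs = 9 * defect_bound * ev e xs"
  by (simp add: search_bound_def)

text \<open>Inside the four quantifiers the environment is n, m, b, a, j, i, Y. The indices of the
  bounds grow with each binder, and a and m are shifted by the search bound to allow negative
  values.\<close>

definition isogeny_expr :: expr where
  "isogeny_expr = EEx (ESpan (search_bound (EVar 2))) (EEx (search_bound (EVar 3))
     (EEx (ESpan (search_bound (EVar 4))) (EEx (search_bound (EVar 5))
       (let a = (EVar 3, search_bound (EVar 6)); b = (EAdd (EVar 2) (EConst 1), EConst 0);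
            m = (EVar 1, search_bound (EVar 6)); n = (EAdd (EVar 0) (EConst 1), EConst 0)
        in EMul (ieq (imul (ipow n 2) (EVar 5, ESq (EVar 6))) (imul (ipow m 2) (A_expr a b)))
                (ieq (imul (ipow n 3) (EVar 4, ECube (EVar 6))) (imul (ipow m 3) (B_expr a b)))))))"

definition curve_expr :: expr where
  "curve_expr = (let A = (EVar 1, ESq (EVar 2)); B = (EVar 0, ECube (EVar 2));
       A3 = imul (iconst 4) (ipow A 3); B2 = imul (iconst 27) (ipow B 2); Z = ipow (EVar 2, EConst 0) 6
     in EMul (ENot (ieq (iadd A3 B2) (iconst 0)))
       (EMul (EMul (ile A3 Z) (EMul (ile (imul (iconst (- 1)) A3) Z) (ile B2 Z)))
       (EMul (ENot nonminimal_expr) isogeny_expr)))"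

text \<open>The double negation normalises the truth value to 0 or 1, so that the sum counts
  curves.\<close>

definition count_expr :: expr where
  "count_expr = ESum (ESpan (ESq (EVar 0))) (ESum (ESpan (ECube (EVar 1))) (ENot (ENot curve_expr)))"

lemma holds_curve_expr:
  assumes Y: "Y \<ge> 1" and ij: "i < 2 * Y ^ 2 + 1" "j < 2 * Y ^ 3 + 1"
  defines "A \<equiv> int i - int Y ^ 2" and "B \<equiv> int j - int Y ^ 3"
  shows "holds curve_expr (j # i # Y # zs) \<longleftrightarrow> (A, B) \<in> isogeny_curves (real Y ^ 6)"
proof -
  have "int i < int (2 * Y ^ 2 + 1)" "int j < int (2 * Y ^ 3 + 1)" using ij by (simp_all only: of_nat_less_iff)
  then have bd: "\<bar>A\<bar> \<le> int (Y ^ 2)" "\<bar>B\<bar> \<le> int (Y ^ 3)" by (simp_all add: A_def B_def abs_le_iff)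
  have nm: "holds nonminimal_expr (j # i # Y # zs) \<longleftrightarrow> (\<exists>l<Y ^ 2 + Y ^ 3 + 1.
     (\<exists>u<2 * Y ^ 2 + 1. A = (int l + 2) ^ 4 * (int u - int (Y ^ 2))) \<and>
      (\<exists>v<2 * Y ^ 3 + 1. B = (int l + 2) ^ 6 * (int v - int (Y ^ 3))))"
    by (simp add: nonminimal_expr_def A_def B_def add.commute)
  define L where "L = 9 * defect_bound * Y"
  have iso_expr: "holds isogeny_expr (j # i # Y # zs) \<longleftrightarrow> (\<exists>a<2 * L + 1. \<exists>b<L. \<exists>m<2 * L + 1. \<exists>n<L.
    (int n + 1) ^ 2 * A = (int m - int L) ^ 2 * A_form (int a - int L) (int b + 1) \<and>
    (int n + 1) ^ 3 * B = (int m - int L) ^ 3 * B_form (int a - int L) (int b + 1))"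
    by (simp add: isogeny_expr_def A_def B_def L_def Let_def add.commute)
  have c: "holds curve_expr (j # i # Y # zs) \<longleftrightarrow> 4 * A ^ 3 + 27 * B ^ 2 \<noteq> 0 \<and>
     (4 * A ^ 3 \<le> int Y ^ 6 \<and> - (4 * A ^ 3) \<le> int Y ^ 6 \<and> 27 * B ^ 2 \<le> int Y ^ 6) \<and>
     \<not> holds nonminimal_expr (j # i # Y # zs) \<and> holds isogeny_expr (j # i # Y # zs)"
    by (simp add: curve_expr_def A_def B_def Let_def)
  have h: "height (A, B) \<le> int Y ^ 6 \<longleftrightarrow> 4 * A ^ 3 \<le> int Y ^ 6 \<and> - (4 * A ^ 3) \<le> int Y ^ 6 \<and> 27 * B ^ 2 \<le> int Y ^ 6"
    by (simp add: abs_le_iff)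
  have hr: "real_of_int (height (A, B)) \<le> real Y ^ 6 \<longleftrightarrow> height (A, B) \<le> int Y ^ 6"
    by (simp only: of_int_le_iff[where 'a = real, symmetric]) (simp del: height.simps)
  have mc: "(A, B) \<in> minimal_curves \<longleftrightarrow> 4 * A ^ 3 + 27 * B ^ 2 \<noteq> 0 \<and> \<not> holds nonminimal_expr (j # i # Y # zs)"
  proof (cases "4 * A ^ 3 + 27 * B ^ 2 = 0")
    case False
    then have nz: "A \<noteq> 0 \<or> B \<noteq> 0" by auto
    show ?thesis unfolding nm minimal_iff_bounded[OF bd nz, symmetric] using False by (simp add: minimal_curves_def)
  qed (simp add: minimal_curves_def)
  have iso: "admits_isogeny 7 A B \<longleftrightarrow> holds isogeny_expr (j # i # Y # zs)"
    if "(A, B) \<in> minimal_curves" "height (A, B) \<le> int Y ^ 6"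
    unfolding iso_expr L_def by (rule isogeny_iff_bounded[OF that Y])
  have "(A, B) \<in> isogeny_curves (real Y ^ 6) \<longleftrightarrow> (A, B) \<in> minimal_curves \<and> height (A, B) \<le> int Y ^ 6 \<and> admits_isogeny 7 A B"
    unfolding isogeny_curves_def curves_upto_def using hr by (simp del: height.simps)
  then show ?thesis using iso mc h c by metis
qed

lemma ev_count_expr:
  assumes Y: "Y \<ge> 1"
  shows "ev count_expr (Y # zs) = count_7_isogeny (real Y ^ 6)"
proof -
  define \<phi> where "\<phi> = (\<lambda>(i, j). (int i - int Y ^ 2, int j - int Y ^ 3))"
  let ?R = "{..<2 * Y ^ 2 + 1} \<times> {..<2 * Y ^ 3 + 1}"
  define W where "W = ?R \<inter> {(i, j). holds curve_expr (j # i # Y # zs)}"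
  have "ev count_expr (Y # zs) = (\<Sum>i<2 * Y ^ 2 + 1. \<Sum>j<2 * Y ^ 3 + 1. of_bool (holds curve_expr (j # i # Y # zs)))"
    by (simp add: count_expr_def ev_ENot)
  also have "\<dots> = (\<Sum>(i, j)\<in>?R. of_bool (holds curve_expr (j # i # Y # zs)))"
    by (rule sum.cartesian_product)
  also have "\<dots> = card W"
    using sum_of_bool_eq[of ?R "\<lambda>(i, j). holds curve_expr (j # i # Y # zs)", where 'a = nat]
    by (simp add: W_def case_prod_unfold)
  also have "\<dots> = card (isogeny_curves (real Y ^ 6))"
  proof (rule bij_betw_same_card, rule bij_betw_imageI)
    show "inj_on \<phi> W" by (auto simp: inj_on_def \<phi>_def)
    show "\<phi> ` W = isogeny_curves (real Y ^ 6)"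
    proof (intro equalityI subsetI)
      fix E assume "E \<in> \<phi> ` W"
      then show "E \<in> isogeny_curves (real Y ^ 6)"
        using holds_curve_expr[OF Y] by (auto simp: W_def \<phi>_def)
    next
      fix E assume E: "E \<in> isogeny_curves (real Y ^ 6)"
      obtain A B where [simp]: "E = (A, B)" by (cases E)
      have "real_of_int (height (A, B)) \<le> real_of_int (int Y ^ 6)"
        using E by (simp add: isogeny_curves_def curves_upto_def del: height.simps)
      then have h: "height (A, B) \<le> int Y ^ 6" by (simp only: of_int_le_iff)
      have "4 * \<bar>A\<bar> ^ 3 \<le> int Y ^ 6" "27 * \<bar>B\<bar> ^ 2 \<le> int Y ^ 6" using h by (simp_all add: abs_mult power_abs)
      moreover have "0 \<le> \<bar>A\<bar> ^ 3" "0 \<le> \<bar>B\<bar> ^ 2" by simp_all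
      ultimately have pw: "\<bar>A\<bar> ^ 3 \<le> int Y ^ 6" "\<bar>B\<bar> ^ 2 \<le> int Y ^ 6" by linarith+
      have "\<bar>A\<bar> ^ 3 \<le> (int Y ^ 2) ^ 3" using pw(1) by (simp flip: power_mult)
      then have "\<bar>A\<bar> \<le> int Y ^ 2" by (rule power_le_imp_le_base[where n = 2, simplified]) simp
      moreover have "\<bar>B\<bar> ^ 2 \<le> (int Y ^ 3) ^ 2" using pw(2) by (simp flip: power_mult)
      then have "\<bar>B\<bar> \<le> int Y ^ 3" by (rule power2_le_imp_le) simp
      ultimately have ij: "nat (A + int Y ^ 2) < 2 * Y ^ 2 + 1" "nat (B + int Y ^ 3) < 2 * Y ^ 3 + 1"
        and eq: "int (nat (A + int Y ^ 2)) - int Y ^ 2 = A" "int (nat (B + int Y ^ 3)) - int Y ^ 3 = B"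
        by (auto simp: nat_less_iff abs_le_iff)
      have "holds curve_expr (nat (B + int Y ^ 3) # nat (A + int Y ^ 2) # Y # zs)"
        using holds_curve_expr[OF Y ij, of zs] E unfolding eq by simp
      then show "E \<in> \<phi> ` W"
        by (intro image_eqI[of _ _ "(nat (A + int Y ^ 2), nat (B + int Y ^ 3))"]) (use ij eq in \<open>auto simp: W_def \<phi>_def\<close>)
    qed
  qed
  also have "\<dots> = count_7_isogeny (real Y ^ 6)" by (simp add: count_7_isogeny_def isogeny_curves_def)
  finally show ?thesis .
qed

section \<open>Recovering the constants\<close>

text \<open>The antiderivative x^2 ln x / 2 - x^2 / 4 of x ln x grows on [n, n + 1] by a value
  between the two endpoint terms, so the error is nondecreasing and telescopes; 1/4 is its value at
  Y = 1.\<close>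

lemma sum_ln_bounds:
  assumes "Y \<ge> 1"
  defines "e \<equiv> (\<Sum>j<Y. real (Suc j) * ln (real (Suc j))) - (real Y ^ 2 * ln (real Y) / 2 - real Y ^ 2 / 4)"
  shows "0 \<le> e" "e \<le> real Y * ln (real Y) + 1 / 4"
proof -
  define f :: "real \<Rightarrow> real" where "f x = x ^ 2 * ln x / 2 - x ^ 2 / 4" for x
  define E where "E Y = (\<Sum>j<Y. real (Suc j) * ln (real (Suc j))) - f (real Y)" for Y :: nat
  have step: "real n * ln (real n) \<le> f (real (Suc n)) - f (real n)"
    "f (real (Suc n)) - f (real n) \<le> real (Suc n) * ln (real (Suc n))" if n: "n \<ge> 1" for n
  proof -
    have "\<exists>z>real n. z < real (Suc n) \<and> f (real (Suc n)) - f (real n) = (real (Suc n) - real n) * (z * ln z)"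
    proof (rule MVT2)
      fix x assume "real n \<le> x" "x \<le> real (Suc n)"
      then have "x > 0" using n by simp
      then show "DERIV f x :> x * ln x"
        unfolding f_def by (auto intro!: derivative_eq_intros simp: field_simps power2_eq_square)
    qed simp
    then obtain z where z: "real n < z" "z < real (Suc n)" "f (real (Suc n)) - f (real n) = z * ln z" by auto
    have n1: "real n \<ge> 1" using n by simp
    show "real n * ln (real n) \<le> f (real (Suc n)) - f (real n)"
      unfolding z(3) using z n1 by (intro mult_mono) auto
    show "f (real (Suc n)) - f (real n) \<le> real (Suc n) * ln (real (Suc n))"
      unfolding z(3) using z n1 by (intro mult_mono) auto
  qed
  have "0 \<le> E Y \<and> E Y \<le> real Y * ln (real Y) + 1 / 4"
    using assms(1)
  proof (induction Y rule: nat_induct_at_least)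
    case base
    show ?case by (simp add: E_def f_def)
  next
    case (Suc n)
    have "E (Suc n) = E n + real (Suc n) * ln (real (Suc n)) - (f (real (Suc n)) - f (real n))"
      by (simp add: E_def)
    then show ?case using Suc.IH step[OF Suc.hyps] by linarith
  qed
  moreover have "e = E Y" by (simp add: e_def E_def f_def)
  ultimately show "0 \<le> e" "e \<le> real Y * ln (real Y) + 1 / 4" by simp_all
qed

text \<open>It is used for a(Y) = N(Y^6), where Y is the sixth root of the height bound; then
  \<alpha> = 6 c_1 and \<beta> = c_2.\<close>

locale nlogn_asymp =
  fixes a :: "nat \<Rightarrow> nat" and \<alpha> \<beta> K :: real
  assumes K: "K \<ge> 0"
    and asymp: "Y \<ge> 1 \<Longrightarrow> \<bar>real (a Y) - (\<alpha> * real Y * ln (real Y) + \<beta> * real Y)\<bar> \<le> K * real Y powr (9/10)"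
begin

text \<open>Since \<open>\<Sum>j\<le>Y. j ln j = Y\<^sup>2 ln Y / 2 - Y\<^sup>2 / 4 + \<dots>\<close>, both the logarithmic term and \<open>\<beta>\<close> cancel
  in \<open>Y a(Y) - 2 \<Sum>j\<le>Y. a(j)\<close>.\<close>

lemma leading_constant_bound:
  assumes Y: "Y \<ge> 1"
  shows "\<bar>\<alpha> / 6 - (real (Y * a Y) - real (2 * (\<Sum>j<Y. a (Suc j)))) / (3 * real Y ^ 2)\<bar>
    \<le> (3 * K + \<bar>\<beta>\<bar> + 6 * \<bar>\<alpha>\<bar>) * real Y powr (- 1/10)"
proof -
  define y where "y = real Y"
  have y1: "y \<ge> 1" using Y by (simp add: y_def)
  define P where "P = y powr (19/10)"
  have P: "y powr (9/10) * y = P" "1 \<le> P" "y \<le> P"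
    using y1 powr_mono[of 1 "19/10" y] by (simp_all add: P_def ge_one_powr_ge_zero powr_mult_base mult.commute)
  define S where "S = (\<Sum>j<Y. real (Suc j) * ln (real (Suc j)))"
  define e where "e = S - (y ^ 2 * ln y / 2 - y ^ 2 / 4)"
  have "ln y \<le> y powr (9/10) / (9/10)" by (rule ln_powr_bound) (use y1 in auto)
  then have "y * ln y \<le> y * (y powr (9/10) / (9/10))" using y1 by (intro mult_left_mono) auto
  then have "y * ln y \<le> 10/9 * P" using P(1) by (simp add: mult.commute)
  then have e: "\<bar>e\<bar> \<le> 3 * P" using sum_ln_bounds[OF Y] P(2) unfolding e_def S_def y_def by linarith
  define T where "T = (\<Sum>j<Y. real (a (Suc j)))"
  have gauss: "(\<Sum>j<n. real (Suc j)) = real n * (real n + 1) / 2" for n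
    by (induction n) (simp_all add: field_simps)
  have "\<bar>T - (\<alpha> * S + \<beta> * (y * (y + 1) / 2))\<bar> = \<bar>\<Sum>j<Y. real (a (Suc j)) - (\<alpha> * real (Suc j) * ln (real (Suc j)) + \<beta> * real (Suc j))\<bar>"
    unfolding T_def S_def y_def gauss[symmetric] by (simp only: sum_subtractf sum.distrib sum_distrib_left mult.assoc)
  also have "\<dots> \<le> (\<Sum>j<Y. K * y powr (9/10))"
  proof (rule order_trans[OF sum_abs], rule sum_mono)
    fix j assume "j \<in> {..<Y}"
    then have "real (Suc j) powr (9/10) \<le> y powr (9/10)" unfolding y_def by (intro powr_mono2) auto
    then have "K * real (Suc j) powr (9/10) \<le> K * y powr (9/10)" using K by (rule mult_left_mono)
    then show "\<bar>real (a (Suc j)) - (\<alpha> * real (Suc j) * ln (real (Suc j)) + \<beta> * real (Suc j))\<bar> \<le> K * y powr (9/10)"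
      using asymp[of "Suc j"] by linarith
  qed
  also have "\<dots> = K * P" unfolding P(1)[symmetric] by (simp add: y_def mult_ac)
  finally have T: "\<bar>T - (\<alpha> * S + \<beta> * (y * (y + 1) / 2))\<bar> \<le> K * P" .
  have "\<bar>y * (real (a Y) - (\<alpha> * y * ln y + \<beta> * y))\<bar> \<le> y * (K * y powr (9/10))"
    using asymp[OF Y] y1 by (simp add: abs_mult y_def)
  also have "\<dots> = K * P" unfolding P(1)[symmetric] by (simp add: mult_ac)
  finally have A: "\<bar>y * (real (a Y) - (\<alpha> * y * ln y + \<beta> * y))\<bar> \<le> K * P" .
  have id: "y * real (a Y) - 2 * T - \<alpha> * y ^ 2 / 2 =
      y * (real (a Y) - (\<alpha> * y * ln y + \<beta> * y)) - 2 * (T - (\<alpha> * S + \<beta> * (y * (y + 1) / 2))) - 2 * (\<alpha> * e) - \<beta> * y"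
    by (simp add: e_def field_simps power2_eq_square)
  have tri: "\<bar>p - 2 * q - 2 * r - t\<bar> \<le> 3 * c + 2 * v + w" if "\<bar>p\<bar> \<le> c" "\<bar>q\<bar> \<le> c" "\<bar>r\<bar> \<le> v" "\<bar>t\<bar> \<le> w"
    for p q r t c v w :: real using that by linarith
  have ae: "\<bar>\<alpha> * e\<bar> \<le> \<bar>\<alpha>\<bar> * (3 * P)" unfolding abs_mult using e by (rule mult_left_mono) simp
  have "\<bar>\<beta> * y\<bar> \<le> \<bar>\<beta>\<bar> * P" unfolding abs_mult using P(3) y1 by (intro mult_left_mono) auto
  then have "\<bar>y * real (a Y) - 2 * T - \<alpha> * y ^ 2 / 2\<bar> \<le> 3 * (K * P) + 2 * (\<bar>\<alpha>\<bar> * (3 * P)) + \<bar>\<beta>\<bar> * P"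
    unfolding id by (rule tri[OF A T ae])
  then have main: "\<bar>y * real (a Y) - 2 * T - \<alpha> * y ^ 2 / 2\<bar> \<le> (3 * K + \<bar>\<beta>\<bar> + 6 * \<bar>\<alpha>\<bar>) * P"
    by (simp add: algebra_simps)
  \<comment> \<open>The combination approximates \<alpha> y^2 / 2; division by 3 y^2 yields \<alpha>
    / 6, which is the constant c_1 of the asymptotic formula.\<close>
  have "\<bar>\<alpha> / 6 - (y * real (a Y) - 2 * T) / (3 * y ^ 2)\<bar> = \<bar>y * real (a Y) - 2 * T - \<alpha> * y ^ 2 / 2\<bar> / (3 * y ^ 2)"
  proof -
    have "\<alpha> / 6 - (y * real (a Y) - 2 * T) / (3 * y ^ 2) = - ((y * real (a Y) - 2 * T - \<alpha> * y ^ 2 / 2) / (3 * y ^ 2))"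
      using y1 by (simp add: field_simps)
    then show ?thesis using y1 by (simp add: abs_divide)
  qed
  also have "\<dots> \<le> (3 * K + \<bar>\<beta>\<bar> + 6 * \<bar>\<alpha>\<bar>) * P / (3 * y ^ 2)" using main y1 by (intro divide_right_mono) auto
  also have "\<dots> \<le> (3 * K + \<bar>\<beta>\<bar> + 6 * \<bar>\<alpha>\<bar>) * P / y ^ 2"
    using y1 K P(2) by (intro divide_left_mono mult_nonneg_nonneg) auto
  also have "y ^ 2 = y powr 2" using y1 by simp
  also have "(3 * K + \<bar>\<beta>\<bar> + 6 * \<bar>\<alpha>\<bar>) * P / y powr 2 = (3 * K + \<bar>\<beta>\<bar> + 6 * \<bar>\<alpha>\<bar>) * y powr (- 1/10)"
    unfolding P_def by (simp add: powr_diff[symmetric] flip: times_divide_eq_right)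
  finally show ?thesis by (simp add: y_def T_def)
qed

text \<open>At 2^M and 2^(M+1) the logarithms are M ln 2 and (M + 1) ln 2, so integer weights cancel
  the \<alpha>-terms without computing \<alpha> or ln 2 and leave 2^(M+1) \<beta>. With M = 20 k the
  relative error is about k / 4^k, which is at most a constant over 2^k.\<close>

lemma second_constant_bound:
  defines "m k \<equiv> 20 * k"
  shows "\<bar>\<beta> - (real ((m k + 1) * 2 * a (2 ^ m k)) - real (m k * a (2 ^ (m k + 1)))) / 2 ^ (m k + 1)\<bar> \<le> 82 * K / 2 ^ k"
proof -
  define M where "M = m k"
  define y :: real where "y = 2 ^ M"
  have y0: "y > 0" by (simp add: y_def)
  define Q :: real where "Q = 2 ^ (18 * k)"
  have lny: "ln y = real M * ln 2" by (simp add: y_def ln_realpow)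
  have ln2y: "ln (2 * y) = real M * ln 2 + ln 2" by (simp add: ln_mult_pos y0 lny)
  have yp: "y powr (9/10) = Q"
  proof -
    have "y = 2 powr real (20 * k)" unfolding y_def M_def m_def by (subst powr_realpow) simp_all
    then have "y powr (9/10) = 2 powr real (18 * k)" by (simp add: powr_powr)
    then show ?thesis unfolding Q_def by (subst (asm) powr_realpow) simp_all
  qed
  have "(2::real) powr (9/10) \<le> 2 powr 1" by (rule powr_mono) auto
  then have "(2 * y) powr (9/10) \<le> 2 * Q" unfolding powr_mult yp using mult_right_mono[of "2 powr (9/10)" 2 Q] by (simp add: Q_def)
  then have K2: "K * (2 * y) powr (9/10) \<le> K * (2 * Q)" using K by (rule mult_left_mono)
  define u v where "u = real (a (2 ^ M)) - (\<alpha> * y * ln y + \<beta> * y)"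
    and "v = real (a (2 ^ (M + 1))) - (\<alpha> * (2 * y) * ln (2 * y) + \<beta> * (2 * y))"
  have u: "\<bar>u\<bar> \<le> K * Q" using asymp[of "2 ^ M"] by (simp add: u_def yp flip: y_def)
  have v: "\<bar>v\<bar> \<le> K * (2 * Q)" using asymp[of "2 ^ (M + 1)"] K2 by (simp add: v_def flip: y_def)
  have id: "(real M + 1) * 2 * real (a (2 ^ M)) - real M * real (a (2 ^ (M + 1))) - 2 * y * \<beta> = (real M + 1) * 2 * u - real M * v"
    unfolding u_def v_def lny ln2y by (simp add: algebra_simps)
  have "\<bar>(real M + 1) * 2 * u\<bar> \<le> (real M + 1) * 2 * (K * Q)" unfolding abs_mult using u by (simp add: abs_of_nonneg mult_left_mono)
  moreover have "\<bar>real M * v\<bar> \<le> real M * (K * (2 * Q))" unfolding abs_mult using v by (simp add: mult_left_mono)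
  ultimately have "\<bar>(real M + 1) * 2 * u - real M * v\<bar> \<le> (real M + 1) * 2 * (K * Q) + real M * (K * (2 * Q))" by linarith
  also have "\<dots> = (2 * real M + 1) * (2 * K * Q)" by (simp add: algebra_simps)
  finally have num: "\<bar>(real M + 1) * 2 * real (a (2 ^ M)) - real M * real (a (2 ^ (M + 1))) - 2 * y * \<beta>\<bar> \<le> (2 * real M + 1) * (2 * K * Q)"
    unfolding id .
  have "real k < 2 ^ k" by (rule of_nat_less_two_power)
  moreover have "(1::real) \<le> 2 ^ k" by simp
  ultimately have "40 * real k + 1 \<le> 41 * 2 ^ k" by linarith
  then have "2 * real M + 1 \<le> 41 * 2 ^ k" by (simp add: M_def m_def)
  then have "(2 * real M + 1) * (2 * K * Q) \<le> 41 * 2 ^ k * (2 * K * Q)" using K by (intro mult_right_mono) (auto simp: Q_def)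
  then have num': "\<bar>(real M + 1) * 2 * real (a (2 ^ M)) - real M * real (a (2 ^ (M + 1))) - 2 * y * \<beta>\<bar> \<le> 82 * K * (2 ^ k * Q)"
    using num by (simp add: mult_ac)
  have yQ: "y = 2 ^ k * (2 ^ k * Q)" unfolding y_def M_def m_def Q_def by (simp flip: power_add)
  have "\<beta> - ((real M + 1) * 2 * real (a (2 ^ M)) - real M * real (a (2 ^ (M + 1)))) / (2 * y)
      = - (((real M + 1) * 2 * real (a (2 ^ M)) - real M * real (a (2 ^ (M + 1))) - 2 * y * \<beta>) / (2 * y))"
    using y0 by (simp add: field_simps)
  then have "\<bar>\<beta> - ((real M + 1) * 2 * real (a (2 ^ M)) - real M * real (a (2 ^ (M + 1)))) / (2 * y)\<bar>
      = \<bar>(real M + 1) * 2 * real (a (2 ^ M)) - real M * real (a (2 ^ (M + 1))) - 2 * y * \<beta>\<bar> / (2 * y)"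
    using y0 by (simp add: abs_divide)
  also have "\<dots> \<le> 82 * K * (2 ^ k * Q) / (2 * y)" using num' y0 by (intro divide_right_mono) auto
  also have "\<dots> \<le> 82 * K * (2 ^ k * Q) / y" using y0 K by (intro divide_left_mono mult_nonneg_nonneg) (auto simp: Q_def)
  also have "\<dots> = 82 * K / 2 ^ k" unfolding yQ by (simp add: Q_def)
  finally show ?thesis by (simp add: M_def[symmetric] y_def algebra_simps)
qed

text \<open>The constants in the error bounds are unknown but fixed, so some power of 2 exceeds
  them; its exponent is written into the expression as a literal and shifts the required
  precision.\<close>

lemma computable_constants:
  assumes e: "\<And>Y zs. Y \<ge> 1 \<Longrightarrow> ev e (Y # zs) = a Y"
  shows "effectively_computable (\<alpha> / 6)" "effectively_computable \<beta>"
proof -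
  have pow: "\<exists>s. C \<le> 2 ^ s" for C :: real
    using real_arch_pow[of 2 C] by (auto intro: less_imp_le)
  define C where "C = 3 * K + \<bar>\<beta>\<bar> + 6 * \<bar>\<alpha>\<bar>"
  obtain s where s: "C \<le> 2 ^ s" using pow by blast
  let ?y = "EPow2 (EMul (EConst 10) (EAdd (EVar 0) (EConst s)))"
  show "effectively_computable (\<alpha> / 6)"
  proof (rule effectively_computableI[of _
      "ELet ?y (EMul (EVar 0) e)"
      "ELet ?y (EMul (EConst 2) (ESum (EVar 0) (ELet (EAdd (EVar 0) (EConst 1)) e)))"
      \<comment> \<open>The encoding divides by r + 1, so the denominator 3 Y^2 is lowered by
        one.\<close>
      "ELet ?y (EMonus (EMul (EConst 3) (EMul (EVar 0) (EVar 0))) (EConst 1))"])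
    fix n
    define Y :: nat where "Y = 2 ^ (10 * (n + s))"
    have Y: "Y \<ge> 1" by (simp add: Y_def)
    have r: "real (3 * (Y * Y) - 1) + 1 = 3 * real Y ^ 2"
      using Y by (simp add: of_nat_diff Suc_le_eq power2_eq_square)
    have "real Y powr (- 1/10) = 1 / 2 ^ (n + s)"
    proof -
      have "real Y = 2 powr real (10 * (n + s))" unfolding Y_def by (subst powr_realpow) simp_all
      then have "real Y powr (- 1/10) = 2 powr (- real (n + s))" by (simp add: powr_powr)
      also have "\<dots> = inverse (2 powr real (n + s))" by (rule powr_minus)
      also have "(2::real) powr real (n + s) = 2 ^ (n + s)" by (rule powr_realpow) simp
      finally show ?thesis by (simp only: inverse_eq_divide)
    qed
    then have "C * real Y powr (- 1/10) \<le> 2 ^ s * (1 / 2 ^ (n + s))" using s by (simp add: divide_right_mono)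
    also have "\<dots> = 1 / 2 ^ n" by (simp add: power_add)
    finally have "C * real Y powr (- 1/10) \<le> 1 / 2 ^ n" .
    then have "\<bar>\<alpha> / 6 - (real (Y * a Y) - real (2 * (\<Sum>j<Y. a (Suc j)))) / (real (3 * (Y * Y) - 1) + 1)\<bar> \<le> 1 / 2 ^ n"
      using leading_constant_bound[OF Y] unfolding r C_def by linarith
    moreover have y: "ev ?y [n] = Y" by (simp add: Y_def)
    have "ev (ELet ?y (EMul (EVar 0) e)) [n] = Y * a Y"
      by (simp only: ev.simps(8) y) (simp add: e[OF Y])
    moreover have "ev (ELet ?y (EMul (EConst 2) (ESum (EVar 0) (ELet (EAdd (EVar 0) (EConst 1)) e)))) [n] = 2 * (\<Sum>j<Y. a (Suc j))"
      by (simp only: ev.simps(8) y) (simp add: e)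
    moreover have "ev (ELet ?y (EMonus (EMul (EConst 3) (EMul (EVar 0) (EVar 0))) (EConst 1))) [n] = 3 * (Y * Y) - 1"
      by (simp only: ev.simps(8) y) simp
    ultimately show "\<bar>\<alpha> / 6 - (real (ev (ELet ?y (EMul (EVar 0) e)) [n]) -
        real (ev (ELet ?y (EMul (EConst 2) (ESum (EVar 0) (ELet (EAdd (EVar 0) (EConst 1)) e)))) [n])) /
       (real (ev (ELet ?y (EMonus (EMul (EConst 3) (EMul (EVar 0) (EVar 0))) (EConst 1))) [n]) + 1)\<bar> \<le> 1 / 2 ^ n"
      by (simp only:)
  qed
  obtain t where t: "82 * K \<le> 2 ^ t" using pow by blast
  let ?m = "EMul (EConst 20) (EAdd (EVar 0) (EConst t))"
  show "effectively_computable \<beta>"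
  proof (rule effectively_computableI[of _
      "ELet ?m (EMul (EMul (EAdd (EVar 0) (EConst 1)) (EConst 2)) (ELet (EPow2 (EVar 0)) e))"
      "ELet ?m (EMul (EVar 0) (ELet (EPow2 (EAdd (EVar 0) (EConst 1))) e))"
      "ELet ?m (EMonus (EPow2 (EAdd (EVar 0) (EConst 1))) (EConst 1))"])
    fix n
    define M :: nat where "M = 20 * (n + t)"
    have r: "real (2 ^ (M + 1) - 1) + 1 = 2 ^ (M + 1)" by (simp add: of_nat_diff)
    have "82 * K / 2 ^ (n + t) \<le> 2 ^ t / 2 ^ (n + t)" using t by (simp add: divide_right_mono)
    also have "\<dots> = 1 / 2 ^ n" by (simp add: power_add)
    finally have "\<bar>\<beta> - (real ((M + 1) * 2 * a (2 ^ M)) - real (M * a (2 ^ (M + 1)))) / (real (2 ^ (M + 1) - 1) + 1)\<bar> \<le> 1 / 2 ^ n"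
      using second_constant_bound[of "n + t", folded M_def] unfolding r by linarith
    moreover have m: "ev ?m [n] = M" by (simp add: M_def)
    have "ev (ELet ?m (EMul (EMul (EAdd (EVar 0) (EConst 1)) (EConst 2)) (ELet (EPow2 (EVar 0)) e))) [n] = (M + 1) * 2 * a (2 ^ M)"
      by (simp only: ev.simps(8) m) (simp add: e)
    moreover have "ev (ELet ?m (EMul (EVar 0) (ELet (EPow2 (EAdd (EVar 0) (EConst 1))) e))) [n] = M * a (2 ^ (M + 1))"
      by (simp only: ev.simps(8) m) (simp add: e)
    moreover have "ev (ELet ?m (EMonus (EPow2 (EAdd (EVar 0) (EConst 1))) (EConst 1))) [n] = 2 ^ (M + 1) - 1"
      by (simp only: ev.simps(8) m) simp
    ultimately show "\<bar>\<beta> - (real (ev (ELet ?m (EMul (EMul (EAdd (EVar 0) (EConst 1)) (EConst 2)) (ELet (EPow2 (EVar 0)) e))) [n]) -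
        real (ev (ELet ?m (EMul (EVar 0) (ELet (EPow2 (EAdd (EVar 0) (EConst 1))) e))) [n])) /
       (real (ev (ELet ?m (EMonus (EPow2 (EAdd (EVar 0) (EConst 1))) (EConst 1))) [n]) + 1)\<bar> \<le> 1 / 2 ^ n"
      by (simp only:)
  qed
qed

end

theorem theorem1p2p2:
  shows "\<exists>c1 c2 :: real. effectively_computable c1 \<and> effectively_computable c2 \<and> c1 > 0 \<and>
    (\<forall>\<epsilon>>0. (\<lambda>x. real (count_7_isogeny x)
               - (c1 * x powr (1/6) * ln x + c2 * x powr (1/6)))
             \<in> O[at_top](\<lambda>x. x powr (3/20 + \<epsilon>)))"
proof -
  obtain c1 c2 K where c: "c1 > 0" "K \<ge> 0" "\<And>x. x \<ge> 1 \<Longrightarrow>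
    \<bar>real (count_7_isogeny x) - (c1 * x powr (1/6) * ln x + c2 * x powr (1/6))\<bar> \<le> K * x powr (3/20)"
    by (rule count_7_isogeny_asymp) blast
  interpret nlogn_asymp "\<lambda>Y. count_7_isogeny (real Y ^ 6)" "6 * c1" c2 K
  proof
    fix Y :: nat assume Y: "Y \<ge> 1"
    have Y6: "real Y ^ 6 = real Y powr 6" using Y by simp
    have "(real Y ^ 6) powr (1/6) = real Y" "(real Y ^ 6) powr (3/20) = real Y powr (9/10)"
      unfolding Y6 powr_powr using Y by simp_all
    moreover have "ln (real Y ^ 6) = 6 * ln (real Y)" using Y by (simp add: ln_realpow)
    moreover have "real Y ^ 6 \<ge> 1" using Y by simp
    ultimately show "\<bar>real (count_7_isogeny (real Y ^ 6)) - (6 * c1 * real Y * ln (real Y) + c2 * real Y)\<bar> \<le> K * real Y powr (9/10)"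
      using c(3)[of "real Y ^ 6"] by (simp add: mult_ac)
  qed (rule c(2))
  have comp: "effectively_computable c1" "effectively_computable c2"
    using computable_constants[OF ev_count_expr] by simp_all
  have "(\<lambda>x. real (count_7_isogeny x) - (c1 * x powr (1/6) * ln x + c2 * x powr (1/6)))
      \<in> O[at_top](\<lambda>x. x powr (3/20 + \<epsilon>))" if \<epsilon>: "\<epsilon> > 0" for \<epsilon>
  proof (rule bigoI[of _ K])
    show "\<forall>\<^sub>F x in at_top. norm (real (count_7_isogeny x) - (c1 * x powr (1/6) * ln x + c2 * x powr (1/6)))
        \<le> K * norm (x powr (3/20 + \<epsilon>))"
      using eventually_ge_at_top[of 1]
    proof eventually_elim
      case (elim x)
      have "x powr (3/20) \<le> x powr (3/20 + \<epsilon>)" using elim \<epsilon> by (intro powr_mono) auto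
      then have "K * x powr (3/20) \<le> K * x powr (3/20 + \<epsilon>)" using c(2) by (rule mult_left_mono)
      then show ?case using c(3)[OF elim] by simp
    qed
  qed
  then show ?thesis using comp c(1) by blast
qed

end
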